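(* Let $K\in\{K_0,K_1\}$ and let $\pi$ be an irreducible principal series representation of $G$ containing a weight $\sigma$ of $K$. Then $I^+(\sigma,\pi)\cap I^-(\sigma,\pi)=\pi^{I_{1,K}}$.
   Context: Group. $F$ is a non-archimedean local field of odd residue characteristic $p$, $E/F$ the unramified quadratic extension with ring of integers $\mathfrak o_E$, maximal ideal $\mathfrak p_E$, and $x\mapsto\bar x$ the non-trivial Galois conjugation; $E^1\subset E^\times$ is the norm $1$ subgroup; $k_F,k_E$ are the residue fields; $\varpi_E\in F$ is a uniformizer of $E$. Let $\beta=\begin{pmatrix}0&0&1\\0&1&0\\1&0&0\end{pmatrix}$ and $G=\{g\in GL_3(E): g^{T}\beta\bar g=\beta\}$ (the unramified $U(2,1)(E/F)$). $B$ is the subgroup of upper triangular matrices of $G$. Put $\alpha=\mathrm{diag}(\varpi_E^{-1},1,\varpi_E)\in G$. Let $K_0=G\cap GL_3(\mathfrak o_E)$ and $K_1=G\cap\begin{pmatrix}\mathfrak o_E&\mathfrak o_E&\mathfrak p_E^{-1}\\\mathfrak p_E&\mathfrak o_E&\mathfrak o_E\\\mathfrak p_E&\mathfrak p_E&\mathfrak o_E\end{pmatrix}$; up to conjugacy these are the maximal compact open subgroups of $G$. For $K\in\{K_0,K_1\}$ let $K^1$ be its maximal normal pro-$p$ subgroup and $\Gamma_K=K/K^1$ (which is $U(2,1)(k_E/k_F)$ for $K_0$ and $(U(1,1)\times U(1))(k_E/k_F)$ for $K_1$). The Iwahori subgroup $I_K$ is the inverse image in $K$ of the upper triangular subgroup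 of $\Gamma_K$, and the pro-$p$ Iwahori subgroup $I_{1,K}$ is the inverse image of its unipotent radical. Representations. All representations are smooth over $\overline{\mathbf F}_p$. A weight of $K$ is an irreducible smooth representation of $K$; it factors through $\Gamma_K$. An irreducible principal series of $G$ means a representation in one of the three cases: (i) $\chi\circ\det$ for a character $\chi$ of $E^1$; (ii) $(\chi\circ\det)\otimes St$ for a character $\chi$ of $E^1$, where $St=\mathrm{ind}_B^G1/1$ is the Steinberg representation; (iii) $\mathrm{ind}_B^G\varepsilon$ (smooth induction) for a character $\varepsilon$ of $B$ which does not factor through the determinant. Subspaces. $\mathrm{ind}_K^G\sigma$ is the compact induction: locally constant compactly supported $f:G\to\sigma$ with $f(kg)=\sigma(k)f(g)$ for $k\in K$, $G$ acting by right translation. For $n\ge 0$, $R_n^+(\sigma)$ (resp. $R_n^-(\sigma)$) is the space of functions in $\mathrm{ind}_K^G\sigma$ supported in $K\alpha^nI_K$ (resp. $K\alpha^{-(n+1)}I_K$). Put $I^+(\sigma)=\bigoplus_{n\ge0}R_n^+(\sigma)$, $I^-(\sigma)=\bigoplus_{n\ge0}R_n^-(\sigma)$, so that $\mathrm{ind}_K^G\sigma=I^+(\sigma)\oplus I^-(\sigma)$ as $I_K$-representations. For a smooth representation $\pi$ of $G$ containing $\sigma$ (i.e. with an embedding of $\sigma$ in $\pi|_K$), let $\iota:\mathrm{ind}_K^G\sigma\to\pi$ be the $G$-map induced by Frobenius reciprocity, and $I^{\pm}(\sigma,\pi)=\iota(I^{\pm}(\sigma))$. *)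

theory Defs
  imports
    "HOL-Analysis.Determinants"
    "HOL-Analysis.Abstract_Topology"
    "HOL-Algebra.Coset"
    "HOL-Library.Function_Algebras"
    "HOL-Computational_Algebra.Polynomial"
begin

section \<open>Local fields\<close>

text \<open>
  A discrete valuation is a function into \<^typ>\<open>int\<close> that is only meaningful on nonzero elements;
  its value at 0 is never used.  Thus \<open>frakp v n\<close> is the \<open>n\<close>-th power of the maximal ideal
  (\<open>n\<close> may be negative), and \<open>frakp v 0\<close> is the ring of integers.
\<close>

definition frakp :: "('e::field \<Rightarrow> int) \<Rightarrow> int \<Rightarrow> 'e set"
  where "frakp v n = {x. x = 0 \<or> n \<le> v x}"

definition residue :: "('e::field \<Rightarrow> int) \<Rightarrow> 'e \<Rightarrow> 'e set"
  where "residue v x = {y. y - x \<in> frakp v 1}"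

text \<open>
  The local field is a subfield \<open>F\<close> of the ambient field; \<open>v\<close> restricted to \<open>F\<close> is its normalized
  valuation and \<open>p\<close> its residue characteristic.
\<close>

locale nonarch_local_field =
  fixes F :: "'e::field set" and v :: "'e \<Rightarrow> int" and p :: nat
  assumes zero_in: "0 \<in> F" and one_in: "1 \<in> F"
    and diff_in: "\<lbrakk>x \<in> F; y \<in> F\<rbrakk> \<Longrightarrow> x - y \<in> F"
    and mult_in: "\<lbrakk>x \<in> F; y \<in> F\<rbrakk> \<Longrightarrow> x * y \<in> F"
    and inverse_in: "x \<in> F \<Longrightarrow> inverse x \<in> F"
    and val_mult_F: "\<lbrakk>x \<in> F; y \<in> F; x \<noteq> 0; y \<noteq> 0\<rbrakk> \<Longrightarrow> v (x * y) = v x + v y"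
    and val_add_F: "\<lbrakk>x \<in> F; y \<in> F; x \<noteq> 0; y \<noteq> 0; x + y \<noteq> 0\<rbrakk> \<Longrightarrow> min (v x) (v y) \<le> v (x + y)"
    and val_normalized: "\<exists>x\<in>F. x \<noteq> 0 \<and> v x = 1"
    and complete_F: "\<lbrakk>range s \<subseteq> F; \<And>n. \<exists>N::nat. \<forall>i\<ge>N. \<forall>j\<ge>N. s i - s j \<in> frakp v n\<rbrakk>
      \<Longrightarrow> \<exists>l\<in>F. \<forall>n. \<exists>N. \<forall>i\<ge>N. s i - l \<in> frakp v n"
    and finite_residue_field: "finite (residue v ` (F \<inter> frakp v 0))"
    and prime_p: "prime p"
    and residue_char: "of_nat p \<in> frakp v 1"

text \<open>
  The data \<open>E/F\<close>: the type \<^typ>\<open>'e\<close> is \<open>E\<close>, and \<open>base\<close> is the subfield \<open>F\<close>.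
\<close>

record 'e quad_ext =
  base :: "'e set"
  val :: "'e \<Rightarrow> int"
  conjg :: "'e \<Rightarrow> 'e"
  unif :: 'e
  rchar :: nat

text \<open>
  That \<open>E/F\<close> is unramified is expressed by the ramification index being 1: the (integer-valued)
  valuation of \<open>E\<close> restricts to the normalized valuation of \<open>F\<close>.  The residue extension is
  separable because the residue field of \<open>F\<close> is finite.
\<close>

locale unramified_quadratic =
  nonarch_local_field "base D" "val D" "rchar D" for D :: "'e::field quad_ext" +
  assumes odd_residue_char: "odd (rchar D)"
    and degree_two: "\<exists>\<theta>. \<theta> \<notin> base D \<and> (\<forall>x. \<exists>a\<in>base D. \<exists>b\<in>base D. x = a + b * \<theta>)"
    and val_mult: "\<lbrakk>x \<noteq> 0; y \<noteq> 0\<rbrakk> \<Longrightarrow> val D (x * y) = val D x + val D y"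
    and val_add: "\<lbrakk>x \<noteq> 0; y \<noteq> 0; x + y \<noteq> 0\<rbrakk> \<Longrightarrow> min (val D x) (val D y) \<le> val D (x + y)"
    and conjg_bij: "bij (conjg D)"
    and conjg_add: "conjg D (x + y) = conjg D x + conjg D y"
    and conjg_mult: "conjg D (x * y) = conjg D x * conjg D y"
    and conjg_base: "x \<in> base D \<Longrightarrow> conjg D x = x"
    and conjg_nontrivial: "\<exists>x. conjg D x \<noteq> x"
    and unif_in_base: "unif D \<in> base D"
    and unif_nonzero: "unif D \<noteq> 0"
    and val_unif: "val D (unif D) = 1"

definition field_topology :: "'e::field quad_ext \<Rightarrow> 'e topology"
  where "field_topology D =
    topology (\<lambda>U. \<forall>x\<in>U. \<exists>n. \<forall>y. y - x \<in> frakp (val D) n \<longrightarrow> y \<in> U)"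

definition matrix_topology :: "'e::field quad_ext \<Rightarrow> ('e^3^3) topology"
  where "matrix_topology D =
    topology (\<lambda>U. \<forall>g\<in>U. \<exists>n. \<forall>h. (\<forall>i j. h$i$j - g$i$j \<in> frakp (val D) n) \<longrightarrow> h \<in> U)"

lemma frakp_antimono: "m \<le> n \<Longrightarrow> frakp v n \<subseteq> frakp v m"
  by (auto simp: frakp_def)

lemma openin_field_topology:
  "openin (field_topology D) U \<longleftrightarrow> (\<forall>x\<in>U. \<exists>n. \<forall>y. y - x \<in> frakp (val D) n \<longrightarrow> y \<in> U)"
proof -
  let ?Q = "\<lambda>x n U. \<forall>y. y - x \<in> frakp (val D) n \<longrightarrow> y \<in> U"
  let ?P = "\<lambda>U. \<forall>x\<in>U. \<exists>n. ?Q x n U"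
  have "?P (S \<inter> T)" if S: "?P S" and T: "?P T" for S T
  proof
    fix x assume "x \<in> S \<inter> T"
    then obtain m n where "\<forall>y. y - x \<in> frakp (val D) m \<longrightarrow> y \<in> S"
      and "\<forall>y. y - x \<in> frakp (val D) n \<longrightarrow> y \<in> T" using S T by blast
    then have "\<forall>y. y - x \<in> frakp (val D) (max m n) \<longrightarrow> y \<in> S \<inter> T"
      using frakp_antimono[of m "max m n" "val D"] frakp_antimono[of n "max m n" "val D"] by auto
    then show "\<exists>k. \<forall>y. y - x \<in> frakp (val D) k \<longrightarrow> y \<in> S \<inter> T" by blast
  qed
  moreover have "?P (\<Union>\<K>)" if \<K>: "\<forall>S\<in>\<K>. ?P S" for \<K>
  proof
    fix x assume "x \<in> \<Union>\<K>"
    then obtain S where S: "S \<in> \<K>" "x \<in> S" by blast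
    with \<K> have "\<exists>n. ?Q x n S" by blast
    then show "\<exists>n. ?Q x n (\<Union>\<K>)" using S(1) by (meson UnionI)
  qed
  ultimately have "istopology ?P"
    unfolding istopology_def by (intro conjI allI impI)
  then show ?thesis
    unfolding field_topology_def by (simp only: topology_inverse')
qed

lemma openin_matrix_topology:
  fixes D :: "'e::field quad_ext" and U :: "('e^3^3) set"
  shows "openin (matrix_topology D) U \<longleftrightarrow>
    (\<forall>g\<in>U. \<exists>n. \<forall>h. (\<forall>i j. h$i$j - g$i$j \<in> frakp (val D) n) \<longrightarrow> h \<in> U)"
proof -
  let ?Q = "\<lambda>(g :: 'e^3^3) n U. \<forall>h. (\<forall>i j. h$i$j - g$i$j \<in> frakp (val D) n) \<longrightarrow> h \<in> U"
  let ?P = "\<lambda>U. \<forall>g\<in>U. \<exists>n. ?Q g n U"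
  have "?P (S \<inter> T)" if S: "?P S" and T: "?P T" for S T
  proof
    fix g assume "g \<in> S \<inter> T"
    then obtain m n where "\<forall>h. (\<forall>i j. h$i$j - g$i$j \<in> frakp (val D) m) \<longrightarrow> h \<in> S"
      and "\<forall>h. (\<forall>i j. h$i$j - g$i$j \<in> frakp (val D) n) \<longrightarrow> h \<in> T" using S T by blast
    then have "\<forall>h. (\<forall>i j. h$i$j - g$i$j \<in> frakp (val D) (max m n)) \<longrightarrow> h \<in> S \<inter> T"
      using frakp_antimono[of m "max m n" "val D"] frakp_antimono[of n "max m n" "val D"]
      by (meson IntI max.cobounded1 max.cobounded2 subsetD)
    then show "\<exists>k. \<forall>h. (\<forall>i j. h$i$j - g$i$j \<in> frakp (val D) k) \<longrightarrow> h \<in> S \<inter> T" by blast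
  qed
  moreover have "?P (\<Union>\<K>)" if \<K>: "\<forall>S\<in>\<K>. ?P S" for \<K>
  proof
    fix x assume "x \<in> \<Union>\<K>"
    then obtain S where S: "S \<in> \<K>" "x \<in> S" by blast
    with \<K> have "\<exists>n. ?Q x n S" by blast
    then show "\<exists>n. ?Q x n (\<Union>\<K>)" using S(1) by (meson UnionI)
  qed
  ultimately have "istopology ?P"
    unfolding istopology_def by (intro conjI allI impI)
  then show ?thesis
    unfolding matrix_topology_def by (simp only: topology_inverse')
qed


section \<open>The unitary group and its subgroups\<close>

text \<open>
  Pitfall: in the index type \<^typ>\<open>3\<close> one has \<open>3 = 0\<close>, so the order of \<^typ>\<open>3\<close> is not the order of
  the matrix positions 1, 2, 3.  Triangularity conditions are therefore spelled out entrywise.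
\<close>

definition beta :: "'e::field^3^3"
  where "beta = vector [vector [0, 0, 1], vector [0, 1, 0], vector [1, 0, 0]]"

definition U21 :: "'e::field quad_ext \<Rightarrow> ('e^3^3) monoid"
  where "U21 D = \<lparr>carrier = {g. invertible g \<and> transpose g ** beta ** map_matrix (conjg D) g = beta},
    monoid.mult = (**), one = mat 1\<rparr>"

definition subgrp :: "'e::field quad_ext \<Rightarrow> ('e^3^3) set \<Rightarrow> ('e^3^3) monoid"
  where "subgrp D H = (U21 D)\<lparr>carrier := H\<rparr>"

definition norm_one_group :: "'e::field quad_ext \<Rightarrow> 'e monoid"
  where "norm_one_group D = \<lparr>carrier = {x. x * conjg D x = 1}, monoid.mult = (*), one = 1\<rparr>"

definition upper_triangular :: "'a \<Rightarrow> 'a^3^3 \<Rightarrow> bool"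
  where "upper_triangular z g \<longleftrightarrow> g$2$1 = z \<and> g$3$1 = z \<and> g$3$2 = z"

definition upper_unipotent :: "'a \<Rightarrow> 'a \<Rightarrow> 'a^3^3 \<Rightarrow> bool"
  where "upper_unipotent z u g \<longleftrightarrow> upper_triangular z g \<and> (\<forall>i. g$i$i = u)"

definition borel_subgroup :: "'e::field quad_ext \<Rightarrow> ('e^3^3) set"
  where "borel_subgroup D = {g \<in> carrier (U21 D). upper_triangular 0 g}"

definition alpha :: "'e::field quad_ext \<Rightarrow> 'e^3^3"
  where "alpha D = vector [vector [inverse (unif D), 0, 0], vector [0, 1, 0], vector [0, 0, unif D]]"

definition GL3_integers :: "'e::field quad_ext \<Rightarrow> ('e^3^3) set"
  where "GL3_integers D = {g. (\<forall>i j. g$i$j \<in> frakp (val D) 0) \<and>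
    (\<exists>h. (\<forall>i j. h$i$j \<in> frakp (val D) 0) \<and> g ** h = mat 1 \<and> h ** g = mat 1)}"

text \<open>\<open>K0\<close> and \<open>K1\<close> index the two conjugacy classes of maximal compact open subgroups.\<close>

datatype vertex = K0 | K1

fun maxcpt :: "'e::field quad_ext \<Rightarrow> vertex \<Rightarrow> ('e^3^3) set"
  where
    "maxcpt D K0 = carrier (U21 D) \<inter> GL3_integers D"
  | "maxcpt D K1 = carrier (U21 D) \<inter> {g.
       g$1$1 \<in> frakp (val D) 0 \<and> g$1$2 \<in> frakp (val D) 0 \<and> g$1$3 \<in> frakp (val D) (-1) \<and>
       g$2$1 \<in> frakp (val D) 1 \<and> g$2$2 \<in> frakp (val D) 0 \<and> g$2$3 \<in> frakp (val D) 0 \<and>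
       g$3$1 \<in> frakp (val D) 1 \<and> g$3$2 \<in> frakp (val D) 1 \<and> g$3$3 \<in> frakp (val D) 0}"

text \<open>
  A subgroup \<open>H\<close> of \<open>G\<close> is pro-\<open>p\<close> if it is profinite and all its open normal subgroups have
  \<open>p\<close>-power index.  As \<open>G\<close> is Hausdorff and totally disconnected, profinite means compact.
\<close>

definition pro_p_subgroup :: "'e::field quad_ext \<Rightarrow> nat \<Rightarrow> ('e^3^3) set \<Rightarrow> bool"
  where "pro_p_subgroup D p H \<longleftrightarrow> subgroup H (U21 D) \<and> compactin (matrix_topology D) H \<and>
    (\<forall>N. N \<lhd> subgrp D H \<and> openin (subtopology (matrix_topology D) H) N
       \<longrightarrow> (\<exists>k. card (rcosets\<^bsub>subgrp D H\<^esub> N) = p ^ k))"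

definition pro_p_radical :: "'e::field quad_ext \<Rightarrow> vertex \<Rightarrow> ('e^3^3) set"
  where "pro_p_radical D i =
    (GREATEST N. N \<lhd> subgrp D (maxcpt D i) \<and> pro_p_subgroup D (rchar D) N)"

definition GammaK :: "'e::field quad_ext \<Rightarrow> vertex \<Rightarrow> ('e^3^3) set monoid"
  where "GammaK D i = subgrp D (maxcpt D i) Mod pro_p_radical D i"

text \<open>
  The identification of \<open>\<Gamma>\<^sub>K\<close> with a matrix group over \<open>k\<^sub>E\<close>.  For \<open>K\<^sub>0\<close> it is entrywise reduction.
  For \<open>K\<^sub>1\<close>, conjugating the \<open>(1,3)\<close>-block by \<open>diag(\<varpi>,1)\<close> makes it integral, while the entries
  in positions (1,2), (2,1), (2,3), (3,2) contribute only to the kernel of the reduction; thus the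
  image lies in \<open>U(1,1) \<times> U(1)\<close>, embedded in \<open>3\<times>3\<close> matrices with \<open>U(1)\<close> in the middle.
  Elements of the residue field are represented by their residue classes.
\<close>

fun reduction :: "'e::field quad_ext \<Rightarrow> vertex \<Rightarrow> 'e^3^3 \<Rightarrow> ('e set)^3^3"
  where
    "reduction D K0 g = map_matrix (residue (val D)) g"
  | "reduction D K1 g = map_matrix (residue (val D))
      (vector [vector [g$1$1, 0, unif D * g$1$3],
               vector [0, g$2$2, 0],
               vector [g$3$1 / unif D, 0, g$3$3]])"

definition GammaK_borel :: "'e::field quad_ext \<Rightarrow> vertex \<Rightarrow> ('e^3^3) set set"
  where "GammaK_borel D i =
    {C \<in> carrier (GammaK D i). \<exists>g\<in>C. upper_triangular (residue (val D) 0) (reduction D i g)}"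

definition GammaK_unipotent :: "'e::field quad_ext \<Rightarrow> vertex \<Rightarrow> ('e^3^3) set set"
  where "GammaK_unipotent D i =
    {C \<in> carrier (GammaK D i).
      \<exists>g\<in>C. upper_unipotent (residue (val D) 0) (residue (val D) 1) (reduction D i g)}"

definition iwahori :: "'e::field quad_ext \<Rightarrow> vertex \<Rightarrow> ('e^3^3) set"
  where "iwahori D i = {g \<in> maxcpt D i. pro_p_radical D i #>\<^bsub>U21 D\<^esub> g \<in> GammaK_borel D i}"

definition pro_p_iwahori :: "'e::field quad_ext \<Rightarrow> vertex \<Rightarrow> ('e^3^3) set"
  where "pro_p_iwahori D i = {g \<in> maxcpt D i. pro_p_radical D i #>\<^bsub>U21 D\<^esub> g \<in> GammaK_unipotent D i}"


section \<open>Smooth representations\<close>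

text \<open>
  \<open>is_Fp_bar TYPE('c) p\<close>: the type is an algebraic closure of its prime field
  \<open>\<int>/p = range of_nat\<close>.
\<close>

definition is_Fp_bar :: "'c::alg_closed_field itself \<Rightarrow> nat \<Rightarrow> bool"
  where "is_Fp_bar _ p \<longleftrightarrow> CHAR('c) = p \<and>
    (\<forall>x::'c. \<exists>q. q \<noteq> 0 \<and> (\<forall>i. coeff q i \<in> range of_nat) \<and> poly q x = 0)"

text \<open>
  A representation lives on a subspace \<open>vspace\<close> of a vector space type with scalar multiplication
  \<open>scal\<close>; the values of \<open>act\<close> matter only for elements of the group in question.
\<close>

record ('g, 'c, 'v) repr =
  scal :: "'c \<Rightarrow> 'v \<Rightarrow> 'v"
  vspace :: "'v set"
  act :: "'g \<Rightarrow> 'v \<Rightarrow> 'v"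

definition linear_on :: "('g, 'c::field, 'v::ab_group_add) repr \<Rightarrow> ('g, 'c, 'w::ab_group_add) repr
    \<Rightarrow> ('v \<Rightarrow> 'w) \<Rightarrow> bool"
  where "linear_on \<pi> \<rho> T \<longleftrightarrow>
    (\<forall>x\<in>vspace \<pi>. T x \<in> vspace \<rho>) \<and>
    (\<forall>x\<in>vspace \<pi>. \<forall>y\<in>vspace \<pi>. T (x + y) = T x + T y) \<and>
    (\<forall>c. \<forall>x\<in>vspace \<pi>. T (scal \<pi> c x) = scal \<rho> c (T x))"

definition smooth_rep :: "'g topology \<Rightarrow> 'g monoid \<Rightarrow> ('g, 'c::field, 'v::ab_group_add) repr \<Rightarrow> bool"
  where "smooth_rep X H \<pi> \<longleftrightarrow>
    vector_space (scal \<pi>) \<and> module.subspace (scal \<pi>) (vspace \<pi>) \<and>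
    (\<forall>g\<in>carrier H. linear_on \<pi> \<pi> (act \<pi> g)) \<and>
    (\<forall>x\<in>vspace \<pi>. act \<pi> \<one>\<^bsub>H\<^esub> x = x) \<and>
    (\<forall>g\<in>carrier H. \<forall>h\<in>carrier H. \<forall>x\<in>vspace \<pi>. act \<pi> (g \<otimes>\<^bsub>H\<^esub> h) x = act \<pi> g (act \<pi> h x)) \<and>
    (\<forall>x\<in>vspace \<pi>. openin (subtopology X (carrier H)) {g \<in> carrier H. act \<pi> g x = x})"

definition irreducible_rep :: "'g monoid \<Rightarrow> ('g, 'c::field, 'v::ab_group_add) repr \<Rightarrow> bool"
  where "irreducible_rep H \<pi> \<longleftrightarrow> vspace \<pi> \<noteq> {0} \<and>
    (\<forall>W. W \<subseteq> vspace \<pi> \<and> module.subspace (scal \<pi>) W \<and> (\<forall>g\<in>carrier H. \<forall>x\<in>W. act \<pi> g x \<in> W)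
      \<longrightarrow> W = {0} \<or> W = vspace \<pi>)"

definition intertwiner :: "'g monoid \<Rightarrow> ('g, 'c::field, 'v::ab_group_add) repr
    \<Rightarrow> ('g, 'c, 'w::ab_group_add) repr \<Rightarrow> ('v \<Rightarrow> 'w) \<Rightarrow> bool"
  where "intertwiner H \<pi> \<rho> T \<longleftrightarrow> linear_on \<pi> \<rho> T \<and>
    (\<forall>g\<in>carrier H. \<forall>x\<in>vspace \<pi>. T (act \<pi> g x) = act \<rho> g (T x))"

definition isomorphic_rep :: "'g monoid \<Rightarrow> ('g, 'c::field, 'v::ab_group_add) repr
    \<Rightarrow> ('g, 'c, 'w::ab_group_add) repr \<Rightarrow> bool"
  where "isomorphic_rep H \<pi> \<rho> \<longleftrightarrow> (\<exists>T. intertwiner H \<pi> \<rho> T \<and> bij_betw T (vspace \<pi>) (vspace \<rho>))"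

text \<open>
  \<open>\<rho>\<close> is isomorphic to the quotient \<open>\<pi>/W\<close>, realized as the set of cosets \<open>x + W\<close>.  Since the
  operations of the quotient are those induced from \<open>\<pi>\<close>, a bijection \<open>\<phi>\<close> on cosets is an isomorphism
  of representations iff its composite with the projection is an intertwiner.
\<close>

definition isomorphic_quotient :: "'g monoid \<Rightarrow> ('g, 'c::field, 'v::ab_group_add) repr \<Rightarrow> 'v set
    \<Rightarrow> ('g, 'c, 'w::ab_group_add) repr \<Rightarrow> bool"
  where "isomorphic_quotient H \<pi> W \<rho> \<longleftrightarrow>
    (\<exists>\<phi>. bij_betw \<phi> ((\<lambda>x. (+) x ` W) ` vspace \<pi>) (vspace \<rho>) \<and>
         intertwiner H \<pi> \<rho> (\<lambda>x. \<phi> ((+) x ` W)))"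

definition invariants :: "('g, 'c, 'v) repr \<Rightarrow> 'g set \<Rightarrow> 'v set"
  where "invariants \<pi> H = {x \<in> vspace \<pi>. \<forall>g\<in>H. act \<pi> g x = x}"

definition smooth_character :: "'g topology \<Rightarrow> 'g monoid \<Rightarrow> ('g \<Rightarrow> 'c::field) \<Rightarrow> bool"
  where "smooth_character X H \<eta> \<longleftrightarrow>
    (\<forall>g\<in>carrier H. \<eta> g \<noteq> 0) \<and>
    (\<forall>g\<in>carrier H. \<forall>h\<in>carrier H. \<eta> (g \<otimes>\<^bsub>H\<^esub> h) = \<eta> g * \<eta> h) \<and>
    openin (subtopology X (carrier H)) {g \<in> carrier H. \<eta> g = 1}"

definition char_rep :: "('g \<Rightarrow> 'c::field) \<Rightarrow> ('g, 'c, 'c) repr"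
  where "char_rep \<eta> = \<lparr>scal = (*), vspace = UNIV, act = (\<lambda>g x. \<eta> g * x)\<rparr>"

definition twist :: "('g \<Rightarrow> 'c) \<Rightarrow> ('g, 'c::field, 'v::ab_group_add) repr \<Rightarrow> ('g, 'c, 'v) repr"
  where "twist \<eta> \<pi> = \<pi>\<lparr>act := (\<lambda>g x. scal \<pi> (\<eta> g) (act \<pi> g x))\<rparr>"


section \<open>Principal series\<close>

text \<open>Functions on \<open>G\<close> are extended by 0 to all matrices.\<close>

definition ind_borel :: "'e::field quad_ext \<Rightarrow> ('e^3^3 \<Rightarrow> 'c::field) \<Rightarrow> ('e^3^3, 'c, 'e^3^3 \<Rightarrow> 'c) repr"
  where "ind_borel D \<epsilon> = \<lparr>
    scal = (\<lambda>c f g. c * f g),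
    vspace = {f. (\<forall>g. g \<notin> carrier (U21 D) \<longrightarrow> f g = 0) \<and>
      (\<forall>b\<in>borel_subgroup D. \<forall>g\<in>carrier (U21 D). f (b ** g) = \<epsilon> b * f g) \<and>
      (\<exists>U. subgroup U (U21 D) \<and> openin (subtopology (matrix_topology D) (carrier (U21 D))) U \<and>
         (\<forall>g\<in>carrier (U21 D). \<forall>u\<in>U. f (g ** u) = f g))},
    act = (\<lambda>h f g. f (g ** h))\<rparr>"

definition constant_functions :: "'e::field quad_ext \<Rightarrow> ('e^3^3 \<Rightarrow> 'c::field) set"
  where "constant_functions D = range (\<lambda>c g. if g \<in> carrier (U21 D) then c else 0)"

definition is_steinberg :: "'e::field quad_ext \<Rightarrow> ('e^3^3, 'c::field, 'v::ab_group_add) repr \<Rightarrow> bool"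
  where "is_steinberg D \<rho> \<longleftrightarrow> smooth_rep (matrix_topology D) (U21 D) \<rho> \<and>
    isomorphic_quotient (U21 D) (ind_borel D (\<lambda>_. 1)) (constant_functions D) \<rho>"

definition irreducible_principal_series ::
    "'e::field quad_ext \<Rightarrow> ('e^3^3, 'c::field, 'v::ab_group_add) repr \<Rightarrow> bool"
  where "irreducible_principal_series D \<pi> \<longleftrightarrow> smooth_rep (matrix_topology D) (U21 D) \<pi> \<and>
    ((\<exists>\<eta>. smooth_character (field_topology D) (norm_one_group D) \<eta> \<and>
        isomorphic_rep (U21 D) (char_rep (\<eta> \<circ> det)) \<pi>) \<or>
     (\<exists>\<eta> (\<rho> :: ('e^3^3, 'c, 'v) repr). smooth_character (field_topology D) (norm_one_group D) \<eta> \<and>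
        is_steinberg D \<rho> \<and> isomorphic_rep (U21 D) (twist (\<eta> \<circ> det) \<rho>) \<pi>) \<or>
     (\<exists>\<epsilon>. smooth_character (matrix_topology D) (subgrp D (borel_subgroup D)) \<epsilon> \<and>
        \<not> (\<exists>\<eta>. \<forall>b\<in>borel_subgroup D. \<epsilon> b = \<eta> (det b)) \<and>
        isomorphic_rep (U21 D) (ind_borel D \<epsilon>) \<pi>))"


section \<open>Weights and compact induction\<close>

definition weight :: "'e::field quad_ext \<Rightarrow> vertex \<Rightarrow> ('e^3^3, 'c::field, 'w::ab_group_add) repr \<Rightarrow> bool"
  where "weight D i \<sigma> \<longleftrightarrow> smooth_rep (matrix_topology D) (subgrp D (maxcpt D i)) \<sigma> \<and>
    irreducible_rep (subgrp D (maxcpt D i)) \<sigma>"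

definition weight_embedding :: "'e::field quad_ext \<Rightarrow> vertex
    \<Rightarrow> ('e^3^3, 'c::field, 'w::ab_group_add) repr \<Rightarrow> ('e^3^3, 'c, 'v::ab_group_add) repr
    \<Rightarrow> ('w \<Rightarrow> 'v) \<Rightarrow> bool"
  where "weight_embedding D i \<sigma> \<pi> j \<longleftrightarrow>
    intertwiner (subgrp D (maxcpt D i)) \<sigma> \<pi> j \<and> inj_on j (vspace \<sigma>)"

text \<open>
  The support of a locally constant function is closed, so it is the set of points where the function
  does not vanish.
\<close>

definition cind :: "'e::field quad_ext \<Rightarrow> vertex \<Rightarrow> ('e^3^3, 'c::field, 'w::ab_group_add) repr
    \<Rightarrow> ('e^3^3, 'c, 'e^3^3 \<Rightarrow> 'w) repr"
  where "cind D i \<sigma> = \<lparr>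
    scal = (\<lambda>c f g. scal \<sigma> c (f g)),
    vspace = {f. (\<forall>g. g \<notin> carrier (U21 D) \<longrightarrow> f g = 0) \<and>
      (\<forall>g\<in>carrier (U21 D). f g \<in> vspace \<sigma>) \<and>
      (\<forall>k\<in>maxcpt D i. \<forall>g\<in>carrier (U21 D). f (k ** g) = act \<sigma> k (f g)) \<and>
      (\<forall>g\<in>carrier (U21 D). \<exists>U. openin (subtopology (matrix_topology D) (carrier (U21 D))) U \<and>
         g \<in> U \<and> (\<forall>h\<in>U. f h = f g)) \<and>
      compactin (matrix_topology D) {g \<in> carrier (U21 D). f g \<noteq> 0}},
    act = (\<lambda>h f g. f (g ** h))\<rparr>"

text \<open>
  Frobenius reciprocity matches a \<open>K\<close>-map \<open>j : \<sigma> \<rightarrow> \<pi>\<close> with the unique \<open>G\<close>-map \<open>\<iota> : cind \<sigma> \<rightarrow> \<pi>\<close>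
  whose restriction along \<open>\<sigma> \<rightarrow> cind \<sigma>\<close>, \<open>x \<mapsto> frob_unit x\<close>, is \<open>j\<close>.
\<close>

definition frob_unit :: "'e::field quad_ext \<Rightarrow> vertex \<Rightarrow> ('e^3^3, 'c::field, 'w::ab_group_add) repr
    \<Rightarrow> 'w \<Rightarrow> 'e^3^3 \<Rightarrow> 'w"
  where "frob_unit D i \<sigma> x = (\<lambda>g. if g \<in> maxcpt D i then act \<sigma> g x else 0)"

definition frobenius_map :: "'e::field quad_ext \<Rightarrow> vertex \<Rightarrow> ('e^3^3, 'c::field, 'w::ab_group_add) repr
    \<Rightarrow> ('e^3^3, 'c, 'v::ab_group_add) repr \<Rightarrow> ('w \<Rightarrow> 'v) \<Rightarrow> (('e^3^3 \<Rightarrow> 'w) \<Rightarrow> 'v) \<Rightarrow> bool"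
  where "frobenius_map D i \<sigma> \<pi> j \<iota> \<longleftrightarrow> intertwiner (U21 D) (cind D i \<sigma>) \<pi> \<iota> \<and>
    (\<forall>x\<in>vspace \<sigma>. \<iota> (frob_unit D i \<sigma> x) = j x)"

definition double_coset :: "'e::field quad_ext \<Rightarrow> vertex \<Rightarrow> int \<Rightarrow> ('e^3^3) set"
  where "double_coset D i m =
    maxcpt D i <#>\<^bsub>U21 D\<^esub> {alpha D [^]\<^bsub>U21 D\<^esub> m} <#>\<^bsub>U21 D\<^esub> iwahori D i"

definition R_plus :: "'e::field quad_ext \<Rightarrow> vertex \<Rightarrow> ('e^3^3, 'c::field, 'w::ab_group_add) repr
    \<Rightarrow> nat \<Rightarrow> ('e^3^3 \<Rightarrow> 'w) set"
  where "R_plus D i \<sigma> n = {f \<in> vspace (cind D i \<sigma>). {g. f g \<noteq> 0} \<subseteq> double_coset D i (int n)}"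

definition R_minus :: "'e::field quad_ext \<Rightarrow> vertex \<Rightarrow> ('e^3^3, 'c::field, 'w::ab_group_add) repr
    \<Rightarrow> nat \<Rightarrow> ('e^3^3 \<Rightarrow> 'w) set"
  where "R_minus D i \<sigma> n = {f \<in> vspace (cind D i \<sigma>). {g. f g \<noteq> 0} \<subseteq> double_coset D i (- (int n + 1))}"

text \<open>The sums of the \<open>R_plus\<close> and \<open>R_minus\<close> are direct because the supports are disjoint.\<close>

definition I_plus :: "'e::field quad_ext \<Rightarrow> vertex \<Rightarrow> ('e^3^3, 'c::field, 'w::ab_group_add) repr
    \<Rightarrow> ('e^3^3 \<Rightarrow> 'w) set"
  where "I_plus D i \<sigma> = module.span (scal (cind D i \<sigma>)) (\<Union>n. R_plus D i \<sigma> n)"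

definition I_minus :: "'e::field quad_ext \<Rightarrow> vertex \<Rightarrow> ('e^3^3, 'c::field, 'w::ab_group_add) repr
    \<Rightarrow> ('e^3^3 \<Rightarrow> 'w) set"
  where "I_minus D i \<sigma> = module.span (scal (cind D i \<sigma>)) (\<Union>n. R_minus D i \<sigma> n)"

end

(*
Write c = 0 for K_0 and c = 1 for K_1.  All compact groups involved are members of Moy--Prasad type
filtrations 2 v(x_ij) + e_i - e_j >= r (or with 3 in place of 2), which makes them pro-p by the
usual computation of p-th powers.  The coset space B\G is the disjoint union of the two I-orbits of
B and B w; each is parametrized by a group N_s of unipotent matrices, contracted by alpha or its
inverse.

Let pi be a quotient of V = ind_B^G eps as in case (ii) or (iii).  A weight sigma is fixed by K^1,
and invariants of K^1 and I_1 lift to V, because a function in the kernel that vanishes at one point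
is zero.  Contraction shows that the preimage of I^+ in V consists of functions that are constant on
N^- (up to eps), and that of I^- of functions constant on w N.  So the intersection lies in the span
of the images of the two I_1-invariant functions supported on a single cell, which is pi^{I_1}.
Conversely, if the preimage W of I^+ contains a nonzero function supported on B w I, then a pro-p
fixed point argument yields the I_1-invariant one, its translates under alpha^{-1} and N span all
functions supported on this cell, and so W contains both I_1-invariant functions.  If W contains no
such function, then it is a line, the kernel is zero, and the line is stable under K and alpha,
hence under G; the unipotent elements act trivially on it, which forces eps to factor through det.
The same argument applies to I^-.
*)

theory Submission
  imports Defs "HOL-Algebra.Multiplicative_Group" "HOL-Algebra.Sylow"
begin

section \<open>Quadratic unramified extensions\<close>

text \<open>Inside a preimage W one value decides everything. Contraction makes its functions
  constant along one cell, so those vanishing at the representative of that cell are supported on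
  the other cell. Hence W contains a nonzero function supported on one cell, or evaluation at the
  representative is injective on W. In the second case the kernel vanishes because W contains a
  function with nonzero image, and this function would be a multiple of any nonzero element of the
  kernel.

  Triviality on unipotent elements reaches the torus through the Bruhat identity in rank one: the
  elements diag(x, cj x / x, 1 / cj x) are products of unipotent elements, and together with the
  unipotent radical they account for the elements of B of determinant 1.

  The requirement that eps not factor through det is imposed only when the kernel is zero. This lets
  twists of Steinberg, where eps does factor but the kernel is a line, share one frame with the
  irreducible inductions.

  A Boolean exchanges the two cells, alpha and its inverse, and I^+ and I^-. The asymmetry of the
  exponents n and -(n+1) survives as a bound m \<ge> 1 on one side, where one contraction step is
  needed to enter K^1.\<close>

context unramified_quadratic
begin

abbreviation cj where "cj \<equiv> conjg D"
abbreviation P where "P \<equiv> frakp (val D)"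
abbreviation G where "G \<equiv> U21 D"
abbreviation X where "X \<equiv> matrix_topology D"

section \<open>Valuations and fractional ideals\<close>

lemma val_one [simp]: "val D 1 = 0"
  using val_mult[of 1 1] by simp

lemma val_uminus [simp]: "val D (- x) = val D x"
proof (cases "x = 0")
  case False
  have "val D (-1) = 0" using val_mult[of "-1" "-1"] by simp
  then show ?thesis using val_mult[of "-1" x] False by simp
qed simp

lemma val_inverse: "x \<noteq> 0 \<Longrightarrow> val D (inverse x) = - val D x"
  using val_mult[of x "inverse x"] by simp

lemma val_power: "x \<noteq> 0 \<Longrightarrow> val D (x ^ n) = int n * val D x"
  by (induction n) (auto simp: val_mult algebra_simps)

lemma frakp_0 [simp]: "0 \<in> P n"
  by (simp add: frakp_def)

lemma frakp_1: "1 \<in> P n \<longleftrightarrow> n \<le> 0"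
  by (simp add: frakp_def)

lemma frakp_uminus [simp]: "- x \<in> P n \<longleftrightarrow> x \<in> P n"
  by (simp add: frakp_def)

lemma frakp_add: "x \<in> P n \<Longrightarrow> y \<in> P n \<Longrightarrow> x + y \<in> P n"
  using val_add[of x y] by (fastforce simp: frakp_def)

lemma frakp_diff: "x \<in> P n \<Longrightarrow> y \<in> P n \<Longrightarrow> x - y \<in> P n"
  using frakp_add[of x n "- y"] by simp

lemma frakp_mult: "x \<in> P m \<Longrightarrow> y \<in> P n \<Longrightarrow> x * y \<in> P (m + n)"
  by (cases "x = 0 \<or> y = 0") (auto simp: frakp_def val_mult)

lemma frakp_le: "x \<in> P m \<Longrightarrow> n \<le> m \<Longrightarrow> x \<in> P n"
  using frakp_antimono by blast

lemma frakp_mult_le: "x \<in> P m \<Longrightarrow> y \<in> P n \<Longrightarrow> k \<le> m + n \<Longrightarrow> x * y \<in> P k"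
  using frakp_mult frakp_le by blast

lemma frakp_all_0: "(\<And>n. x \<in> P n) \<Longrightarrow> x = 0"
  using add.right_neutral[of "val D x"] by (force simp: frakp_def dest: spec[of _ "val D x + 1"])

lemma frakp_mult_iff: "y \<noteq> 0 \<Longrightarrow> x * y \<in> P n \<longleftrightarrow> x \<in> P (n - val D y)"
  by (cases "x = 0") (auto simp: frakp_def val_mult)

lemma frakp_divide_iff: "y \<noteq> 0 \<Longrightarrow> x / y \<in> P n \<longleftrightarrow> x \<in> P (n + val D y)"
  using frakp_mult_iff[of "inverse y" x n] by (simp add: divide_inverse val_inverse)

lemma frakp_of_nat: "of_nat n \<in> P 0"
  by (induction n) (auto intro: frakp_add simp: frakp_1)

lemma val_sum_dominant:
  assumes "x \<noteq> 0" "y \<in> P (val D x + 1)"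
  shows "x + y \<noteq> 0" "val D (x + y) = val D x"
proof -
  have "x + y \<notin> P (val D x + 1)"
  proof
    assume "x + y \<in> P (val D x + 1)"
    then have "x + y - y \<in> P (val D x + 1)" using assms(2) by (rule frakp_diff)
    then show False using assms(1) by (simp add: frakp_def)
  qed
  then have *: "x + y \<noteq> 0" "val D (x + y) < val D x + 1" by (auto simp: frakp_def)
  have "x + y \<in> P (val D x)"
    by (rule frakp_add) (use assms in \<open>auto simp: frakp_def\<close>)
  with * show "x + y \<noteq> 0" "val D (x + y) = val D x" by (auto simp: frakp_def)
qed

lemma prime_rchar: "prime (rchar D)" by (rule prime_p)

text \<open>The residue characteristic \<open>2 * k + 1\<close> lies in the maximal ideal; if 2 did
  as well, so would 1.\<close>

lemma two_unit: "(2::'e) \<noteq> 0" "val D 2 = 0"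
proof -
  obtain k where k: "rchar D = 2 * k + 1" using odd_residue_char by (elim oddE)
  have "(2::'e) \<notin> P 1"
  proof
    assume "(2::'e) \<in> P 1"
    then have "2 * of_nat k \<in> P 1" using frakp_mult[of 2 1 "of_nat k" 0] frakp_of_nat by simp
    then have "of_nat (rchar D) - 2 * of_nat k \<in> P 1" using residue_char frakp_diff by blast
    then show False by (simp add: k frakp_1)
  qed
  moreover have "(2::'e) \<in> P 0" using frakp_of_nat[of 2] by simp
  ultimately show "(2::'e) \<noteq> 0" "val D 2 = 0" by (auto simp: frakp_def)
qed

lemma half_in: "x / 2 \<in> P n \<longleftrightarrow> x \<in> P n"
  using two_unit by (simp add: frakp_divide_iff)

section \<open>The conjugation and its fixed field\<close>

lemma divide_in: "x \<in> base D \<Longrightarrow> y \<in> base D \<Longrightarrow> x / y \<in> base D"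
  by (simp add: divide_inverse mult_in inverse_in)

lemma cj_0 [simp]: "cj 0 = 0" and cj_1 [simp]: "cj 1 = 1"
  using conjg_base zero_in one_in by auto

lemma cj_uminus [simp]: "cj (- x) = - cj x"
  using conjg_add[of x "- x"] by (simp add: eq_neg_iff_add_eq_0 add.commute)

lemma cj_diff [simp]: "cj (x - y) = cj x - cj y"
  using conjg_add[of x "- y"] by simp

declare conjg_add [simp] conjg_mult [simp]

lemma cj_inverse [simp]: "cj (inverse x) = inverse (cj x)"
proof (cases "x = 0")
  case False
  then have "cj x * cj (inverse x) = 1" by (metis conjg_mult cj_1 right_inverse)
  then show ?thesis by (metis inverse_unique)
qed simp

lemma cj_divide [simp]: "cj (x / y) = cj x / cj y"
  by (simp add: divide_inverse)

lemma cj_inj: "cj x = cj y \<longleftrightarrow> x = y"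
  using conjg_bij by (auto simp: bij_def inj_def)

lemma cj_eq_0 [simp]: "cj x = 0 \<longleftrightarrow> x = 0"
  using cj_inj[of x 0] by simp

lemma cj_unif [simp]: "cj (unif D) = unif D"
  by (simp add: conjg_base unif_in_base)

lemma cj_2 [simp]: "cj 2 = 2"
  using conjg_add[of 1 1] by simp

text \<open>Both \<theta> and its conjugate are roots of the same monic quadratic polynomial over F.
  Subtracting the two equations and cancelling \<open>\<theta> - cj \<theta>\<close> identifies the
  trace with a coefficient.\<close>

lemma quadratic_generator:
  obtains \<theta> where "cj \<theta> \<noteq> \<theta>" "\<And>x. \<exists>a\<in>base D. \<exists>b\<in>base D. x = a + b * \<theta>" "\<theta> + cj \<theta> \<in> base D"
proof -
  obtain \<theta> where \<theta>: "\<theta> \<notin> base D" "\<And>x. \<exists>a\<in>base D. \<exists>b\<in>base D. x = a + b * \<theta>"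
    using degree_two by blast
  have nt: "cj \<theta> \<noteq> \<theta>"
  proof
    assume "cj \<theta> = \<theta>"
    then have "cj x = x" for x using \<theta>(2)[of x] by (auto simp: conjg_base)
    then show False using conjg_nontrivial by blast
  qed
  obtain a b where ab: "a \<in> base D" "b \<in> base D" "\<theta> * \<theta> = a + b * \<theta>" using \<theta>(2) by blast
  then have "cj \<theta> * cj \<theta> = a + b * cj \<theta>"
    by (metis conjg_add conjg_base conjg_mult)
  with ab have "(\<theta> - cj \<theta>) * (\<theta> + cj \<theta> - b) = 0" by (simp add: algebra_simps)
  then have "\<theta> + cj \<theta> = b" using nt by simp
  then show ?thesis using that[of \<theta>] \<theta>(2) nt ab(2) by simp
qed

text \<open>The locale only provides a nontrivial automorphism over F. Its order is 2 because the
  trace of the generator lies in F and is therefore fixed.\<close>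

lemma cj_cj [simp]: "cj (cj x) = x"
proof -
  obtain \<theta> where \<theta>: "\<And>x. \<exists>a\<in>base D. \<exists>b\<in>base D. x = a + b * \<theta>" "\<theta> + cj \<theta> \<in> base D"
    using quadratic_generator by blast
  have "cj (\<theta> + cj \<theta>) = \<theta> + cj \<theta>" using \<theta>(2) by (rule conjg_base)
  then have "cj (cj \<theta>) = \<theta>" by (simp add: add.commute)
  then show ?thesis using \<theta>(1)[of x] by (auto simp: conjg_base)
qed

lemma base_eq_fixed: "x \<in> base D \<longleftrightarrow> cj x = x"
proof -
  obtain \<theta> where \<theta>: "cj \<theta> \<noteq> \<theta>" "\<And>x. \<exists>a\<in>base D. \<exists>b\<in>base D. x = a + b * \<theta>"
    using quadratic_generator by blast
  obtain a b where "a \<in> base D" "b \<in> base D" "x = a + b * \<theta>" using \<theta>(2) by blast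
  then have "cj x = x \<Longrightarrow> x \<in> base D" using \<theta>(1) by (auto simp: conjg_base)
  then show ?thesis using conjg_base by blast
qed

text \<open>Completeness with an explicit rate: by the ultrametric inequality the distance from the
  i-th term to the limit is governed by the i-th increment.\<close>

lemma frakp_complete_base:
  assumes "\<And>i. s i \<in> base D" "\<And>i. s (Suc i) - s i \<in> P (n0 + int i)"
  obtains l where "l \<in> base D" "\<And>i. s i - l \<in> P (n0 + int i)"
proof -
  have d: "s (i + k) - s i \<in> P (n0 + int i)" for i k
  proof (induction k)
    case (Suc k)
    have "s (Suc (i + k)) - s (i + k) \<in> P (n0 + int i)"
      by (rule frakp_le[OF assms(2)]) simp
    with Suc show ?case using frakp_add by fastforce
  qed simp
  have "\<exists>N::nat. \<forall>i\<ge>N. \<forall>j\<ge>N. s i - s j \<in> P n" for n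
  proof (intro exI allI impI)
    let ?N = "nat (n - n0)"
    fix i j assume "i \<ge> ?N" "j \<ge> ?N"
    then have "s i - s ?N \<in> P n" "s j - s ?N \<in> P n"
      using d[of ?N "i - ?N"] d[of ?N "j - ?N"] by (auto elim!: frakp_le)
    then show "s i - s j \<in> P n" using frakp_diff by fastforce
  qed
  then obtain l where l: "l \<in> base D" "\<And>n. \<exists>N. \<forall>i\<ge>N. s i - l \<in> P n"
    using complete_F[of s] assms(1) by blast
  have "s i - l \<in> P (n0 + int i)" for i
  proof -
    obtain N where N: "\<forall>j\<ge>N. s j - l \<in> P (n0 + int i)" using l(2) by blast
    have "s (i + N) - l - (s (i + N) - s i) \<in> P (n0 + int i)"
      using N d by (intro frakp_diff[of "_ - _" _ "_ - _"]) auto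
    then show ?thesis by simp
  qed
  with l(1) show ?thesis using that by blast
qed

text \<open>If \<open>x\<close> had smaller valuation than its conjugate, it would be the limit of the sequence
  \<open>y \<mapsto> T - N / y\<close> in \<open>F\<close>, where \<open>T\<close> and \<open>N\<close> are its trace and norm.\<close>

lemma val_cj_not_less: "x \<noteq> 0 \<Longrightarrow> \<not> val D x < val D (cj x)"
proof
  assume x0: "x \<noteq> 0" and lt: "val D x < val D (cj x)"
  define T where "T = x + cj x"
  define N where "N = x * cj x"
  define y where "y = rec_nat T (\<lambda>_ y. T - N / y)"
  have y_simps: "y 0 = T" "y (Suc n) = T - N / y n" for n by (auto simp: y_def)
  have TN: "T \<in> base D" "N \<in> base D" by (auto simp: base_eq_fixed T_def N_def add.commute mult.commute)
  have x_eq: "x = T - N / x" using x0 by (simp add: T_def N_def)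
  have y_base: "y n \<in> base D" for n by (induction n) (auto simp: y_simps TN intro!: diff_in divide_in)
  have y_close: "y n - x \<in> P (val D x + 1 + int n)" for n
  proof (induction n)
    case 0
    show ?case using lt by (auto simp: y_simps T_def frakp_def)
  next
    case (Suc n)
    have "y n - x \<in> P (val D x + 1)" using Suc by (rule frakp_le) simp
    from val_sum_dominant[OF x0 this] have yn: "y n \<noteq> 0" "val D (y n) = val D x" by auto
    \<comment> \<open>The number x is a fixed point of the iteration. The error is multiplied by
      \<open>cj x / y n\<close>, whose valuation \<open>val D (cj x) - val D x\<close> is at least
      1, so each step gains a level.\<close>
    have "y (Suc n) - x = (T - N / y n) - (T - N / x)" by (simp only: y_simps(2) x_eq[symmetric])
    also have "\<dots> = N / x - N / y n" by simp
    also have "\<dots> = cj x * ((y n - x) * inverse (y n))"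
      using x0 yn(1) by (simp add: N_def field_simps)
    also have "\<dots> \<in> P (val D (cj x) + ((val D x + 1 + int n) + - val D x))"
      using yn by (intro frakp_mult Suc) (auto simp: frakp_def val_inverse)
    finally show ?case by (rule frakp_le) (use lt in simp)
  qed
  have "y (Suc i) - y i \<in> P (val D x + 1 + int i)" for i
  proof -
    have "y (Suc i) - x \<in> P (val D x + 1 + int i)" by (rule frakp_le[OF y_close]) simp
    from frakp_diff[OF this y_close] show ?thesis by simp
  qed
  then obtain l where l: "l \<in> base D" "\<And>i. y i - l \<in> P (val D x + 1 + int i)"
    using frakp_complete_base[of y "val D x + 1"] y_base by blast
  have "x - l = 0"
  proof (rule frakp_all_0)
    fix n
    let ?i = "nat (n - val D x)"
    have "y ?i - l - (y ?i - x) \<in> P (val D x + 1 + int ?i)" using l(2) y_close frakp_diff by blast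
    then have "x - l \<in> P (val D x + 1 + int ?i)" by simp
    then show "x - l \<in> P n" by (rule frakp_le) simp
  qed
  then have "cj x = x" using l(1) by (simp add: base_eq_fixed)
  with lt show False by simp
qed

lemma val_cj [simp]: "val D (cj x) = val D x"
  using val_cj_not_less[of x] val_cj_not_less[of "cj x"] by (cases "x = 0") auto

lemma frakp_cj [simp]: "cj x \<in> P n \<longleftrightarrow> x \<in> P n"
  by (simp add: frakp_def)

text \<open>The difference of a generator and its conjugate changes sign under conjugation; a power
  of the uniformizer, which lies in F, normalizes its valuation. Since 2 is a unit, 1 and \<tau>
  form an integral basis of E over F.\<close>

lemma trace_zero_unit:
  obtains \<tau> where "\<tau> \<noteq> 0" "val D \<tau> = 0" "cj \<tau> = - \<tau>"
proof -
  obtain \<theta> where \<theta>: "cj \<theta> \<noteq> \<theta>" using quadratic_generator by blast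
  define \<delta> where "\<delta> = \<theta> - cj \<theta>"
  have \<delta>: "\<delta> \<noteq> 0" "cj \<delta> = - \<delta>" using \<theta> by (auto simp: \<delta>_def)
  define u where "u = (if val D \<delta> \<ge> 0 then inverse (unif D) ^ nat (val D \<delta>) else unif D ^ nat (- val D \<delta>))"
  have u: "u \<noteq> 0" "val D u = - val D \<delta>"
    using val_power[of "unif D"] val_power[of "inverse (unif D)"]
    by (auto simp: u_def unif_nonzero val_inverse val_unif)
  have "cj (unif D ^ n) = unif D ^ n" "cj (inverse (unif D) ^ n) = inverse (unif D) ^ n" for n
    by (induction n) auto
  then have "cj u = u" by (simp add: u_def)
  then show ?thesis using that[of "u * \<delta>"] u \<delta> by (simp add: val_mult)
qed

lemma trace_zero_decomposition: "\<tau> \<noteq> 0 \<Longrightarrow> x = (x + cj x) / 2 + \<tau> * ((x - cj x) / 2 / \<tau>)"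
proof -
  assume "\<tau> \<noteq> 0"
  then have "(x + cj x) / 2 + \<tau> * ((x - cj x) / 2 / \<tau>) = (x + cj x) / 2 + (x - cj x) / 2" by simp
  also have "\<dots> = (2 * x) / 2" unfolding add_divide_distrib[symmetric] by simp
  finally show ?thesis using two_unit by simp
qed

text \<open>Completeness is given for F only. The coordinates with respect to 1 and \<tau> lie in F
  and have at least the valuation of the element, so limits can be taken coordinatewise.\<close>

lemma frakp_complete:
  assumes "\<And>i. s (Suc i) - s i \<in> P (n0 + int i)"
  obtains l where "\<And>i. s i - l \<in> P (n0 + int i)"
proof -
  obtain \<tau> where \<tau>: "\<tau> \<noteq> 0" "val D \<tau> = 0" "cj \<tau> = - \<tau>" using trace_zero_unit by blast
  define a where "a i = (s i + cj (s i)) / 2" for i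
  define b where "b i = (s i - cj (s i)) / 2 / \<tau>" for i
  have base: "a i \<in> base D" "b i \<in> base D" for i
    using \<tau> by (auto simp: base_eq_fixed a_def b_def add.commute minus_divide_left)
  have "a (Suc i) - a i = ((s (Suc i) - s i) + cj (s (Suc i) - s i)) / 2" for i
    by (simp add: a_def diff_divide_distrib add_divide_distrib)
  moreover have "s (Suc i) - s i + cj (s (Suc i) - s i) \<in> P (n0 + int i)" for i
    by (rule frakp_add) (simp_all only: frakp_cj assms)
  ultimately have "a (Suc i) - a i \<in> P (n0 + int i)" for i by (simp only: half_in)
  then obtain la where la: "la \<in> base D" "\<And>i. a i - la \<in> P (n0 + int i)"
    using frakp_complete_base[of a n0] base by blast
  have "b (Suc i) - b i = ((s (Suc i) - s i) - cj (s (Suc i) - s i)) / 2 / \<tau>" for i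
    by (simp add: b_def diff_divide_distrib)
  moreover have "((s (Suc i) - s i) - cj (s (Suc i) - s i)) / 2 / \<tau> \<in> P (n0 + int i)" for i
  proof -
    have "s (Suc i) - s i - cj (s (Suc i) - s i) \<in> P (n0 + int i)"
      by (rule frakp_diff) (simp_all only: frakp_cj assms)
    then show ?thesis using \<tau> two_unit by (simp add: frakp_divide_iff val_mult)
  qed
  ultimately have "b (Suc i) - b i \<in> P (n0 + int i)" for i by simp
  then obtain lb where lb: "lb \<in> base D" "\<And>i. b i - lb \<in> P (n0 + int i)"
    using frakp_complete_base[of b n0] base by blast
  have "s i - (la + \<tau> * lb) \<in> P (n0 + int i)" for i
  proof -
    have "s i = a i + \<tau> * b i" unfolding a_def b_def using \<tau>(1) by (rule trace_zero_decomposition)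
    then have e: "s i - (la + \<tau> * lb) = (a i - la) + (b i - lb) * \<tau>" by (simp add: algebra_simps)
    moreover have "(b i - lb) * \<tau> \<in> P (n0 + int i)" using lb \<tau> by (simp add: frakp_mult_iff)
    ultimately show ?thesis unfolding e using la by (intro frakp_add)
  qed
  then show ?thesis using that by blast
qed

text \<open>Representatives for the residue field of F, taken in each of the coordinates with
  respect to 1 and \<tau>.\<close>

lemma finite_residue_repr:
  obtains R where "finite R" "\<And>x. x \<in> P 0 \<Longrightarrow> \<exists>r\<in>R. x - r \<in> P 1"
proof -
  obtain \<tau> where \<tau>: "\<tau> \<noteq> 0" "val D \<tau> = 0" "cj \<tau> = - \<tau>" using trace_zero_unit by blast
  let ?S = "base D \<inter> P 0"
  define rp where "rp = inv_into ?S (residue (val D))"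
  define R0 where "R0 = rp ` (residue (val D) ` ?S)"
  have fin: "finite R0" unfolding R0_def by (rule finite_imageI[OF finite_residue_field])
  have R0: "\<exists>r\<in>R0. x - r \<in> P 1" if "x \<in> ?S" for x
  proof
    show "rp (residue (val D) x) \<in> R0" unfolding R0_def using that by (intro imageI)
    have "residue (val D) (rp (residue (val D) x)) = residue (val D) x"
      unfolding rp_def by (rule f_inv_into_f) (rule imageI[OF that])
    moreover have "x \<in> residue (val D) x" by (simp add: residue_def)
    ultimately have "x \<in> residue (val D) (rp (residue (val D) x))" by metis
    then show "x - rp (residue (val D) x) \<in> P 1" by (simp add: residue_def)
  qed
  show ?thesis
  proof (rule that)
    show "finite ((\<lambda>(r, r'). r + r' * \<tau>) ` (R0 \<times> R0))" using fin by simp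
    fix x assume x: "x \<in> P 0"
    define a where "a = (x + cj x) / 2"
    define b where "b = (x - cj x) / 2 / \<tau>"
    have "cj a = a" by (simp add: a_def add.commute)
    moreover have "a \<in> P 0" unfolding a_def half_in using x by (intro frakp_add) simp_all
    ultimately have "a \<in> ?S" by (simp add: base_eq_fixed)
    then obtain r where r: "r \<in> R0" "a - r \<in> P 1" using R0 by blast
    have "cj b = b" using \<tau> by (simp add: b_def minus_divide_left)
    moreover have "x - cj x \<in> P 0" using x by (intro frakp_diff) simp_all
    then have "b \<in> P 0" using \<tau> two_unit by (simp add: b_def frakp_divide_iff val_mult)
    ultimately have "b \<in> ?S" by (simp add: base_eq_fixed)
    then obtain r' where r': "r' \<in> R0" "b - r' \<in> P 1" using R0 by blast
    have "x = a + \<tau> * b" unfolding a_def b_def using \<tau>(1) by (rule trace_zero_decomposition)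
    then have e: "x - (r + r' * \<tau>) = (a - r) + (b - r') * \<tau>" by (simp add: algebra_simps)
    have "(b - r') * \<tau> \<in> P 1" using r' \<tau> by (simp add: frakp_mult_iff)
    then have "x - (r + r' * \<tau>) \<in> P 1" unfolding e using r(2) by (intro frakp_add)
    then show "\<exists>r\<in>(\<lambda>(r, r'). r + r' * \<tau>) ` (R0 \<times> R0). x - r \<in> P 1"
      using r r' by force
  qed
qed

lemma val_unif_powi: "val D (unif D powi n) = n"
  by (cases "n \<ge> 0") (auto simp: power_int_def val_power val_inverse unif_nonzero val_unif)

lemma cj_unif_powi [simp]: "cj (unif D powi n) = unif D powi n"
proof -
  have "cj (unif D ^ n) = unif D ^ n" "cj (inverse (unif D) ^ n) = inverse (unif D) ^ n" for n
    by (induction n) auto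
  then show ?thesis by (simp add: power_int_def)
qed

lemma unif_powi_nonzero [simp]: "unif D powi n \<noteq> 0"
  by (simp add: unif_nonzero)

lemma finite_frakp_repr:
  obtains R where "finite R" "\<And>x. x \<in> P n \<Longrightarrow> \<exists>r\<in>R. x - r \<in> P (n + 1)"
proof -
  obtain R where R: "finite R" "\<And>x. x \<in> P 0 \<Longrightarrow> \<exists>r\<in>R. x - r \<in> P 1" using finite_residue_repr by blast
  let ?u = "unif D powi n"
  show ?thesis
  proof (rule that)
    show "finite ((\<lambda>r. r * ?u) ` R)" using R by simp
    fix x assume "x \<in> P n"
    then have "x / ?u \<in> P 0" by (simp add: frakp_divide_iff val_unif_powi unif_nonzero)
    then obtain r where r: "r \<in> R" "x / ?u - r \<in> P 1" using R by blast
    have "x - r * ?u = (x / ?u - r) * ?u" by (simp add: left_diff_distrib unif_nonzero)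
    also have "\<dots> \<in> P (n + 1)" using r by (simp only: frakp_mult_iff[OF unif_powi_nonzero] val_unif_powi) simp
    finally show "\<exists>r\<in>(\<lambda>r. r * ?u) ` R. x - r \<in> P (n + 1)" using r by blast
  qed
qed

end

section \<open>Matrices, topology and the unitary group\<close>

lemma matrix_mult_3:
  "((A::'a::semiring_1^3^3) ** B) $ i $ j = A$i$1 * B$1$j + A$i$2 * B$2$j + A$i$3 * B$3$j"
  by (simp add: matrix_matrix_mult_def sum_3)

lemma matrix_eq_3:
  "(A::'a^3^3) = B \<longleftrightarrow> A$1$1 = B$1$1 \<and> A$1$2 = B$1$2 \<and> A$1$3 = B$1$3 \<and> A$2$1 = B$2$1 \<and>
    A$2$2 = B$2$2 \<and> A$2$3 = B$2$3 \<and> A$3$1 = B$3$1 \<and> A$3$2 = B$3$2 \<and> A$3$3 = B$3$3"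
  by (simp add: vec_eq_iff forall_3 conj_ac)

lemma matrix_add_rdistrib': "(A + B) ** C = A ** C + B ** (C::'a::semiring_1^3^3)"
  by (simp add: vec_eq_iff matrix_matrix_mult_def sum.distrib distrib_right)

lemma matrix_diff_ldistrib: "A ** (B - C) = A ** B - A ** (C::'a::ring_1^3^3)"
  by (simp add: vec_eq_iff matrix_matrix_mult_def sum_subtractf right_diff_distrib)

lemma matrix_diff_rdistrib: "(A - B) ** C = A ** C - B ** (C::'a::ring_1^3^3)"
  by (simp add: vec_eq_iff matrix_matrix_mult_def sum_subtractf left_diff_distrib)

lemma mat_1_3:
  "(mat 1::'a::zero_neq_one^3^3)$1$1 = 1" "(mat 1::'a^3^3)$1$2 = 0" "(mat 1::'a^3^3)$1$3 = 0"
  "(mat 1::'a^3^3)$2$1 = 0" "(mat 1::'a^3^3)$2$2 = 1" "(mat 1::'a^3^3)$2$3 = 0"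
  "(mat 1::'a^3^3)$3$1 = 0" "(mat 1::'a^3^3)$3$2 = 0" "(mat 1::'a^3^3)$3$3 = 1"
  by (simp_all add: mat_def)

lemma transpose_component [simp]: "transpose A $ i $ j = A $ j $ i"
  by (simp add: transpose_def)

lemma beta_square: "beta ** beta = (mat 1 :: 'e::field^3^3)"
  by (simp add: matrix_eq_3 matrix_mult_3 beta_def mat_1_3)

context unramified_quadratic
begin

abbreviation cjm :: "'e^3^3 \<Rightarrow> 'e^3^3" where "cjm \<equiv> map_matrix cj"

lemma cjm_mult: "cjm (A ** B) = cjm A ** cjm B"
  by (simp add: matrix_eq_3 matrix_mult_3)

lemma cjm_cjm [simp]: "cjm (cjm A) = A"
  by (simp add: matrix_eq_3)

lemma cjm_beta [simp]: "cjm beta = beta"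
  by (simp add: matrix_eq_3 beta_def)

lemma cjm_transpose: "cjm (transpose A) = transpose (cjm A)"
  by (simp add: matrix_eq_3)

text \<open>The adjoint with respect to the hermitian form, i.e. the inverse on \<open>G\<close>.\<close>

definition adj :: "'e^3^3 \<Rightarrow> 'e^3^3"
  where "adj g = beta ** transpose (cjm g) ** beta"

lemma adj_entries:
  "adj g $ 1 $ 1 = cj (g$3$3)" "adj g $ 1 $ 2 = cj (g$2$3)" "adj g $ 1 $ 3 = cj (g$1$3)"
  "adj g $ 2 $ 1 = cj (g$3$2)" "adj g $ 2 $ 2 = cj (g$2$2)" "adj g $ 2 $ 3 = cj (g$1$2)"
  "adj g $ 3 $ 1 = cj (g$3$1)" "adj g $ 3 $ 2 = cj (g$2$1)" "adj g $ 3 $ 3 = cj (g$1$1)"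
  by (simp_all add: adj_def matrix_mult_3 beta_def)

lemma adj_mult: "adj (A ** B) = adj B ** adj A"
  by (simp add: matrix_eq_3 matrix_mult_3 adj_entries algebra_simps)

lemma adj_diff: "adj (A - B) = adj A - adj B"
  by (simp add: matrix_eq_3 adj_entries)

lemma adj_one [simp]: "adj (mat 1) = mat 1"
  by (simp add: matrix_eq_3 adj_entries mat_1_3)

lemma adj_adj [simp]: "adj (adj A) = A"
  by (simp add: matrix_eq_3 adj_entries)

text \<open>Conjugating the defining identity and multiplying by the involution \<open>beta\<close>
  says that \<open>adj g\<close> is a left inverse. For square matrices this includes
  invertibility.\<close>

lemma mem_U21: "g \<in> carrier G \<longleftrightarrow> adj g ** g = mat 1"
proof -
  have "transpose g ** beta ** cjm g = beta \<longleftrightarrow> adj g ** g = mat 1"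
  proof
    assume "transpose g ** beta ** cjm g = beta"
    then have "cjm (transpose g ** beta ** cjm g) = cjm beta" by simp
    then have "transpose (cjm g) ** beta ** g = beta"
      by (simp add: cjm_mult cjm_transpose)
    then have "beta ** (transpose (cjm g) ** beta ** g) = mat 1" by (simp add: beta_square)
    then show "adj g ** g = mat 1" by (simp add: adj_def matrix_mul_assoc)
  next
    assume "adj g ** g = mat 1"
    then have "beta ** (adj g ** g) = beta" by simp
    then have "transpose (cjm g) ** beta ** g = beta"
      by (simp add: adj_def matrix_mul_assoc beta_square)
    then have "cjm (transpose (cjm g) ** beta ** g) = cjm beta" by simp
    then show "transpose g ** beta ** cjm g = beta" by (simp add: cjm_mult cjm_transpose)
  qed
  moreover have "adj g ** g = mat 1 \<Longrightarrow> invertible g"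
    by (metis invertible_def matrix_left_right_inverse)
  ultimately show ?thesis by (auto simp: U21_def)
qed

lemma mult_U21 [simp]: "g \<otimes>\<^bsub>G\<^esub> h = g ** h" and one_U21 [simp]: "\<one>\<^bsub>G\<^esub> = mat 1"
  by (simp_all add: U21_def)

lemma mult_adj: "g \<in> carrier G \<Longrightarrow> g ** adj g = mat 1"
  by (simp add: mem_U21 matrix_left_right_inverse)

lemma adj_mult_self: "g \<in> carrier G \<Longrightarrow> adj g ** g = mat 1"
  by (simp add: mem_U21)

lemma adj_in [simp]: "g \<in> carrier G \<Longrightarrow> adj g \<in> carrier G"
  using mult_adj by (simp add: mem_U21)

lemma mult_in [simp]: "g \<in> carrier G \<Longrightarrow> h \<in> carrier G \<Longrightarrow> g ** h \<in> carrier G"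
proof -
  assume "g \<in> carrier G" "h \<in> carrier G"
  then have "adj h ** (adj g ** g) ** h = mat 1" by (simp add: mem_U21)
  then show ?thesis by (simp add: mem_U21 adj_mult matrix_mul_assoc)
qed

lemma one_in_U21 [simp]: "mat 1 \<in> carrier G"
  by (simp add: mem_U21)

lemma group_U21: "group G"
proof (rule groupI)
  show "\<exists>y\<in>carrier G. y \<otimes>\<^bsub>G\<^esub> x = \<one>\<^bsub>G\<^esub>" if "x \<in> carrier G" for x
    using that by (intro bexI[of _ "adj x"]) (simp_all add: adj_mult_self)
qed (auto simp: matrix_mul_assoc)

sublocale UG: group G by (rule group_U21)

lemma inv_U21: "g \<in> carrier G \<Longrightarrow> inv\<^bsub>G\<^esub> g = adj g"
  by (rule UG.inv_equality) (auto simp: adj_mult_self)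

lemma adj_cancel [simp]:
  assumes "g \<in> carrier G"
  shows "A ** g ** adj g = A" "A ** adj g ** g = A" "adj g ** (g ** A) = A" "g ** (adj g ** A) = A"
proof -
  note a = mult_adj[OF assms] adj_mult_self[OF assms]
  show "A ** g ** adj g = A" by (metis a(1) matrix_mul_assoc matrix_mul_rid)
  show "A ** adj g ** g = A" by (metis a(2) matrix_mul_assoc matrix_mul_rid)
  show "adj g ** (g ** A) = A" by (metis a(2) matrix_mul_assoc matrix_mul_lid)
  show "g ** (adj g ** A) = A" by (metis a(1) matrix_mul_assoc matrix_mul_lid)
qed

lemma U21_cancel_right: "g \<in> carrier G \<Longrightarrow> x ** g = y ** g \<longleftrightarrow> x = (y::'e^3^3)"
  by (metis adj_cancel(1)[of g x] adj_cancel(1)[of g y])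

lemma U21_entries:
  assumes "g \<in> carrier G"
  shows "cj (g$3$i) * g$1$j + cj (g$2$i) * g$2$j + cj (g$1$i) * g$3$j = beta $ i $ j"
proof -
  have "beta ** (adj g ** g) = transpose (cjm g) ** beta ** g"
    by (simp add: adj_def matrix_mul_assoc beta_square)
  then have "transpose (cjm g) ** beta ** g = beta" using assms by (simp add: mem_U21)
  then have "(transpose (cjm g) ** beta ** g) $ i $ j = beta $ i $ j" by simp
  then show ?thesis by (simp add: matrix_mult_3 beta_def)
qed

subsection \<open>Filtrations\<close>

definition box :: "int \<Rightarrow> ('e^3^3) set"
  where "box n = {A. \<forall>i j. A $ i $ j \<in> P n}"

lemma box_0 [simp]: "0 \<in> box n" by (simp add: box_def)

lemma box_add: "A \<in> box n \<Longrightarrow> B \<in> box n \<Longrightarrow> A + B \<in> box n"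
  by (simp add: box_def frakp_add)

lemma box_diff: "A \<in> box n \<Longrightarrow> B \<in> box n \<Longrightarrow> A - B \<in> box n"
  by (simp add: box_def frakp_diff)

lemma box_mono: "A \<in> box m \<Longrightarrow> n \<le> m \<Longrightarrow> A \<in> box n"
  by (auto simp: box_def intro: frakp_le)

lemma box_mult: "A \<in> box m \<Longrightarrow> B \<in> box n \<Longrightarrow> A ** B \<in> box (m + n)"
  by (simp add: box_def matrix_mult_3 frakp_add frakp_mult)

lemma box_adj [simp]: "adj A \<in> box n \<longleftrightarrow> A \<in> box n"
  by (simp add: box_def forall_3 adj_entries) blast

lemma in_some_box: "\<exists>n\<le>0. A \<in> box n"
proof -
  let ?S = "insert 0 ((\<lambda>(i, j). val D (A $ i $ j)) ` UNIV)"
  have "Min ?S \<le> val D (A $ i $ j)" for i j by (rule Min_le) force+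
  then have "A \<in> box (Min ?S)" by (simp add: box_def frakp_def)
  moreover have "Min ?S \<le> 0" by (rule Min_le) auto
  ultimately show ?thesis by blast
qed

lemma mult_small: "\<exists>N. \<forall>Z\<in>box N. A ** Z ** B \<in> box n"
proof -
  obtain a b where "A \<in> box a" "B \<in> box b" using in_some_box by metis
  then have "A ** Z ** B \<in> box n" if "Z \<in> box (n - a - b)" for Z
  proof -
    have "A ** Z ** B \<in> box (a + (n - a - b) + b)" using \<open>A \<in> box a\<close> \<open>B \<in> box b\<close> that by (intro box_mult)
    then show ?thesis by simp
  qed
  then show ?thesis by blast
qed

definition wt :: "int \<Rightarrow> int^3" where "wt e = vector [e, 0, - e]"

lemma wt_simps [simp]: "wt e $ 1 = e" "wt e $ 2 = 0" "wt e $ 3 = - e"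
  by (simp_all add: wt_def)

text \<open>With \<open>e = 0\<close> these are the congruence filtrations of the standard order; the other values of
  \<open>e / m\<close> give the Moy--Prasad filtrations along the standard apartment.\<close>

definition Mf :: "int \<Rightarrow> int \<Rightarrow> int \<Rightarrow> ('e^3^3) set"
  where "Mf m e r = {A. \<forall>i j. A $ i $ j = 0 \<or> r \<le> m * val D (A $ i $ j) + wt e $ i - wt e $ j}"

lemma level_add:
  assumes "m \<ge> 0" "x = 0 \<or> (k::int) \<le> m * val D x" "y = 0 \<or> k \<le> m * val D y"
  shows "x + y = 0 \<or> k \<le> m * val D (x + y)"
proof (cases "x = 0 \<or> y = 0 \<or> x + y = 0")
  case False
  then have "min (val D x) (val D y) \<le> val D (x + y)" using val_add by blast
  then have "m * min (val D x) (val D y) \<le> m * val D (x + y)" using assms(1) by (rule mult_left_mono)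
  then show ?thesis using assms False by (auto simp: min_def split: if_splits)
qed (use assms in auto)

lemma Mf_add:
  assumes "m \<ge> 0" "A \<in> Mf m e r" "B \<in> Mf m e r"
  shows "A + B \<in> Mf m e r"
proof -
  have "A$i$j + B$i$j = 0 \<or> r - wt e $ i + wt e $ j \<le> m * val D (A$i$j + B$i$j)" for i j
    by (rule level_add[OF assms(1)]) (use assms(2,3) in \<open>simp_all add: Mf_def algebra_simps\<close>)
  then show ?thesis by (simp add: Mf_def algebra_simps)
qed

lemma Mf_0 [simp]: "0 \<in> Mf m e r"
  by (simp add: Mf_def)

lemma Mf_mono: "A \<in> Mf m e r \<Longrightarrow> s \<le> r \<Longrightarrow> A \<in> Mf m e s"
  by (force simp: Mf_def)

lemma Mf_mult:
  assumes "m \<ge> 0" "A \<in> Mf m e r" "B \<in> Mf m e s"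
  shows "A ** B \<in> Mf m e (r + s)"
proof -
  have *: "A$i$k * B$k$j = 0 \<or> r + s - wt e $ i + wt e $ j \<le> m * val D (A$i$k * B$k$j)" for i j k
  proof (cases "A$i$k = 0 \<or> B$k$j = 0")
    case False
    then have "r \<le> m * val D (A$i$k) + wt e $ i - wt e $ k" "s \<le> m * val D (B$k$j) + wt e $ k - wt e $ j"
      using assms(2,3) False unfolding Mf_def by blast+
    then show ?thesis using False by (simp add: val_mult algebra_simps)
  qed auto
  have "(A ** B)$i$j = 0 \<or> r + s - wt e $ i + wt e $ j \<le> m * val D ((A ** B)$i$j)" for i j
    unfolding matrix_mult_3 by (rule level_add[OF assms(1) level_add[OF assms(1) * *] *])
  then show ?thesis by (auto simp: Mf_def algebra_simps)
qed

lemma Mf_one: "r \<le> 0 \<Longrightarrow> mat 1 \<in> Mf m e r"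
  by (auto simp: Mf_def mat_def)

lemma Mf_adj: "A \<in> Mf m e r \<Longrightarrow> adj A \<in> Mf m e r"
  by (simp add: Mf_def forall_3 adj_entries)

text \<open>The number \<open>2 * \<bar>e\<bar>\<close> bounds all differences of weights. With the
  converse inclusion \<open>box_subset_Mf\<close> this makes the two filtrations cofinal, so
  neighbourhoods of 1 can be measured by either.\<close>

lemma Mf_subset_box: "m \<ge> 1 \<Longrightarrow> Mf m e (m * n + 2 * \<bar>e\<bar>) \<subseteq> box n"
proof
  fix A assume m: "m \<ge> 1" and A: "A \<in> Mf m e (m * n + 2 * \<bar>e\<bar>)"
  have w: "wt e $ i - wt e $ j \<le> 2 * \<bar>e\<bar>" for i j
    using exhaust_3[of i] exhaust_3[of j] by auto
  have "n \<le> val D (A$i$j)" if "A$i$j \<noteq> 0" for i j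
  proof -
    have "m * n + 2 * \<bar>e\<bar> \<le> m * val D (A$i$j) + wt e $ i - wt e $ j"
      using A that by (auto simp: Mf_def)
    then have "m * n \<le> m * val D (A$i$j)" using w[of i j] by linarith
    then show ?thesis using m by simp
  qed
  then show "A \<in> box n" by (auto simp: box_def frakp_def)
qed

lemma box_subset_Mf: "m \<ge> 1 \<Longrightarrow> box (\<bar>r\<bar> + 2 * \<bar>e\<bar>) \<subseteq> Mf m e r"
proof
  fix A assume m: "m \<ge> 1" and A: "A \<in> box (\<bar>r\<bar> + 2 * \<bar>e\<bar>)"
  have w: "wt e $ j - wt e $ i \<le> 2 * \<bar>e\<bar>" for i j
    using exhaust_3[of i] exhaust_3[of j] by auto
  have "r \<le> m * val D (A$i$j) + wt e $ i - wt e $ j" if "A$i$j \<noteq> 0" for i j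
  proof -
    have v: "\<bar>r\<bar> + 2 * \<bar>e\<bar> \<le> val D (A$i$j)" using A that by (auto simp: box_def frakp_def)
    then have "val D (A$i$j) \<le> m * val D (A$i$j)" using m mult_right_mono[of 1 m "val D (A$i$j)"] by simp
    then show ?thesis using w[of j i] v by linarith
  qed
  then show "A \<in> Mf m e r" by (auto simp: Mf_def)
qed

subsection \<open>The matrix topology\<close>

lemma openin_X: "openin X U \<longleftrightarrow> (\<forall>g\<in>U. \<exists>n. \<forall>h. h - g \<in> box n \<longrightarrow> h \<in> U)"
  by (simp add: openin_matrix_topology box_def)

lemma topspace_X [simp]: "topspace X = UNIV"
proof -
  have "openin X UNIV" by (simp add: openin_X)
  then show ?thesis using openin_subset by blast
qed

lemma open_ball_X: "openin X {h. h - g \<in> box n}"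
  unfolding openin_X
proof (intro ballI exI allI impI)
  fix h k assume "h \<in> {h. h - g \<in> box n}" "k - h \<in> box n"
  then have "(k - h) + (h - g) \<in> box n" using box_add by blast
  then show "k \<in> {h. h - g \<in> box n}" by simp
qed

lemma continuous_map_mult: "continuous_map X X (\<lambda>h. A ** h ** B)"
  unfolding continuous_map_def
proof (intro conjI allI impI)
  fix U assume U: "openin X U"
  show "openin X {x \<in> topspace X. A ** x ** B \<in> U}" unfolding openin_X
  proof
    fix g assume "g \<in> {x \<in> topspace X. A ** x ** B \<in> U}"
    then obtain n where n: "\<And>h. h - A ** g ** B \<in> box n \<Longrightarrow> h \<in> U" using U by (auto simp: openin_X)
    obtain N where N: "\<And>Z. Z \<in> box N \<Longrightarrow> A ** Z ** B \<in> box n" using mult_small by blast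
    show "\<exists>n. \<forall>h. h - g \<in> box n \<longrightarrow> h \<in> {x \<in> topspace X. A ** x ** B \<in> U}"
    proof (intro exI allI impI)
      fix h assume "h - g \<in> box N"
      then have "A ** h ** B - A ** g ** B \<in> box n"
        using N by (fastforce simp: matrix_diff_ldistrib matrix_diff_rdistrib)
      then show "h \<in> {x \<in> topspace X. A ** x ** B \<in> U}" using n by simp
    qed
  qed
qed simp

lemma finite_box_repr:
  obtains R where "finite R" "R \<subseteq> box n" "\<And>A. A \<in> box n \<Longrightarrow> \<exists>B\<in>R. A - B \<in> box (n + 1)"
proof -
  obtain R where R: "finite R" "\<And>x. x \<in> P n \<Longrightarrow> \<exists>r\<in>R. x - r \<in> P (n + 1)"
    using finite_frakp_repr[of n] by metis
  let ?M = "{B :: 'e^3^3. \<forall>i j. B $ i $ j \<in> R}"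
  have "?M \<subseteq> (\<lambda>f. \<chi> i j. f (i, j)) ` (UNIV \<rightarrow>\<^sub>E R)"
  proof
    fix B assume "B \<in> ?M"
    then show "B \<in> (\<lambda>f. \<chi> i j. f (i, j)) ` (UNIV \<rightarrow>\<^sub>E R)"
      by (intro image_eqI[of _ _ "\<lambda>(i, j). B $ i $ j"]) (auto simp: vec_eq_iff)
  qed
  then have fin: "finite ?M" by (rule finite_subset) (auto intro!: finite_PiE R(1))
  show ?thesis
  proof (rule that)
    show "finite (?M \<inter> box n)" using fin by simp
    fix A assume A: "A \<in> box n"
    have "\<forall>i j. \<exists>r\<in>R. A $ i $ j - r \<in> P (n + 1)" using A R(2) by (simp add: box_def)
    then obtain r where r: "\<And>i j. r i j \<in> R" "\<And>i j. A $ i $ j - r i j \<in> P (n + 1)" by metis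
    let ?B = "\<chi> i j. r i j"
    have d: "A - ?B \<in> box (n + 1)" using r by (simp add: box_def)
    have "A - (A - ?B) \<in> box n" by (rule box_diff[OF A box_mono[OF d]]) simp
    then have "?B \<in> ?M \<inter> box n" using r by simp
    then show "\<exists>B\<in>?M \<inter> box n. A - B \<in> box (n + 1)" using d by (rule rev_bexI)
  qed simp
qed

text \<open>A subdivision argument: a ball without finite subcover contains one of the finitely many
  balls of the next level without finite subcover. The centres converge by completeness, and an open
  set around the limit swallows one of these balls.\<close>

lemma compact_box: "compactin X (box N)"
  unfolding compactin_def
proof (intro conjI allI impI)
  fix \<U> assume \<U>: "(\<forall>U\<in>\<U>. openin X U) \<and> box N \<subseteq> \<Union>\<U>"
  define fin where "fin S \<longleftrightarrow> (\<exists>\<F>. finite \<F> \<and> \<F> \<subseteq> \<U> \<and> S \<subseteq> \<Union>\<F>)" for S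
  define ball where "ball g n = {h. h - g \<in> box n}" for g n
  have step: "\<exists>g'. g' - g \<in> box n \<and> \<not> fin (ball g' (n + 1))" if nf: "\<not> fin (ball g n)" for g n
  proof (rule ccontr)
    assume neg: "\<nexists>g'. g' - g \<in> box n \<and> \<not> fin (ball g' (n + 1))"
    obtain R where R: "finite R" "R \<subseteq> box n" "\<And>A. A \<in> box n \<Longrightarrow> \<exists>B\<in>R. A - B \<in> box (n + 1)"
      using finite_box_repr[of n] by metis
    have "\<forall>B\<in>R. \<exists>\<F>. finite \<F> \<and> \<F> \<subseteq> \<U> \<and> ball (g + B) (n + 1) \<subseteq> \<Union>\<F>"
      using neg R(2) unfolding fin_def by (metis add_diff_cancel_left' subsetD)
    then obtain \<F> where \<F>: "\<And>B. B \<in> R \<Longrightarrow> finite (\<F> B) \<and> \<F> B \<subseteq> \<U> \<and> ball (g + B) (n + 1) \<subseteq> \<Union>(\<F> B)"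
      by metis
    have "ball g n \<subseteq> \<Union>(\<Union>B\<in>R. \<F> B)"
    proof
      fix h assume "h \<in> ball g n"
      then obtain B where "B \<in> R" "h - g - B \<in> box (n + 1)" using R(3) by (auto simp: ball_def)
      then have "h \<in> ball (g + B) (n + 1)" by (simp add: ball_def diff_diff_eq)
      then obtain S where "S \<in> \<F> B" "h \<in> S" using \<F>[OF \<open>B \<in> R\<close>] by blast
      then show "h \<in> \<Union>(\<Union>B\<in>R. \<F> B)" using \<open>B \<in> R\<close> by blast
    qed
    moreover have "finite (\<Union>B\<in>R. \<F> B)" using R(1) \<F> by simp
    moreover have "(\<Union>B\<in>R. \<F> B) \<subseteq> \<U>" using \<F> by (simp add: UN_least)
    ultimately show False using nf unfolding fin_def by metis
  qed
  show "\<exists>\<F>. finite \<F> \<and> \<F> \<subseteq> \<U> \<and> box N \<subseteq> \<Union>\<F>"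
  proof (rule ccontr)
    assume "\<nexists>\<F>. finite \<F> \<and> \<F> \<subseteq> \<U> \<and> box N \<subseteq> \<Union>\<F>"
    then have "\<not> fin (ball 0 N)" by (simp add: fin_def ball_def)
    have "\<exists>s. s 0 = 0 \<and> (\<forall>n. \<not> fin (ball (s n) (N + int n))) \<and> (\<forall>n. s (Suc n) - s n \<in> box (N + int n))"
    proof -
      have "\<exists>s. \<forall>n. (\<not> fin (ball (s n) (N + int n)) \<and> (n = 0 \<longrightarrow> s n = 0)) \<and> s (Suc n) - s n \<in> box (N + int n)"
      proof (rule dependent_nat_choice)
        show "\<exists>x. \<not> fin (ball x (N + int 0)) \<and> ((0::nat) = 0 \<longrightarrow> x = 0)" using \<open>\<not> fin (ball 0 N)\<close> by simp
        fix x n assume "\<not> fin (ball x (N + int n)) \<and> (n = 0 \<longrightarrow> x = 0)"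
        then show "\<exists>y. (\<not> fin (ball y (N + int (Suc n))) \<and> (Suc n = 0 \<longrightarrow> y = 0)) \<and> y - x \<in> box (N + int n)"
          using step[of x "N + int n"] by (auto simp: algebra_simps)
      qed
      then obtain s where "\<And>n. (\<not> fin (ball (s n) (N + int n)) \<and> (n = 0 \<longrightarrow> s n = 0)) \<and> s (Suc n) - s n \<in> box (N + int n)"
        by metis
      then show ?thesis by (intro exI[of _ s]) simp
    qed
    then obtain s where s: "s 0 = 0" "\<And>n. \<not> fin (ball (s n) (N + int n))" "\<And>n. s (Suc n) - s n \<in> box (N + int n)"
      by metis
    have "\<forall>i j. \<exists>l. \<forall>n. s n $ i $ j - l \<in> P (N + int n)"
    proof (intro allI)
      fix i j
      have "s (Suc n) $ i $ j - s n $ i $ j \<in> P (N + int n)" for n using s(3)[of n] by (simp add: box_def)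
      then show "\<exists>l. \<forall>n. s n $ i $ j - l \<in> P (N + int n)"
        using frakp_complete[of "\<lambda>n. s n $ i $ j" N] by metis
    qed
    then obtain l where l: "\<And>i j n. s n $ i $ j - l i j \<in> P (N + int n)" by metis
    define L where "L = (\<chi> i j. l i j)"
    have L: "s n - L \<in> box (N + int n)" for n using l by (simp add: L_def box_def)
    have "L \<in> box N" using L[of 0] s(1) by (simp add: box_def)
    then obtain U where U: "U \<in> \<U>" "L \<in> U" "openin X U" using \<U> by blast
    then obtain n where n: "\<And>h. h - L \<in> box n \<Longrightarrow> h \<in> U" by (auto simp: openin_X)
    define k where "k = nat (n - N)"
    have k: "n \<le> N + int k" by (simp add: k_def)
    have "ball (s k) (N + int k) \<subseteq> U"
    proof
      fix h assume "h \<in> ball (s k) (N + int k)"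
      then have "h - s k \<in> box (N + int k)" by (simp add: ball_def)
      from box_add[OF this L[of k]] have "h - L \<in> box (N + int k)" by simp
      then have "h - L \<in> box n" using k by (rule box_mono)
      then show "h \<in> U" by (rule n)
    qed
    then have "fin (ball (s k) (N + int k))" unfolding fin_def using U(1)
      by (intro exI[of _ "{U}"]) simp
    with s(2) show False by blast
  qed
qed simp

text \<open>A nonzero entry of \<open>adj g ** g - mat 1\<close> cannot be cancelled by a
  perturbation of larger valuation.\<close>

lemma closedin_U21: "closedin X (carrier G)"
  unfolding closedin_def
proof (intro conjI)
  show "openin X (topspace X - carrier G)" unfolding openin_X
  proof
    fix g assume "g \<in> topspace X - carrier G"
    then have "adj g ** g \<noteq> mat 1" by (simp add: mem_U21)
    then obtain i j where ij: "(adj g ** g - mat 1) $ i $ j \<noteq> 0" by (auto simp: vec_eq_iff)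
    define x where "x = (adj g ** g - mat 1) $ i $ j"
    obtain a where a: "a \<le> 0" "g \<in> box a" using in_some_box by blast
    define n where "n = max 0 (val D x + 1 - a)"
    have "h \<in> topspace X - carrier G" if h: "h - g \<in> box n" for h
    proof -
      have "(h - g) + g \<in> box a" using h a by (intro box_add) (auto simp: n_def elim: box_mono)
      then have ha: "h \<in> box a" by simp
      have "adj h ** h - adj g ** g = adj h ** (h - g) + adj (h - g) ** g"
        by (simp add: matrix_diff_ldistrib matrix_diff_rdistrib adj_diff)
      moreover have "adj h ** (h - g) \<in> box (a + n)" "adj (h - g) ** g \<in> box (n + a)"
        using ha h a by (auto intro!: box_mult simp del: adj_diff)
      ultimately have "adj h ** h - adj g ** g \<in> box (n + a)" by (simp add: box_add add.commute)
      then have "adj h ** h - adj g ** g \<in> box (val D x + 1)" by (rule box_mono) (simp add: n_def)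
      then have "(adj h ** h - adj g ** g) $ i $ j \<in> P (val D x + 1)" by (simp add: box_def)
      then have "x + (adj h ** h - adj g ** g) $ i $ j \<noteq> 0"
        using val_sum_dominant(1)[of x] ij x_def by blast
      moreover have "x + (adj h ** h - adj g ** g) $ i $ j = (adj h ** h - mat 1) $ i $ j"
        by (simp add: x_def)
      ultimately have "(adj h ** h - mat 1) $ i $ j \<noteq> 0" by metis
      then have "adj h ** h \<noteq> mat 1" by auto
      then show ?thesis by (simp add: mem_U21)
    qed
    then show "\<exists>n. \<forall>h. h - g \<in> box n \<longrightarrow> h \<in> topspace X - carrier G" by blast
  qed
qed simp

lemma near_identity:
  assumes "g \<in> carrier G" "k \<in> carrier G"
  obtains N where "\<And>h. h - g \<in> box N \<Longrightarrow> k ** (adj g ** h) ** adj k - mat 1 \<in> box n"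
    "\<And>h. h - g \<in> box N \<Longrightarrow> h ** adj g - mat 1 \<in> box n"
proof -
  obtain N where N: "\<And>Z. Z \<in> box N \<Longrightarrow> k ** adj g ** Z ** adj k \<in> box n" using mult_small by blast
  obtain N' where N': "\<And>Z. Z \<in> box N' \<Longrightarrow> mat 1 ** Z ** adj g \<in> box n" using mult_small by blast
  show ?thesis
  proof (rule that[of "max N N'"])
    fix h assume "h - g \<in> box (max N N')"
    then have h: "h - g \<in> box N" "h - g \<in> box N'" by (auto elim: box_mono)
    have "k ** adj g ** (h - g) ** adj k = k ** (adj g ** h) ** adj k - mat 1"
      by (simp only: matrix_diff_ldistrib matrix_diff_rdistrib matrix_mul_assoc adj_cancel(2)[OF assms(1)]
          mult_adj[OF assms(2)])
    then show "k ** (adj g ** h) ** adj k - mat 1 \<in> box n" using N[OF h(1)] by simp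
    have "(h - g) ** adj g = h ** adj g - mat 1"
      by (simp only: matrix_diff_rdistrib mult_adj[OF assms(1)])
    then show "h ** adj g - mat 1 \<in> box n" using N'[OF h(2)] by simp
  qed
qed

end

section \<open>Pro-p groups and fixed points\<close>

text \<open>Sylow's theorem with exponent 1 supplies an element of order q for each prime divisor q
  of the order. That order divides a power of p, so q = p.\<close>

lemma finite_p_group_order:
  assumes Q: "group Q" "finite (carrier Q)" and p: "prime p"
    and pow: "\<And>x. x \<in> carrier Q \<Longrightarrow> \<exists>n. x [^]\<^bsub>Q\<^esub> (p ^ n :: nat) = \<one>\<^bsub>Q\<^esub>"
  shows "\<exists>k. Coset.order Q = p ^ k"
proof -
  interpret Q: group Q by fact
  have pos: "Coset.order Q > 0" using Q(2) Q.order_gt_0_iff_finite by blast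
  have "q = p" if q: "prime q" "q dvd Coset.order Q" for q
  proof -
    obtain m where "Coset.order Q = q ^ 1 * m" using q(2) by (auto elim: dvdE)
    then obtain H where H: "subgroup H Q" "card H = q"
      using sylow_thm[of q Q 1 m] q(1) Q by auto
    have "finite H" using H(2) q(1) by (metis card.infinite not_prime_0)
    have "H \<noteq> {\<one>\<^bsub>Q\<^esub>}" using H(2) q(1) by auto
    then obtain x where x: "x \<in> H" "x \<noteq> \<one>\<^bsub>Q\<^esub>" using subgroup.one_closed[OF H(1)] by blast
    have xQ: "x \<in> carrier Q" using H(1) x(1) by (rule subgroup.mem_carrier)
    have "x [^]\<^bsub>Q\<lparr>carrier := H\<rparr>\<^esub> Coset.order (Q\<lparr>carrier := H\<rparr>) = \<one>\<^bsub>Q\<lparr>carrier := H\<rparr>\<^esub>"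
      using x(1) by (intro group.pow_order_eq_1 subgroup.subgroup_is_group[OF H(1) Q(1)]) simp
    then have "x [^]\<^bsub>Q\<^esub> q = \<one>\<^bsub>Q\<^esub>"
      using Q.nat_pow_consistent[of x q H] H(2) by (simp add: Coset.order_def)
    then have dq: "Q.ord x dvd q" using Q.pow_eq_id[OF xQ] by blast
    obtain n where "x [^]\<^bsub>Q\<^esub> (p ^ n :: nat) = \<one>\<^bsub>Q\<^esub>" using pow[OF xQ] by blast
    then have dp: "Q.ord x dvd p ^ n" using Q.pow_eq_id[OF xQ] by blast
    have "Q.ord x \<noteq> 1" using x(2) Q.pow_ord_eq_1[OF xQ] xQ by (metis Q.nat_pow_eone)
    then have "Q.ord x = q" using dq q(1) by (metis prime_nat_iff)
    then show "q = p" using dp q(1) p by (metis prime_dvd_power primes_dvd_imp_eq)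
  qed
  then have "prime_factors (Coset.order Q) \<subseteq> {p}" using pos by (auto simp: in_prime_factors_iff)
  then have "set_mset (prime_factorization (Coset.order Q)) \<subseteq> {p}" by simp
  then have "prime_factorization (Coset.order Q) = replicate_mset (size (prime_factorization (Coset.order Q))) p"
    by (simp add: set_mset_subset_singletonD)
  then have "prod_mset (prime_factorization (Coset.order Q)) = p ^ size (prime_factorization (Coset.order Q))"
    by (metis prod_mset_replicate_mset)
  then have "Coset.order Q = p ^ size (prime_factorization (Coset.order Q))"
    using pos prod_mset_prime_factorization_nat by simp
  then show ?thesis by blast
qed

context unramified_quadratic
begin

definition Hf :: "int \<Rightarrow> int \<Rightarrow> int \<Rightarrow> ('e^3^3) set"
  where "Hf m e r = {g \<in> carrier G. g - mat 1 \<in> Mf m e r}"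

definition Kf :: "int \<Rightarrow> int \<Rightarrow> ('e^3^3) set"
  where "Kf m e = carrier G \<inter> Mf m e 0"

lemma Hf_subset_Kf: "m \<ge> 0 \<Longrightarrow> r \<ge> 0 \<Longrightarrow> Hf m e r \<subseteq> Kf m e"
proof
  fix g assume a: "m \<ge> 0" "r \<ge> 0" "g \<in> Hf m e r"
  then have "(g - mat 1) + mat 1 \<in> Mf m e 0"
    by (intro Mf_add Mf_one) (auto simp: Hf_def intro: Mf_mono)
  then show "g \<in> Kf m e" using a by (simp add: Hf_def Kf_def)
qed

lemma subgroup_Kf: "m \<ge> 0 \<Longrightarrow> subgroup (Kf m e) G"
proof (rule UG.subgroupI)
  show "Kf m e \<noteq> {}" using Mf_one[of 0 m e] by (auto simp: Kf_def)
  show "a \<otimes>\<^bsub>G\<^esub> b \<in> Kf m e" if "m \<ge> 0" "a \<in> Kf m e" "b \<in> Kf m e" for a b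
    using that Mf_mult[of m a e 0 b 0] by (simp add: Kf_def)
  show "inv\<^bsub>G\<^esub> a \<in> Kf m e" if "a \<in> Kf m e" for a
    using that by (simp add: Kf_def inv_U21 Mf_adj)
qed (auto simp: Kf_def)

lemma subgroup_Hf:
  assumes "m \<ge> 0" "r \<ge> 0"
  shows "subgroup (Hf m e r) G"
proof (rule UG.subgroupI)
  show "Hf m e r \<noteq> {}" using Mf_0 by (auto simp: Hf_def intro!: exI[of _ "mat 1"])
  fix a b assume a: "a \<in> Hf m e r"
  then have a': "a - mat 1 \<in> Mf m e r" "a \<in> carrier G" by (auto simp: Hf_def)
  have "adj (a - mat 1) \<in> Mf m e r" using a'(1) by (rule Mf_adj)
  then show "inv\<^bsub>G\<^esub> a \<in> Hf m e r" using a'(2) by (simp add: Hf_def inv_U21 adj_diff)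
  assume b: "b \<in> Hf m e r"
  then have b': "b - mat 1 \<in> Mf m e r" "b \<in> carrier G" "b \<in> Mf m e 0"
    using Hf_subset_Kf[OF assms, of e] by (auto simp: Hf_def Kf_def)
  have "(a - mat 1) ** b \<in> Mf m e r" using Mf_mult[OF assms(1) a'(1) b'(3)] by simp
  then have "(a - mat 1) ** b + (b - mat 1) \<in> Mf m e r" using b'(1) Mf_add assms(1) by blast
  then show "a \<otimes>\<^bsub>G\<^esub> b \<in> Hf m e r"
    using a'(2) b'(2) by (simp add: Hf_def matrix_diff_rdistrib)
qed (auto simp: Hf_def)

lemma Hf_conj:
  assumes "m \<ge> 0" "k \<in> Kf m e" "h \<in> Hf m e r"
  shows "k ** h ** adj k \<in> Hf m e r"
proof -
  have k: "k \<in> carrier G" "k \<in> Mf m e 0" "adj k \<in> Mf m e 0" and h: "h \<in> carrier G" "h - mat 1 \<in> Mf m e r"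
    using assms by (auto simp: Kf_def Hf_def Mf_adj)
  have "k ** (h - mat 1) ** adj k \<in> Mf m e (0 + r + 0)"
    using assms(1) k h by (intro Mf_mult)
  moreover have "k ** (h - mat 1) ** adj k = k ** h ** adj k - mat 1"
    using k(1) by (simp add: matrix_diff_ldistrib matrix_diff_rdistrib mult_adj)
  ultimately show ?thesis using k h by (simp add: Hf_def)
qed

lemma Hf_mono: "s \<le> r \<Longrightarrow> Hf m e r \<subseteq> Hf m e s"
  by (auto simp: Hf_def intro: Mf_mono)

lemma one_in_Hf [simp]: "mat 1 \<in> Hf m e r"
  by (simp add: Hf_def)

lemma Hf_nhd:
  assumes "m \<ge> 1"
  shows "\<exists>n. \<forall>g\<in>carrier G. g - mat 1 \<in> box n \<longrightarrow> g \<in> Hf m e r"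
  using box_subset_Mf[OF assms, of r e] by (auto simp: Hf_def)

lemma nhd_Hf:
  assumes "m \<ge> 1"
  shows "\<exists>r\<ge>0. \<forall>g\<in>Hf m e r. g - mat 1 \<in> box n"
proof (intro exI conjI ballI)
  let ?r = "m * \<bar>n\<bar> + 2 * \<bar>e\<bar>"
  show "?r \<ge> 0" using assms by simp
  fix g assume "g \<in> Hf m e ?r"
  then have "g - mat 1 \<in> box \<bar>n\<bar>" using Mf_subset_box[OF assms, of e "\<bar>n\<bar>"] by (auto simp: Hf_def)
  then show "g - mat 1 \<in> box n" by (rule box_mono) simp
qed

lemma Kf_subset_box: "m \<ge> 1 \<Longrightarrow> Kf m e \<subseteq> box (- 2 * \<bar>e\<bar>)"
proof
  fix g assume m: "m \<ge> 1" and g: "g \<in> Kf m e"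
  have "m * (- 2 * \<bar>e\<bar>) + 2 * \<bar>e\<bar> = 2 * (1 - m) * \<bar>e\<bar>" by (simp add: algebra_simps)
  also have "\<dots> \<le> 0" using m by (simp add: mult_nonpos_nonneg)
  finally have "g \<in> Mf m e (m * (- 2 * \<bar>e\<bar>) + 2 * \<bar>e\<bar>)" using g by (auto simp: Kf_def intro: Mf_mono)
  then show "g \<in> box (- 2 * \<bar>e\<bar>)" using Mf_subset_box[OF m] by blast
qed

subsection \<open>Open subgroups\<close>

text \<open>Openness at the identity only. For subgroups this amounts to openness
  (\<open>nhd1_openin\<close>), and it passes to intersections and smaller groups without handling
  subspace topologies.\<close>

definition nhd1 :: "('e^3^3) set \<Rightarrow> ('e^3^3) set \<Rightarrow> bool"
  where "nhd1 H S \<longleftrightarrow> (\<exists>n. \<forall>g\<in>H. g - mat 1 \<in> box n \<longrightarrow> g \<in> S)"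

lemma nhd1_subset: "nhd1 H S \<Longrightarrow> S \<subseteq> T \<Longrightarrow> H' \<subseteq> H \<Longrightarrow> nhd1 H' T"
  unfolding nhd1_def by blast

lemma nhd1_Int: "nhd1 H S \<Longrightarrow> nhd1 H T \<Longrightarrow> nhd1 H (S \<inter> T)"
  unfolding nhd1_def
proof (elim exE)
  fix n k assume "\<forall>g\<in>H. g - mat 1 \<in> box n \<longrightarrow> g \<in> S" "\<forall>g\<in>H. g - mat 1 \<in> box k \<longrightarrow> g \<in> T"
  then have "\<forall>g\<in>H. g - mat 1 \<in> box (max n k) \<longrightarrow> g \<in> S \<inter> T"
    using box_mono[of _ "max n k" n] box_mono[of _ "max n k" k] by auto
  then show "\<exists>n. \<forall>g\<in>H. g - mat 1 \<in> box n \<longrightarrow> g \<in> S \<inter> T" by blast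
qed

lemma nhd1_INT: "finite I \<Longrightarrow> (\<And>i. i \<in> I \<Longrightarrow> nhd1 H (S i)) \<Longrightarrow> nhd1 H {g \<in> H. \<forall>i\<in>I. g \<in> S i}"
proof (induction I rule: finite_induct)
  case (insert i I)
  then have "nhd1 H (S i \<inter> {g \<in> H. \<forall>i\<in>I. g \<in> S i})" by (intro nhd1_Int) auto
  then show ?case by (rule nhd1_subset) auto
qed (simp add: nhd1_def)

lemma openin_nhd1:
  assumes "openin (subtopology X C) S" "mat 1 \<in> S"
  shows "nhd1 C S"
proof -
  obtain T where T: "openin X T" "S = T \<inter> C" using assms(1) by (auto simp: openin_subtopology)
  then obtain n where "\<And>h. h - mat 1 \<in> box n \<Longrightarrow> h \<in> T" using assms(2) by (auto simp: openin_X)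
  then show ?thesis using T(2) by (auto simp: nhd1_def)
qed

lemma subgroup_props:
  assumes "subgroup H G"
  shows "mat 1 \<in> H" "g \<in> H \<Longrightarrow> g \<in> carrier G" "g \<in> H \<Longrightarrow> h \<in> H \<Longrightarrow> g ** h \<in> H" "g \<in> H \<Longrightarrow> adj g \<in> H"
  using subgroup.one_closed[OF assms] subgroup.mem_carrier[OF assms] subgroup.m_closed[OF assms]
    subgroup.m_inv_closed[OF assms] by (auto simp: inv_U21)

lemma subgroup_adj_iff: "subgroup H G \<Longrightarrow> adj g \<in> H \<longleftrightarrow> g \<in> H"
  using subgroup_props(4)[of H g] subgroup_props(4)[of H "adj g"] by auto

lemma nhd1_left:
  assumes "nhd1 H S" "subgroup H G" "g \<in> H"
  obtains N where "\<And>h. h \<in> H \<Longrightarrow> h - g \<in> box N \<Longrightarrow> adj g ** h \<in> S"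
proof -
  obtain n where n: "\<And>g. g \<in> H \<Longrightarrow> g - mat 1 \<in> box n \<Longrightarrow> g \<in> S" using assms(1) by (auto simp: nhd1_def)
  have "g \<in> carrier G" using assms(2,3) subgroup_props(2) by blast
  then obtain N where "\<And>h. h - g \<in> box N \<Longrightarrow> mat 1 ** (adj g ** h) ** adj (mat 1) - mat 1 \<in> box n"
    using near_identity[of g "mat 1" n] one_in_U21 by metis
  then have "\<And>h. h \<in> H \<Longrightarrow> h - g \<in> box N \<Longrightarrow> adj g ** h \<in> S"
    using n assms(2,3) subgroup_props by simp
  then show ?thesis by (rule that)
qed

lemma nhd1_openin:
  assumes "nhd1 H S" "subgroup H G" "subgroup S G" "S \<subseteq> H"
  shows "openin (subtopology X H) S"
proof -
  have "\<forall>g\<in>S. \<exists>N. \<forall>h\<in>H. h - g \<in> box N \<longrightarrow> h \<in> S"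
  proof
    fix g assume g: "g \<in> S"
    then obtain N where N: "\<And>h. h \<in> H \<Longrightarrow> h - g \<in> box N \<Longrightarrow> adj g ** h \<in> S"
      using nhd1_left[OF assms(1,2)] assms(4) by blast
    have "h \<in> S" if "h \<in> H" "h - g \<in> box N" for h
    proof -
      have "g ** (adj g ** h) \<in> S" using N[OF that] g assms(3) subgroup_props(3) by blast
      then show ?thesis using g assms(3) subgroup_props(2) by simp
    qed
    then show "\<exists>N. \<forall>h\<in>H. h - g \<in> box N \<longrightarrow> h \<in> S" by blast
  qed
  then obtain N where N: "\<And>g h. g \<in> S \<Longrightarrow> h \<in> H \<Longrightarrow> h - g \<in> box (N g) \<Longrightarrow> h \<in> S" by metis
  have "openin X (\<Union>g\<in>S. {h. h - g \<in> box (N g)})" by (intro openin_Union) (auto intro: open_ball_X)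
  moreover have "S = (\<Union>g\<in>S. {h. h - g \<in> box (N g)}) \<inter> H"
  proof
    have "g \<in> {h. h - g \<in> box (N g)}" for g by simp
    then show "S \<subseteq> (\<Union>g\<in>S. {h. h - g \<in> box (N g)}) \<inter> H" using assms(4) by blast
    show "(\<Union>g\<in>S. {h. h - g \<in> box (N g)}) \<inter> H \<subseteq> S" using N by blast
  qed
  ultimately show ?thesis by (auto simp: openin_subtopology)
qed

text \<open>Inside G the complement is a union of translates of an open subgroup; outside G it is
  open because G is closed.\<close>

lemma nhd1_closedin:
  assumes "nhd1 (carrier G) S" "subgroup S G"
  shows "closedin X S"
  unfolding closedin_def openin_X
proof (intro conjI ballI)
  fix g assume g: "g \<in> topspace X - S"
  show "\<exists>n. \<forall>h. h - g \<in> box n \<longrightarrow> h \<in> topspace X - S"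
  proof (cases "g \<in> carrier G")
    case False
    then have "g \<in> topspace X - carrier G" by simp
    then obtain n where "\<And>h. h - g \<in> box n \<Longrightarrow> h \<in> topspace X - carrier G"
      using closedin_U21 unfolding closedin_def openin_X by blast
    then show ?thesis using subgroup_props(2)[OF assms(2)] by blast
  next
    case True
    obtain N where N: "\<And>h. h \<in> carrier G \<Longrightarrow> h - g \<in> box N \<Longrightarrow> adj g ** h \<in> S"
      using nhd1_left[OF assms(1) UG.subgroup_self True] by blast
    have "h \<notin> S" if "h - g \<in> box N" for h
    proof
      assume h: "h \<in> S"
      then have hG: "h \<in> carrier G" using assms(2) subgroup_props(2) by blast
      have "(adj g ** h) ** adj h \<in> S"
        by (rule subgroup_props(3)[OF assms(2) N[OF hG that] subgroup_props(4)[OF assms(2) h]])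
      then have "adj g \<in> S" using hG by simp
      then show False using g assms(2) by (simp add: subgroup_adj_iff)
    qed
    then show ?thesis by auto
  qed
qed simp

lemma finite_left_cosets:
  assumes "compactin X H" "subgroup H G" "nhd1 H S"
  obtains F where "finite F" "F \<subseteq> H" "\<And>h. h \<in> H \<Longrightarrow> \<exists>f\<in>F. adj f ** h \<in> S"
proof -
  have "\<forall>g\<in>H. \<exists>N. \<forall>h\<in>H. h - g \<in> box N \<longrightarrow> adj g ** h \<in> S"
    using nhd1_left[OF assms(3,2)] by metis
  then obtain N where N: "\<And>g h. g \<in> H \<Longrightarrow> h \<in> H \<Longrightarrow> h - g \<in> box (N g) \<Longrightarrow> adj g ** h \<in> S" by metis
  let ?\<U> = "(\<lambda>g. {h. h - g \<in> box (N g)}) ` H"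
  have "H \<subseteq> \<Union>?\<U>" by auto
  moreover have "\<forall>U\<in>?\<U>. openin X U" by (auto intro: open_ball_X)
  ultimately obtain \<F> where \<F>: "finite \<F>" "\<F> \<subseteq> ?\<U>" "H \<subseteq> \<Union>\<F>"
    using assms(1) unfolding compactin_def by meson
  obtain F where F: "F \<subseteq> H" "finite F" "\<F> = (\<lambda>g. {h. h - g \<in> box (N g)}) ` F"
    using finite_subset_image[OF \<F>(1,2)] by blast
  show ?thesis
  proof (rule that[OF F(2,1)])
    fix h assume "h \<in> H"
    then obtain f where "f \<in> F" "h - f \<in> box (N f)" using \<F>(3) F(3) by blast
    then show "\<exists>f\<in>F. adj f ** h \<in> S" using N F(1) \<open>h \<in> H\<close> by blast
  qed
qed

lemma compact_subgroup:
  assumes "nhd1 (carrier G) S" "subgroup S G" "S \<subseteq> box n"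
  shows "compactin X S"
  using compact_box assms(3) nhd1_closedin[OF assms(1,2)] by (rule closed_compactin)

lemma nhd1_Hf: "m \<ge> 1 \<Longrightarrow> nhd1 (carrier G) (Hf m e r)"
  unfolding nhd1_def by (rule Hf_nhd)

lemma nhd1_Kf: "m \<ge> 1 \<Longrightarrow> nhd1 (carrier G) (Kf m e)"
  using nhd1_Hf[of m e 0] Hf_subset_Kf[of m 0 e] by (auto elim: nhd1_subset)

lemma compact_Kf: "m \<ge> 1 \<Longrightarrow> compactin X (Kf m e)"
  by (rule compact_subgroup[OF nhd1_Kf subgroup_Kf Kf_subset_box]) auto

lemma compact_Hf: "m \<ge> 1 \<Longrightarrow> r \<ge> 0 \<Longrightarrow> compactin X (Hf m e r)"
  by (rule compact_subgroup[OF nhd1_Hf subgroup_Hf subset_trans[OF Hf_subset_Kf Kf_subset_box]]) auto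

subsection \<open>The filtration subgroups are pro-p\<close>

lemma mat_in_Mf: "c \<in> P n \<Longrightarrow> r \<le> m * n \<Longrightarrow> m \<ge> 0 \<Longrightarrow> mat c \<in> Mf m e r"
  using mult_left_mono[of n "val D c" m] by (force simp: Mf_def mat_def frakp_def)

text \<open>The matrix S is the geometric sum 1 + g + ... + g^(n-1). Each summand is congruent to 1
  at level 1, hence S is congruent to n.\<close>

lemma pow_minus_one:
  assumes "m \<ge> 1" "g \<in> Hf m e 1"
  shows "\<exists>S. g [^]\<^bsub>G\<^esub> n - mat 1 = (g - mat 1) ** S \<and> S - mat (of_nat n) \<in> Mf m e 1"
proof (induction n)
  case 0
  have "mat (of_nat 0) = (0::'e^3^3)" by (simp add: vec_eq_iff mat_def)
  then show ?case by (intro exI[of _ 0]) (simp add: matrix_eq_3 matrix_mult_3)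
next
  case (Suc n)
  then obtain S where S: "g [^]\<^bsub>G\<^esub> n - mat 1 = (g - mat 1) ** S" "S - mat (of_nat n) \<in> Mf m e 1" by blast
  have g: "g \<in> carrier G" "g - mat 1 \<in> Mf m e 1" "g \<in> Mf m e 0"
    using assms Hf_subset_Kf[of m 1 e] by (auto simp: Hf_def Kf_def)
  have pow: "g [^]\<^bsub>G\<^esub> n = mat 1 + (g - mat 1) ** S" using S(1) by (simp add: algebra_simps)
  have "g [^]\<^bsub>G\<^esub> Suc n - mat 1 = (g - mat 1) ** (S ** g + mat 1)"
    by (simp add: pow matrix_add_rdistrib' matrix_diff_rdistrib matrix_add_ldistrib matrix_mul_assoc)
  moreover have "S ** g + mat 1 - mat (of_nat (Suc n)) = (S - mat (of_nat n)) ** g + mat (of_nat n) ** (g - mat 1)"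
  proof -
    have "mat (of_nat (Suc n)) = mat (of_nat n) + (mat 1 :: 'e^3^3)" by (simp add: vec_eq_iff mat_def)
    then show ?thesis by (simp add: matrix_diff_rdistrib matrix_diff_ldistrib)
  qed
  moreover have "(S - mat (of_nat n)) ** g \<in> Mf m e (1 + 0)" "mat (of_nat n) ** (g - mat 1) \<in> Mf m e (0 + 1)"
    using assms(1) S(2) g mat_in_Mf[OF frakp_of_nat, of 0 m n e]
      Mf_mult[of m "S - mat (of_nat n)" e 1 g 0] Mf_mult[of m "mat (of_nat n)" e 0 "g - mat 1" 1] by auto
  ultimately show ?case using assms(1) by (intro exI[of _ "S ** g + mat 1"]) (simp add: Mf_add)
qed

text \<open>For n equal to the residue characteristic, n itself has level at least 1, so the
  geometric sum has level 1 and contributes the extra level.\<close>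

lemma pow_rchar_Hf:
  assumes "m \<ge> 1" "r \<ge> 1" "g \<in> Hf m e r"
  shows "g [^]\<^bsub>G\<^esub> rchar D \<in> Hf m e (r + 1)"
proof -
  have "g \<in> Hf m e 1" using assms Hf_mono by blast
  then obtain S where S: "g [^]\<^bsub>G\<^esub> rchar D - mat 1 = (g - mat 1) ** S" "S - mat (of_nat (rchar D)) \<in> Mf m e 1"
    using pow_minus_one[OF assms(1)] by blast
  have "mat (of_nat (rchar D)) \<in> Mf m e 1" using assms(1) by (intro mat_in_Mf[OF residue_char]) auto
  then have "S - mat (of_nat (rchar D)) + mat (of_nat (rchar D)) \<in> Mf m e 1"
    using S(2) assms(1) by (intro Mf_add) auto
  then have "S \<in> Mf m e 1" by simp
  then have "(g - mat 1) ** S \<in> Mf m e (r + 1)" using assms by (intro Mf_mult) (auto simp: Hf_def)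
  moreover have "g [^]\<^bsub>G\<^esub> rchar D \<in> carrier G" using assms by (auto simp: Hf_def)
  ultimately show ?thesis using S(1) by (simp add: Hf_def)
qed

lemma pow_power_Hf:
  assumes "m \<ge> 1" "g \<in> Hf m e 1"
  shows "g [^]\<^bsub>G\<^esub> (rchar D ^ n) \<in> Hf m e (1 + int n)"
proof (induction n)
  case (Suc n)
  have g: "g \<in> carrier G" using assms by (simp add: Hf_def)
  have "(g [^]\<^bsub>G\<^esub> (rchar D ^ n)) [^]\<^bsub>G\<^esub> rchar D \<in> Hf m e (1 + int n + 1)"
    using assms(1) Suc by (intro pow_rchar_Hf) auto
  then show ?case using g by (simp add: UG.nat_pow_pow mult.commute add.commute)
qed (use assms UG.nat_pow_eone in \<open>simp add: Hf_def\<close>)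

lemma pow_power_nhd1:
  assumes "m \<ge> 1" "g \<in> Hf m e 1" "nhd1 H S" "subgroup H G" "g \<in> H"
  obtains n where "g [^]\<^bsub>G\<^esub> (rchar D ^ n) \<in> S"
proof -
  obtain k where k: "\<And>g. g \<in> H \<Longrightarrow> g - mat 1 \<in> box k \<Longrightarrow> g \<in> S" using assms(3) by (auto simp: nhd1_def)
  obtain r where r: "r \<ge> 0" "\<And>g. g \<in> Hf m e r \<Longrightarrow> g - mat 1 \<in> box k" using nhd_Hf[OF assms(1)] by metis
  have "g [^]\<^bsub>G\<^esub> (rchar D ^ nat r) \<in> Hf m e r"
    using pow_power_Hf[OF assms(1,2), of "nat r"] Hf_mono[of r "1 + int (nat r)" m e] r(1) by auto
  moreover have "g [^]\<^bsub>G\<^esub> j \<in> H" for j :: nat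
    by (induction j) (use assms(4,5) subgroup_props in auto)
  ultimately have "g [^]\<^bsub>G\<^esub> (rchar D ^ nat r) \<in> S" using r(2) k by blast
  then show ?thesis by (rule that)
qed

lemma subgrp_simps [simp]: "carrier (subgrp D H) = H" "mult (subgrp D H) = (**)" "one (subgrp D H) = mat 1"
  by (simp_all add: subgrp_def U21_def)

lemma group_subgrp: "subgroup H G \<Longrightarrow> group (subgrp D H)"
  unfolding subgrp_def by (rule subgroup.subgroup_is_group[OF _ group_U21])

lemma inv_subgrp: "subgroup H G \<Longrightarrow> g \<in> H \<Longrightarrow> inv\<^bsub>subgrp D H\<^esub> g = adj g"
  unfolding subgrp_def using UG.m_inv_consistent[of H g] subgroup_props(2)[of H g] by (simp add: inv_U21)

lemma subgroup_subgrp: "subgroup H G \<Longrightarrow> subgroup S (subgrp D H) \<longleftrightarrow> subgroup S G \<and> S \<subseteq> H"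
  unfolding subgrp_def using UG.subgroup_incl UG.incl_subgroup subgroup.subset
  by (metis partial_object.select_convs(1) partial_object.surjective partial_object.update_convs(1))

lemma normal_subgrp:
  assumes "subgroup H G"
  shows "N \<lhd> subgrp D H \<longleftrightarrow> subgroup N G \<and> N \<subseteq> H \<and> (\<forall>h\<in>H. \<forall>n\<in>N. h ** n ** adj h \<in> N)"
  unfolding group.normal_inv_iff[OF group_subgrp[OF assms]] subgroup_subgrp[OF assms]
  using inv_subgrp[OF assms] by auto

text \<open>Compactness makes the index of an open subgroup finite. Iterated p-th powers of an
  element enter every neighbourhood of 1, so each element of the quotient has p-power order.\<close>

lemma pro_p_Hf:
  assumes m: "m \<ge> 1"
  shows "pro_p_subgroup D (rchar D) (Hf m e 1)"
  unfolding pro_p_subgroup_def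
proof (intro conjI allI impI)
  let ?H = "Hf m e 1"
  show sub: "subgroup ?H G" using m by (intro subgroup_Hf) auto
  show cpt: "compactin X ?H" using m by (intro compact_Hf) auto
  fix N assume N: "N \<lhd> subgrp D ?H \<and> openin (subtopology X ?H) N"
  let ?S = "subgrp D ?H"
  interpret S: group ?S by (rule group_subgrp[OF sub])
  interpret N: normal N ?S using N by blast
  interpret Q: group "?S Mod N" by (rule N.factorgroup_is_group)
  have Nsub: "subgroup N G" "N \<subseteq> ?H" using N normal_subgrp[OF sub] by auto
  have nhd: "nhd1 ?H N" using N subgroup_props(1)[OF Nsub(1)] by (intro openin_nhd1) auto
  then obtain F where F: "finite F" "F \<subseteq> ?H" "\<And>h. h \<in> ?H \<Longrightarrow> \<exists>f\<in>F. adj f ** h \<in> N"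
    using finite_left_cosets[OF cpt sub] by blast
  have "rcosets\<^bsub>?S\<^esub> N \<subseteq> (\<lambda>f. N #>\<^bsub>?S\<^esub> f) ` F"
  proof
    fix C assume "C \<in> rcosets\<^bsub>?S\<^esub> N"
    then obtain h where h: "h \<in> ?H" "C = N #>\<^bsub>?S\<^esub> h" by (auto simp: RCOSETS_def)
    then obtain f where f: "f \<in> F" "adj f ** h \<in> N" using F(3) by blast
    have fH: "f \<in> ?H" using f F(2) by blast
    have "f ** (adj f ** h) ** adj f \<in> N" using N fH f(2) normal_subgrp[OF sub] by blast
    then have "h ** adj f \<in> N" using fH sub subgroup_props(2) by simp
    then have "h \<in> N #>\<^bsub>?S\<^esub> f" unfolding r_coset_def using fH sub subgroup_props(2)
      by (auto intro!: bexI[of _ "h ** adj f"])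
    then have "N #>\<^bsub>?S\<^esub> f = N #>\<^bsub>?S\<^esub> h" using fH h(1) N.subgroup_axioms by (intro S.repr_independence) auto
    then show "C \<in> (\<lambda>f. N #>\<^bsub>?S\<^esub> f) ` F" using f h by blast
  qed
  then have fin: "finite (carrier (?S Mod N))" using F(1) by (auto simp: FactGroup_def intro: finite_subset)
  have "\<exists>k. Coset.order (?S Mod N) = rchar D ^ k"
  proof (rule finite_p_group_order[OF Q.is_group fin prime_rchar])
    fix C assume "C \<in> carrier (?S Mod N)"
    then obtain g where g: "g \<in> ?H" "C = N #>\<^bsub>?S\<^esub> g" by (auto simp: FactGroup_def RCOSETS_def)
    obtain n where n: "g [^]\<^bsub>G\<^esub> (rchar D ^ n) \<in> N" using pow_power_nhd1[OF m g(1) nhd sub g(1)] by blast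
    have "C [^]\<^bsub>?S Mod N\<^esub> (rchar D ^ n) = N #>\<^bsub>?S\<^esub> (g [^]\<^bsub>?S\<^esub> (rchar D ^ n))"
      using hom_nat_pow[OF N.r_coset_hom_Mod _ S.is_group Q.is_group, of g] g by simp
    also have "g [^]\<^bsub>?S\<^esub> (rchar D ^ n) = g [^]\<^bsub>G\<^esub> (rchar D ^ n)"
      unfolding subgrp_def by (rule UG.nat_pow_consistent[symmetric])
    also have "N #>\<^bsub>?S\<^esub> (g [^]\<^bsub>G\<^esub> (rchar D ^ n)) = N"
      using n Nsub by (intro S.coset_join2 N.subgroup_axioms) auto
    finally show "\<exists>n. C [^]\<^bsub>?S Mod N\<^esub> (rchar D ^ n) = \<one>\<^bsub>?S Mod N\<^esub>" by (auto simp: FactGroup_def)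
  qed
  then show "\<exists>k. card (rcosets\<^bsub>?S\<^esub> N) = rchar D ^ k" by (simp add: Coset.order_def FactGroup_def)
qed

subsection \<open>Fixed points of pro-p groups\<close>

text \<open>The kernel of the action on the finite set is open and normal, so H acts through a
  finite group of p-power order and all orbits have p-power size. If \<open>x0\<close> were the only
  fixed point, \<open>card A\<close> would be 1 modulo p.\<close>

lemma pro_p_fixed_point:
  assumes H: "pro_p_subgroup D (rchar D) H"
    and fin: "finite A" and cl: "\<And>g x. g \<in> H \<Longrightarrow> x \<in> A \<Longrightarrow> a g x \<in> A"
    and a1: "\<And>x. x \<in> A \<Longrightarrow> a (mat 1) x = x"
    and am: "\<And>g h x. g \<in> H \<Longrightarrow> h \<in> H \<Longrightarrow> x \<in> A \<Longrightarrow> a (g ** h) x = a g (a h x)"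
    and sm: "\<And>x. x \<in> A \<Longrightarrow> nhd1 H {g. a g x = x}"
    and pA: "rchar D dvd card A" and x0: "x0 \<in> A" "\<And>g. g \<in> H \<Longrightarrow> a g x0 = x0"
  shows "\<exists>x\<in>A. x \<noteq> x0 \<and> (\<forall>g\<in>H. a g x = x)"
proof (rule ccontr)
  assume neg: "\<not> (\<exists>x\<in>A. x \<noteq> x0 \<and> (\<forall>g\<in>H. a g x = x))"
  let ?p = "rchar D" and ?S = "subgrp D H"
  have sub: "subgroup H G" using H by (simp add: pro_p_subgroup_def)
  note HG = subgroup_props[OF sub]
  have inv1: "a (adj g) (a g x) = x" and inv2: "a g (a (adj g) x) = x" if "g \<in> H" "x \<in> A" for g x
    using am[of "adj g" g x] am[of g "adj g" x] that HG a1
    by (simp_all add: adj_mult_self mult_adj)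
  \<comment> \<open>Restricting to \<open>A\<close> makes two group elements equal exactly when they
    act equally there; the fibres of \<open>\<rho>\<close> are then the cosets of the kernel
    \<open>N\<close>.\<close>
  define \<rho> where "\<rho> g = restrict (a g) A" for g
  define T where "T = \<rho> ` H"
  define N where "N = {g \<in> H. \<forall>x\<in>A. a g x = x}"
  have nhd: "nhd1 H N" unfolding N_def using nhd1_INT[OF fin sm] by (rule nhd1_subset) auto
  have subN: "subgroup N G"
  proof (rule UG.subgroupI)
    show "inv\<^bsub>G\<^esub> g \<in> N" if "g \<in> N" for g
      using that HG inv1[of g] by (auto simp: N_def inv_U21)
  qed (use HG a1 am in \<open>auto simp: N_def\<close>)
  have norm: "N \<lhd> ?S" unfolding normal_subgrp[OF sub]
  proof (intro conjI ballI subN)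
    fix h n assume hn: "h \<in> H" "n \<in> N"
    then have "a (h ** n ** adj h) x = x" if "x \<in> A" for x
      using that by (simp add: N_def am HG cl inv2)
    then show "h ** n ** adj h \<in> N" using hn HG by (simp add: N_def)
  qed (auto simp: N_def)
  have opn: "openin (subtopology X H) N" using nhd sub subN by (rule nhd1_openin) (auto simp: N_def)
  obtain k where k: "card (rcosets\<^bsub>?S\<^esub> N) = ?p ^ k" using H norm opn by (auto simp: pro_p_subgroup_def)
  have coset: "{h \<in> H. \<rho> h = \<rho> g} = N #>\<^bsub>?S\<^esub> g" if g: "g \<in> H" for g
  proof (rule subset_antisym; rule subsetI)
    fix h assume "h \<in> {h \<in> H. \<rho> h = \<rho> g}"
    then have h: "h \<in> H" "\<And>x. x \<in> A \<Longrightarrow> a h x = a g x" by (auto simp: \<rho>_def restrict_def fun_eq_iff) metis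
    have "h ** adj g \<in> N" using h g HG cl inv2 by (simp add: N_def am)
    moreover have "h = (h ** adj g) ** g" using HG g by simp
    ultimately show "h \<in> N #>\<^bsub>?S\<^esub> g" by (auto simp: r_coset_def)
  next
    fix h assume "h \<in> N #>\<^bsub>?S\<^esub> g"
    then obtain n where "n \<in> N" "h = n ** g" by (auto simp: r_coset_def)
    then show "h \<in> {h \<in> H. \<rho> h = \<rho> g}" using g HG cl by (auto simp: N_def \<rho>_def am intro!: restrict_ext)
  qed
  have "bij_betw (\<lambda>t. {h \<in> H. \<rho> h = t}) T (rcosets\<^bsub>?S\<^esub> N)"
    unfolding bij_betw_def
  proof
    show "inj_on (\<lambda>t. {h \<in> H. \<rho> h = t}) T"
    proof (rule inj_onI)
      fix s t assume "s \<in> T" and st: "{h \<in> H. \<rho> h = s} = {h \<in> H. \<rho> h = t}"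
      then obtain g where g: "g \<in> H" "s = \<rho> g" by (auto simp: T_def)
      then have "g \<in> {h \<in> H. \<rho> h = t}" unfolding st[symmetric] by simp
      then show "s = t" using g by simp
    qed
    show "(\<lambda>t. {h \<in> H. \<rho> h = t}) ` T = rcosets\<^bsub>?S\<^esub> N"
    proof -
      have "(\<lambda>t. {h \<in> H. \<rho> h = t}) ` T = (\<lambda>g. {h \<in> H. \<rho> h = \<rho> g}) ` H"
        by (simp only: T_def image_image)
      also have "\<dots> = (\<lambda>g. N #>\<^bsub>?S\<^esub> g) ` H" by (rule image_cong) (simp, rule coset)
      also have "\<dots> = rcosets\<^bsub>?S\<^esub> N" unfolding RCOSETS_def subgrp_simps by (rule UNION_singleton_eq_range[symmetric])
      finally show ?thesis .
    qed
  qed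
  from bij_betw_same_card[OF this] have cT: "card T = ?p ^ k" using k by simp
  have p0: "?p > 0" using prime_rchar prime_gt_0_nat by blast
  then have finT: "finite T" using cT card_ge_0_finite by force
  define orb where "orb x = (\<lambda>g. a g x) ` H" for x
  have orbA: "orb x \<subseteq> A" if "x \<in> A" for x using that cl by (auto simp: orb_def)
  have x_orb: "x \<in> orb x" if "x \<in> A" for x using a1 HG(1) that by (force simp: orb_def)
  have orb_eq: "orb y = orb x" if xy: "x \<in> A" "y \<in> orb x" for x y
  proof -
    obtain g where g: "g \<in> H" "y = a g x" using xy(2) by (auto simp: orb_def)
    have "a h y = a (h ** g) x" "a h x = a (h ** adj g) y" if "h \<in> H" for h
      using g that xy(1) HG cl by (simp_all add: am inv1)
    then show ?thesis using g(1) HG(3,4) unfolding orb_def by (intro subset_antisym image_subsetI) auto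
  qed
  have card_orb: "card (orb x) dvd ?p ^ k" if x: "x \<in> A" for x
  proof -
    \<comment> \<open>Composition with the action of h maps the stabilizer of x bijectively onto the
      elements sending x to y, so the orbit size divides the order of T.\<close>
    have fib: "card {t \<in> T. t x = y} = card {t \<in> T. t x = x}" if y: "y \<in> orb x" for y
    proof -
      obtain h where h: "h \<in> H" "y = a h x" using y by (auto simp: orb_def)
      have comp: "(\<lambda>z\<in>A. a h (\<rho> g z)) = \<rho> (h ** g)" if "h \<in> H" "g \<in> H" for h g
        using that by (auto simp: \<rho>_def am)
      have cv: "\<rho> (h ** g) x = a h (\<rho> g x)" if "h \<in> H" "g \<in> H" for h g
        using that x by (simp add: \<rho>_def am)
      have "bij_betw (\<lambda>t. \<lambda>z\<in>A. a h (t z)) {t \<in> T. t x = x} {t \<in> T. t x = y}"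
      proof (rule bij_betw_byWitness[where f' = "\<lambda>t. \<lambda>z\<in>A. a (adj h) (t z)"])
        have r: "(\<lambda>z\<in>A. a (adj h) ((\<lambda>z\<in>A. a h (\<rho> g z)) z)) = \<rho> g"
          "(\<lambda>z\<in>A. a h ((\<lambda>z\<in>A. a (adj h) (\<rho> g z)) z)) = \<rho> g" if "g \<in> H" for g
          using that h(1) cl by (auto simp: \<rho>_def inv1 inv2)
        show "\<forall>t\<in>{t \<in> T. t x = x}. (\<lambda>z\<in>A. a (adj h) ((\<lambda>z\<in>A. a h (t z)) z)) = t"
          "\<forall>t\<in>{t \<in> T. t x = y}. (\<lambda>z\<in>A. a h ((\<lambda>z\<in>A. a (adj h) (t z)) z)) = t"
          using r unfolding T_def by blast+
        show "(\<lambda>t. \<lambda>z\<in>A. a h (t z)) ` {t \<in> T. t x = x} \<subseteq> {t \<in> T. t x = y}"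
          using comp h HG x cv by (auto simp: T_def)
        show "(\<lambda>t. \<lambda>z\<in>A. a (adj h) (t z)) ` {t \<in> T. t x = y} \<subseteq> {t \<in> T. t x = x}"
          using comp[of "adj h"] h HG x inv1 cv[of "adj h"] by (auto simp: T_def)
      qed
      from bij_betw_same_card[OF this] show ?thesis by simp
    qed
    have "T = (\<Union>y\<in>orb x. {t \<in> T. t x = y})"
      using x by (auto simp: T_def \<rho>_def orb_def)
    then have "card T = card (\<Union>y\<in>orb x. {t \<in> T. t x = y})" by simp
    also have "\<dots> = (\<Sum>y\<in>orb x. card {t \<in> T. t x = y})"
      using finT finite_subset[OF orbA[OF x] fin] by (intro card_UN_disjoint) auto
    also have "\<dots> = card (orb x) * card {t \<in> T. t x = x}" using fib by simp
    finally show ?thesis using cT by (metis dvd_triv_left)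
  qed
  have dv: "?p dvd card C" if C: "C \<in> orb ` A" "C \<noteq> {x0}" for C
  proof -
    obtain x where x: "x \<in> A" "C = orb x" using C by blast
    obtain i where i: "card C = ?p ^ i" using card_orb[OF x(1)] divides_primepow_nat[OF prime_rchar] x(2) by auto
    show ?thesis
    proof (cases i)
      case 0
      then have "card C = 1" using i by simp
      then have "orb x = {x}" using x_orb[OF x(1)] x(2) by (metis card_1_singletonE singletonD)
      then have "\<forall>g\<in>H. a g x = x" by (auto simp: orb_def)
      then have "x = x0" using neg x(1) by blast
      then show ?thesis using C(2) x(2) \<open>orb x = {x}\<close> by simp
    qed (use i in simp)
  qed
  have "orb x0 = {x0}" using x0 HG(1) by (auto simp: orb_def)
  then have mem: "{x0} \<in> orb ` A" using x0(1) by force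
  have "pairwise disjnt (orb ` A)"
    unfolding pairwise_def disjnt_def using orb_eq by blast
  then have "card (\<Union>(orb ` A)) = sum card (orb ` A)"
    by (rule card_Union_disjoint) (use orbA fin finite_subset in blast)
  moreover have "\<Union>(orb ` A) = A" using orbA x_orb by blast
  ultimately have "card A = 1 + sum card (orb ` A - {{x0}})"
    using mem fin by (simp add: sum.remove[of _ "{x0}"])
  moreover have "?p dvd sum card (orb ` A - {{x0}})" using dv by (intro dvd_sum) auto
  ultimately have "?p dvd 1" using pA by (metis dvd_add_left_iff)
  then show False using prime_rchar by auto
qed

text \<open>Smoothness makes the orbit of w finite. Its span over the prime field is a finite stable
  set whose order is divisible by p, and counting produces a fixed vector besides 0.\<close>

lemma pro_p_fixed_vector:
  fixes scl :: "'c::field \<Rightarrow> 'v::ab_group_add \<Rightarrow> 'v"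
  assumes H: "pro_p_subgroup D (rchar D) H" and p: "CHAR('c) = rchar D"
    and V: "vector_space scl" and W: "module.subspace scl W"
    and cl: "\<And>g x. g \<in> H \<Longrightarrow> x \<in> W \<Longrightarrow> a g x \<in> W"
    and add: "\<And>g x y. g \<in> H \<Longrightarrow> x \<in> W \<Longrightarrow> y \<in> W \<Longrightarrow> a g (x + y) = a g x + a g y"
    and scal: "\<And>g c x. g \<in> H \<Longrightarrow> x \<in> W \<Longrightarrow> a g (scl c x) = scl c (a g x)"
    and a1: "\<And>x. x \<in> W \<Longrightarrow> a (mat 1) x = x"
    and am: "\<And>g h x. g \<in> H \<Longrightarrow> h \<in> H \<Longrightarrow> x \<in> W \<Longrightarrow> a (g ** h) x = a g (a h x)"
    and sm: "\<And>x. x \<in> W \<Longrightarrow> nhd1 H {g. a g x = x}"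
    and w: "w \<in> W" "w \<noteq> 0"
  shows "\<exists>x\<in>W. x \<noteq> 0 \<and> (\<forall>g\<in>H. a g x = x)"
proof -
  interpret V: vector_space scl by fact
  have sub: "subgroup H G" and cpt: "compactin X H" using H by (auto simp: pro_p_subgroup_def)
  note HG = subgroup_props[OF sub]
  note WW = V.subspace_0[OF W] V.subspace_add[OF W] V.subspace_scale[OF W] V.subspace_sum[OF W]
  have a0: "a g 0 = 0" if "g \<in> H" for g using scal[OF that WW(1), of 0] by simp
  have asum: "a g (sum f I) = (\<Sum>i\<in>I. a g (f i))" if "g \<in> H" "finite I" "\<And>i. i \<in> I \<Longrightarrow> f i \<in> W" for g f and I :: "'v set"
    using that(2,3) by (induction I rule: finite_induct) (auto simp: a0 that(1) add WW)
  obtain F where F: "finite F" "F \<subseteq> H" "\<And>h. h \<in> H \<Longrightarrow> \<exists>f\<in>F. adj f ** h \<in> {g. a g w = w}"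
    using finite_left_cosets[OF cpt sub sm[OF w(1)]] by blast
  define O' where "O' = (\<lambda>g. a g w) ` H"
  have "O' \<subseteq> (\<lambda>g. a g w) ` F"
  proof
    fix y assume "y \<in> O'"
    then obtain h where h: "h \<in> H" "y = a h w" by (auto simp: O'_def)
    then obtain f where f: "f \<in> F" "a (adj f ** h) w = w" using F(3) by blast
    have fH: "f \<in> H" using f F(2) by blast
    have "y = a (f ** (adj f ** h)) w" using fH HG h by simp
    also have "\<dots> = a f w" using am[of f "adj f ** h" w] fH h HG w(1) f(2) by simp
    finally show "y \<in> (\<lambda>g. a g w) ` F" using f by blast
  qed
  then have finO: "finite O'" using F(1) finite_subset by blast
  have OW: "O' \<subseteq> W" using cl w(1) by (auto simp: O'_def)
  have wO: "w \<in> O'" using a1[OF w(1)] HG(1) by (force simp: O'_def)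
  have p0: "rchar D > 0" using prime_rchar prime_gt_0_nat by blast
  have char0: "(of_nat (rchar D) :: 'c) = 0" using p of_nat_CHAR[where 'a='c] by simp
  \<comment> \<open>The prime field, as the image of the natural numbers. Coefficients are
    restricted to it to keep the span of the orbit finite.\<close>
  define PF :: "'c set" where "PF = range of_nat"
  have "(of_nat n :: 'c) \<in> of_nat ` {..<rchar D}" for n
  proof -
    have "of_nat n = (of_nat (rchar D * (n div rchar D) + n mod rchar D) :: 'c)" by simp
    also have "\<dots> = of_nat (n mod rchar D)" by (simp only: of_nat_add of_nat_mult char0 mult_zero_left add_0_left)
    finally show ?thesis using p0 by auto
  qed
  then have "PF \<subseteq> of_nat ` {..<rchar D}" by (auto simp: PF_def)
  then have finP: "finite PF" using finite_subset by blast
  have PF: "0 \<in> PF" "1 \<in> PF" "\<And>x y. x \<in> PF \<Longrightarrow> y \<in> PF \<Longrightarrow> x + y \<in> PF"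
    using rangeI[of "of_nat :: nat \<Rightarrow> 'c" 0] rangeI[of "of_nat :: nat \<Rightarrow> 'c" 1]
    by (auto simp: PF_def simp flip: of_nat_add)
  define comb where "comb c = (\<Sum>y\<in>O'. scl (c y) y)" for c
  define A where "A = comb ` (O' \<rightarrow>\<^sub>E PF)"
  have finA: "finite A" unfolding A_def using finO finP by (intro finite_imageI finite_PiE) auto
  have inA: "comb c \<in> A" if "\<And>y. y \<in> O' \<Longrightarrow> c y \<in> PF" for c
  proof -
    have "comb c = comb (restrict c O')" by (simp add: comb_def)
    moreover have "restrict c O' \<in> O' \<rightarrow>\<^sub>E PF" using that by auto
    ultimately show ?thesis by (auto simp: A_def)
  qed
  have AE: "\<exists>c. x = comb c \<and> (\<forall>y\<in>O'. c y \<in> PF)" if "x \<in> A" for x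
    using that by (auto simp: A_def)
  have AW: "A \<subseteq> W" unfolding A_def comb_def using WW OW by (intro image_subsetI WW(4)) auto
  have A0: "0 \<in> A" using inA[of "\<lambda>_. 0"] PF by (simp add: comb_def)
  have Aadd: "x + y \<in> A" if xy: "x \<in> A" "y \<in> A" for x y
  proof -
    obtain c d where "x = comb c" "y = comb d" "\<forall>y\<in>O'. c y \<in> PF" "\<forall>y\<in>O'. d y \<in> PF" using AE xy by metis
    then show ?thesis using inA[of "\<lambda>y. c y + d y"] PF(3) by (simp add: comb_def V.scale_left_distrib sum.distrib)
  qed
  have wA: "w \<in> A"
  proof -
    have "comb (\<lambda>y. if y = w then 1 else 0) = (\<Sum>y\<in>O'. if y = w then y else 0)"
      unfolding comb_def by (rule sum.cong) auto
    also have "\<dots> = w" using wO finO by simp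
    finally show ?thesis using inA[of "\<lambda>y. if y = w then 1 else 0"] PF by auto
  qed
  have aA: "a g x \<in> A" if g: "g \<in> H" and x: "x \<in> A" for g x
  proof -
    obtain c where c: "x = comb c" "\<forall>y\<in>O'. c y \<in> PF" using AE x by blast
    have inv: "a (adj g) (a g y) = y" "a g (a (adj g) y) = y" if "y \<in> W" for y
      using am[of "adj g" g y] am[of g "adj g" y] that g HG a1 by (simp_all add: adj_mult_self mult_adj)
    have Og: "a g y \<in> O'" if g: "g \<in> H" and y: "y \<in> O'" for g y
    proof -
      obtain h where "h \<in> H" "y = a h w" using y by (auto simp: O'_def)
      then have "a g y = a (g ** h) w" "g ** h \<in> H" using am g w(1) HG by auto
      then show ?thesis by (auto simp: O'_def)
    qed
    have "a g x = (\<Sum>y\<in>O'. a g (scl (c y) y))"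
      unfolding c(1) comb_def using g finO OW WW by (intro asum) auto
    also have "\<dots> = (\<Sum>y\<in>O'. scl (c y) (a g y))" using scal g OW by (intro sum.cong) auto
    also have "\<dots> = (\<Sum>y\<in>O'. scl (c (a (adj g) y)) y)"
      by (rule sum.reindex_bij_witness[of _ "a (adj g)" "a g"]) (use inv OW Og g HG in auto)
    finally show ?thesis using inA[of "\<lambda>y. c (a (adj g) y)"] c(2) Og[of "adj g"] g HG by (simp add: comb_def)
  qed
  \<comment> \<open>The additive group of the span is introduced only to show that its order is a
    power of p: every element is killed by p.\<close>
  define Q where "Q = \<lparr>carrier = A, monoid.mult = (+), one = (0::'v)\<rparr>"
  have Qpow: "x [^]\<^bsub>Q\<^esub> (n::nat) = scl (of_nat n) x" for x n
    by (induction n) (simp_all add: Q_def nat_pow_def V.scale_left_distrib add.commute)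
  have Amul: "scl (of_nat n) x \<in> A" if "x \<in> A" for x n
    by (induction n) (use that A0 Aadd in \<open>auto simp: V.scale_left_distrib\<close>)
  have neg1: "x + scl (of_nat (rchar D - 1)) x = 0" for x
  proof -
    have "scl 1 x + scl (of_nat (rchar D - 1)) x = scl (of_nat (Suc (rchar D - 1))) x"
      by (simp add: V.scale_left_distrib)
    also have "\<dots> = 0" using p0 char0 by simp
    finally show ?thesis by simp
  qed
  have grp: "group Q"
  proof (rule groupI)
    show "\<exists>y\<in>carrier Q. y \<otimes>\<^bsub>Q\<^esub> x = \<one>\<^bsub>Q\<^esub>" if "x \<in> carrier Q" for x
      using that Amul neg1[of x] by (auto simp: Q_def add.commute intro!: bexI[of _ "scl (of_nat (rchar D - 1)) x"])
  qed (auto simp: Q_def A0 Aadd add.assoc)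
  have "\<exists>k. Coset.order Q = rchar D ^ k"
  proof (rule finite_p_group_order[OF grp _ prime_rchar])
    fix x assume "x \<in> carrier Q"
    have "x [^]\<^bsub>Q\<^esub> (rchar D ^ 1) = \<one>\<^bsub>Q\<^esub>" by (simp add: Qpow char0) (simp add: Q_def)
    then show "\<exists>n. x [^]\<^bsub>Q\<^esub> (rchar D ^ n) = \<one>\<^bsub>Q\<^esub>" by blast
  qed (simp add: Q_def finA)
  then obtain k where k: "card A = rchar D ^ k" by (auto simp: Coset.order_def Q_def)
  have "card A \<noteq> 1" using A0 wA w(2) by (metis card_1_singletonE singletonD)
  then have "rchar D dvd card A" using k by (cases k) auto
  have "\<exists>x\<in>A. x \<noteq> 0 \<and> (\<forall>g\<in>H. a g x = x)"
  proof (rule pro_p_fixed_point[OF H finA])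
    show "rchar D dvd card A" by fact
  qed (use aA a1 am sm A0 a0 AW in auto)
  then show ?thesis using AW by blast
qed

subsection \<open>Unipotent and Weyl elements\<close>

text \<open>Under the condition \<open>iso a b\<close> these are the elements of the unipotent
  radical of B, and \<open>nl a b\<close> those of the opposite one: \<open>a\<close> is the short
  root coordinate and \<open>b\<close> the long root coordinate.\<close>

definition nu :: "'e \<Rightarrow> 'e \<Rightarrow> 'e^3^3"
  where "nu a b = vector [vector [1, a, b], vector [0, 1, - cj a], vector [0, 0, 1]]"

definition nl :: "'e \<Rightarrow> 'e \<Rightarrow> 'e^3^3"
  where "nl a b = vector [vector [1, 0, 0], vector [- cj a, 1, 0], vector [b, a, 1]]"

text \<open>A representative of the nontrivial Weyl group element. The powers of the uniformizer are
  chosen so that \<open>ww (vx i)\<close> lies in the maximal compact subgroup of the vertex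
  \<open>i\<close>.\<close>

definition ww :: "int \<Rightarrow> 'e^3^3"
  where "ww c = vector [vector [0, 0, unif D powi (- c)], vector [0, 1, 0], vector [unif D powi c, 0, 0]]"

lemma nu_entries [simp]: "nu a b $1$1 = 1" "nu a b $1$2 = a" "nu a b $1$3 = b" "nu a b $2$1 = 0" "nu a b $2$2 = 1"
  "nu a b $2$3 = - cj a" "nu a b $3$1 = 0" "nu a b $3$2 = 0" "nu a b $3$3 = 1"
  by (simp_all add: nu_def)

lemma nl_entries [simp]: "nl a b $1$1 = 1" "nl a b $1$2 = 0" "nl a b $1$3 = 0" "nl a b $2$1 = - cj a" "nl a b $2$2 = 1"
  "nl a b $2$3 = 0" "nl a b $3$1 = b" "nl a b $3$2 = a" "nl a b $3$3 = 1"
  by (simp_all add: nl_def)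

lemma ww_entries [simp]: "ww c $1$1 = 0" "ww c $1$2 = 0" "ww c $1$3 = unif D powi (- c)" "ww c $2$1 = 0" "ww c $2$2 = 1"
  "ww c $2$3 = 0" "ww c $3$1 = unif D powi c" "ww c $3$2 = 0" "ww c $3$3 = 0"
  by (simp_all add: ww_def)

text \<open>The vector (b, a, 1) is isotropic for the hermitian form.\<close>

definition iso :: "'e \<Rightarrow> 'e \<Rightarrow> bool" where "iso a b \<longleftrightarrow> b + cj b + a * cj a = 0"

lemma nu_in: "nu a b \<in> carrier G \<longleftrightarrow> iso a b"
  by (simp add: mem_U21 matrix_eq_3 matrix_mult_3 adj_entries mat_1_3 iso_def algebra_simps)

lemma nl_in: "nl a b \<in> carrier G \<longleftrightarrow> iso a b"
  by (simp add: mem_U21 matrix_eq_3 matrix_mult_3 adj_entries mat_1_3 iso_def algebra_simps)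

lemma powi_cancel [simp]: "unif D powi c * unif D powi (- c) = 1" "unif D powi (- c) * unif D powi c = 1"
  using unif_nonzero by (simp_all add: power_int_minus)

lemma ww_in [simp]: "ww c \<in> carrier G"
  by (simp add: mem_U21 matrix_eq_3 matrix_mult_3 adj_entries mat_1_3)

end

section \<open>The parahoric subgroups\<close>

primrec vx :: "vertex \<Rightarrow> int" where "vx K0 = 0" | "vx K1 = 1"

lemma vx_range: "0 \<le> vx i" "vx i \<le> 1"
  by (cases i; simp)+

context unramified_quadratic
begin

text \<open>The term \<open>- ((- k) div m)\<close> is the ceiling of k / m.\<close>

lemma level_P:
  assumes "m \<ge> 1"
  shows "x = 0 \<or> k \<le> m * val D x \<longleftrightarrow> x \<in> P (- ((- k) div m))"
proof -
  have "k \<le> m * v \<longleftrightarrow> - ((- k) div m) \<le> v" for v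
  proof
    assume "k \<le> m * v"
    then have "(- v * m) div m \<le> (- k) div m" using assms by (intro zdiv_mono1) (auto simp: mult.commute)
    moreover have "(- v * m) div m = - v" using assms by (intro nonzero_mult_div_cancel_right) simp
    ultimately show "- ((- k) div m) \<le> v" by linarith
  next
    assume "- ((- k) div m) \<le> v"
    then have "- v * m \<le> ((- k) div m) * m" using assms by (intro mult_right_mono) auto
    also have "\<dots> \<le> - k" using assms div_mult_mod_eq[of "- k" m] pos_mod_sign[of m "- k"] by linarith
    finally show "k \<le> m * v" by (simp add: mult.commute)
  qed
  then show ?thesis by (simp add: frakp_def)
qed

lemma Mf_iff:
  assumes "m \<ge> 1"
  shows "A \<in> Mf m e r \<longleftrightarrow> (\<forall>i j. A $ i $ j \<in> P (- ((wt e $ i - wt e $ j - r) div m)))"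
proof -
  have "(x = 0 \<or> r \<le> m * val D x + wt e $ i - wt e $ j) \<longleftrightarrow> x \<in> P (- ((wt e $ i - wt e $ j - r) div m))" for x i j
    using level_P[OF assms, of x "r - wt e $ i + wt e $ j"] by (simp add: algebra_simps)
  then show ?thesis by (simp add: Mf_def)
qed

text \<open>The bounds are the ceilings of (e_j - e_i) / 2 for the weights (c, 0, -c), where c is 0
  or 1.\<close>

lemma Kf_iff:
  "g \<in> Kf 2 (vx i) \<longleftrightarrow> g \<in> carrier G \<and>
    g$1$1 \<in> P 0 \<and> g$1$2 \<in> P 0 \<and> g$1$3 \<in> P (- vx i) \<and>
    g$2$1 \<in> P (vx i) \<and> g$2$2 \<in> P 0 \<and> g$2$3 \<in> P 0 \<and>
    g$3$1 \<in> P (vx i) \<and> g$3$2 \<in> P (vx i) \<and> g$3$3 \<in> P 0"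
  by (cases i) (simp_all add: Kf_def Mf_iff forall_3 conj_ac)

lemma radical_iff:
  "g \<in> Hf 2 (vx i) 1 \<longleftrightarrow> g \<in> carrier G \<and>
    g$1$1 - 1 \<in> P 1 \<and> g$1$2 \<in> P (1 - vx i) \<and> g$1$3 \<in> P (1 - vx i) \<and>
    g$2$1 \<in> P 1 \<and> g$2$2 - 1 \<in> P 1 \<and> g$2$3 \<in> P (1 - vx i) \<and>
    g$3$1 \<in> P (1 + vx i) \<and> g$3$2 \<in> P 1 \<and> g$3$3 - 1 \<in> P 1"
  by (cases i) (simp_all add: Hf_def Mf_iff forall_3 conj_ac mat_1_3)

text \<open>The vertices of the apartment are the half-integers, and (1 + c) / 3 lies strictly
  between c / 2 and (c + 1) / 2. It is thus an interior point of an alcove with vertex c / 2, and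
  the first step of its filtration is the pro-p Iwahori subgroup.\<close>

lemma pro_p_iwahori_iff:
  "g \<in> Hf 3 (1 + vx i) 1 \<longleftrightarrow> g \<in> carrier G \<and>
    g$1$1 - 1 \<in> P 1 \<and> g$1$2 \<in> P 0 \<and> g$1$3 \<in> P (- vx i) \<and>
    g$2$1 \<in> P 1 \<and> g$2$2 - 1 \<in> P 1 \<and> g$2$3 \<in> P 0 \<and>
    g$3$1 \<in> P (1 + vx i) \<and> g$3$2 \<in> P 1 \<and> g$3$3 - 1 \<in> P 1"
  by (cases i) (simp_all add: Hf_def Mf_iff forall_3 conj_ac mat_1_3)

text \<open>For \<open>K0\<close> the required integral inverse comes for free: it is
  \<open>adj g\<close>, whose entries are conjugates of those of g.\<close>

lemma maxcpt_eq: "maxcpt D i = Kf 2 (vx i)"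
proof (cases i)
  case K0
  have "g \<in> GL3_integers D" if "g \<in> carrier G" "\<forall>i j. g$i$j \<in> P 0" for g
  proof -
    have "\<forall>i j. adj g $i$j \<in> P 0" using that(2) by (simp add: forall_3 adj_entries)
    then show ?thesis using that mult_adj adj_mult_self unfolding GL3_integers_def by blast
  qed
  moreover have "g \<in> Kf 2 (vx K0) \<longleftrightarrow> g \<in> carrier G \<and> (\<forall>i j. g$i$j \<in> P 0)" for g
    unfolding Kf_iff by (simp add: forall_3 conj_ac)
  ultimately show ?thesis using K0 by (auto simp: GL3_integers_def simp del: vx.simps)
next
  case K1
  then show ?thesis using Kf_iff[of _ K1] by auto
qed

section \<open>Lattice chains and the maximality of the congruence subgroup\<close>

definition Lv :: "int \<Rightarrow> int \<Rightarrow> int \<Rightarrow> ('e^3) set"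
  where "Lv m e r = {x. \<forall>i. x $ i = 0 \<or> r \<le> m * val D (x $ i) + wt e $ i}"

lemma Lv_0 [simp]: "0 \<in> Lv m e r" by (simp add: Lv_def)

lemma Lv_add:
  assumes "m \<ge> 0" "x \<in> Lv m e r" "y \<in> Lv m e r"
  shows "x + y \<in> Lv m e r"
proof -
  have "x$i + y$i = 0 \<or> r - wt e $ i \<le> m * val D (x$i + y$i)" for i
    by (rule level_add[OF assms(1)]) (use assms(2,3) in \<open>simp_all add: Lv_def algebra_simps\<close>)
  then show ?thesis by (simp add: Lv_def algebra_simps)
qed

lemma Lv_uminus: "x \<in> Lv m e r \<Longrightarrow> - x \<in> Lv m e r"
  by (simp add: Lv_def)

lemma Lv_diff: "m \<ge> 0 \<Longrightarrow> x \<in> Lv m e r \<Longrightarrow> y \<in> Lv m e r \<Longrightarrow> x - y \<in> Lv m e r"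
  using Lv_add[of m x e r "- y"] Lv_uminus[of y m e r] by simp

lemma Lv_mono: "x \<in> Lv m e r \<Longrightarrow> s \<le> r \<Longrightarrow> x \<in> Lv m e s"
  by (force simp: Lv_def)

lemma matrix_vector_3: "(A *v x) $ i = A$i$1 * x$1 + A$i$2 * x$2 + A$i$3 * (x::'e^3)$3"
  by (simp add: matrix_vector_mult_def sum_3)

lemma Mf_Lv:
  assumes "m \<ge> 0" "A \<in> Mf m e r" "x \<in> Lv m e s"
  shows "A *v x \<in> Lv m e (r + s)"
proof -
  have *: "A$i$k * x$k = 0 \<or> r + s - wt e $ i \<le> m * val D (A$i$k * x$k)" for i k
  proof (cases "A$i$k = 0 \<or> x$k = 0")
    case False
    then have "r \<le> m * val D (A$i$k) + wt e $ i - wt e $ k" "s \<le> m * val D (x$k) + wt e $ k"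
      using assms(2,3) False unfolding Mf_def Lv_def by blast+
    then show ?thesis using False by (simp add: val_mult algebra_simps)
  qed auto
  have "(A *v x)$i = 0 \<or> r + s - wt e $ i \<le> m * val D ((A *v x)$i)" for i
    unfolding matrix_vector_3 by (rule level_add[OF assms(1) level_add[OF assms(1) * *] *])
  then show ?thesis by (auto simp: Lv_def algebra_simps)
qed

lemma Lv_scale:
  assumes "m \<ge> 0" "t \<noteq> 0" "x \<in> Lv m e r"
  shows "t *s x \<in> Lv m e (r + m * val D t)"
proof -
  have "t * x$i = 0 \<or> r + m * val D t \<le> m * val D (t * x$i) + wt e $ i" for i
  proof (cases "x $ i = 0")
    case False
    then have "r \<le> m * val D (x $ i) + wt e $ i" using assms(3) by (auto simp: Lv_def)
    then show ?thesis using False assms(2) by (simp add: val_mult algebra_simps)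
  qed simp
  then show ?thesis by (simp add: Lv_def)
qed

text \<open>The quotient of two consecutive lattices is a finite p-group on which N acts, so a
  nontrivial quotient contains a nonzero fixed class.\<close>

lemma pro_p_fixed_lattice:
  assumes N: "pro_p_subgroup D (rchar D) N" "N \<subseteq> Kf m e" and m: "m \<ge> 1"
    and x0: "x0 \<in> Lv m e r" "x0 \<notin> Lv m e (r + 1)"
  shows "\<exists>x\<in>Lv m e r. x \<notin> Lv m e (r + 1) \<and> (\<forall>g\<in>N. g *v x - x \<in> Lv m e (r + 1))"
proof -
  let ?L = "Lv m e r" and ?L' = "Lv m e (r + 1)"
  have m0: "m \<ge> 0" using m by simp
  have sub: "subgroup N G" using N by (simp add: pro_p_subgroup_def)
  note NG = subgroup_props[OF sub]
  have L'L: "?L' \<subseteq> ?L" by (auto intro: Lv_mono)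
  have stab: "g *v x \<in> Lv m e s" if "g \<in> N" "x \<in> Lv m e s" for g x s
    using Mf_Lv[OF m0 _ that(2), of g 0] N(2) that(1) by (auto simp: Kf_def)
  define cs where "cs x = {y. y - x \<in> ?L'}" for x
  have cs_eq: "cs x = cs y \<longleftrightarrow> x - y \<in> ?L'" for x y
  proof
    assume "cs x = cs y"
    moreover have "x \<in> cs x" by (simp add: cs_def)
    ultimately have "x \<in> cs y" by simp
    then show "x - y \<in> ?L'" by (simp add: cs_def)
  next
    assume xy: "x - y \<in> ?L'"
    have "z - x \<in> ?L' \<longleftrightarrow> z - y \<in> ?L'" for z
      using Lv_add[OF m0 xy, of "z - x"] Lv_diff[OF m0 _ xy, of "z - y"] by auto
    then show "cs x = cs y" by (simp add: cs_def)
  qed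
  define a where "a g C = (\<lambda>x. g *v x) ` C" for g :: "'e^3^3" and C :: "('e^3) set"
  have a_cs: "a g (cs x) = cs (g *v x)" if g: "g \<in> N" for g x
  proof (rule subset_antisym; rule subsetI)
    fix z assume "z \<in> a g (cs x)"
    then obtain y where "y - x \<in> ?L'" "z = g *v y" by (auto simp: a_def cs_def)
    then show "z \<in> cs (g *v x)"
      using stab[OF g, of "y - x"] by (simp add: cs_def matrix_vector_mult_diff_distrib)
  next
    fix z assume "z \<in> cs (g *v x)"
    then have "adj g *v (z - g *v x) \<in> ?L'" using stab NG g by (simp add: cs_def)
    then have "adj g *v z - x \<in> ?L'"
      using NG g by (simp add: matrix_vector_mult_diff_distrib matrix_vector_mul_assoc adj_mult_self)
    moreover have "z = g *v (adj g *v z)" using NG g by (simp add: matrix_vector_mul_assoc mult_adj)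
    ultimately show "z \<in> a g (cs x)" by (auto simp: a_def cs_def)
  qed
  define A where "A = cs ` ?L"
  have finA: "finite A"
  proof -
    \<comment> \<open>The least valuation allowed in coordinate i; raising it by one raises the
      level by \<open>m\<close>, hence at least by one.\<close>
    define k where "k i = - ((wt e $ i - r) div m)" for i
    have Lk: "x $ i \<in> P (k i)" if "x \<in> ?L" for x i
      using that level_P[OF m, of "x$i" "r - wt e $ i"] by (auto simp: Lv_def k_def algebra_simps)
    have "\<forall>i. \<exists>R. finite R \<and> (\<forall>x\<in>P (k i). \<exists>y\<in>R. x - y \<in> P (k i + 1))"
      using finite_frakp_repr by metis
    then obtain R where R: "\<And>i. finite (R i)" "\<And>i x. x \<in> P (k i) \<Longrightarrow> \<exists>y\<in>R i. x - y \<in> P (k i + 1)" by metis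
    have "A \<subseteq> cs ` ((\<lambda>f. \<chi> i. f i) ` (PiE UNIV R))"
    proof
      fix C assume "C \<in> A"
      then obtain x where x: "x \<in> ?L" "C = cs x" by (auto simp: A_def)
      have "\<forall>i. \<exists>y\<in>R i. x$i - y \<in> P (k i + 1)" using Lk[OF x(1)] R(2) by blast
      then obtain f where f: "\<And>i. f i \<in> R i" "\<And>i. x$i - f i \<in> P (k i + 1)" by metis
      have "x - (\<chi> i. f i) \<in> ?L'"
      proof -
        have "x$i - f i = 0 \<or> r + 1 \<le> m * val D (x$i - f i) + wt e $ i" for i
        proof (cases "x$i - f i = 0")
          case False
          then have "k i + 1 \<le> val D (x$i - f i)" using f(2)[of i] by (auto simp: frakp_def)
          then have "m * (k i + 1) \<le> m * val D (x$i - f i)" using m0 by (rule mult_left_mono)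
          moreover have "m * ((wt e $ i - r) div m) \<le> wt e $ i - r"
            using m mult_div_mod_eq[of m "wt e $ i - r"] pos_mod_sign[of m "wt e $ i - r"] by linarith
          ultimately show ?thesis using m by (simp add: k_def algebra_simps)
        qed simp
        then show ?thesis by (simp add: Lv_def)
      qed
      then have "C = cs (\<chi> i. f i)" using x(2) by (simp add: cs_eq)
      then show "C \<in> cs ` ((\<lambda>f. \<chi> i. f i) ` (PiE UNIV R))" using f(1) by auto
    qed
    then show ?thesis by (rule finite_subset) (intro finite_imageI finite_PiE, auto simp: R)
  qed
  \<comment> \<open>The quotient group, written on cosets. Multiplication by the residue
    characteristic raises the level, so its order is a power of that prime.\<close>
  define Q where "Q = \<lparr>carrier = A, monoid.mult = (\<lambda>C C'. {u + v | u v. u \<in> C \<and> v \<in> C'}), one = cs 0\<rparr>"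
  have Qm: "cs x \<otimes>\<^bsub>Q\<^esub> cs y = cs (x + y)" for x y
  proof (rule subset_antisym; rule subsetI)
    fix z assume "z \<in> cs x \<otimes>\<^bsub>Q\<^esub> cs y"
    then obtain u v where "u - x \<in> ?L'" "v - y \<in> ?L'" "z = u + v" by (auto simp: Q_def cs_def)
    then show "z \<in> cs (x + y)" using Lv_add[OF m0, of "u - x" e "r + 1" "v - y"] by (simp add: cs_def algebra_simps)
  next
    fix z assume "z \<in> cs (x + y)"
    then have "z - y \<in> cs x" "y \<in> cs y" by (auto simp: cs_def algebra_simps)
    moreover have "z = (z - y) + y" by simp
    ultimately show "z \<in> cs x \<otimes>\<^bsub>Q\<^esub> cs y" unfolding Q_def monoid.select_convs by blast
  qed
  have carr: "carrier Q = cs ` ?L" and one: "\<one>\<^bsub>Q\<^esub> = cs 0" by (simp_all add: Q_def A_def)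
  have grp: "group Q"
  proof (rule groupI; unfold carr one)
    show "cs 0 \<in> cs ` ?L" by simp
    fix C assume "C \<in> cs ` ?L"
    then obtain x where x: "x \<in> ?L" "C = cs x" by blast
    show "cs 0 \<otimes>\<^bsub>Q\<^esub> C = C" using x by (simp add: Qm)
    have "- x \<in> ?L" "cs (- x) \<otimes>\<^bsub>Q\<^esub> C = cs 0" using x by (auto simp: Qm Lv_uminus)
    then show "\<exists>C'\<in>cs ` ?L. C' \<otimes>\<^bsub>Q\<^esub> C = cs 0" by blast
    fix C' assume "C' \<in> cs ` ?L"
    then obtain y where y: "y \<in> ?L" "C' = cs y" by blast
    show "C \<otimes>\<^bsub>Q\<^esub> C' \<in> cs ` ?L" using x y Lv_add[OF m0] by (auto simp: Qm)
    fix C'' assume "C'' \<in> cs ` ?L"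
    then show "C \<otimes>\<^bsub>Q\<^esub> C' \<otimes>\<^bsub>Q\<^esub> C'' = C \<otimes>\<^bsub>Q\<^esub> (C' \<otimes>\<^bsub>Q\<^esub> C'')"
      using x y by (auto simp: Qm add.assoc)
  qed
  have Qpow: "cs x [^]\<^bsub>Q\<^esub> (n::nat) = cs (of_nat n *s x)" for x n
  proof (induction n)
    case 0
    then show ?case by (simp add: nat_pow_def one)
  next
    case (Suc n)
    have "of_nat (Suc n) *s x = of_nat n *s x + x" by (simp add: vec_eq_iff algebra_simps)
    then show ?case using Suc monoid.nat_pow_Suc[OF group.is_monoid[OF grp]] by (simp add: nat_pow_def Qm)
  qed
  have "\<exists>k. Coset.order Q = rchar D ^ k"
  proof (rule finite_p_group_order[OF grp _ prime_rchar])
    fix C assume "C \<in> carrier Q"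
    then obtain x where x: "x \<in> ?L" "C = cs x" by (auto simp: carr)
    have "of_nat (rchar D) *s x \<in> ?L'"
    proof (cases "of_nat (rchar D) = (0::'e)")
      case False
      then have "of_nat (rchar D) *s x \<in> Lv m e (r + m * val D (of_nat (rchar D)))"
        using Lv_scale m0 x(1) by blast
      moreover have "1 * 1 \<le> m * val D (of_nat (rchar D))"
        using residue_char False m by (intro mult_mono) (auto simp: frakp_def)
      ultimately show ?thesis by (auto intro: Lv_mono)
    qed simp
    then have "C [^]\<^bsub>Q\<^esub> (rchar D ^ 1) = \<one>\<^bsub>Q\<^esub>" using x by (simp add: Qpow one cs_eq)
    then show "\<exists>n. C [^]\<^bsub>Q\<^esub> (rchar D ^ n) = \<one>\<^bsub>Q\<^esub>" by blast
  qed (use finA in \<open>simp add: Q_def\<close>)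
  then obtain k where k: "card A = rchar D ^ k" by (auto simp: Coset.order_def Q_def)
  have ne: "cs x0 \<noteq> cs 0" "cs x0 \<in> A" "cs 0 \<in> A" using x0 by (auto simp: cs_eq A_def)
  then have "card A \<noteq> 1" by (metis card_1_singletonE singletonD)
  then have dv: "rchar D dvd card A" using k by (cases k) auto
  have "\<exists>C\<in>A. C \<noteq> cs 0 \<and> (\<forall>g\<in>N. a g C = C)"
  proof (rule pro_p_fixed_point[OF N(1) finA _ _ _ _ dv])
    show "cs 0 \<in> A" by fact
    show "a g (cs 0) = cs 0" if "g \<in> N" for g using that by (simp add: a_cs)
    fix C assume "C \<in> A"
    then obtain x where x: "x \<in> ?L" "C = cs x" by (auto simp: A_def)
    show "a g C \<in> A" if "g \<in> N" for g using that x stab by (auto simp: A_def a_cs)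
    show "a (mat 1) C = C" using x NG by (simp add: a_cs)
    show "a (g ** h) C = a g (a h C)" if "g \<in> N" "h \<in> N" for g h
      using that x NG by (simp add: a_cs matrix_vector_mul_assoc)
    have "a g C = C" if "g \<in> N" "g \<in> Hf m e 1" for g
    proof -
      have "(g - mat 1) *v x \<in> Lv m e (1 + r)" using that(2) x(1) m0 by (intro Mf_Lv) (auto simp: Hf_def)
      then show ?thesis using x that by (simp add: a_cs cs_eq matrix_vector_mult_diff_rdistrib add.commute)
    qed
    then show "nhd1 N {g. a g C = C}"
      using nhd1_Hf[OF m, of e 1] NG(2) unfolding nhd1_def by blast
  qed
  then obtain x where x: "x \<in> ?L" "cs x \<noteq> cs 0" "\<And>g. g \<in> N \<Longrightarrow> a g (cs x) = cs x" by (auto simp: A_def)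
  then have "x \<notin> ?L'" "\<And>g. g \<in> N \<Longrightarrow> g *v x - x \<in> ?L'" by (auto simp: cs_eq a_cs)
  with x(1) show ?thesis by blast
qed

lemma iso_half: "iso a (- (a * cj a) / 2)"
  using two_unit by (simp add: iso_def field_simps)

text \<open>Let \<open>F r\<close> consist of the vectors fixed by N modulo the next lattice.
  Normality makes it stable under K, and the fixed point argument makes it nontrivial in every
  nonzero quotient. Unipotent and Weyl elements of K carry a fixed vector to suitable multiples of
  the basis vectors, and N fixing these modulo the next lattice is membership in level 1.\<close>

lemma normal_pro_p_subset:
  assumes N: "N \<lhd> subgrp D (Kf 2 (vx i))" "pro_p_subgroup D (rchar D) N"
  shows "N \<subseteq> Hf 2 (vx i) 1"
proof -
  define c where "c = vx i"
  let ?K = "Kf 2 c" and ?L = "Lv 2 c"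
  have subK: "subgroup ?K G" by (rule subgroup_Kf) simp
  note KG = subgroup_props[OF subK]
  have NK: "N \<subseteq> ?K" and conj: "\<And>k n. k \<in> ?K \<Longrightarrow> n \<in> N \<Longrightarrow> k ** n ** adj k \<in> N" and subN: "subgroup N G"
    using N(1) normal_subgrp[OF subK] by (auto simp: c_def)
  have KL: "k *v x \<in> ?L s" if "k \<in> ?K" "x \<in> ?L s" for k x s
    using Mf_Lv[of 2 k c 0 x s] that by (simp add: Kf_def)
  define F where "F r = {x \<in> ?L r. \<forall>g\<in>N. g *v x - x \<in> ?L (r + 1)}" for r
  have F_add: "x + y \<in> F r" if "x \<in> F r" "y \<in> F r" for x y r
    using that Lv_add[of 2 x c r y] Lv_add[of 2 "g *v x - x" c "r + 1" "g *v y - y" for g]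
    by (simp add: F_def matrix_vector_right_distrib algebra_simps)
  have F_scale: "t *s x \<in> F (r + 2 * val D t)" if "t \<noteq> 0" "x \<in> F r" for t x r
  proof -
    have e: "g *v (t *s x) - t *s x = t *s (g *v x - x)" for g
      by (simp add: vec_eq_iff matrix_vector_3 algebra_simps)
    have "t *s (g *v x - x) \<in> ?L (r + 1 + 2 * val D t)" if "g \<in> N" for g
      using that \<open>x \<in> F r\<close> \<open>t \<noteq> 0\<close> by (intro Lv_scale) (auto simp: F_def)
    moreover have "t *s x \<in> ?L (r + 2 * val D t)" using that by (intro Lv_scale) (auto simp: F_def)
    ultimately show ?thesis unfolding F_def by (simp add: e ac_simps)
  qed
  have F_unit: "t *s x \<in> F r" if "t \<noteq> 0" "val D t = 0" "x \<in> F r" for t x r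
    using F_scale[OF that(1,3)] that(2) by simp
  have F_diff: "x - y \<in> F r" if "x \<in> F r" "y \<in> F r" for x y r
  proof -
    have "(- 1) *s y \<in> F r" by (rule F_unit[OF _ _ that(2)]) auto
    then have "x + (- 1) *s y \<in> F r" using F_add that(1) by blast
    moreover have "x + (- 1) *s y = x - y" by (simp add: vec_eq_iff)
    ultimately show ?thesis by simp
  qed
  have F_K: "k *v x \<in> F r" if k: "k \<in> ?K" and x: "x \<in> F r" for k x r
  proof -
    have "g *v (k *v x) - k *v x \<in> ?L (r + 1)" if g: "g \<in> N" for g
    proof -
      have "adj k ** g ** adj (adj k) \<in> N" using conj g k KG(4) by blast
      then have "adj k ** g ** k \<in> N" by simp
      then have "(adj k ** g ** k) *v x - x \<in> ?L (r + 1)" using x by (simp add: F_def)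
      then have "k *v ((adj k ** g ** k) *v x - x) \<in> ?L (r + 1)" using KL k by blast
      moreover have "k ** (adj k ** g ** k) = g ** k"
        using k KG(2) by (simp add: matrix_mul_assoc mult_adj)
      ultimately show ?thesis by (simp add: matrix_vector_mult_diff_distrib matrix_vector_mul_assoc)
    qed
    then show ?thesis using KL[OF k] x by (simp add: F_def)
  qed
  have LF: "x \<in> F r" if "x \<in> ?L (r + 1)" for x r
  proof -
    have "g *v x - x \<in> ?L (r + 1)" if "g \<in> N" for g
      using KL[of g x "r + 1"] NK that \<open>x \<in> ?L (r + 1)\<close> by (intro Lv_diff) auto
    then show ?thesis using Lv_mono[OF that, of r] by (simp add: F_def)
  qed
  have ex: "\<exists>x\<in>F r. x \<notin> ?L (r + 1)" if "y \<in> ?L r" "y \<notin> ?L (r + 1)" for y r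
    using pro_p_fixed_lattice[OF N(2) NK _ that] by (auto simp: F_def)
  obtain \<tau> where \<tau>: "\<tau> \<noteq> 0" "val D \<tau> = 0" "cj \<tau> = - \<tau>" using trace_zero_unit by blast
  \<comment> \<open>Trace zero makes \<open>iso 0 b\<close> hold, and the valuation -c is the
    smallest that the corner entry of an element of K may have.\<close>
  define b where "b = \<tau> * unif D powi (- c)"
  have b: "b \<noteq> 0" "val D b = - c" "cj b = - b"
    using \<tau> by (auto simp: b_def val_mult val_unif_powi unif_nonzero)
  define h :: 'e where "h = - 1 / 2"
  have h: "h \<in> P 0" using half_in[of "- 1" 0] by (simp add: h_def frakp_1)
  have isoh: "iso 1 h" using iso_half[of 1] by (simp add: h_def)
  have c01: "0 \<le> c" "c \<le> 1" using vx_range by (auto simp: c_def)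
  have nK: "nu 0 b \<in> ?K" "ww c \<in> ?K" "nu 1 h \<in> ?K"
    using b c01 h isoh unfolding c_def
    by (auto simp: Kf_iff nu_in iso_def frakp_1) (auto simp: frakp_def val_unif_powi)
  define e1 e2 e3 :: "'e^3" where "e1 = vector [1, 0, 0]" and "e2 = vector [0, 1, 0]" and "e3 = vector [0, 0, 1]"
  note e_def = e1_def e2_def e3_def
  \<comment> \<open>The difference of y and its image under \<open>nu 0 b\<close> is
    \<open>b * y$3\<close> times \<open>e1\<close>, and this coefficient is a unit.\<close>
  have Fe1': "e1 \<in> F c" if y: "y \<in> F c" "y$3 \<noteq> 0" "val D (y$3) = c" for y
  proof -
    have "nu 0 b *v y - y \<in> F c" using y(1) nK F_K F_diff by blast
    moreover have "nu 0 b *v y - y = (b * y$3) *s e1"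
      by (simp add: vec_eq_iff forall_3 matrix_vector_3 e_def)
    ultimately have "inverse (b * y$3) *s ((b * y$3) *s e1) \<in> F c"
      using y b by - (rule F_unit, auto simp: val_inverse val_mult)
    moreover have "inverse t *s (t *s e1) = e1" if "t \<noteq> 0" for t
      using that by (simp only: vector_smult_assoc) simp
    moreover have "b * y$3 \<noteq> 0" using y b by simp
    ultimately show ?thesis by metis
  qed
  have Fe1'': "e1 \<in> F c" if x: "x \<in> F c" "x$1 \<noteq> 0" "val D (x$1) = 0" for x
  proof (rule Fe1')
    show "ww c *v x \<in> F c" using x nK F_K by blast
  qed (use x unif_nonzero in \<open>auto simp: matrix_vector_3 val_mult val_unif_powi\<close>)
  have Fe1: "e1 \<in> F c"
  proof -
    have "e1 \<in> ?L c" "e1 \<notin> ?L (c + 1)" by (auto simp: Lv_def forall_3 e_def)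
    then obtain x where x: "x \<in> F c" "x \<notin> ?L (c + 1)" using ex by blast
    then have xL: "x \<in> ?L c" by (simp add: F_def)
    \<comment> \<open>A vector of this level outside the next lattice has a coordinate of least
      allowed valuation. The middle coordinate is a candidate only for c = 0, since for c = 1 its
      bounds in the two lattices coincide.\<close>
    consider "x$1 \<noteq> 0" "val D (x$1) = 0" | "x$3 \<noteq> 0" "val D (x$3) = c"
      | "c = 0" "x$2 \<noteq> 0" "val D (x$2) = 0" "x$3 \<in> P 1"
      using x(2) xL c01 by (auto simp: Lv_def forall_3 frakp_def) fastforce+
    then show ?thesis
    proof cases
      case 3
      define z where "z = nu 1 h *v x - x"
      have z: "z \<in> F c" unfolding z_def using x nK F_K F_diff by blast
      have "h * x$3 \<in> P (val D (x$2) + 1)" using 3 h frakp_mult[of h 0 "x$3" 1] by simp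
      then have "x$2 + h * x$3 \<noteq> 0" "val D (x$2 + h * x$3) = 0" using val_sum_dominant[of "x$2"] 3 by auto
      moreover have "z$1 = x$2 + h * x$3" by (simp add: z_def matrix_vector_3)
      ultimately show ?thesis using Fe1''[OF z] by simp
    qed (use x Fe1' Fe1'' in blast)+
  qed
  have Fe3: "e3 \<in> F (- c)"
  proof -
    have "ww c *v e1 \<in> F c" using Fe1 nK F_K by blast
    moreover have "ww c *v e1 = unif D powi c *s e3" by (simp add: vec_eq_iff forall_3 matrix_vector_3 e_def)
    ultimately have "unif D powi (- c) *s (unif D powi c *s e3) \<in> F (c + 2 * val D (unif D powi (- c)))"
      using unif_nonzero by - (rule F_scale, auto)
    then show ?thesis by (simp add: vector_smult_assoc val_unif_powi)
  qed
  have Fe2: "e2 \<in> F 0"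
  proof (cases "c = 0")
    case True
    \<comment> \<open>For c = 0 the third column of \<open>nu 1 h\<close> gives this difference as
      \<open>h *s e1 - e2\<close>, which yields \<open>e2\<close> from the vectors already
      known.\<close>
    have "nu 1 h *v e3 - e3 \<in> F 0" using Fe3 nK F_K F_diff True by auto
    moreover have "h = - inverse 2" by (simp add: h_def inverse_eq_divide)
    then have "val D h = 0" by (simp only: val_uminus val_inverse[OF two_unit(1)] two_unit(2) minus_zero)
    then have "h *s e1 \<in> F 0" using Fe1 True two_unit(1) F_unit[of h e1 0] by (simp add: h_def)
    ultimately have "h *s e1 - (nu 1 h *v e3 - e3) \<in> F 0" using F_diff by blast
    moreover have "h *s e1 - (nu 1 h *v e3 - e3) = e2"
      by (simp add: vec_eq_iff forall_3 matrix_vector_3 e_def)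
    ultimately show ?thesis by simp
  next
    case False
    \<comment> \<open>For c = 1 the quotient at level 0 is spanned by the class of
      \<open>e2\<close>, so any nonzero fixed class is a unit multiple of it.\<close>
    then have c1: "c = 1" using c01 by simp
    have "e2 \<in> ?L 0" "e2 \<notin> ?L (0 + 1)" by (auto simp: Lv_def forall_3 e_def)
    then obtain x where x: "x \<in> F 0" "x \<notin> ?L (0 + 1)" using ex by blast
    then have xL: "x \<in> ?L 0" by (simp add: F_def)
    have x1: "x$1 = 0 \<or> 0 \<le> val D (x$1)" and x3: "x$3 = 0 \<or> 1 \<le> val D (x$3)"
      using xL c1 by (auto simp: Lv_def forall_3)
    have x2: "x$2 \<noteq> 0" "val D (x$2) = 0"
      using x(2) xL c1 x1 x3 by (auto simp: Lv_def forall_3)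
    define y :: "'e^3" where "y = vector [x$1, 0, x$3]"
    have "y \<in> ?L (0 + 1)" using x1 x3 c1 by (auto simp: Lv_def forall_3 y_def)
    then have "x - y \<in> F 0" using LF x(1) F_diff by blast
    then have "inverse (x$2) *s (x - y) \<in> F 0" using x2 by (intro F_unit) (auto simp: val_inverse)
    moreover have "inverse (x$2) *s (x - y) = e2" using x2 by (simp add: vec_eq_iff forall_3 e_def y_def)
    ultimately show ?thesis by simp
  qed
  show ?thesis
  proof
    fix g assume g: "g \<in> N"
    have "g *v e1 - e1 \<in> ?L (c + 1)" "g *v e2 - e2 \<in> ?L (0 + 1)" "g *v e3 - e3 \<in> ?L (- c + 1)"
      using Fe1 Fe2 Fe3 g by (auto simp: F_def)
    then have "g - mat 1 \<in> Mf 2 c 1"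
      by (simp add: Lv_def Mf_def forall_3 matrix_vector_3 e_def mat_1_3 algebra_simps)
    moreover have "g \<in> carrier G" using g subgroup_props(2)[OF subN] by blast
    ultimately show "g \<in> Hf 2 (vx i) 1" by (simp add: Hf_def c_def)
  qed
qed

lemma pro_p_radical_eq: "pro_p_radical D i = Hf 2 (vx i) 1"
  unfolding pro_p_radical_def maxcpt_eq
proof (rule Greatest_equality)
  have "subgroup (Kf 2 (vx i)) G" by (rule subgroup_Kf) simp
  then show "Hf 2 (vx i) 1 \<lhd> subgrp D (Kf 2 (vx i)) \<and> pro_p_subgroup D (rchar D) (Hf 2 (vx i) 1)"
    using Hf_subset_Kf[of 2 1 "vx i"] Hf_conj[of 2 _ "vx i" _ 1]
    by (auto simp: normal_subgrp pro_p_Hf subgroup_Hf)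
qed (use normal_pro_p_subset in blast)

section \<open>Reduction and the two Iwahori subgroups\<close>

lemma residue_eq: "residue (val D) x = residue (val D) y \<longleftrightarrow> x - y \<in> P 1"
proof
  assume e: "residue (val D) x = residue (val D) y"
  have "x \<in> residue (val D) x" by (simp add: residue_def)
  then show "x - y \<in> P 1" unfolding e by (simp add: residue_def)
next
  assume xy: "x - y \<in> P 1"
  have "z - x \<in> P 1 \<longleftrightarrow> z - y \<in> P 1" for z
    using frakp_add[OF xy, of "z - x"] frakp_diff[OF _ xy, of "z - y"] by auto
  then show "residue (val D) x = residue (val D) y" by (simp add: residue_def)
qed

lemma upper_triangular_reduction:
  assumes "g \<in> Kf 2 (vx i)"
  shows "upper_triangular (residue (val D) 0) (reduction D i g) \<longleftrightarrow>
    g$2$1 \<in> P 1 \<and> g$3$2 \<in> P 1 \<and> g$3$1 \<in> P (1 + vx i)"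
  using assms[unfolded Kf_iff] unif_nonzero val_unif
  by (cases i) (auto simp: upper_triangular_def residue_eq frakp_divide_iff)

lemma upper_unipotent_reduction:
  assumes "g \<in> Kf 2 (vx i)"
  shows "upper_unipotent (residue (val D) 0) (residue (val D) 1) (reduction D i g) \<longleftrightarrow> g \<in> Hf 3 (1 + vx i) 1"
proof -
  have "(\<forall>j. reduction D i g $ j $ j = residue (val D) 1) \<longleftrightarrow> g$1$1 - 1 \<in> P 1 \<and> g$2$2 - 1 \<in> P 1 \<and> g$3$3 - 1 \<in> P 1"
    by (cases i) (simp_all add: forall_3 residue_eq)
  then show ?thesis using assms
    by (auto simp: upper_unipotent_def upper_triangular_reduction[OF assms] pro_p_iwahori_iff Kf_iff)
qed

lemma radical_coset_in_GammaK: "g \<in> maxcpt D i \<Longrightarrow> pro_p_radical D i #>\<^bsub>G\<^esub> g \<in> carrier (GammaK D i)"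
  by (auto simp: GammaK_def FactGroup_def RCOSETS_def r_coset_def)

lemma radical_mult_Kf:
  assumes "g \<in> Kf 2 (vx i)" "k \<in> Hf 2 (vx i) 1"
  shows "k ** g \<in> Kf 2 (vx i)" "k ** g - g \<in> Mf 2 (vx i) 1"
proof -
  have "k \<in> Kf 2 (vx i)" using assms(2) Hf_subset_Kf[of 2 1 "vx i"] by auto
  then show "k ** g \<in> Kf 2 (vx i)" using assms(1) subgroup_props(3)[OF subgroup_Kf[of 2 "vx i"]] by simp
  have "(k - mat 1) ** g \<in> Mf 2 (vx i) (1 + 0)" using assms by (intro Mf_mult) (auto simp: Hf_def Kf_def)
  then show "k ** g - g \<in> Mf 2 (vx i) 1" by (simp add: matrix_diff_rdistrib)
qed

text \<open>The definition asks for one member of a coset with triangular reduction. Multiplication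
  by the radical changes the three lower entries only within the ideals that define the condition,
  so all members agree.\<close>

lemma iwahori_eq:
  "iwahori D i = {g \<in> Kf 2 (vx i). g$2$1 \<in> P 1 \<and> g$3$2 \<in> P 1 \<and> g$3$1 \<in> P (1 + vx i)}"
proof -
  have "(\<exists>h \<in> pro_p_radical D i #>\<^bsub>G\<^esub> g. upper_triangular (residue (val D) 0) (reduction D i h)) \<longleftrightarrow>
      g$2$1 \<in> P 1 \<and> g$3$2 \<in> P 1 \<and> g$3$1 \<in> P (1 + vx i)" (is "?l \<longleftrightarrow> ?r g") if g: "g \<in> Kf 2 (vx i)" for g
  proof -
    have "?r (k ** g) \<longleftrightarrow> ?r g" if k: "k \<in> Hf 2 (vx i) 1" for k
    proof -
      have "(k ** g - g)$2$1 \<in> P 1" "(k ** g - g)$3$2 \<in> P 1" "(k ** g - g)$3$1 \<in> P (1 + vx i)"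
        using radical_mult_Kf(2)[OF g k] by (cases i; simp add: Mf_iff forall_3)+
      then show ?thesis
        using frakp_diff[of "(k ** g)$2$1" 1 "(k ** g - g)$2$1"] frakp_add[of "g$2$1" 1 "(k ** g - g)$2$1"]
          frakp_diff[of "(k ** g)$3$2" 1 "(k ** g - g)$3$2"] frakp_add[of "g$3$2" 1 "(k ** g - g)$3$2"]
          frakp_diff[of "(k ** g)$3$1" "1 + vx i" "(k ** g - g)$3$1"] frakp_add[of "g$3$1" "1 + vx i" "(k ** g - g)$3$1"]
        by auto
    qed
    then have "?l \<longleftrightarrow> (\<exists>k\<in>Hf 2 (vx i) 1. ?r g)"
      using radical_mult_Kf(1)[OF g] by (simp add: r_coset_def pro_p_radical_eq upper_triangular_reduction cong: bex_cong)
    then show ?thesis using one_in_Hf by blast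
  qed
  then show ?thesis using radical_coset_in_GammaK
    by (auto simp: iwahori_def GammaK_borel_def maxcpt_eq)
qed

text \<open>This group contains the radical, so membership does not depend on the representative of
  the coset.\<close>

lemma pro_p_iwahori_eq: "pro_p_iwahori D i = Hf 3 (1 + vx i) 1"
proof -
  have sub: "subgroup (Hf 3 (1 + vx i) 1) G" by (rule subgroup_Hf) auto
  have "x \<in> P 0" "x \<in> P (- vx i)" if "x \<in> P (1 - vx i)" for x
    by (rule frakp_le[OF that]; use vx_range[of i] in simp)+
  then have HI: "Hf 2 (vx i) 1 \<subseteq> Hf 3 (1 + vx i) 1"
    by (auto simp: pro_p_iwahori_iff radical_iff)
  have IK: "Hf 3 (1 + vx i) 1 \<subseteq> Kf 2 (vx i)"
  proof
    fix g assume g: "g \<in> Hf 3 (1 + vx i) 1"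
    have "x \<in> P 0" if "x - 1 \<in> P 1" for x
      using frakp_add[of "x - 1" 0 1] frakp_le[OF that, of 0] by (simp add: frakp_1)
    then show "g \<in> Kf 2 (vx i)"
      using g vx_range[of i] by (auto simp: pro_p_iwahori_iff Kf_iff elim!: frakp_le)
  qed
  have "(\<exists>h \<in> pro_p_radical D i #>\<^bsub>G\<^esub> g. upper_unipotent (residue (val D) 0) (residue (val D) 1) (reduction D i h)) \<longleftrightarrow>
      g \<in> Hf 3 (1 + vx i) 1" (is "?l \<longleftrightarrow> _") if g: "g \<in> Kf 2 (vx i)" for g
  proof -
    have "k ** g \<in> Hf 3 (1 + vx i) 1 \<longleftrightarrow> g \<in> Hf 3 (1 + vx i) 1" if k: "k \<in> Hf 2 (vx i) 1" for k
    proof -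
      have kI: "k \<in> Hf 3 (1 + vx i) 1" using k HI by blast
      have "adj k ** (k ** g) = g" using k by (simp add: Hf_def)
      then show ?thesis using subgroup_props[OF sub] kI by metis
    qed
    then have "?l \<longleftrightarrow> (\<exists>k\<in>Hf 2 (vx i) 1. g \<in> Hf 3 (1 + vx i) 1)"
      using radical_mult_Kf(1)[OF g] by (simp add: r_coset_def pro_p_radical_eq upper_unipotent_reduction cong: bex_cong)
    then show ?thesis using one_in_Hf by blast
  qed
  then show ?thesis using radical_coset_in_GammaK IK
    by (auto simp: pro_p_iwahori_def GammaK_unipotent_def maxcpt_eq)
qed

end

section \<open>Bruhat and Iwahori decompositions\<close>

locale unramified_vertex = unramified_quadratic D for D :: "'e::field quad_ext" +
  fixes i :: vertex
begin

abbreviation c where "c \<equiv> vx i"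
abbreviation B where "B \<equiv> borel_subgroup D"
abbreviation K where "K \<equiv> Kf 2 (vx i)"
abbreviation R where "R \<equiv> Hf 2 (vx i) 1"
abbreviation Iw where "Iw \<equiv> Kf 3 (1 + vx i)"
abbreviation I1 where "I1 \<equiv> Hf 3 (1 + vx i) 1"

lemma c01: "0 \<le> c" "c \<le> 1"
  by (rule vx_range)+

lemma Iw_iff:
  "g \<in> Iw \<longleftrightarrow> g \<in> carrier G \<and> g$1$1 \<in> P 0 \<and> g$1$2 \<in> P 0 \<and> g$1$3 \<in> P (- c) \<and>
    g$2$1 \<in> P 1 \<and> g$2$2 \<in> P 0 \<and> g$2$3 \<in> P 0 \<and> g$3$1 \<in> P (1 + c) \<and> g$3$2 \<in> P 1 \<and> g$3$3 \<in> P 0"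
  by (cases i) (simp_all add: Kf_def Mf_iff forall_3 conj_ac)

lemma iwahori_Iw: "iwahori D i = Iw"
proof -
  have "x \<in> P c" if "x \<in> P 1" for x using that c01 by (auto intro: frakp_le)
  moreover have "x \<in> P c" if "x \<in> P (1 + c)" for x using that c01 by (auto intro: frakp_le)
  ultimately show ?thesis by (auto simp: iwahori_eq Iw_iff Kf_iff)
qed

lemma subgroups: "subgroup K G" "subgroup R G" "subgroup Iw G" "subgroup I1 G"
  by (auto intro: subgroup_Kf subgroup_Hf)

lemmas K_props = subgroup_props[OF subgroups(1)]
lemmas R_props = subgroup_props[OF subgroups(2)]
lemmas Iw_props = subgroup_props[OF subgroups(3)]
lemmas I1_props = subgroup_props[OF subgroups(4)]

lemma I1_Iw: "I1 \<subseteq> Iw" by (rule Hf_subset_Kf) auto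

lemma Iw_K: "Iw \<subseteq> K"
  using iwahori_eq[of i] iwahori_Iw by auto

lemma R_I1: "R \<subseteq> I1"
proof -
  have "x \<in> P 0" "x \<in> P (- c)" if "x \<in> P (1 - c)" for x
    by (rule frakp_le[OF that]; use c01 in simp)+
  then show ?thesis by (auto simp: pro_p_iwahori_iff radical_iff)
qed

lemma Iw_conj_I1: "k \<in> Iw \<Longrightarrow> h \<in> I1 \<Longrightarrow> k ** h ** adj k \<in> I1"
  by (rule Hf_conj) auto

lemma K_conj_R: "k \<in> K \<Longrightarrow> h \<in> R \<Longrightarrow> k ** h ** adj k \<in> R"
  by (rule Hf_conj) auto

text \<open>Modulo the maximal ideal the hermitian relation between the first and third columns
  reads \<open>cj (g$1$1) * g$3$3 = 1\<close>.\<close>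

lemma Iw_diag:
  assumes "g \<in> Iw"
  shows "g$1$1 \<noteq> 0" "val D (g$1$1) = 0" "g$3$3 \<noteq> 0" "val D (g$3$3) = 0"
proof -
  have g: "g \<in> carrier G" using assms Iw_props by blast
  have "cj (g$3$1) * g$1$3 + cj (g$2$1) * g$2$3 + cj (g$1$1) * g$3$3 = 1"
    using U21_entries[OF g, of 1 3] by (simp add: beta_def)
  moreover have "cj (g$3$1) * g$1$3 \<in> P 1" using assms frakp_mult[of "cj (g$3$1)" "1 + c" "g$1$3" "- c"]
    by (simp add: Iw_iff)
  moreover have "cj (g$2$1) * g$2$3 \<in> P 1" using assms frakp_mult[of "cj (g$2$1)" 1 "g$2$3" 0]
    by (simp add: Iw_iff)
  ultimately have "1 - cj (g$1$1) * g$3$3 \<in> P 1"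
    using frakp_add[of "cj (g$3$1) * g$1$3" 1 "cj (g$2$1) * g$2$3"] by (metis add_diff_cancel_right')
  then have "- (1 - cj (g$1$1) * g$3$3) \<in> P (val D 1 + 1)" by (simp only: frakp_uminus) simp
  from val_sum_dominant[OF _ this] have *: "cj (g$1$1) * g$3$3 \<noteq> 0" "val D (cj (g$1$1) * g$3$3) = 0" by auto
  then show "g$1$1 \<noteq> 0" "g$3$3 \<noteq> 0" by auto
  with * have "val D (g$1$1) + val D (g$3$3) = 0" by (simp add: val_mult)
  moreover have "0 \<le> val D (g$1$1)" "0 \<le> val D (g$3$3)"
    using assms \<open>g$1$1 \<noteq> 0\<close> \<open>g$3$3 \<noteq> 0\<close> by (auto simp: Iw_iff frakp_def)
  ultimately show "val D (g$1$1) = 0" "val D (g$3$3) = 0" by linarith+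
qed

subsection \<open>Borel subgroup, torus and unipotent radicals\<close>

text \<open>Once the last row is known, the isotropy of the first column forces the norm of the
  entry (2,1) to vanish.\<close>

lemma mem_B: "g \<in> B \<longleftrightarrow> g \<in> carrier G \<and> g$3$1 = 0 \<and> g$3$2 = 0"
proof
  assume g: "g \<in> carrier G \<and> g$3$1 = 0 \<and> g$3$2 = 0"
  then have "cj (g$2$1) * g$2$1 = 0" using U21_entries[of g 1 1] by (simp add: beta_def)
  then show "g \<in> B" using g by (simp add: borel_subgroup_def upper_triangular_def)
qed (simp add: borel_subgroup_def upper_triangular_def)

lemma B_21: "g \<in> B \<Longrightarrow> g$2$1 = 0"
  by (simp add: borel_subgroup_def upper_triangular_def)

lemma B_props: "g \<in> B \<Longrightarrow> g \<in> carrier G" "mat 1 \<in> B" "g \<in> B \<Longrightarrow> h \<in> B \<Longrightarrow> g ** h \<in> B" "g \<in> B \<Longrightarrow> adj g \<in> B"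
proof -
  show "g \<in> B \<Longrightarrow> adj g \<in> B" using B_21[of g] by (auto simp: mem_B adj_entries)
qed (auto simp: mem_B mat_1_3 matrix_mult_3)

lemma B_row3: "b \<in> B \<Longrightarrow> (b ** h) $ 3 $ j = b$3$3 * h$3$j"
  by (simp add: mem_B matrix_mult_3)

lemma B_33: "b \<in> B \<Longrightarrow> b$3$3 \<noteq> 0"
proof
  assume b: "b \<in> B" "b$3$3 = 0"
  then have "(b ** adj b) $ 3 $ 3 = 0" by (simp add: B_row3)
  then show False using b B_props(1) mult_adj by (simp add: mat_1_3)
qed

definition al :: "int \<Rightarrow> 'e^3^3"
  where "al m = vector [vector [unif D powi (- m), 0, 0], vector [0, 1, 0], vector [0, 0, unif D powi m]]"

lemma al_entries [simp]: "al m $1$1 = unif D powi (- m)" "al m $1$2 = 0" "al m $1$3 = 0" "al m $2$1 = 0" "al m $2$2 = 1"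
  "al m $2$3 = 0" "al m $3$1 = 0" "al m $3$2 = 0" "al m $3$3 = unif D powi m"
  by (simp_all add: al_def)

lemma powi_add': "unif D powi (m + n) = unif D powi m * unif D powi n"
  using unif_nonzero by (intro power_int_add) simp

lemma al_add: "al (m + n) = al m ** al n"
  using powi_add'[of "- m" "- n"] by (simp add: matrix_eq_3 matrix_mult_3 powi_add'[of m n])

lemma al_0 [simp]: "al 0 = mat 1"
  by (simp add: matrix_eq_3 mat_1_3)

lemma adj_al [simp]: "adj (al m) = al (- m)"
  by (simp add: matrix_eq_3 adj_entries)

lemma al_in [simp]: "al m \<in> carrier G"
  by (simp add: mem_U21 al_add[symmetric])

lemma al_B [simp]: "al m \<in> B"
  by (simp add: mem_B)

lemma alpha_al: "alpha D = al 1"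
  by (simp add: matrix_eq_3 alpha_def power_int_minus)

lemma alpha_pow: "alpha D [^]\<^bsub>G\<^esub> (m::int) = al m"
proof -
  have nat: "alpha D [^]\<^bsub>G\<^esub> (n::nat) = al (int n)" for n
    by (induction n) (simp_all add: alpha_al al_add[symmetric] add.commute)
  show ?thesis
  proof (cases "m < 0")
    case True
    then show ?thesis by (simp add: int_pow_def2 nat inv_U21)
  qed (simp add: int_pow_def2 nat)
qed

lemma adj_ww [simp]: "adj (ww m) = ww m"
  by (simp add: matrix_eq_3 adj_entries)

lemma ww_K: "ww c \<in> K"
  using c01 by (auto simp: Kf_iff frakp_1) (auto simp: frakp_def val_unif_powi)

text \<open>The norm of a is minus the trace of b and has valuation 2 v(a), so v(a) \<ge> k / 2; the
  bound on k' expresses rounding up.\<close>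

lemma iso_frakp:
  assumes "iso a b" "b \<in> P k" "2 * k' \<le> k + 1"
  shows "a \<in> P k'"
proof (cases "a = 0")
  case False
  have "a * cj a = - (b + cj b)" using assms(1) by (simp add: iso_def eq_neg_iff_add_eq_0 algebra_simps)
  then have "a * cj a \<in> P k" using assms(2) by (simp add: frakp_add del: minus_add_distrib)
  then have "k \<le> 2 * val D a" using False by (simp add: frakp_def val_mult)
  then show ?thesis using assms(3) by (simp add: frakp_def)
qed simp

lemma nu_mult: "nu a b ** nu a' b' = nu (a + a') (b + b' - a * cj a')"
  by (simp add: matrix_eq_3 matrix_mult_3)

lemma nl_mult: "nl a b ** nl a' b' = nl (a + a') (b + b' - a * cj a')"
  by (simp add: matrix_eq_3 matrix_mult_3)

lemma adj_nu: "adj (nu a b) = nu (- a) (cj b)"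
  by (simp add: matrix_eq_3 adj_entries)

lemma adj_nl: "adj (nl a b) = nl (- a) (cj b)"
  by (simp add: matrix_eq_3 adj_entries)

text \<open>The two double cosets of \<open>B\<close> and the Iwahori subgroup are treated uniformly: \<open>pt s\<close> is the
  representative, \<open>N0 s\<close> parametrizes \<open>B\<close>-cosets in it and \<open>dl s\<close> contracts \<open>N0 s\<close>.  The value
  \<open>s = True\<close> is the big cell.\<close>

definition pt :: "bool \<Rightarrow> 'e^3^3" where "pt s = (if s then ww c else mat 1)"
definition nx :: "bool \<Rightarrow> 'e \<Rightarrow> 'e \<Rightarrow> 'e^3^3" where "nx s = (if s then nu else nl)"
text \<open>The bound on the long root coordinate in the pro-p Iwahori subgroup; the bound on the
  short root coordinate then follows from \<open>iso_frakp\<close>.\<close>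

definition depth :: "bool \<Rightarrow> int" where "depth s = (if s then - c else 1 + c)"
definition NN :: "bool \<Rightarrow> ('e^3^3) set" where "NN s = {nx s a b | a b. iso a b}"
definition N0 :: "bool \<Rightarrow> ('e^3^3) set" where "N0 s = {nx s a b | a b. iso a b \<and> b \<in> P (depth s)}"
definition dl :: "bool \<Rightarrow> nat \<Rightarrow> 'e^3^3" where "dl s k = al (if s then - int k else int k)"
definition cell :: "bool \<Rightarrow> ('e^3^3) set" where "cell s = {b ** pt s ** n | b n. b \<in> B \<and> n \<in> N0 s}"

lemma nx_in: "nx s a b \<in> carrier G \<longleftrightarrow> iso a b"
  by (simp add: nx_def nu_in nl_in)

lemma nx_mult: "nx s a b ** nx s a' b' = nx s (a + a') (b + b' - a * cj a')"
  by (simp add: nx_def nu_mult nl_mult)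

lemma adj_nx: "adj (nx s a b) = nx s (- a) (cj b)"
  by (simp add: nx_def adj_nu adj_nl)

lemma N0_NN: "N0 s \<subseteq> NN s" by (auto simp: N0_def NN_def)

lemma NN_in: "n \<in> NN s \<Longrightarrow> n \<in> carrier G"
  by (auto simp: NN_def nx_in)

lemma N0_in: "n \<in> N0 s \<Longrightarrow> n \<in> carrier G"
  using N0_NN NN_in by blast

lemma pt_in [simp]: "pt s \<in> carrier G"
  by (simp add: pt_def)

lemma pt_K: "pt s \<in> K"
  using ww_K K_props by (simp add: pt_def)

lemma iso_0 [simp]: "iso 0 0" by (simp add: iso_def)

lemma nx_0 [simp]: "nx s 0 0 = mat 1"
  by (simp add: nx_def matrix_eq_3 mat_1_3)

lemma one_N0 [simp]: "mat 1 \<in> N0 s"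
  unfolding N0_def by (rule CollectI, rule exI[of _ 0], rule exI[of _ 0]) simp

lemma NN_I: "n = nx s a b \<Longrightarrow> n \<in> carrier G \<Longrightarrow> n \<in> NN s"
  using nx_in by (auto simp: NN_def)

lemma NN_mult: "n \<in> NN s \<Longrightarrow> n' \<in> NN s \<Longrightarrow> n ** n' \<in> NN s"
proof -
  assume n: "n \<in> NN s" "n' \<in> NN s"
  then obtain a b a' b' where "n = nx s a b" "n' = nx s a' b'" unfolding NN_def by blast
  then have "n ** n' = nx s (a + a') (b + b' - a * cj a')" by (simp only: nx_mult)
  then show ?thesis by (rule NN_I) (simp add: NN_in[OF n(1)] NN_in[OF n(2)])
qed

lemma NN_adj: "n \<in> NN s \<Longrightarrow> adj n \<in> NN s"
proof -
  assume n: "n \<in> NN s"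
  then obtain a b where "n = nx s a b" unfolding NN_def by blast
  then have "adj n = nx s (- a) (cj b)" by (simp only: adj_nx)
  then show ?thesis by (rule NN_I) (simp add: NN_in[OF n])
qed

lemma N0_I1: "N0 s \<subseteq> I1"
proof
  fix n assume "n \<in> N0 s"
  then obtain a b where n: "n = nx s a b" "iso a b" "b \<in> P (depth s)" by (auto simp: N0_def)
  have "a \<in> P (if s then 0 else 1)" by (rule iso_frakp[OF n(2,3)]) (use c01 in \<open>auto simp: depth_def\<close>)
  then show "n \<in> I1" using n nx_in[of s a b] by (cases s) (auto simp: pro_p_iwahori_iff nx_def depth_def)
qed

lemma N0_iff: "n \<in> N0 s \<longleftrightarrow> n \<in> NN s \<and> n \<in> I1"
proof
  assume "n \<in> N0 s"
  then show "n \<in> NN s \<and> n \<in> I1" using N0_NN N0_I1 by blast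
next
  assume "n \<in> NN s \<and> n \<in> I1"
  then obtain a b where n: "n = nx s a b" "iso a b" "n \<in> I1" by (auto simp: NN_def)
  then have "b \<in> P (depth s)" by (cases s) (auto simp: pro_p_iwahori_iff nx_def depth_def)
  then show "n \<in> N0 s" using n by (auto simp: N0_def)
qed

lemma N0_mult: "n \<in> N0 s \<Longrightarrow> n' \<in> N0 s \<Longrightarrow> n ** n' \<in> N0 s"
  using NN_mult I1_props by (simp add: N0_iff)

lemma N0_adj: "n \<in> N0 s \<Longrightarrow> adj n \<in> N0 s"
  using NN_adj I1_props by (simp add: N0_iff)

subsection \<open>Cells\<close>

lemma row3_iso:
  assumes "g \<in> carrier G"
  shows "g$3$3 \<noteq> 0 \<Longrightarrow> iso (g$3$2 / g$3$3) (g$3$1 / g$3$3)" "g$3$1 \<noteq> 0 \<Longrightarrow> iso (g$3$2 / g$3$1) (g$3$3 / g$3$1)"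
proof -
  have "(g ** adj g) $ 3 $ 1 = 0" using assms by (simp add: mult_adj mat_1_3)
  then have "g$3$1 * cj (g$3$3) + g$3$2 * cj (g$3$2) + g$3$3 * cj (g$3$1) = 0"
    by (simp add: matrix_mult_3 adj_entries)
  then show "g$3$3 \<noteq> 0 \<Longrightarrow> iso (g$3$2 / g$3$3) (g$3$1 / g$3$3)" "g$3$1 \<noteq> 0 \<Longrightarrow> iso (g$3$2 / g$3$1) (g$3$3 / g$3$1)"
    by (auto simp: iso_def field_simps)
qed

text \<open>The last row is changed by B only by a scalar, so the ratio of its outer entries is a
  function on cosets of B. The two bounds, v(g33) - v(g31) \<ge> -c and v(g31) - v(g33) \<ge> 1 + c,
  are complementary.\<close>

definition incell :: "bool \<Rightarrow> 'e^3^3 \<Rightarrow> bool"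
  where "incell s g \<longleftrightarrow> (if s then g$3$1 \<noteq> 0 \<and> g$3$3 / g$3$1 \<in> P (- c) else g$3$3 \<noteq> 0 \<and> g$3$1 / g$3$3 \<in> P (1 + c))"

lemma row_mult: "(\<And>j. g$k$j = t * n$l$j) \<Longrightarrow> (g ** h) $ k $ j = t * (n ** h) $ l $ (j::3)" for g n h :: "'e^3^3"
  by (simp only: matrix_mult_3 distrib_left mult.assoc)

text \<open>The coset \<open>B g\<close> is determined by the line spanned by the last row of \<open>g\<close>.\<close>

lemma incell_factor:
  assumes g: "g \<in> carrier G" and c: "incell s g"
  shows "\<exists>n\<in>N0 s. g ** adj n ** adj (pt s) \<in> B"
proof (cases s)
  case False
  let ?n = "nl (g$3$2 / g$3$3) (g$3$1 / g$3$3)"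
  have g33: "g$3$3 \<noteq> 0" using c False by (simp add: incell_def)
  have iso: "iso (g$3$2 / g$3$3) (g$3$1 / g$3$3)" using row3_iso(1)[OF g g33] .
  have n: "?n \<in> N0 s" using iso False c by (auto simp: N0_def nx_def incell_def depth_def)
  have "g$3$j = g$3$3 * ?n$3$j" for j using exhaust_3[of j] g33 by auto
  then have "(g ** adj ?n) $ 3 $ j = g$3$3 * (?n ** adj ?n) $ 3 $ j" for j by (rule row_mult)
  then have "(g ** adj ?n) $ 3 $ 1 = 0" "(g ** adj ?n) $ 3 $ 2 = 0"
    using mult_adj[OF N0_in[OF n]] by (simp_all add: mat_1_3)
  then have "g ** adj ?n \<in> B" using g N0_in[OF n] by (simp add: mem_B)
  then show ?thesis using n False by (intro bexI[of _ ?n]) (simp_all add: pt_def)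
next
  case True
  let ?n = "nu (g$3$2 / g$3$1) (g$3$3 / g$3$1)"
  have g31: "g$3$1 \<noteq> 0" using c True by (simp add: incell_def)
  have iso: "iso (g$3$2 / g$3$1) (g$3$3 / g$3$1)" using row3_iso(2)[OF g g31] .
  have n: "?n \<in> N0 s" using iso True c by (auto simp: N0_def nx_def incell_def depth_def)
  have "g$3$j = g$3$1 * ?n$1$j" for j using exhaust_3[of j] g31 by auto
  then have "(g ** adj ?n) $ 3 $ j = g$3$1 * (?n ** adj ?n) $ 1 $ j" for j by (rule row_mult)
  then have "(g ** adj ?n) $ 3 $ 2 = 0" "(g ** adj ?n) $ 3 $ 3 = 0"
    using mult_adj[OF N0_in[OF n]] by (simp_all add: mat_1_3)
  then have "g ** adj ?n ** ww (vx i) \<in> B" using g N0_in[OF n]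
    by (simp add: mem_B matrix_mult_3[of "g ** adj ?n" "ww (vx i)"])
  then show ?thesis using n True by (intro bexI[of _ ?n]) (simp_all add: pt_def)
qed

text \<open>The second part recovers the unipotent factor from the last row alone; this is the
  source of the uniqueness of the factorization.\<close>

lemma cell_incell:
  assumes "b \<in> B" "n \<in> NN s"
  defines "g \<equiv> b ** pt s ** n"
  shows "n \<in> N0 s \<Longrightarrow> incell s g"
    "n = (if s then nu (g$3$2 / g$3$1) (g$3$3 / g$3$1) else nl (g$3$2 / g$3$3) (g$3$1 / g$3$3))"
proof -
  obtain a x where n: "n = nx s a x" "iso a x" using assms(2) by (auto simp: NN_def)
  have b33: "b$3$3 \<noteq> 0" using B_33 assms(1) by blast
  have row: "g$3$j = b$3$3 * (pt s ** n)$3$j" for j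
    unfolding g_def using B_row3[OF assms(1), of "pt s ** n" j] by (simp add: matrix_mul_assoc)
  have ptn: "(pt s ** n)$3$j = (if s then unif D powi c * n$1$j else n$3$j)" for j
    by (simp add: pt_def matrix_mult_3[of "ww c"])
  have rown: "g$3$j = b$3$3 * (if s then unif D powi c * nx s a x$1$j else nx s a x$3$j)" for j
    by (simp only: row ptn n(1)[symmetric])
  show n_eq: "n = (if s then nu (g$3$2 / g$3$1) (g$3$3 / g$3$1) else nl (g$3$2 / g$3$3) (g$3$1 / g$3$3))"
    unfolding rown using b33 unif_nonzero by (cases s) (simp_all add: n(1) nx_def)
  assume "n \<in> N0 s"
  then obtain a' x' where n': "n = nx s a' x'" "x' \<in> P (depth s)" by (auto simp: N0_def)
  then have "x' = x"
    using arg_cong[of _ _ "\<lambda>n. if s then n$1$3 else n$3$1", OF trans[OF n(1)[symmetric] n'(1)]]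
    by (cases s) (simp_all add: nx_def)
  then show "incell s g" using n'(2) b33 unif_nonzero unfolding incell_def rown
    by (cases s) (simp_all add: nx_def depth_def)
qed

lemma incell_exclusive: "\<not> (incell True g \<and> incell False g)"
  by (auto simp: incell_def frakp_divide_iff) (auto simp: frakp_def)

lemma incell_cover:
  assumes g: "g \<in> carrier G"
  shows "\<exists>s. incell s g"
proof (cases "incell False g")
  case False
  have "g$3$1 \<noteq> 0"
  proof
    assume g31: "g$3$1 = 0"
    then have "g$3$3 = 0" using False by (auto simp: incell_def)
    moreover have "(g ** adj g) $ 3 $ 1 = 0" "(g ** adj g) $ 3 $ 3 = 1" using g by (simp_all add: mult_adj mat_1_3)
    ultimately show False using g31 by (auto simp: matrix_mult_3 adj_entries)
  qed
  then have "incell True g" using False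
    by (auto simp: incell_def frakp_divide_iff) (auto simp: frakp_def divide_inverse val_mult val_inverse)
  then show ?thesis ..
qed blast

lemma cell_iff: "g \<in> cell s \<longleftrightarrow> g \<in> carrier G \<and> incell s g"
proof
  assume "g \<in> cell s"
  then show "g \<in> carrier G \<and> incell s g"
    using cell_incell(1) N0_NN N0_in B_props(1) by (fastforce simp: cell_def)
next
  assume g: "g \<in> carrier G \<and> incell s g"
  then obtain n where n: "n \<in> N0 s" "g ** adj n ** adj (pt s) \<in> B" using incell_factor by blast
  have "(g ** adj n ** adj (pt s)) ** pt s ** n = g" using N0_in[OF n(1)] by simp
  then show "g \<in> cell s" using n unfolding cell_def by force
qed

lemma cell_cover: "g \<in> carrier G \<Longrightarrow> \<exists>s. g \<in> cell s"
  using incell_cover cell_iff by blast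

lemma cell_disjoint: "g \<in> cell s \<Longrightarrow> g \<in> cell t \<Longrightarrow> s = t"
  using incell_exclusive[of g] unfolding cell_iff by (cases s; cases t) auto

lemma cell_unique:
  assumes "b \<in> B" "b' \<in> B" "n \<in> NN s" "n' \<in> NN s" "b ** pt s ** n = b' ** pt s ** n'"
  shows "b = b'" "n = n'"
proof -
  show n: "n = n'" using cell_incell(2)[OF assms(1,3)] cell_incell(2)[OF assms(2,4)]
    unfolding assms(5) by (rule trans[OF _ sym])
  then have "b ** pt s = b' ** pt s" using assms(5) NN_in[OF assms(4)] by (simp add: U21_cancel_right)
  then show "b = b'" by (simp add: U21_cancel_right)
qed

lemma cell_in: "g \<in> cell s \<Longrightarrow> g \<in> carrier G"
  by (simp add: cell_iff)

lemma cell_B: "b \<in> B \<Longrightarrow> g \<in> cell s \<Longrightarrow> b ** g \<in> cell s"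
  unfolding cell_def using B_props(3) by (force simp: matrix_mul_assoc)

lemma pt_N0_cell: "n \<in> N0 s \<Longrightarrow> pt s ** n \<in> cell s"
  unfolding cell_def using B_props(2) by force

text \<open>Conjugation by \<open>ww c\<close> keeps the required bounds on and above the diagonal;
  below the diagonal they could fail, but there membership in B makes the entries vanish.\<close>

lemma pt_I1_conj:
  assumes "k \<in> I1" "pt s ** k ** adj (pt s) \<in> B"
  shows "pt s ** k ** adj (pt s) \<in> I1"
proof (cases s)
  case True
  let ?u = "unif D powi c" and ?v = "unif D powi (- c)"
  let ?h = "ww c ** k ** ww c"
  have h: "?h$1$1 = k$3$3" "?h$1$2 = ?v * k$3$2" "?h$1$3 = ?v * k$3$1 * ?v" "?h$2$2 = k$2$2" "?h$2$3 = k$2$1 * ?v"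
    "?h$3$3 = k$1$1"
    by (simp_all add: matrix_mult_3)
  have B: "?h \<in> B" using assms(2) True by (simp add: pt_def)
  have v: "?v \<in> P (- c)" by (simp add: frakp_def val_unif_powi)
  have "?v * k$3$2 \<in> P 0" "k$2$1 * ?v \<in> P 0" "?v * k$3$1 * ?v \<in> P (- c)"
    using assms(1) c01 by (auto simp: pro_p_iwahori_iff intro!: frakp_mult_le[OF v, of _ 1] frakp_mult_le[OF _ v, of _ 1]
        frakp_mult_le[OF frakp_mult[OF v] v, of _ "1 + c"])
  then show ?thesis using assms(1) True B B_21[OF B] B_props(1)[OF B]
    by (simp add: pt_def pro_p_iwahori_iff h) (simp add: mem_B)
qed (use assms in \<open>simp add: pt_def\<close>)

text \<open>The corner diagonal entries of an Iwahori element are units, so the ratio tested by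
  \<open>incell\<close> inherits the bound of its numerator.\<close>

lemma cell_Iw:
  assumes "n \<in> N0 s" "k \<in> Iw"
  shows "pt s ** n ** k \<in> cell s"
proof -
  have m: "n ** k \<in> Iw" using assms N0_I1 I1_Iw Iw_props by blast
  have in_G: "pt s ** n ** k \<in> carrier G" using assms N0_in Iw_props by simp
  have e: "pt s ** n ** k = pt s ** (n ** k)" by (simp add: matrix_mul_assoc)
  have "incell s (pt s ** (n ** k))"
  proof (cases s)
    case True
    have "(n ** k)$1$3 \<in> P (- c)" using m unfolding Iw_iff by blast
    then show ?thesis using True Iw_diag[OF m] unif_nonzero
      by (simp add: incell_def pt_def matrix_mult_3[of "ww c"] frakp_divide_iff)
  next
    case False
    have "(n ** k)$3$1 \<in> P (1 + c)" using m unfolding Iw_iff by blast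
    then show ?thesis using False Iw_diag[OF m] by (simp add: incell_def pt_def frakp_divide_iff)
  qed
  then show ?thesis using in_G e by (simp add: cell_iff)
qed

lemma cell_mult_Iw: "g \<in> cell s \<Longrightarrow> k \<in> Iw \<Longrightarrow> g ** k \<in> cell s"
proof -
  assume "g \<in> cell s" "k \<in> Iw"
  then obtain b n where b: "b \<in> B" "n \<in> N0 s" "g = b ** pt s ** n" by (auto simp: cell_def)
  have "g ** k = b ** (pt s ** n ** k)" by (simp add: b(3) matrix_mul_assoc)
  then show ?thesis using cell_B[OF b(1) cell_Iw[OF b(2) \<open>k \<in> Iw\<close>]] by simp
qed

text \<open>The essential gain is that the B-factor again lies in I1, where \<open>eps\<close> takes
  the value 1. It is the conjugate by \<open>pt s\<close> of an element of I1.\<close>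

lemma cell_I1:
  assumes "n \<in> N0 s" "k \<in> I1"
  obtains b n' where "b \<in> B" "b \<in> I1" "n' \<in> N0 s" "pt s ** n ** k = b ** pt s ** n'"
proof -
  have "pt s ** n ** k \<in> cell s" using cell_Iw assms I1_Iw by blast
  then obtain b n' where b: "b \<in> B" "n' \<in> N0 s" "pt s ** n ** k = b ** pt s ** n'" by (auto simp: cell_def)
  let ?h = "n ** k ** adj n'"
  have "n \<in> I1" "n' \<in> I1" using assms(1) b(2) N0_I1 by auto
  then have h: "?h \<in> I1" using assms(2) I1_props by simp
  have "pt s ** ?h ** adj (pt s) = (pt s ** n ** k) ** adj n' ** adj (pt s)" by (simp add: matrix_mul_assoc)
  also have "\<dots> = b" unfolding b(3) using N0_in[OF b(2)] by simp
  finally have "b \<in> I1" using pt_I1_conj[OF h, of s] b(1) by simp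
  then show ?thesis using that b by blast
qed

lemma Iw_factor:
  assumes "k \<in> Iw"
  obtains n b where "n \<in> N0 s" "b \<in> Iw" "pt s ** b ** adj (pt s) \<in> B" "k = n ** b"
proof -
  have "pt s ** mat 1 ** adj k \<in> cell s" using cell_Iw assms Iw_props by (intro cell_Iw) auto
  then obtain b n where b: "b \<in> B" "n \<in> N0 s" "pt s ** adj k = b ** pt s ** n" by (auto simp: cell_def)
  have kG: "k \<in> carrier G" using assms Iw_props by blast
  have n: "n \<in> carrier G" "n \<in> Iw" using N0_in b(2) subsetD[OF N0_I1] subsetD[OF I1_Iw] by auto
  define h where "h = n ** k"
  have "pt s ** h ** adj (pt s) = adj b ** ((b ** pt s ** n) ** k) ** adj (pt s)"
    using B_props(1)[OF b(1)] by (simp add: h_def matrix_mul_assoc adj_mult_self)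
  also have "\<dots> = adj b" using kG by (simp add: b(3)[symmetric])
  finally have "pt s ** h ** adj (pt s) \<in> B" using B_props(4) b(1) by simp
  moreover have "h \<in> Iw" using n assms Iw_props by (simp add: h_def)
  moreover have "k = adj n ** h" using n by (simp add: h_def)
  ultimately show ?thesis using that N0_adj[OF b(2)] by blast
qed

subsection \<open>Contraction\<close>

lemma dl_in [simp]: "dl s k \<in> carrier G" by (simp add: dl_def)

lemma dl_add: "dl s (j + k) = dl s j ** dl s k"
  by (simp add: dl_def al_add[symmetric] algebra_simps)

lemma dl_0 [simp]: "dl s 0 = mat 1" by (simp add: dl_def)

lemma adj_dl: "adj (dl s k) = dl (\<not> s) k" by (simp add: dl_def)

text \<open>As \<open>ww c\<close> inverts the powers of alpha, the torus element appearing on the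
  left depends only on whether s and t agree; for s = t it is the k-th power of alpha for both
  cells.\<close>

lemma pt_dl: "pt s ** dl t k = dl (s \<noteq> t) k ** pt s"
  by (simp add: matrix_eq_3 matrix_mult_3 pt_def dl_def mat_1_3 power_int_minus mult.commute)

lemma dl_B: "dl s k \<in> B" by (simp add: dl_def)

lemma cj_unif_pow [simp]: "cj (unif D ^ k) = unif D ^ k"
  using cj_unif_powi[of "int k"] by simp

lemma unif_pow_cancel [simp]: "unif D ^ k * (inverse (unif D ^ k) * x) = x" "inverse (unif D ^ k) * (unif D ^ k * x) = x"
  using unif_nonzero by (simp_all add: mult.assoc[symmetric])

lemma dl_conj_nx: "dl s k ** nx s a b ** adj (dl s k) = nx s (unif D ^ k * a) (unif D ^ (2 * k) * b)"
  by (cases s) (simp_all add: matrix_eq_3 matrix_mult_3 dl_def nx_def power_int_minus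
      power_mult power2_eq_square power_mult_distrib unif_nonzero mult_ac)

lemma iso_scale: "iso a b \<Longrightarrow> iso (unif D ^ k * a) (unif D ^ (2 * k) * b)"
  using nx_in[of True] dl_conj_nx[of True k a b] by (metis adj_in dl_in mult_in)

lemma P_unif_pow: "x \<in> P m \<Longrightarrow> l \<le> m + int k \<Longrightarrow> unif D ^ k * x \<in> P l"
  by (rule frakp_mult_le[of _ "int k"]) (auto simp: frakp_def val_power val_unif unif_nonzero)

lemma dl_N0: "n \<in> N0 s \<Longrightarrow> dl s k ** n ** adj (dl s k) \<in> N0 s"
proof -
  assume "n \<in> N0 s"
  then obtain a b where "n = nx s a b" "iso a b" "b \<in> P (depth s)" by (auto simp: N0_def)
  then show ?thesis using iso_scale P_unif_pow[of b "depth s" "depth s" "2 * k"]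
    by (auto simp: dl_conj_nx N0_def intro!: exI)
qed

lemma dl_NN_inverse: "n \<in> NN s \<Longrightarrow> adj (dl s k) ** n ** dl s k \<in> NN s"
proof -
  assume "n \<in> NN s"
  then obtain a b where n: "n = nx s a b" "iso a b" by (auto simp: NN_def)
  let ?a = "a / unif D ^ k" and ?b = "b / unif D ^ (2 * k)"
  have e: "dl s k ** nx s ?a ?b ** adj (dl s k) = nx s a b" using unif_nonzero by (simp add: dl_conj_nx)
  then have e2: "adj (dl s k) ** n ** dl s k = nx s ?a ?b" using n(1)
    by (metis adj_cancel(2,3) dl_in matrix_mul_assoc)
  have "nx s ?a ?b \<in> carrier G" using e2 n nx_in by (metis adj_in dl_in mult_in)
  then show ?thesis using e2 nx_in by (auto simp: NN_def)
qed

lemma dl_N0_small: "\<exists>k. \<forall>n\<in>N0 s. dl s k ** n ** adj (dl s k) - mat 1 \<in> box m"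
proof (intro exI ballI)
  define k where "k = nat m + 1"
  fix n assume "n \<in> N0 s"
  then obtain a b where n: "n = nx s a b" "iso a b" "b \<in> P (depth s)" by (auto simp: N0_def)
  have a: "a \<in> P 0" by (rule iso_frakp[OF n(2,3)]) (use c01 in \<open>auto simp: depth_def\<close>)
  have b: "b \<in> P (- 1)" using n(3) c01 by (auto simp: depth_def intro: frakp_le)
  have "unif D ^ k * a \<in> P m" "unif D ^ k * cj a \<in> P m" "unif D ^ (2 * k) * b \<in> P m"
    using P_unif_pow[OF a, of m k] P_unif_pow[of "cj a" 0 m k] P_unif_pow[OF b, of m "2 * k"] a by (auto simp: k_def)
  then show "dl s k ** n ** adj (dl s k) - mat 1 \<in> box m" unfolding n(1) dl_conj_nx
    by (cases s) (simp_all add: box_def forall_3 nx_def mat_1_3)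
qed

text \<open>Elements of \<open>N0 False\<close> already lie in the radical, whereas those of
  \<open>N0 True\<close> need one contraction step. This matches the exponents at which I^+ and I^-
  start.\<close>

lemma dl_N0_R:
  assumes "n \<in> N0 s" "s \<Longrightarrow> k \<ge> 1"
  shows "dl s k ** n ** adj (dl s k) \<in> R"
proof -
  obtain a b where n: "n = nx s a b" "iso a b" "b \<in> P (depth s)" using assms(1) by (auto simp: N0_def)
  have a: "a \<in> P (if s then 0 else 1)" by (rule iso_frakp[OF n(2,3)]) (use c01 in \<open>auto simp: depth_def\<close>)
  show ?thesis
  proof (cases s)
    case True
    then have "k \<ge> 1" "a \<in> P 0" "b \<in> P (- c)" using a n(3) assms(2) by (auto simp: depth_def)
    then have "unif D ^ k * a \<in> P (1 - c)" "unif D ^ k * cj a \<in> P (1 - c)" "unif D ^ (2 * k) * b \<in> P (1 - c)"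
      using P_unif_pow[of a 0 "1 - c" k] P_unif_pow[of "cj a" 0 "1 - c" k] P_unif_pow[of b "- c" "1 - c" "2 * k"] c01 by auto
    then show ?thesis using True iso_scale[OF n(2), of k] unfolding n(1) dl_conj_nx
      by (simp add: radical_iff nx_def nu_in)
  next
    case False
    then have "unif D ^ k * a \<in> P 1" "unif D ^ k * cj a \<in> P 1" "unif D ^ (2 * k) * b \<in> P (1 + c)"
      using P_unif_pow[of a 1 1 k] P_unif_pow[of "cj a" 1 1 k] P_unif_pow[of b "1 + c" "1 + c" "2 * k"] a n(3) by (auto simp: depth_def)
    then show ?thesis using False iso_scale[OF n(2), of k] unfolding n(1) dl_conj_nx
      by (simp add: radical_iff nx_def nl_in)
  qed
qed

lemma N0_False_R: "N0 False \<subseteq> R"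
  using dl_N0_R[of _ False 0] by auto

lemma dl_expand_N0: "n \<in> NN s \<Longrightarrow> \<exists>k. dl s k ** n ** adj (dl s k) \<in> N0 s"
proof -
  assume "n \<in> NN s"
  then obtain a b where n: "n = nx s a b" "iso a b" by (auto simp: NN_def)
  obtain m where m: "b \<in> P m" by (cases "b = 0") (auto simp: frakp_def)
  let ?k = "nat (depth s - m)"
  have "unif D ^ (2 * ?k) * b \<in> P (depth s)" by (rule P_unif_pow[OF m]) simp
  then show ?thesis using n iso_scale[OF n(2), of ?k] unfolding N0_def n(1) dl_conj_nx by blast
qed

text \<open>The hypothesis puts b in the Borel subgroup opposite to \<open>NN s\<close>, whose
  unipotent part is contracted by the inverse of \<open>dl s k\<close>.\<close>

lemma dl_conj_K:
  assumes "b \<in> K" "pt s ** b ** adj (pt s) \<in> B"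
  shows "adj (dl s k) ** b ** dl s k \<in> K"
proof (cases s)
  case True
  let ?h = "ww c ** b ** ww c"
  have "?h \<in> B" using assms(2) True by (simp add: pt_def)
  then have "?h$2$1 = 0" "?h$3$1 = 0" "?h$3$2 = 0" using B_21[of ?h] mem_B by auto
  then have z: "b$2$3 = 0" "b$1$3 = 0" "b$1$2 = 0" using unif_nonzero by (simp_all add: matrix_mult_3)
  have G: "al (int k) ** b ** al (- int k) \<in> carrier G" using assms(1) K_props by simp
  have "unif D ^ k * b$2$1 \<in> P c" "unif D ^ k * b$3$2 \<in> P c" "unif D ^ (2 * k) * b$3$1 \<in> P c"
    using assms(1) by (auto simp: Kf_iff intro!: P_unif_pow[of _ c])
  then show ?thesis using True G assms(1) z
    by (simp add: Kf_iff dl_def) (simp add: matrix_mult_3 power_int_minus unif_nonzero mult_ac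
        power_mult power2_eq_square power_mult_distrib)
next
  case False
  then have "b \<in> B" using assms(2) by (simp add: pt_def)
  then have z: "b$2$1 = 0" "b$3$1 = 0" "b$3$2 = 0" using B_21[of b] mem_B by auto
  have G: "al (- int k) ** b ** al (int k) \<in> carrier G" using assms(1) K_props by simp
  have "unif D ^ k * b$1$2 \<in> P 0" "unif D ^ k * b$2$3 \<in> P 0" "unif D ^ (2 * k) * b$1$3 \<in> P (- c)"
    using assms(1) P_unif_pow[of "b$1$2" 0 0 k] P_unif_pow[of "b$2$3" 0 0 k] P_unif_pow[of "b$1$3" "- c" "- c" "2 * k"]
    by (auto simp: Kf_iff)
  then show ?thesis using False G assms(1) z
    by (simp add: Kf_iff dl_def) (simp add: matrix_mult_3 power_int_minus unif_nonzero mult_ac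
        power_mult power2_eq_square power_mult_distrib)
qed

lemma R_factor:
  assumes "k \<in> R"
  obtains b n where "b \<in> B" "b \<in> R" "n \<in> N0 False" "k = b ** n"
proof -
  have "k \<in> I1" using assms R_I1 by blast
  then obtain b n' where b: "b \<in> B" "b \<in> I1" "n' \<in> N0 False" "pt False ** mat 1 ** k = b ** pt False ** n'"
    by (rule cell_I1[OF one_N0])
  then have k: "k = b ** n'" by (simp add: pt_def)
  then have "b = k ** adj n'" using N0_in[OF b(3)] by simp
  moreover have "n' \<in> R" using b(3) N0_False_R by blast
  ultimately have "b \<in> R" using assms R_props by simp
  then show ?thesis using that b k by blast
qed

lemma NN_conj_pt: "n \<in> NN False \<Longrightarrow> ww c ** n ** ww c \<in> B"
  by (auto simp: NN_def mem_B nx_def matrix_mult_3 nl_in)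

lemma nu_B: "iso a b \<Longrightarrow> nu a b \<in> B"
  by (simp add: mem_B nu_in)

subsection \<open>Tori generated by unipotent elements\<close>

text \<open>The monomial element in the Bruhat decomposition of a lower unipotent element with
  corner entry b.\<close>

definition anti :: "'e \<Rightarrow> 'e^3^3"
  where "anti b = vector [vector [0, 0, 1 / cj b], vector [0, - cj b / b, 0], vector [b, 0, 0]]"

text \<open>The general diagonal element of G of determinant 1.\<close>

definition tor :: "'e \<Rightarrow> 'e^3^3"
  where "tor x = vector [vector [x, 0, 0], vector [0, cj x / x, 0], vector [0, 0, 1 / cj x]]"

text \<open>The Bruhat identity in rank one. Solved for the middle factor, it writes
  \<open>anti b\<close> as a product of unipotent elements.\<close>

lemma anti_factor:
  assumes "iso a b" "b \<noteq> 0"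
  shows "iso (a / cj b) (1 / b)" "iso (a / b) (1 / b)"
    "nu (a / cj b) (1 / b) ** anti b ** nu (a / b) (1 / b) = nl a b"
proof -
  have i: "a * cj a = - b - cj b" using assms(1) by (simp add: iso_def eq_neg_iff_add_eq_0 algebra_simps)
  have "1 / b + 1 / cj b + (a / cj b) * (cj a / b) = (b + cj b + a * cj a) / (b * cj b)"
    using assms(2) by (simp add: field_simps)
  then show "iso (a / cj b) (1 / b)" "iso (a / b) (1 / b)" using assms(2) i by (simp_all add: iso_def mult.commute)
  have "- cj b / b - cj a / b * a = (- cj b - a * cj a) / b" by (simp add: diff_divide_distrib mult.commute)
  also have "\<dots> = 1" unfolding i using assms(2) by simp
  finally have "- cj b / b - cj a / b * a = 1" .
  then show "nu (a / cj b) (1 / b) ** anti b ** nu (a / b) (1 / b) = nl a b"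
    using assms(2) by (simp add: matrix_eq_3 matrix_mult_3 anti_def) (simp add: field_simps, insert i, simp)
qed

text \<open>It suffices to find two corner entries whose quotient is \<open>1 / cj x\<close>, each
  completed to an isotropic pair. The freedom of scaling both by an element of F is used to
  prescribe a trace.\<close>

lemma tor_factor:
  assumes "x \<noteq> 0"
  obtains a b b' where "iso a b" "iso 0 b'" "b \<noteq> 0" "b' \<noteq> 0" "tor x = anti b ** adj (anti b')"
proof -
  obtain \<tau> where \<tau>: "\<tau> \<noteq> 0" "cj \<tau> = - \<tau>" using trace_zero_unit by blast
  define y where "y = \<tau> / cj x"
  have y: "y \<noteq> 0" using \<tau> assms by (simp add: y_def)
  have ta: "tor x = anti (f * y) ** adj (anti (f * \<tau>))" if "f \<noteq> 0" "cj f = f" for f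
    using that \<tau> assms by (simp add: matrix_eq_3 matrix_mult_3 adj_entries anti_def tor_def y_def)
  show ?thesis
  proof (cases "y + cj y = 0")
    case True
    then show ?thesis using that[of 0 "1 * y" "1 * \<tau>"] ta[of 1] \<tau> y by (simp add: iso_def)
  next
    case False
    \<comment> \<open>This scaling makes the trace of \<open>?f * y\<close> equal to -1, so a = 1
      completes the pair; the entry \<open>?f * \<tau>\<close> keeps trace zero.\<close>
    let ?f = "- 1 / (y + cj y)"
    have f: "?f \<noteq> 0" "cj ?f = ?f" using False by (simp_all add: add.commute)
    have "iso 1 (?f * y)"
    proof -
      have "?f * y + cj (?f * y) = ?f * (y + cj y)" by (simp only: conjg_mult f(2) distrib_left)
      also have "\<dots> = - 1" using False by simp
      finally show ?thesis by (simp add: iso_def)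
    qed
    moreover have "iso 0 (?f * \<tau>)" unfolding iso_def by (simp only: conjg_mult f(2) \<tau>(2)) simp
    ultimately show ?thesis using that[OF _ _ _ _ ta[OF f]] f(1) y \<tau>(1) by (metis mult_eq_0_iff)
  qed
qed

text \<open>The hermitian relation and the determinant express the diagonal of the quotient through
  its first entry; dividing by the resulting \<open>tor x\<close> leaves a unipotent
  element.\<close>

lemma B_det_one:
  assumes "b \<in> B" "b' \<in> B" "det b = det b'"
  obtains x u where "x \<noteq> 0" "tor x \<in> B" "u \<in> NN True" "b' = tor x ** u ** b"
proof -
  let ?g = "b' ** adj b"
  have gB: "?g \<in> B" using assms B_props by blast
  have "det ?g = 1"
  proof -
    have "det b * det (adj b) = 1"
      using mult_adj[OF B_props(1)[OF assms(1)]] det_mul[of b "adj b"] by simp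
    then show ?thesis using assms(3) by (simp add: det_mul)
  qed
  moreover have "det ?g = ?g$1$1 * ?g$2$2 * ?g$3$3"
    using gB B_21[OF gB] by (simp add: det_3 mem_B)
  ultimately have d: "?g$1$1 * ?g$2$2 * ?g$3$3 = 1" by simp
  define g where "g = ?g"
  have g: "g \<in> B" "g \<in> carrier G" "g$2$1 = 0" "g$3$1 = 0" "g$3$2 = 0" "g$1$1 * g$2$2 * g$3$3 = 1"
    using gB B_21[OF gB] d B_props(1) by (auto simp: g_def mem_B)
  have e13: "cj (g$1$1) * g$3$3 = 1" using U21_entries[OF g(2), of 1 3] g by (simp add: beta_def)
  define x where "x = g$1$1"
  have x: "x \<noteq> 0" using e13 by (auto simp: x_def)
  have g33: "g$3$3 = 1 / cj x" using e13 x by (simp add: x_def field_simps)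
  have g22: "g$2$2 = cj x / x" using g(6) x g33 by (simp add: x_def[symmetric] field_simps)
  have torG: "tor x \<in> carrier G"
    using x by (simp add: mem_U21 matrix_eq_3 matrix_mult_3 adj_entries tor_def mat_1_3)
  then have torB: "tor x \<in> B" by (simp add: mem_B tor_def)
  define u where "u = adj (tor x) ** g"
  have u_entries: "u$1$1 = 1" "u$2$1 = 0" "u$2$2 = 1" "u$3$1 = 0" "u$3$2 = 0" "u$3$3 = 1"
    using x g g33 g22 by (simp_all add: u_def matrix_mult_3 adj_entries tor_def x_def[symmetric])
  have uG: "u \<in> carrier G" using torG g(2) by (simp add: u_def)
  have "cj (u$3$2) * u$1$3 + cj (u$2$2) * u$2$3 + cj (u$1$2) * u$3$3 = 0"
    using U21_entries[OF uG, of 2 3] by (simp add: beta_def)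
  then have "u$2$3 = - cj (u$1$2)" using u_entries by (simp add: eq_neg_iff_add_eq_0)
  then have u_eq: "u = nu (u$1$2) (u$1$3)" using u_entries by (simp add: matrix_eq_3)
  then have "iso (u$1$2) (u$1$3)" using uG nu_in by metis
  then have "u \<in> NN True" using u_eq by (auto simp: NN_def nx_def)
  moreover have "tor x ** u ** b = b'"
    using torG B_props(1)[OF assms(1)] by (simp add: u_def g_def matrix_mul_assoc mult_adj)
  ultimately show ?thesis using that[OF x torB] by simp
qed

end

section \<open>Quotients of principal series\<close>

lemma vector_space_fun: "vector_space (\<lambda>(c::'c::field) (f::'g \<Rightarrow> 'c) g. c * f g)"
  by unfold_locales (auto simp: algebra_simps plus_fun_def)

text \<open>Parabolic inductions and twists of the Steinberg representation are both images of an induced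
  representation \<open>V\<close> under a map \<open>Phi\<close>.  All that is needed of its kernel is that a function in it
  vanishes as soon as it vanishes at one point.\<close>

locale principal_series_quotient = unramified_vertex D i
  for D :: "'e::field quad_ext" and i :: vertex +
  fixes eps :: "'e^3^3 \<Rightarrow> 'c::field" and pi :: "('e^3^3, 'c, 'v::ab_group_add) repr"
    and Phi :: "('e^3^3 \<Rightarrow> 'c) \<Rightarrow> 'v"
  assumes char_c: "CHAR('c) = rchar D"
    and eps_nz: "b \<in> borel_subgroup D \<Longrightarrow> eps b \<noteq> 0"
    and eps_mult: "b \<in> borel_subgroup D \<Longrightarrow> b' \<in> borel_subgroup D \<Longrightarrow> eps (b ** b') = eps b * eps b'"
    and eps_I1: "b \<in> borel_subgroup D \<Longrightarrow> b \<in> Hf 3 (1 + vx i) 1 \<Longrightarrow> eps b = 1"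
    and smooth_pi: "smooth_rep (matrix_topology D) (U21 D) pi"
    and Phi_int: "intertwiner (U21 D) (ind_borel D eps) pi Phi"
    and Phi_surj: "Phi ` vspace (ind_borel D eps) = vspace pi"
    and Phi_ker: "f \<in> vspace (ind_borel D eps) \<Longrightarrow> Phi f = 0 \<Longrightarrow> g \<in> carrier (U21 D) \<Longrightarrow> f g = 0 \<Longrightarrow> f = 0"
    and eps_not_det: "(\<And>f. f \<in> vspace (ind_borel D eps) \<Longrightarrow> Phi f = 0 \<Longrightarrow> f = 0) \<Longrightarrow>
      \<not> (\<exists>\<eta>. \<forall>b\<in>borel_subgroup D. eps b = \<eta> (det b))"
begin

abbreviation V where "V \<equiv> vspace (ind_borel D eps)"
abbreviation U where "U r \<equiv> Hf 2 (vx i) r"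

section \<open>The induced representation and its image\<close>

definition tr :: "'e^3^3 \<Rightarrow> ('e^3^3 \<Rightarrow> 'c) \<Rightarrow> 'e^3^3 \<Rightarrow> 'c"
  where "tr h f = (\<lambda>g. f (g ** h))"

definition sc :: "'c \<Rightarrow> ('e^3^3 \<Rightarrow> 'c) \<Rightarrow> 'e^3^3 \<Rightarrow> 'c"
  where "sc a f = (\<lambda>g. a * f g)"

lemma vs_sc: "vector_space sc"
  unfolding sc_def by (rule vector_space_fun)

sublocale SC: vector_space sc by (rule vs_sc)
sublocale PI: vector_space "scal pi" using smooth_pi by (simp add: smooth_rep_def)

lemma tr_mult: "tr (a ** b) f = tr a (tr b f)"
  by (simp add: tr_def matrix_mul_assoc)

lemma tr_one [simp]: "tr (mat 1) f = f"
  by (simp add: tr_def)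

lemma tr_add: "tr h (f + f') = tr h f + tr h f'" and tr_diff: "tr h (f - f') = tr h f - tr h f'"
  and tr_sc: "tr h (sc a f) = sc a (tr h f)"
  by (simp_all add: tr_def sc_def fun_eq_iff)

lemma tr_cancel [simp]:
  assumes "h \<in> carrier G"
  shows "tr (adj h) (tr h f) = f" "tr h (tr (adj h) f) = f"
  using assms by (simp_all add: tr_mult[symmetric] mult_adj adj_mult_self)

lemma subgroup_U: "r \<ge> 0 \<Longrightarrow> subgroup (U r) G"
  by (rule subgroup_Hf) auto

text \<open>The open subgroup in the definition may be shrunk to a member of one fixed filtration,
  so that two such conditions combine by taking the larger level.\<close>

lemma V_iff:
  "f \<in> V \<longleftrightarrow> (\<forall>g. g \<notin> carrier G \<longrightarrow> f g = 0) \<and> (\<forall>b\<in>B. \<forall>g\<in>carrier G. f (b ** g) = eps b * f g) \<and>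
    (\<exists>r\<ge>0. \<forall>g\<in>carrier G. \<forall>u\<in>U r. f (g ** u) = f g)"
proof -
  have "(\<exists>S. subgroup S G \<and> openin (subtopology X (carrier G)) S \<and> (\<forall>g\<in>carrier G. \<forall>u\<in>S. f (g ** u) = f g))
    \<longleftrightarrow> (\<exists>r\<ge>0. \<forall>g\<in>carrier G. \<forall>u\<in>U r. f (g ** u) = f g)" (is "?l \<longleftrightarrow> ?r")
  proof
    assume ?l
    then obtain S where S: "subgroup S G" "openin (subtopology X (carrier G)) S" "\<forall>g\<in>carrier G. \<forall>u\<in>S. f (g ** u) = f g"
      by blast
    obtain n where n: "\<forall>g\<in>carrier G. g - mat 1 \<in> box n \<longrightarrow> g \<in> S"
      using openin_nhd1[OF S(2)] subgroup_props(1)[OF S(1)] by (auto simp: nhd1_def)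
    obtain r where "r \<ge> 0" "\<forall>g\<in>U r. g - mat 1 \<in> box n" using nhd_Hf[of 2] by fastforce
    then show ?r using n S(3) by (metis (no_types, lifting) Hf_def mem_Collect_eq)
  next
    assume ?r
    then obtain r where r: "r \<ge> 0" "\<forall>g\<in>carrier G. \<forall>u\<in>U r. f (g ** u) = f g" by blast
    have "openin (subtopology X (carrier G)) (U r)"
      using subgroup_U[OF r(1)] by (intro nhd1_openin nhd1_Hf UG.subgroup_self) (auto simp: Hf_def)
    then show ?l using r subgroup_U by blast
  qed
  then show ?thesis by (simp add: ind_borel_def)
qed

lemma V_0: "g \<notin> carrier G \<Longrightarrow> f \<in> V \<Longrightarrow> f g = 0"
  and V_B: "b \<in> B \<Longrightarrow> g \<in> carrier G \<Longrightarrow> f \<in> V \<Longrightarrow> f (b ** g) = eps b * f g"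
  by (simp_all add: V_iff)

lemma U_shrink:
  assumes "h \<in> carrier G"
  shows "\<exists>r'\<ge>0. \<forall>u\<in>U r'. adj h ** u ** h \<in> U r"
proof -
  obtain n where n: "\<forall>g\<in>carrier G. g - mat 1 \<in> box n \<longrightarrow> g \<in> U r" using Hf_nhd[of 2 "vx i" r] by auto
  obtain N where N: "\<forall>Z\<in>box N. adj h ** Z ** h \<in> box n" using mult_small by blast
  obtain r' where r': "r' \<ge> 0" "\<forall>g\<in>U r'. g - mat 1 \<in> box N" using nhd_Hf[of 2 "vx i" N] by auto
  have "adj h ** u ** h \<in> U r" if u: "u \<in> U r'" for u
  proof -
    have "adj h ** (u - mat 1) ** h = adj h ** u ** h - mat 1"
      using assms by (simp add: matrix_diff_ldistrib matrix_diff_rdistrib adj_mult_self)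
    then have "adj h ** u ** h - mat 1 \<in> box n" using N r'(2) u by metis
    moreover have "adj h ** u ** h \<in> carrier G" using u assms by (simp add: Hf_def)
    ultimately show ?thesis using n by blast
  qed
  then show ?thesis using r'(1) by blast
qed

lemma V_tr: "h \<in> carrier G \<Longrightarrow> f \<in> V \<Longrightarrow> tr h f \<in> V"
proof -
  assume h: "h \<in> carrier G" and f: "f \<in> V"
  obtain r where r: "r \<ge> 0" "\<forall>g\<in>carrier G. \<forall>u\<in>U r. f (g ** u) = f g" using f V_iff by blast
  obtain r' where r': "r' \<ge> 0" "\<forall>u\<in>U r'. adj h ** u ** h \<in> U r" using U_shrink[OF h] by blast
  have inv: "tr h f (g ** u) = tr h f g" if "g \<in> carrier G" "u \<in> U r'" for g u
  proof -
    have "f ((g ** h) ** (adj h ** u ** h)) = f (g ** h)" using r(2) r'(2) that h by simp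
    moreover have "(g ** h) ** (adj h ** u ** h) = g ** u ** h" using h by (simp add: matrix_mul_assoc)
    ultimately show ?thesis by (simp add: tr_def)
  qed
  have out: "tr h f g = 0" if "g \<notin> carrier G" for g
  proof -
    have "g ** h \<notin> carrier G"
    proof
      assume "g ** h \<in> carrier G"
      then have "g ** h ** adj h \<in> carrier G" by (rule mult_in[OF _ adj_in[OF h]])
      then show False using that h by simp
    qed
    then show ?thesis using V_0 f by (simp add: tr_def)
  qed
  have "tr h f (b ** g) = eps b * tr h f g" if "b \<in> B" "g \<in> carrier G" for b g
    using V_B[of b "g ** h" f] that h f by (simp add: tr_def matrix_mul_assoc)
  then show "tr h f \<in> V" unfolding V_iff using inv out r'(1) by blast
qed

lemma V_subspace: "SC.subspace V"
proof (rule SC.subspaceI)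
  show "0 \<in> V" unfolding V_iff by (auto intro: exI[of _ 0])
  show "f + f' \<in> V" if f: "f \<in> V" "f' \<in> V" for f f'
  proof -
    obtain r where r: "r \<ge> 0" "\<forall>g\<in>carrier G. \<forall>u\<in>U r. f (g ** u) = f g" using f V_iff by blast
    obtain r' where r': "r' \<ge> 0" "\<forall>g\<in>carrier G. \<forall>u\<in>U r'. f' (g ** u) = f' g" using f V_iff by blast
    have "u \<in> U r" "u \<in> U r'" if "u \<in> U (max r r')" for u
      using subsetD[OF Hf_mono that, of r] subsetD[OF Hf_mono that, of r'] by auto
    then have "\<forall>g\<in>carrier G. \<forall>u\<in>U (max r r'). (f + f') (g ** u) = (f + f') g"
      using r r' by (metis plus_fun_apply)
    then have "\<exists>r\<ge>0. \<forall>g\<in>carrier G. \<forall>u\<in>U r. (f + f') (g ** u) = (f + f') g"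
      using r(1) by (intro exI[of _ "max r r'"]) auto
    then show ?thesis unfolding V_iff using V_0[OF _ f(1)] V_0[OF _ f(2)] V_B[OF _ _ f(1)] V_B[OF _ _ f(2)]
      by (auto simp: distrib_left)
  qed
  show "sc a f \<in> V" if f: "f \<in> V" for a f
  proof -
    obtain r where r: "r \<ge> 0" "\<forall>g\<in>carrier G. \<forall>u\<in>U r. f (g ** u) = f g" using f V_iff by blast
    then have "\<exists>r\<ge>0. \<forall>g\<in>carrier G. \<forall>u\<in>U r. sc a f (g ** u) = sc a f g" by (auto simp: sc_def)
    then show ?thesis unfolding V_iff using V_0[OF _ f] V_B[OF _ _ f] by (auto simp: sc_def)
  qed
qed

lemmas V_ops = SC.subspace_0[OF V_subspace] SC.subspace_add[OF V_subspace] SC.subspace_diff[OF V_subspace]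
  SC.subspace_scale[OF V_subspace] SC.subspace_sum[OF V_subspace]

lemma Phi_in: "f \<in> V \<Longrightarrow> Phi f \<in> vspace pi"
  and Phi_add: "f \<in> V \<Longrightarrow> f' \<in> V \<Longrightarrow> Phi (f + f') = Phi f + Phi f'"
  and Phi_sc: "f \<in> V \<Longrightarrow> Phi (sc a f) = scal pi a (Phi f)"
  and Phi_tr: "g \<in> carrier G \<Longrightarrow> f \<in> V \<Longrightarrow> Phi (tr g f) = act pi g (Phi f)"
  using Phi_int by (auto simp: intertwiner_def linear_on_def ind_borel_def sc_def tr_def)

lemma Phi_0: "Phi 0 = 0"
  using Phi_sc[OF V_ops(1), of 0] by simp

lemma Phi_diff: "f \<in> V \<Longrightarrow> f' \<in> V \<Longrightarrow> Phi (f - f') = Phi f - Phi f'"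
  using Phi_add[of "f - f'" f'] V_ops by (simp add: algebra_simps)

lemma pi_subspace: "PI.subspace (vspace pi)"
  using smooth_pi by (simp add: smooth_rep_def)

lemma pi_act: "g \<in> carrier G \<Longrightarrow> y \<in> vspace pi \<Longrightarrow> act pi g y \<in> vspace pi"
  "g \<in> carrier G \<Longrightarrow> y \<in> vspace pi \<Longrightarrow> z \<in> vspace pi \<Longrightarrow> act pi g (y + z) = act pi g y + act pi g z"
  "g \<in> carrier G \<Longrightarrow> y \<in> vspace pi \<Longrightarrow> act pi g (scal pi a y) = scal pi a (act pi g y)"
  "y \<in> vspace pi \<Longrightarrow> act pi (mat 1) y = y"
  "g \<in> carrier G \<Longrightarrow> h \<in> carrier G \<Longrightarrow> y \<in> vspace pi \<Longrightarrow> act pi (g ** h) y = act pi g (act pi h y)"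
  using smooth_pi by (auto simp: smooth_rep_def linear_on_def)

subsection \<open>Values on the cells\<close>

lemma V_eqI:
  assumes "f \<in> V" "f' \<in> V" "\<And>s n. n \<in> N0 s \<Longrightarrow> f (pt s ** n) = f' (pt s ** n)"
  shows "f = f'"
proof
  fix g
  show "f g = f' g"
  proof (cases "g \<in> carrier G")
    case True
    then obtain s where "g \<in> cell s" using cell_cover by blast
    then obtain b n where "b \<in> B" "n \<in> N0 s" "g = b ** (pt s ** n)"
      by (auto simp: cell_def matrix_mul_assoc)
    then show ?thesis using V_B[OF _ _ assms(1)] V_B[OF _ _ assms(2)] assms(3) N0_in by simp
  qed (simp add: V_0[OF _ assms(1)] V_0[OF _ assms(2)])
qed

text \<open>The function supported on a single cell with value \<open>eps b\<close> at
  \<open>b ** pt s ** n\<close>; the description is unambiguous by \<open>cell_unique\<close>. The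
  two functions span the I1-invariants of V.\<close>

definition fx :: "bool \<Rightarrow> 'e^3^3 \<Rightarrow> 'c"
  where "fx s g = (if g \<in> cell s then eps (THE b. b \<in> B \<and> (\<exists>n\<in>N0 s. g = b ** pt s ** n)) else 0)"

lemma fx_val: "b \<in> B \<Longrightarrow> n \<in> N0 s \<Longrightarrow> fx s (b ** pt s ** n) = eps b"
proof -
  assume b: "b \<in> B" "n \<in> N0 s"
  have "(THE b'. b' \<in> B \<and> (\<exists>n'\<in>N0 s. b ** pt s ** n = b' ** pt s ** n')) = b"
  proof (rule the_equality)
    show "b' = b" if "b' \<in> B \<and> (\<exists>n'\<in>N0 s. b ** pt s ** n = b' ** pt s ** n')" for b'
      using that cell_unique(1)[of b' b] b N0_NN by (metis subsetD)
  qed (use b in blast)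
  moreover have "b ** pt s ** n \<in> cell s" using b by (auto simp: cell_def)
  ultimately show ?thesis by (simp add: fx_def)
qed

lemma fx_val1: "n \<in> N0 s \<Longrightarrow> fx s (pt s ** n) = 1"
  using fx_val[OF B_props(2), of n s] eps_I1[OF B_props(2)] I1_props by simp

lemma fx_out: "g \<notin> cell s \<Longrightarrow> fx s g = 0"
  by (simp add: fx_def)

lemma fx_I1: "k \<in> I1 \<Longrightarrow> tr k (fx s) = fx s"
proof
  fix g assume k: "k \<in> I1"
  then have kI: "k \<in> Iw" "adj k \<in> Iw" "k \<in> carrier G" using I1_Iw I1_props by auto
  show "tr k (fx s) g = fx s g"
  proof (cases "g \<in> cell s")
    case True
    then obtain b n where b: "b \<in> B" "n \<in> N0 s" "g = b ** pt s ** n" by (auto simp: cell_def)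
    obtain b' n' where b': "b' \<in> B" "b' \<in> I1" "n' \<in> N0 s" "pt s ** n ** k = b' ** pt s ** n'"
      by (rule cell_I1[OF b(2) k])
    have "g ** k = (b ** b') ** pt s ** n'" using b(3) b'(4) by (metis matrix_mul_assoc)
    then have "fx s (g ** k) = eps (b ** b')" using fx_val b(1) b' B_props by simp
    then show ?thesis using fx_val[OF b(1,2)] b b' eps_mult eps_I1 by (simp add: tr_def)
  next
    case False
    then have "g ** k \<notin> cell s" using cell_mult_Iw[of "g ** k" s "adj k"] kI by auto
    then show ?thesis using False by (simp add: tr_def fx_out)
  qed
qed

lemma fx_V: "fx s \<in> V"
  unfolding V_iff
proof (intro conjI ballI allI impI)
  show "fx s g = 0" if "g \<notin> carrier G" for g using that cell_in fx_out by blast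
  show "fx s (b ** g) = eps b * fx s g" if b: "b \<in> B" and "g \<in> carrier G" for b g
  proof (cases "g \<in> cell s")
    case True
    then obtain b' n where b': "b' \<in> B" "n \<in> N0 s" "g = b' ** pt s ** n" by (auto simp: cell_def)
    have "fx s ((b ** b') ** pt s ** n) = eps (b ** b')" using b b' B_props by (intro fx_val) auto
    moreover have "(b ** b') ** pt s ** n = b ** g" by (simp add: b'(3) matrix_mul_assoc)
    ultimately show ?thesis using fx_val[OF b'(1,2)] b b' eps_mult by simp
  next
    case False
    then have "b ** g \<notin> cell s" using cell_B[of "adj b" "b ** g" s] b B_props by auto
    then show ?thesis using False by (simp add: fx_out)
  qed
  have "fx s (g ** u) = fx s g" if "u \<in> U 1" for g u
    using fx_I1[of u s] R_I1 that by (auto simp: tr_def fun_eq_iff)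
  then show "\<exists>r\<ge>0. \<forall>g\<in>carrier G. \<forall>u\<in>U r. fx s (g ** u) = fx s g" by (intro exI[of _ 1]) auto
qed

text \<open>Constancy is demanded on one cell only, with no restriction on the other. The preimage
  of I^+ will lie in \<open>Q False\<close> and that of I^- in \<open>Q True\<close>.\<close>

definition Q :: "bool \<Rightarrow> ('e^3^3 \<Rightarrow> 'c) set"
  where "Q s = {f \<in> V. \<forall>n\<in>N0 s. f (pt s ** n) = f (pt s)}"

lemma Q_V: "f \<in> Q s \<Longrightarrow> f \<in> V" by (simp add: Q_def)

lemma Q_subspace: "SC.subspace (Q s)"
proof (rule SC.subspaceI)
  show "sc a f \<in> Q s" if "f \<in> Q s" for a f
    using that V_ops(4)[of f a] by (auto simp: Q_def sc_def)
qed (auto simp: Q_def V_ops)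

text \<open>Constancy along \<open>N0 s\<close> improves to invariance under I1 on the whole cell,
  because moving by I1 changes the B-factor only within the kernel of \<open>eps\<close>.\<close>

lemma Q_I1: "f \<in> Q s \<Longrightarrow> x \<in> cell s \<Longrightarrow> k \<in> I1 \<Longrightarrow> f (x ** k) = f x"
proof -
  assume f: "f \<in> Q s" and x: "x \<in> cell s" and k: "k \<in> I1"
  obtain b n where b: "b \<in> B" "n \<in> N0 s" "x = b ** pt s ** n" using x by (auto simp: cell_def)
  obtain b' n' where b': "b' \<in> B" "b' \<in> I1" "n' \<in> N0 s" "pt s ** n ** k = b' ** pt s ** n'"
    by (rule cell_I1[OF b(2) k])
  have e: "x ** k = b ** (b' ** (pt s ** n'))" "x = b ** (pt s ** n)"
    using b(3) b'(4) by (metis matrix_mul_assoc)+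
  have "f (b' ** (pt s ** n')) = eps b' * f (pt s ** n')"
    using f b' N0_in by (intro V_B) (auto simp: Q_def)
  also have "\<dots> = f (pt s ** n)" using f b b' eps_I1 by (simp add: Q_def)
  finally have "eps b * f (b' ** (pt s ** n')) = eps b * f (pt s ** n)" by simp
  moreover have "f (b ** (b' ** (pt s ** n'))) = eps b * f (b' ** (pt s ** n'))"
    using b(1) b' N0_in B_props(1) Q_V[OF f] by (intro V_B) auto
  moreover have "f (b ** (pt s ** n)) = eps b * f (pt s ** n)"
    using b N0_in Q_V[OF f] by (intro V_B) auto
  ultimately show ?thesis using e by metis
qed

text \<open>An Iwahori element normalizes I1, so moving n past k replaces it by an element of I1, to
  which \<open>Q_I1\<close> applies.\<close>

lemma Q_tr: "k \<in> Iw \<Longrightarrow> f \<in> Q s \<Longrightarrow> tr k f \<in> Q s"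
proof -
  assume k: "k \<in> Iw" and f: "f \<in> Q s"
  have kG: "k \<in> carrier G" using k Iw_props by blast
  have "f (pt s ** n ** k) = f (pt s ** k)" if n: "n \<in> N0 s" for n
  proof -
    have "adj k ** n ** adj (adj k) \<in> I1" using Iw_conj_I1[of "adj k" n] k n N0_I1 Iw_props by auto
    moreover have "pt s ** k \<in> cell s" using cell_Iw[OF one_N0 k] by simp
    ultimately have "f ((pt s ** k) ** (adj k ** n ** adj (adj k))) = f (pt s ** k)" using Q_I1[OF f] by blast
    moreover have "(pt s ** k) ** (adj k ** n ** adj (adj k)) = pt s ** n ** k"
      using kG by (simp add: matrix_mul_assoc)
    ultimately show ?thesis by simp
  qed
  then show ?thesis using V_tr[OF kG Q_V[OF f]] by (simp add: Q_def tr_def)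
qed

lemma Q_both:
  assumes "f \<in> Q True" "f \<in> Q False"
  shows "f = sc (f (pt True)) (fx True) + sc (f (pt False)) (fx False)"
proof (rule V_eqI)
  fix s n assume n: "n \<in> N0 s"
  have "pt s ** n \<notin> cell (\<not> s)" using pt_N0_cell[OF n] cell_disjoint by blast
  then show "f (pt s ** n) = (sc (f (pt True)) (fx True) + sc (f (pt False)) (fx False)) (pt s ** n)"
    using n assms by (cases s) (simp_all add: sc_def fx_out fx_val1 Q_def)
qed (use assms Q_V V_ops fx_V in auto)

lemma I1_fixed_Q: "f \<in> V \<Longrightarrow> (\<And>k. k \<in> I1 \<Longrightarrow> tr k f = f) \<Longrightarrow> f \<in> Q s"
proof -
  assume f: "f \<in> V" "\<And>k. k \<in> I1 \<Longrightarrow> tr k f = f"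
  have "f (pt s ** n) = f (pt s)" if "n \<in> N0 s" for n
    using f(2)[of n] N0_I1 that by (auto simp: tr_def fun_eq_iff)
  then show ?thesis using f(1) by (simp add: Q_def)
qed

subsection \<open>Lifting invariants along \<open>Phi\<close>\<close>

text \<open>The difference \<open>tr b f - f\<close> lies in the kernel, so one zero suffices. For b
  in B it is the identity; for b in \<open>N0 False\<close> it is \<open>ww c\<close>, because
  conjugation by \<open>ww c\<close> moves b into B and I1.\<close>

lemma lift_fixed_aux:
  assumes f: "f \<in> V" and b: "b \<in> B \<and> b \<in> I1 \<or> b \<in> N0 False" and fixd: "act pi b (Phi f) = Phi f"
  shows "tr b f = f"
proof -
  have bG: "b \<in> carrier G" using b B_props(1) N0_in by blast
  have z: "tr b f - f \<in> V" "Phi (tr b f - f) = 0"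
    using f bG fixd V_tr V_ops by (simp_all add: Phi_diff Phi_tr)
  have "\<exists>g\<in>carrier G. (tr b f - f) g = 0"
    using b
  proof
    assume "b \<in> B \<and> b \<in> I1"
    then have "(tr b f - f) (mat 1) = 0" using V_B[of b "mat 1" f] f eps_I1 by (simp add: tr_def)
    then show ?thesis using one_in_U21 by blast
  next
    assume n: "b \<in> N0 False"
    have bI: "b \<in> I1" using n N0_I1 by blast
    have wB: "ww c ** b ** ww c \<in> B" using n N0_NN NN_conj_pt by blast
    then have "ww c ** b ** ww c \<in> I1" using pt_I1_conj[OF bI, of True] by (simp add: pt_def)
    then have "f ((ww c ** b ** ww c) ** ww c) = f (ww c)" using V_B[OF wB ww_in f] eps_I1 wB by simp
    moreover have "(ww c ** b ** ww c) ** ww c = ww c ** b"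
      using adj_cancel(1)[OF ww_in, of "ww c ** b" c] by simp
    ultimately have "(tr b f - f) (ww c) = 0" by (simp add: tr_def)
    then show ?thesis using ww_in by blast
  qed
  then have "tr b f - f = 0" using Phi_ker[OF z] by blast
  then show ?thesis by simp
qed

lemma lift_fixed:
  assumes f: "f \<in> V" and S: "S = I1 \<or> S = R" and fixd: "\<And>k. k \<in> S \<Longrightarrow> act pi k (Phi f) = Phi f" and k: "k \<in> S"
  shows "tr k f = f"
proof -
  obtain b n where b: "b \<in> B" "b \<in> I1" "b \<in> S" "n \<in> N0 False" "n \<in> S" "k = b ** n"
  proof -
    show thesis
    proof (cases "S = R")
      case True
      then obtain b n where "b \<in> B" "b \<in> R" "n \<in> N0 False" "k = b ** n" using R_factor k by metis
      then show thesis using that True N0_False_R R_I1 by blast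
    next
      case False
      then have "k \<in> I1" using S k by simp
      then obtain b n where "b \<in> B" "b \<in> I1" "n \<in> N0 False" "pt False ** mat 1 ** k = b ** pt False ** n"
        by (rule cell_I1[OF one_N0])
      then show thesis using that False S N0_I1 by (auto simp: pt_def)
    qed
  qed
  have "tr n f = f" using lift_fixed_aux f b(4,5) fixd by blast
  moreover have "tr b f = f" using lift_fixed_aux f b(1-3) fixd by blast
  ultimately show ?thesis unfolding b(6) tr_mult by simp
qed

lemma ker_Q: "f \<in> V \<Longrightarrow> Phi f = 0 \<Longrightarrow> f \<in> Q s"
proof (rule I1_fixed_Q)
  fix k assume f: "f \<in> V" "Phi f = 0" and k: "k \<in> I1"
  have "act pi k (Phi f) = Phi f" if "k \<in> I1" for k
    using pi_act(3)[of k 0 0] that I1_props f(2) PI.subspace_0[OF pi_subspace] by auto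
  then show "tr k f = f" using lift_fixed[OF f(1), of I1] k by blast
qed

lemma invariants_lift:
  assumes "y \<in> invariants pi I1"
  obtains f where "f \<in> V" "f \<in> Q True" "f \<in> Q False" "y = Phi f"
proof -
  obtain f where f: "f \<in> V" "y = Phi f" using assms Phi_surj by (auto simp: invariants_def)
  have "tr k f = f" if "k \<in> I1" for k
    using lift_fixed[OF f(1), of I1] that assms f(2) by (auto simp: invariants_def)
  then show ?thesis using that f I1_fixed_Q by blast
qed

subsection \<open>Functions supported on one cell\<close>

lemma nhd1_fixed: "f \<in> V \<Longrightarrow> nhd1 (carrier G) {g. tr g f = f}"
proof -
  assume f: "f \<in> V"
  obtain r where r: "r \<ge> 0" "\<forall>g\<in>carrier G. \<forall>u\<in>U r. f (g ** u) = f g" using f V_iff by blast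
  have "tr u f = f" if u: "u \<in> U r" for u
  proof
    fix g
    have uG: "u \<in> carrier G" using u by (simp add: Hf_def)
    show "tr u f g = f g" using r(2) u V_0[OF _ f] V_0[OF _ V_tr[OF uG f]]
      by (cases "g \<in> carrier G") (auto simp: tr_def)
  qed
  then show ?thesis using nhd1_Hf[of 2 "vx i" r] by (auto elim!: nhd1_subset)
qed

lemma cell_dl: "g \<in> cell s \<Longrightarrow> g ** adj (dl s k) \<in> cell s"
proof -
  assume "g \<in> cell s"
  then obtain b n where b: "b \<in> B" "n \<in> N0 s" "g = b ** pt s ** n" by (auto simp: cell_def)
  let ?n = "dl s k ** n ** adj (dl s k)"
  have n: "?n \<in> N0 s" using dl_N0 b(2) by blast
  have "g ** adj (dl s k) = b ** (pt s ** adj (dl s k)) ** ?n" by (simp add: b(3) matrix_mul_assoc)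
  also have "pt s ** adj (dl s k) = dl (s \<noteq> (\<not> s)) k ** pt s" by (simp only: adj_dl pt_dl)
  also have "b ** (dl (s \<noteq> (\<not> s)) k ** pt s) ** ?n = (b ** dl (s \<noteq> (\<not> s)) k) ** (pt s ** ?n)"
    by (simp only: matrix_mul_assoc)
  also have "\<dots> \<in> cell s" using pt_N0_cell[OF n] cell_B b(1) B_props(3) dl_B by blast
  finally show ?thesis .
qed

text \<open>A fixed vector of I1 supported on the cell is a multiple of \<open>fx s\<close>.
  Contracting \<open>fx s\<close> by \<open>dl s k\<close> shrinks its support to a small
  neighbourhood, and translates by \<open>N0 s\<close> cover the cell, so every locally constant
  function on it is a combination of these translates.\<close>

lemma supported_span:
  assumes WV: "W \<subseteq> V" and W: "SC.subspace W" and I1: "\<And>k f. k \<in> I1 \<Longrightarrow> f \<in> W \<Longrightarrow> tr k f \<in> W"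
    and dl: "\<And>f. f \<in> W \<Longrightarrow> tr (dl s 1) f \<in> W"
    and f0: "f0 \<in> W" "f0 \<noteq> 0" "\<And>g. g \<notin> cell s \<Longrightarrow> f0 g = 0"
    and f: "f \<in> V" "\<And>g. g \<notin> cell s \<Longrightarrow> f g = 0"
  shows "f \<in> W"
proof -
  note Wops = SC.subspace_0[OF W] SC.subspace_add[OF W] SC.subspace_scale[OF W] SC.subspace_sum[OF W]
  let ?W = "{f \<in> W. \<forall>g. g \<notin> cell s \<longrightarrow> f g = 0}"
  have "\<exists>f\<in>?W. f \<noteq> 0 \<and> (\<forall>g\<in>I1. tr g f = f)"
  proof (rule pro_p_fixed_vector[OF pro_p_Hf char_c vs_sc, where w = f0 and a = tr])
    show "SC.subspace ?W" by (rule SC.subspaceI) (use Wops in \<open>auto simp: sc_def\<close>)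
    show "f0 \<in> ?W" using f0 by blast
    show "nhd1 I1 {g. tr g f = f}" if "f \<in> ?W" for f
      by (rule nhd1_subset[OF nhd1_fixed[of f]]) (use that WV I1_props in auto)
    show "tr g f \<in> ?W" if "g \<in> I1" "f \<in> ?W" for g f
    proof -
      have "g \<in> carrier G" "adj g \<in> Iw" using that I1_props I1_Iw by auto
      then have "x ** g \<notin> cell s" if "x \<notin> cell s" for x
        using cell_mult_Iw[of "x ** g" s "adj g"] that by auto
      then show ?thesis using that I1 by (auto simp: tr_def)
    qed
  qed (use f0 in \<open>auto simp: tr_add tr_sc tr_mult\<close>)
  then obtain f1 where f1: "f1 \<in> W" "\<And>g. g \<notin> cell s \<Longrightarrow> f1 g = 0" "f1 \<noteq> 0" "\<And>k. k \<in> I1 \<Longrightarrow> tr k f1 = f1" by blast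
  have "f1 \<in> Q s" using f1 WV by (intro I1_fixed_Q) auto
  then have "f1 = sc (f1 (pt s)) (fx s)"
  proof (intro V_eqI)
    fix t n assume n: "n \<in> N0 t"
    show "f1 (pt t ** n) = sc (f1 (pt s)) (fx s) (pt t ** n)"
    proof (cases "t = s")
      case True
      then show ?thesis using n \<open>f1 \<in> Q s\<close> by (simp add: Q_def sc_def fx_val1)
    next
      case False
      then have "pt t ** n \<notin> cell s" using pt_N0_cell[OF n] cell_disjoint by blast
      then show ?thesis by (simp add: f1(2) sc_def fx_out)
    qed
  qed (use f1 WV V_ops fx_V in auto)
  moreover from this have "f1 (pt s) \<noteq> 0" using f1(3) by (metis SC.scale_zero_left)
  ultimately have "fx s = sc (inverse (f1 (pt s))) f1" by (metis SC.scale_left_imp_eq SC.scale_one SC.scale_scale left_inverse)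
  then have fxW: "fx s \<in> W" using Wops f1(1) by metis
  \<comment> \<open>The exponent k is chosen so large that the contracted copy of
    \<open>N0 s\<close> lies in a group fixing f on the right; f is then constant on its cosets in
    \<open>N0 s\<close>.\<close>
  obtain r where r: "r \<ge> 0" "\<forall>g\<in>carrier G. \<forall>u\<in>U r. f (g ** u) = f g" using f(1) V_iff by blast
  obtain m where m: "\<forall>g\<in>carrier G. g - mat 1 \<in> box m \<longrightarrow> g \<in> U r" using Hf_nhd[of 2 "vx i" r] by auto
  obtain k where "\<forall>n\<in>N0 s. dl s k ** n ** adj (dl s k) - mat 1 \<in> box m" using dl_N0_small by blast
  then have k: "dl s k ** n ** adj (dl s k) \<in> U r" if "n \<in> N0 s" for n
    using m that N0_in by simp
  define \<phi> where "\<phi> = tr (dl s k) (fx s)"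
  have "tr (dl s j) (fx s) \<in> W" for j
  proof (induction j)
    case (Suc j)
    have "dl s (Suc j) = dl s 1 ** dl s j" using dl_add[of s 1 j] by simp
    then show ?case using dl[OF Suc] by (simp add: tr_mult)
  qed (use fxW in simp)
  then have \<phi>W: "\<phi> \<in> W" by (simp add: \<phi>_def)
  define e where "e = dl False k"
  have eB: "e \<in> B" by (simp add: e_def dl_B)
  have pt_e: "pt s ** dl s k = e ** pt s" by (simp add: pt_dl e_def)
  \<comment> \<open>In the coordinate u' of the cell, \<open>sh u\<close> is \<open>eps e\<close>
    times the indicator of the coset of u under the contracted group.\<close>
  define sh where "sh u = tr (adj u) \<phi>" for u
  have sh_val: "sh u (pt s ** u') = (if adj (dl s k) ** (u' ** adj u) ** dl s k \<in> N0 s then eps e else 0)"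
    if u: "u \<in> N0 s" "u' \<in> N0 s" for u u'
  proof -
    let ?m = "adj (dl s k) ** (u' ** adj u) ** dl s k"
    have "u' ** adj u \<in> N0 s" using u N0_mult N0_adj by blast
    then have mNN: "?m \<in> NN s" using dl_NN_inverse N0_NN by blast
    have "pt s ** u' ** adj u ** dl s k = (pt s ** dl s k) ** ?m" by (simp add: matrix_mul_assoc)
    then have e1: "sh u (pt s ** u') = fx s (e ** pt s ** ?m)"
      by (simp only: sh_def \<phi>_def tr_def pt_e)
    show ?thesis
    proof (cases "?m \<in> N0 s")
      case True
      then show ?thesis using e1 fx_val[OF eB True] by simp
    next
      case False
      have "e ** pt s ** ?m \<notin> cell s"
      proof
        assume "e ** pt s ** ?m \<in> cell s"
        then obtain b n where "b \<in> B" "n \<in> N0 s" "e ** pt s ** ?m = b ** pt s ** n" by (auto simp: cell_def)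
        then have "?m = n" using cell_unique(2)[OF eB _ mNN] N0_NN by blast
        then show False using False \<open>n \<in> N0 s\<close> by simp
      qed
      then show ?thesis using e1 False fx_out by simp
    qed
  qed
  have sh_eq: "sh u = sh u'" "f (pt s ** u') = f (pt s ** u)"
    if u: "u \<in> N0 s" "u' \<in> N0 s" "adj (dl s k) ** (u' ** adj u) ** dl s k \<in> N0 s" for u u'
  proof -
    define m' where "m' = adj (dl s k) ** (u' ** adj u) ** dl s k"
    define h where "h = dl s k ** m' ** adj (dl s k)"
    have uG: "u \<in> carrier G" "u' \<in> carrier G" using u N0_in by auto
    have m': "m' \<in> N0 s" using u(3) by (simp add: m'_def)
    have hu: "h = u' ** adj u" by (simp add: h_def m'_def matrix_mul_assoc mult_adj)
    then have u': "u' = h ** u" using uG by simp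
    have hG: "h \<in> carrier G" using hu uG by simp
    have adjh: "adj h ** dl s k = dl s k ** adj m'" by (simp add: h_def adj_mult matrix_mul_assoc)
    have "tr (adj h) \<phi> = tr (dl s k) (tr (adj m') (fx s))"
      unfolding \<phi>_def tr_mult[symmetric] adjh ..
    also have "\<dots> = \<phi>" using fx_I1[OF subsetD[OF N0_I1 N0_adj[OF m']]] by (simp add: \<phi>_def)
    finally have "sh u' = tr (adj u) \<phi>" by (simp add: sh_def u' adj_mult tr_mult)
    then show "sh u = sh u'" by (simp add: sh_def)
    have "h \<in> U r" using k[OF m'] by (simp add: h_def)
    moreover have "adj u \<in> K" using N0_adj[OF u(1)] N0_I1 I1_Iw Iw_K by blast
    ultimately have "adj u ** h ** adj (adj u) \<in> U r" by (intro Hf_conj) auto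
    then have "f ((pt s ** u) ** (adj u ** h ** adj (adj u))) = f (pt s ** u)" using r(2) uG by simp
    moreover have "(pt s ** u) ** (adj u ** h ** adj (adj u)) = pt s ** u'"
      using uG by (simp add: u' matrix_mul_assoc)
    ultimately show "f (pt s ** u') = f (pt s ** u)" by simp
  qed
  have self: "adj (dl s k) ** (u ** adj u) ** dl s k \<in> N0 s" if "u \<in> N0 s" for u
    using that N0_in by (simp add: mult_adj adj_mult_self)
  \<comment> \<open>Only finitely many translates are distinct, since the compact group I1 acts on a
    smooth vector with finite orbit.\<close>
  define O' where "O' = sh ` N0 s"
  have "compactin X I1" by (rule compact_Hf) auto
  moreover have "nhd1 I1 {g. tr g \<phi> = \<phi>}" by (rule nhd1_subset[OF nhd1_fixed[of \<phi>]]) (use \<phi>W WV I1_props in auto)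
  ultimately obtain F where F: "finite F" "F \<subseteq> I1" "\<And>h. h \<in> I1 \<Longrightarrow> \<exists>f\<in>F. adj f ** h \<in> {g. tr g \<phi> = \<phi>}"
    using finite_left_cosets[OF _ subgroups(4)] by blast
  have "O' \<subseteq> (\<lambda>h. tr h \<phi>) ` F"
  proof
    fix \<psi> assume "\<psi> \<in> O'"
    then obtain u where u: "u \<in> N0 s" "\<psi> = tr (adj u) \<phi>" by (auto simp: O'_def sh_def)
    then have "adj u \<in> I1" using N0_adj N0_I1 by blast
    then obtain h where h: "h \<in> F" "tr (adj h ** adj u) \<phi> = \<phi>" using F(3) by blast
    have "h \<in> carrier G" using h(1) F(2) I1_props by blast
    then have "tr (adj u) \<phi> = tr h \<phi>" using h(2) tr_cancel(2)[of h "tr (adj u) \<phi>"] by (simp add: tr_mult)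
    then show "\<psi> \<in> (\<lambda>h. tr h \<phi>) ` F" using u h by blast
  qed
  then have finO: "finite O'" using F(1) finite_subset by blast
  define pick where "pick \<psi> = (SOME u. u \<in> N0 s \<and> sh u = \<psi>)" for \<psi>
  have pick: "pick \<psi> \<in> N0 s" "sh (pick \<psi>) = \<psi>" if "\<psi> \<in> O'" for \<psi>
  proof -
    have "\<exists>u. u \<in> N0 s \<and> sh u = \<psi>" using that by (auto simp: O'_def)
    from someI_ex[OF this] show "pick \<psi> \<in> N0 s" "sh (pick \<psi>) = \<psi>" by (simp_all add: pick_def)
  qed
  define F' where "F' = (\<Sum>\<psi>\<in>O'. sc (f (pt s ** pick \<psi>) / eps e) \<psi>)"
  have O'W: "O' \<subseteq> W" unfolding O'_def sh_def using I1 N0_adj N0_I1 \<phi>W by blast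
  then have F'W: "F' \<in> W" unfolding F'_def using Wops by (intro Wops(4)) auto
  have F'_app: "F' g = (\<Sum>\<psi>\<in>O'. f (pt s ** pick \<psi>) / eps e * \<psi> g)" for g
    unfolding F'_def using finO by (induction O' rule: finite_induct) (auto simp: sc_def)
  have "f = F'"
  proof (rule V_eqI[OF f(1)])
    show "F' \<in> V" using F'W WV by blast
    fix t n assume n: "n \<in> N0 t"
    show "f (pt t ** n) = F' (pt t ** n)"
    proof (cases "t = s")
      case True
      have ns: "n \<in> N0 s" using n True by simp
      have mem: "sh n \<in> O'" using ns by (simp add: O'_def)
      have zero: "\<psi> (pt s ** n) = 0" if \<psi>: "\<psi> \<in> O'" "\<psi> \<noteq> sh n" for \<psi>
        using sh_val[OF pick(1)[OF \<psi>(1)] ns] sh_eq(1)[OF pick(1)[OF \<psi>(1)] ns] pick(2)[OF \<psi>(1)] \<psi>(2) by metis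
      have "F' (pt s ** n) = (\<Sum>\<psi>\<in>{sh n}. f (pt s ** pick \<psi>) / eps e * \<psi> (pt s ** n))"
        unfolding F'_app using mem zero finO by (intro sum.mono_neutral_right) auto
      also have "\<dots> = f (pt s ** pick (sh n)) / eps e * sh n (pt s ** n)" by simp
      also have "sh n (pt s ** n) = eps e" using sh_val[OF ns ns] self[OF ns] by simp
      also have "f (pt s ** pick (sh n)) = f (pt s ** n)"
      proof -
        have "sh (pick (sh n)) (pt s ** n) \<noteq> 0"
          using pick(2)[OF mem] \<open>sh n (pt s ** n) = eps e\<close> eps_nz[OF eB] by simp
        then have "adj (dl s k) ** (n ** adj (pick (sh n))) ** dl s k \<in> N0 s"
          using sh_val[OF pick(1)[OF mem] ns] by metis
        from sh_eq(2)[OF pick(1)[OF mem] ns this] show ?thesis by simp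
      qed
      finally show ?thesis using True eps_nz[OF eB] by simp
    next
      case False
      then have ts: "t = (\<not> s)" by simp
      have cn: "pt t ** n \<in> cell t" using n by (rule pt_N0_cell)
      have "\<psi> (pt t ** n) = 0" if \<psi>: "\<psi> \<in> O'" for \<psi>
      proof -
        obtain u where u: "u \<in> N0 s" "\<psi> = sh u" using \<psi> by (auto simp: O'_def)
        have "adj u \<in> Iw" using N0_adj[OF u(1)] N0_I1 I1_Iw by blast
        \<comment> \<open>Translation by \<open>adj u\<close> preserves the opposite cell, and so
          does \<open>adj (dl t k)\<close>, which equals \<open>dl s k\<close>; hence no translate
          meets the other cell.\<close>
        then have "(pt t ** n) ** adj u \<in> cell t" using cell_mult_Iw cn by blast
        then have "(pt t ** n) ** adj u ** adj (dl t k) \<in> cell t" by (rule cell_dl)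
        then have "(pt t ** n) ** adj u ** dl s k \<notin> cell s" using cell_disjoint False ts by (auto simp: adj_dl)
        then show ?thesis by (simp add: u(2) sh_def \<phi>_def tr_def fx_out)
      qed
      then have "F' (pt t ** n) = 0" unfolding F'_app by (intro sum.neutral) simp
      moreover have "pt t ** n \<notin> cell s" using cn cell_disjoint False by blast
      ultimately show ?thesis using f(2) by simp
    qed
  qed
  then show ?thesis using F'W by simp
qed

text \<open>Elements of W vanishing at \<open>pt (\<not> s)\<close> are supported on the cell s. The
  function \<open>f0\<close> therefore brings all functions supported there into W; subtracting the
  right multiple of \<open>fx (\<not> s)\<close> from h leaves one of them, so
  \<open>fx (\<not> s)\<close> is also in W.\<close>

lemma fx_in_subspace:
  assumes WQ: "W \<subseteq> Q (\<not> s)" and W: "SC.subspace W" and I1: "\<And>k f. k \<in> I1 \<Longrightarrow> f \<in> W \<Longrightarrow> tr k f \<in> W"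
    and dl: "\<And>f. f \<in> W \<Longrightarrow> tr (dl s 1) f \<in> W"
    and h: "h \<in> W" "h (pt (\<not> s)) \<noteq> 0" and f0: "f0 \<in> W" "f0 \<noteq> 0" "f0 (pt (\<not> s)) = 0"
  shows "fx t \<in> W"
proof -
  have WV: "W \<subseteq> V" using WQ Q_V by blast
  have van: "f g = 0" if "f \<in> Q (\<not> s)" "f (pt (\<not> s)) = 0" "g \<notin> cell s" for f g
  proof (cases "g \<in> carrier G")
    case True
    then obtain t where t: "g \<in> cell t" using cell_cover by blast
    then have "t = (\<not> s)" using that(3) by (cases t; cases s) auto
    then have "g \<in> cell (\<not> s)" using t by simp
    then obtain b n where b: "b \<in> B" "n \<in> N0 (\<not> s)" "g = b ** (pt (\<not> s) ** n)" by (auto simp: cell_def matrix_mul_assoc)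
    then show ?thesis using that(1,2) V_B[OF b(1) _ Q_V[OF that(1)]] N0_in by (simp add: Q_def)
  qed (use V_0 Q_V that(1) in blast)
  have span: "f \<in> W" if "f \<in> V" "\<And>g. g \<notin> cell s \<Longrightarrow> f g = 0" for f
  proof (rule supported_span[OF WV W I1 dl f0(1,2) _ that])
    show "f0 g = 0" if "g \<notin> cell s" for g using van f0 WQ that by blast
  qed
  have s: "fx s \<in> W" by (rule span[OF fx_V]) (rule fx_out)
  have fxQ: "fx (\<not> s) \<in> Q (\<not> s)" using fx_I1 fx_V by (intro I1_fixed_Q) auto
  have "sc (h (pt (\<not> s))) (fx (\<not> s)) \<in> Q (\<not> s)" by (rule SC.subspace_scale[OF Q_subspace fxQ])
  then have dQ: "h - sc (h (pt (\<not> s))) (fx (\<not> s)) \<in> Q (\<not> s)" using SC.subspace_diff[OF Q_subspace] h(1) WQ by blast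
  have "(h - sc (h (pt (\<not> s))) (fx (\<not> s))) (pt (\<not> s)) = 0"
    using fx_val1[OF one_N0, of "\<not> s"] by (simp add: sc_def)
  then have "h - sc (h (pt (\<not> s))) (fx (\<not> s)) \<in> W" using van[OF dQ] Q_V[OF dQ] by (intro span) auto
  then have "h - (h - sc (h (pt (\<not> s))) (fx (\<not> s))) \<in> W" by (rule SC.subspace_diff[OF W h(1)])
  then have "sc (h (pt (\<not> s))) (fx (\<not> s)) \<in> W" by simp
  then have "sc (inverse (h (pt (\<not> s)))) (sc (h (pt (\<not> s))) (fx (\<not> s))) \<in> W"
    by (rule SC.subspace_scale[OF W])
  then have "fx (\<not> s) \<in> W" by (simp only: SC.scale_scale left_inverse[OF h(2)] SC.scale_one)
  then show ?thesis using s by (cases t; cases s) auto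
qed

subsection \<open>Eigenvectors\<close>

lemma eps_one: "eps (mat 1) = 1"
  using eps_I1[OF B_props(2)] I1_props by simp

text \<open>Conjugation by a torus element moves n into I1, where \<open>eps\<close> is trivial, and
  leaves the value of a character unchanged.\<close>

lemma eps_NN: "n \<in> NN True \<Longrightarrow> n \<in> B \<and> eps n = 1"
proof -
  assume n: "n \<in> NN True"
  have B: "n \<in> B" if "n \<in> NN True" for n
    using that by (auto simp: NN_def nx_def nu_B)
  obtain k where k: "dl True k ** n ** adj (dl True k) \<in> N0 True" using dl_expand_N0[OF n] by blast
  let ?d = "dl True k"
  have "eps (?d ** n ** adj ?d) = 1" using k N0_I1 N0_NN B by (intro eps_I1) blast+
  moreover have "eps (?d ** n ** adj ?d) = eps ?d * eps n * eps (adj ?d)"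
    using eps_mult B[OF n] dl_B B_props by simp
  moreover have "eps ?d * eps (adj ?d) = 1"
    using eps_mult[of ?d "adj ?d"] dl_B B_props(4) mult_adj[OF dl_in] eps_one by simp
  ultimately have "eps n = 1" by (metis mult.assoc mult.commute mult.left_neutral)
  then show ?thesis using B[OF n] by blast
qed

lemma ww_NN: "n \<in> NN False \<Longrightarrow> ww c ** n ** ww c \<in> NN True"
proof -
  assume n: "n \<in> NN False"
  then obtain a b where ab: "n = nl a b" by (auto simp: NN_def nx_def)
  have eq: "ww c ** n ** ww c = nu (unif D powi (- c) * a) (unif D powi (- c) * b * unif D powi (- c))"
    by (simp add: ab matrix_eq_3 matrix_mult_3 mult.commute)
  have G: "ww c ** n ** ww c \<in> carrier G" using NN_in[OF n] by simp
  show ?thesis by (rule NN_I[OF _ G]) (simp add: nx_def eq)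
qed

text \<open>If a line in \<open>V\<close> is stable under \<open>K\<close> and \<open>\<alpha>\<close>, then it is stable under \<open>G\<close>, the unipotent
  elements act trivially on it, and so do the elements \<open>tor x\<close>.\<close>

lemma eigenvector_det:
  assumes v: "v \<in> V" "v \<noteq> 0" and K: "\<And>k. k \<in> K \<Longrightarrow> \<exists>a. tr k v = sc a v"
    and dl: "\<exists>a. tr (dl s 1) v = sc a v"
  shows "\<exists>\<eta>. \<forall>b\<in>B. eps b = \<eta> (det b)"
proof -
  define E where "E = {g \<in> carrier G. \<exists>a. tr g v = sc a v}"
  have KE: "K \<subseteq> E" using K K_props by (auto simp: E_def)
  have E_mult: "g ** h \<in> E" if gh: "g \<in> E" "h \<in> E" for g h
  proof -
    obtain a b where "tr g v = sc a v" "tr h v = sc b v" using gh by (auto simp: E_def)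
    then have "tr (g ** h) v = sc (b * a) v" by (simp add: tr_mult tr_sc)
    then show ?thesis using gh by (auto simp: E_def)
  qed
  have E_adj: "adj g \<in> E" if g: "g \<in> E" for g
  proof -
    obtain a where a: "tr g v = sc a v" "g \<in> carrier G" using g by (auto simp: E_def)
    have v_eq: "v = sc a (tr (adj g) v)" using tr_cancel(1)[OF a(2), of v] by (simp add: a(1) tr_sc)
    then have "a \<noteq> 0" using v(2) by (metis SC.scale_zero_left)
    then have "tr (adj g) v = sc (inverse a) v" using v_eq by (metis SC.scale_one SC.scale_scale left_inverse)
    then show ?thesis using a(2) by (auto simp: E_def)
  qed
  have dlE: "dl t 1 \<in> E" for t
  proof (cases "t = s")
    case True
    then show ?thesis using dl by (simp add: E_def)
  next
    case False
    have "dl s 1 \<in> E" using dl by (simp add: E_def)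
    from E_adj[OF this] show ?thesis using False by (cases t; cases s) (simp_all add: adj_dl)
  qed
  have dlkE: "dl t k \<in> E" for t k
  proof (induction k)
    case (Suc k)
    then show ?case using E_mult[OF dlE[of t] Suc] dl_add[of t 1 k] by simp
  qed (use KE K_props in auto)
  have NNE: "n \<in> E" if n: "n \<in> NN t" for n t
  proof -
    obtain k where k: "dl t k ** n ** adj (dl t k) \<in> N0 t" using dl_expand_N0[OF n] by blast
    then have "dl t k ** n ** adj (dl t k) \<in> E" using N0_I1 I1_Iw Iw_K KE by blast
    then have "adj (dl t k) ** (dl t k ** n ** adj (dl t k)) ** dl t k \<in> E" using E_mult E_adj dlkE by blast
    then show ?thesis using NN_in[OF n] by (simp add: matrix_mul_assoc adj_mult_self)
  qed
  \<comment> \<open>Up to B every point lies in K, and K acts on v by scalars, so a nonzero value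
    anywhere forces one at the identity.\<close>
  have v1: "v (mat 1) \<noteq> 0"
  proof -
    obtain g where "v g \<noteq> 0" using v(2) by (auto simp: fun_eq_iff)
    then have "g \<in> carrier G" using V_0 v(1) by blast
    then obtain t where "g \<in> cell t" using cell_cover by blast
    then obtain b n where b: "b \<in> B" "n \<in> N0 t" "g = b ** (pt t ** n)" by (auto simp: cell_def matrix_mul_assoc)
    have m: "pt t ** n \<in> K" using pt_K b(2) N0_I1 I1_Iw Iw_K K_props by blast
    have "v g = eps b * v (pt t ** n)" unfolding b(3) using b v(1) N0_in by (intro V_B) auto
    then have "v (pt t ** n) \<noteq> 0" using \<open>v g \<noteq> 0\<close> by auto
    moreover obtain a where "tr (pt t ** n) v = sc a v" using K[OF m] by blast
    then have "v (pt t ** n) = a * v (mat 1)" by (metis matrix_mul_lid tr_def sc_def)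
    ultimately show ?thesis by auto
  qed
  have vw: "v (ww c) \<noteq> 0"
  proof -
    obtain a where "tr (ww c) v = sc a v" using K[OF ww_K] by blast
    then have "v (ww c ** ww c) = a * v (ww c)" by (metis tr_def sc_def)
    moreover have "ww c ** ww c = mat 1" using mult_adj[OF ww_in, of c] by simp
    ultimately show ?thesis using v1 by auto
  qed
  \<comment> \<open>The scalar by which n acts is read off at a point g with \<open>g ** n\<close>
    in the B-coset of g: the identity for upper, \<open>ww c\<close> for lower unipotent elements.
    The B-factor there is unipotent, so \<open>eps\<close> contributes 1.\<close>
  have fixd: "tr n v = v" if n: "n \<in> NN t" for n t
  proof -
    obtain a where a: "tr n v = sc a v" using NNE[OF n] by (auto simp: E_def)
    have "\<exists>g. v g \<noteq> 0 \<and> v (g ** n) = v g"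
    proof (cases t)
      case True
      then have "n \<in> B" "eps n = 1" using eps_NN n by auto
      then have "v (mat 1 ** n) = v (mat 1)" using V_B[of n "mat 1" v] v(1) by simp
      then show ?thesis using v1 by blast
    next
      case False
      have "ww c ** n ** ww c \<in> B" "eps (ww c ** n ** ww c) = 1" using eps_NN ww_NN n False by auto
      then have "v ((ww c ** n ** ww c) ** ww c) = v (ww c)" using V_B[of _ "ww c" v] v(1) by simp
      moreover have "(ww c ** n ** ww c) ** ww c = ww c ** n"
        using adj_cancel(1)[OF ww_in, of "ww c ** n" c] by simp
      ultimately show ?thesis using vw by metis
    qed
    then obtain g where g: "v g \<noteq> 0" "v (g ** n) = v g" by blast
    then have "a * v g = v g" using a by (metis tr_def sc_def)
    then show ?thesis using a g(1) by simp
  qed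
  have fix_adj: "tr (adj g) v = v" if "tr g v = v" "g \<in> carrier G" for g
    using tr_cancel(1)[OF that(2), of v] that(1) by simp
  have fix_mult: "tr (g ** h) v = v" if "tr g v = v" "tr h v = v" for g h
    using that by (simp add: tr_mult)
  have nuE: "tr (nu a b) v = v" if "iso a b" for a b
    using that by (intro fixd[of _ True]) (auto simp: NN_def nx_def)
  have nlE: "tr (nl a b) v = v" if "iso a b" for a b
    using that by (intro fixd[of _ False]) (auto simp: NN_def nx_def)
  have anti_fix: "tr (anti b) v = v \<and> anti b \<in> carrier G" if ab: "iso a b" "b \<noteq> 0" for a b
  proof -
    note A = anti_factor[OF ab]
    let ?n1 = "nu (a / cj b) (1 / b)" and ?n2 = "nu (a / b) (1 / b)"
    have G: "?n1 \<in> carrier G" "?n2 \<in> carrier G" "nl a b \<in> carrier G" using A(1,2) ab by (simp_all add: nu_in nl_in)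
    have e: "anti b = adj ?n1 ** nl a b ** adj ?n2"
      unfolding A(3)[symmetric] using G by (simp add: matrix_mul_assoc adj_mult_self)
    have "tr (adj ?n1 ** nl a b ** adj ?n2) v = v"
      using nuE nlE A(1,2) ab(1) G fix_adj by (intro fix_mult) auto
    moreover have "adj ?n1 ** nl a b ** adj ?n2 \<in> carrier G" using G by simp
    ultimately show ?thesis unfolding e by simp
  qed
  have tor_eps: "eps (tor x) = 1" if x: "x \<noteq> 0" "tor x \<in> B" for x
  proof -
    obtain a b b' where t: "iso a b" "iso 0 b'" "b \<noteq> 0" "b' \<noteq> 0" "tor x = anti b ** adj (anti b')"
      using tor_factor[OF x(1)] by blast
    have "tr (tor x) v = v" unfolding t(5) using anti_fix[OF t(1,3)] anti_fix[OF t(2,4)] fix_adj fix_mult by blast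
    then have "v (mat 1 ** tor x) = v (mat 1)" by (metis tr_def)
    then show ?thesis using V_B[OF x(2) one_in_U21 v(1)] v1 by simp
  qed
  have same: "eps b = eps b'" if b: "b \<in> B" "b' \<in> B" "det b = det b'" for b b'
  proof -
    obtain x u where x: "x \<noteq> 0" "tor x \<in> B" "u \<in> NN True" "b' = tor x ** u ** b" using B_det_one[OF b] by blast
    then have "eps b' = eps (tor x) * eps u * eps b" using eps_mult eps_NN b(1) B_props(3) by simp
    then show ?thesis using tor_eps x eps_NN by simp
  qed
  have "\<forall>b\<in>B. eps b = (\<lambda>d. eps (SOME b. b \<in> B \<and> det b = d)) (det b)"
  proof
    fix b assume b: "b \<in> B"
    then have "\<exists>b'. b' \<in> B \<and> det b' = det b" by blast
    from someI_ex[OF this] show "eps b = (\<lambda>d. eps (SOME b. b \<in> B \<and> det b = d)) (det b)"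
      using same[OF b] by simp
  qed
  then show ?thesis by (intro exI[of _ "\<lambda>d. eps (SOME b. b \<in> B \<and> det b = d)"])
qed

subsection \<open>The intersection for a \<open>K\<close>-stable subspace\<close>

text \<open>When S is the weight inside \<open>pi\<close>, these vectors span I^+ or I^-. For s =
  True the elements \<open>dl s m\<close> are alpha^(-m) with m \<ge> 0, for s = False they are
  alpha^m with m \<ge> 1: the inverses of the double coset representatives.\<close>

definition Gen :: "'v set \<Rightarrow> bool \<Rightarrow> 'v set"
  where "Gen S s = {act pi (k ** dl s m) y | k m y. k \<in> Iw \<and> y \<in> S \<and> (\<not> s \<longrightarrow> m \<ge> 1)}"

definition J :: "'v set \<Rightarrow> bool \<Rightarrow> 'v set"
  where "J S s = PI.span (Gen S s)"

lemma span_act: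
  assumes "A \<subseteq> vspace pi" "g \<in> carrier G" "\<And>y. y \<in> A \<Longrightarrow> act pi g y \<in> PI.span A'" "A' \<subseteq> vspace pi" "y \<in> PI.span A"
  shows "act pi g y \<in> PI.span A'"
proof -
  have AV: "PI.span A \<subseteq> vspace pi" using assms(1) pi_subspace by (rule PI.span_minimal)
  have "y \<in> PI.span A \<and> act pi g y \<in> PI.span A'"
    using assms(5)
  proof (induction rule: PI.span_induct_alt)
    case base
    have "act pi g (scal pi 0 0) = scal pi 0 (act pi g 0)"
      using assms(2) PI.subspace_0[OF pi_subspace] by (rule pi_act(3))
    then show ?case by (simp add: PI.span_zero)
  next
    case (step a x y)
    then have x: "x \<in> vspace pi" "y \<in> vspace pi" "scal pi a x \<in> vspace pi"
      using AV assms(1) PI.subspace_scale[OF pi_subspace] by auto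
    then have "act pi g (scal pi a x + y) = scal pi a (act pi g x) + act pi g y"
      using assms(2) by (simp add: pi_act)
    then show ?case using step assms(3) by (auto intro: PI.span_add PI.span_scale PI.span_base)
  qed
  then show ?thesis ..
qed

context
  fixes S :: "'v set"
  assumes S_pi: "S \<subseteq> vspace pi" and S_K: "\<And>k y. k \<in> K \<Longrightarrow> y \<in> S \<Longrightarrow> act pi k y \<in> S"
    and S_R: "\<And>k y. k \<in> R \<Longrightarrow> y \<in> S \<Longrightarrow> act pi k y = y"
    and S_nz: "\<exists>y\<in>S. y \<noteq> 0"
begin

lemma Gen_pi: "Gen S s \<subseteq> vspace pi"
  using S_pi Iw_props(2) by (auto simp: Gen_def intro!: pi_act)

lemma J_pi: "J S s \<subseteq> vspace pi"
  unfolding J_def using Gen_pi pi_subspace by (rule PI.span_minimal)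

lemma Gen_I: "k \<in> Iw \<Longrightarrow> y \<in> S \<Longrightarrow> (\<not> s \<Longrightarrow> m \<ge> 1) \<Longrightarrow> act pi (k ** dl s m) y \<in> J S s"
  unfolding J_def Gen_def by (intro PI.span_base) blast

lemma J_Iw: "k \<in> Iw \<Longrightarrow> y \<in> J S s \<Longrightarrow> act pi k y \<in> J S s"
  unfolding J_def
proof (rule span_act[OF Gen_pi _ _ Gen_pi])
  fix y assume k: "k \<in> Iw" and "y \<in> Gen S s"
  then obtain k' m z where z: "k' \<in> Iw" "z \<in> S" "\<not> s \<longrightarrow> m \<ge> 1" "y = act pi (k' ** dl s m) z" by (auto simp: Gen_def)
  have "act pi k y = act pi ((k ** k') ** dl s m) z"
    using z k Iw_props(2) S_pi pi_act(5)[of k "k' ** dl s m" z] by (auto simp: matrix_mul_assoc)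
  then show "act pi k y \<in> PI.span (Gen S s)"
    using Gen_I[of "k ** k'" z s m] z k Iw_props(3) by (simp add: J_def)
qed (use Iw_props in auto)

text \<open>Factor the Iwahori element as n b. Conjugation by \<open>dl s 1\<close> contracts n,
  which stays in the Iwahori subgroup, while b passes to the right of \<open>dl s m\<close> and is
  absorbed into S as an element of K.\<close>

lemma J_dl: "y \<in> J S s \<Longrightarrow> act pi (dl s 1) y \<in> J S s"
  unfolding J_def
proof (rule span_act[OF Gen_pi dl_in _ Gen_pi])
  fix y assume "y \<in> Gen S s"
  then obtain k m z where z: "k \<in> Iw" "z \<in> S" "\<not> s \<longrightarrow> m \<ge> 1" "y = act pi (k ** dl s m) z" by (auto simp: Gen_def)
  obtain n b where nb: "n \<in> N0 s" "b \<in> Iw" "pt s ** b ** adj (pt s) \<in> B" "k = n ** b"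
    by (rule Iw_factor[OF z(1)])
  let ?n = "dl s 1 ** n ** adj (dl s 1)" and ?b = "adj (dl s m) ** b ** dl s m"
  have b: "?b \<in> K" using nb(2,3) Iw_K by (intro dl_conj_K) auto
  have n: "?n \<in> Iw" using dl_N0[OF nb(1)] N0_I1 I1_Iw by blast
  have G: "k \<in> carrier G" "n \<in> carrier G" "b \<in> carrier G" "?b \<in> carrier G" "?n \<in> carrier G" "z \<in> vspace pi"
    using z nb b n Iw_props(2) N0_in K_props(2) S_pi by auto
  have "?n ** dl s (1 + m) ** ?b = dl s 1 ** (k ** dl s m)"
    by (simp only: dl_add nb(4) matrix_mul_assoc adj_cancel(1,2)[OF dl_in])
  then have "act pi (dl s 1) y = act pi ((?n ** dl s (1 + m)) ** ?b) z"
    using pi_act(5)[OF dl_in _ G(6), of "k ** dl s m" s 1] G(1) z(4) by simp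
  also have "\<dots> = act pi (?n ** dl s (1 + m)) (act pi ?b z)" using G by (intro pi_act(5)) simp_all
  also have "\<dots> \<in> J S s" using n S_K[OF b z(2)] by (intro Gen_I) auto
  finally show "act pi (dl s 1) y \<in> PI.span (Gen S s)" by (simp add: J_def)
qed

definition Wl :: "bool \<Rightarrow> ('e^3^3 \<Rightarrow> 'c) set"
  where "Wl s = {f \<in> V. Phi f \<in> J S s}"

lemma Wl_subspace: "SC.subspace (Wl s)"
proof (rule SC.subspaceI)
  show "0 \<in> Wl s" using V_ops Phi_0 by (simp add: Wl_def J_def PI.span_zero)
  show "f + f' \<in> Wl s" if "f \<in> Wl s" "f' \<in> Wl s" for f f'
    using that V_ops by (auto simp: Wl_def J_def Phi_add PI.span_add)
  show "sc a f \<in> Wl s" if "f \<in> Wl s" for a f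
    using that V_ops by (auto simp: Wl_def J_def Phi_sc PI.span_scale)
qed

lemma Wl_tr: "k \<in> Iw \<Longrightarrow> f \<in> Wl s \<Longrightarrow> tr k f \<in> Wl s" "f \<in> Wl s \<Longrightarrow> tr (dl s 1) f \<in> Wl s"
  using Iw_props(2) V_tr J_Iw J_dl by (auto simp: Wl_def Phi_tr)

lemma lift_S:
  assumes "y \<in> S"
  obtains f where "f \<in> V" "y = Phi f" "\<forall>k\<in>R. tr k f = f"
proof -
  obtain f where f: "f \<in> V" "y = Phi f" using assms S_pi Phi_surj by blast
  have "tr k f = f" if "k \<in> R" for k
    using lift_fixed[OF f(1), of R] S_R assms f(2) that by simp
  then show ?thesis using that f by blast
qed

text \<open>Moving an element of \<open>N0 (\<not> s)\<close> across \<open>dl s m\<close> contracts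
  it into the radical, which fixes f. The bound on m is the one from \<open>dl_N0_R\<close>.\<close>

lemma dl_Q:
  assumes f: "f \<in> V" "\<And>k. k \<in> R \<Longrightarrow> tr k f = f" and m: "\<not> s \<Longrightarrow> m \<ge> 1"
  shows "tr (dl s m) f \<in> Q (\<not> s)"
proof -
  have "f (pt (\<not> s) ** n ** dl s m) = f (pt (\<not> s) ** dl s m)" if n: "n \<in> N0 (\<not> s)" for n
  proof -
    let ?n = "dl (\<not> s) m ** n ** adj (dl (\<not> s) m)"
    have d: "dl s m = adj (dl (\<not> s) m)" by (simp add: adj_dl)
    have "?n \<in> R" using n m by (intro dl_N0_R) auto
    then have "f ((pt (\<not> s) ** dl s m) ** ?n) = f (pt (\<not> s) ** dl s m)" using f(2) by (metis tr_def)
    moreover have "(pt (\<not> s) ** dl s m) ** ?n = pt (\<not> s) ** n ** dl s m"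
      by (simp add: d matrix_mul_assoc)
    ultimately show ?thesis by simp
  qed
  then show ?thesis using V_tr[OF dl_in f(1)] by (simp add: Q_def tr_def)
qed

text \<open>The generators have lifts in \<open>Q (\<not> s)\<close>, and so does their span. As the
  kernel lies in \<open>Q (\<not> s)\<close> too, every other lift does as well.\<close>

lemma Wl_Q: "Wl s \<subseteq> Q (\<not> s)"
proof
  fix f assume f: "f \<in> Wl s"
  have sub: "PI.subspace (Phi ` Q (\<not> s))"
  proof (rule PI.subspaceI)
    show "0 \<in> Phi ` Q (\<not> s)" using SC.subspace_0[OF Q_subspace] Phi_0 by force
    show "y + z \<in> Phi ` Q (\<not> s)" if yz: "y \<in> Phi ` Q (\<not> s)" "z \<in> Phi ` Q (\<not> s)" for y z
    proof -
      obtain f g where fg: "f \<in> Q (\<not> s)" "g \<in> Q (\<not> s)" "y = Phi f" "z = Phi g" using yz by blast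
      then have "y + z = Phi (f + g)" using Q_V Phi_add by metis
      then show ?thesis using SC.subspace_add[OF Q_subspace] fg by blast
    qed
    show "scal pi a y \<in> Phi ` Q (\<not> s)" if y: "y \<in> Phi ` Q (\<not> s)" for a y
    proof -
      obtain f where f: "f \<in> Q (\<not> s)" "y = Phi f" using y by blast
      then have "scal pi a y = Phi (sc a f)" using Q_V Phi_sc by metis
      then show ?thesis using SC.subspace_scale[OF Q_subspace] f by blast
    qed
  qed
  have "Gen S s \<subseteq> Phi ` Q (\<not> s)"
  proof
    fix y assume "y \<in> Gen S s"
    then obtain k m z where z: "k \<in> Iw" "z \<in> S" "\<not> s \<longrightarrow> m \<ge> 1" "y = act pi (k ** dl s m) z" by (auto simp: Gen_def)
    obtain h where h: "h \<in> V" "z = Phi h" "\<forall>k\<in>R. tr k h = h" by (rule lift_S[OF z(2)])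
    have "tr (dl s m) h \<in> Q (\<not> s)" using z(3) h by (intro dl_Q) auto
    then have "tr k (tr (dl s m) h) \<in> Q (\<not> s)" by (rule Q_tr[OF z(1)])
    moreover have "y = Phi (tr (k ** dl s m) h)" using z h Iw_props(2) by (simp add: Phi_tr)
    ultimately show "y \<in> Phi ` Q (\<not> s)" by (auto simp: tr_mult)
  qed
  then have "J S s \<subseteq> Phi ` Q (\<not> s)" unfolding J_def using sub by (rule PI.span_minimal)
  then obtain h where h: "h \<in> Q (\<not> s)" "Phi f = Phi h" using f by (auto simp: Wl_def)
  have fV: "f \<in> V" using f by (simp add: Wl_def)
  have "f - h \<in> Q (\<not> s)"
    using fV h Q_V V_ops by (intro ker_Q) (auto simp: Phi_diff)
  then have "(f - h) + h \<in> Q (\<not> s)" using h(1) by (rule SC.subspace_add[OF Q_subspace])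
  then show "f \<in> Q (\<not> s)" by simp
qed

lemma fx_Wl: "fx t \<in> Wl s"
proof -
  \<comment> \<open>The exponent \<open>?m\<close> is the least one that \<open>Gen\<close> admits;
    it turns a lift of a vector of S into an element of \<open>Wl s\<close> without affecting
    nonvanishing at \<open>?p\<close>.\<close>
  let ?p = "pt (\<not> s)" and ?m = "if s then 0 else 1 :: nat"
  have val: "tr (dl s ?m) f ?p \<noteq> 0 \<longleftrightarrow> f ?p \<noteq> 0" if "f \<in> V" for f
  proof -
    have "f (?p ** dl s ?m) = eps (dl ((\<not> s) \<noteq> s) ?m) * f ?p"
      unfolding pt_dl using dl_B that by (intro V_B) auto
    then show ?thesis using eps_nz[OF dl_B] by (simp add: tr_def)
  qed
  have mem: "tr (dl s ?m) f \<in> Wl s" if "f \<in> V" "Phi f \<in> S" for f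
  proof -
    have "act pi (mat 1 ** dl s ?m) (Phi f) \<in> J S s" using that Iw_props(1) by (intro Gen_I) auto
    then show ?thesis using that V_tr by (simp add: Wl_def Phi_tr)
  qed
  obtain y where y: "y \<in> S" "y \<noteq> 0" using S_nz by blast
  obtain v0 where v0: "v0 \<in> V" "y = Phi v0" using lift_S[OF y(1)] by blast
  have "v0 \<noteq> 0" using v0 y Phi_0 by auto
  then obtain g where g: "v0 g \<noteq> 0" by (auto simp: fun_eq_iff)
  then have "g \<in> carrier G" using V_0 v0(1) by blast
  then obtain r where "g \<in> cell r" using cell_cover by blast
  then obtain b n where b: "b \<in> B" "n \<in> N0 r" "g = b ** (pt r ** n)" by (auto simp: cell_def matrix_mul_assoc)
  have nK: "n \<in> K" using b(2) N0_I1 I1_Iw Iw_K by blast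
  \<comment> \<open>By the Iwasawa decomposition \<open>v0\<close> is nonzero at a point of K, and
    this k translates that point to \<open>?p\<close>.\<close>
  define k where "k = adj ?p ** (pt r ** n)"
  have kK: "k \<in> K" using nK pt_K K_props by (simp add: k_def)
  have kG: "k \<in> carrier G" using kK K_props by blast
  define v where "v = tr k v0"
  have v: "v \<in> V" "Phi v \<in> S" using v0 kG kK S_K y V_tr by (simp_all add: v_def Phi_tr)
  have "v0 g = eps b * v0 (pt r ** n)" unfolding b(3) using b v0(1) N0_in by (intro V_B) auto
  then have "v0 (pt r ** n) \<noteq> 0" using g by auto
  moreover have "?p ** k = pt r ** n" by (simp add: k_def)
  ultimately have vp: "v ?p \<noteq> 0" by (simp add: v_def tr_def)
  then have v_nz: "v \<noteq> 0" by auto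
  define h where "h = tr (dl s ?m) v"
  have h: "h \<in> Wl s" "h ?p \<noteq> 0" using mem v val vp by (simp_all add: h_def)
  have Phi_h: "Phi h \<noteq> 0"
  proof
    assume "Phi h = 0"
    then have "act pi (dl s ?m) (act pi k y) = 0" using v v0 kG by (simp add: h_def v_def Phi_tr V_tr)
    then have "act pi (adj (dl s ?m ** k)) (act pi (dl s ?m ** k) y) = act pi (adj (dl s ?m ** k)) 0"
      using pi_act(5)[of "dl s ?m" k y] kG y S_pi by auto
    moreover have "act pi (adj (dl s ?m ** k)) 0 = 0"
      using pi_act(3)[of "adj (dl s ?m ** k)" 0 0] kG PI.subspace_0[OF pi_subspace] by simp
    moreover have "act pi (adj (dl s ?m ** k)) (act pi (dl s ?m ** k) y) = y"
      using pi_act(5)[of "adj (dl s ?m ** k)" "dl s ?m ** k" y] pi_act(4)[of y] kG y S_pi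
      by (simp add: adj_mult_self subsetD)
    ultimately show False using y by simp
  qed
  note WV = subset_trans[OF Wl_Q] and Wops = SC.subspace_diff[OF Wl_subspace] SC.subspace_scale[OF Wl_subspace]
  have "\<exists>f0\<in>Wl s. f0 \<noteq> 0 \<and> f0 ?p = 0"
  proof (rule ccontr)
    assume "\<not> (\<exists>f0\<in>Wl s. f0 \<noteq> 0 \<and> f0 ?p = 0)"
    then have uniq: "f = 0" if "f \<in> Wl s" "f ?p = 0" for f using that by blast
    have propo: "f' = sc (f' ?p / f ?p) f" if f: "f \<in> Wl s" "f' \<in> Wl s" "f ?p \<noteq> 0" for f f'
    proof -
      have "f' - sc (f' ?p / f ?p) f \<in> Wl s" using f Wops by blast
      moreover have "(f' - sc (f' ?p / f ?p) f) ?p = 0" using f by (simp add: sc_def)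
      ultimately have "f' - sc (f' ?p / f ?p) f = 0" by (rule uniq)
      then show ?thesis by simp
    qed
    have ker0: "z = 0" if z: "z \<in> V" "Phi z = 0" for z
    proof (rule ccontr)
      assume "z \<noteq> 0"
      have zW: "z \<in> Wl s" using z by (simp add: Wl_def J_def PI.span_zero)
      then have "z ?p \<noteq> 0" using uniq \<open>z \<noteq> 0\<close> by blast
      then have "h = sc (h ?p / z ?p) z" using propo zW h(1) by blast
      then have "Phi h = 0" using z Phi_sc[of z "h ?p / z ?p"] by simp
      then show False using Phi_h by simp
    qed
    \<comment> \<open>K acts on lifts of S, whereas proportionality is known in \<open>Wl s\<close>.
      Eigenvalue statements are therefore proved after applying \<open>dl s ?m\<close> and then
      pulled back.\<close>
    have undo: "f' = sc a f" if "tr (dl s ?m) f' = sc a (tr (dl s ?m) f)" for f f' a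
      using arg_cong[OF that, of "tr (adj (dl s ?m))"] by (simp add: tr_sc)
    have "\<exists>a. tr k v = sc a v" if k: "k \<in> K" for k
    proof -
      have "tr (dl s ?m) (tr k v) \<in> Wl s"
        using mem[of "tr k v"] v V_tr K_props(2)[OF k] S_K[OF k] by (simp add: Phi_tr)
      from propo[OF h(1) this h(2)] have "\<exists>a. tr (dl s ?m) (tr k v) = sc a (tr (dl s ?m) v)" unfolding h_def by blast
      then show ?thesis using undo by blast
    qed
    moreover have "\<exists>a. tr (dl s 1) v = sc a v"
    proof -
      have "tr (dl s 1) h \<in> Wl s" using h(1) by (rule Wl_tr(2))
      moreover have "tr (dl s 1) h = tr (dl s ?m) (tr (dl s 1) v)"
        by (simp only: h_def tr_mult[symmetric] dl_add[symmetric] add.commute)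
      ultimately have "tr (dl s ?m) (tr (dl s 1) v) \<in> Wl s" by simp
      from propo[OF h(1) this h(2)] have "\<exists>a. tr (dl s ?m) (tr (dl s 1) v) = sc a (tr (dl s ?m) v)" unfolding h_def by blast
      then show ?thesis using undo by blast
    qed
    ultimately have "\<exists>\<eta>. \<forall>b\<in>B. eps b = \<eta> (det b)" using v(1) v_nz by (intro eigenvector_det)
    then show False using eps_not_det ker0 by blast
  qed
  then obtain f0 where "f0 \<in> Wl s" "f0 \<noteq> 0" "f0 ?p = 0" by blast
  then show ?thesis
    using fx_in_subspace[OF Wl_Q Wl_subspace _ Wl_tr(2) h] Wl_tr(1) I1_Iw by blast
qed

theorem J_Int: "J S True \<inter> J S False = invariants pi I1"
proof (rule subset_antisym; rule subsetI)
  fix y assume y: "y \<in> J S True \<inter> J S False"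
  then obtain f where f: "f \<in> V" "y = Phi f" using J_pi Phi_surj by blast
  then have "f \<in> Wl True" "f \<in> Wl False" using y by (auto simp: Wl_def)
  then have "f \<in> Q True" "f \<in> Q False" using Wl_Q[of True] Wl_Q[of False] by auto
  from Q_both[OF this] have f_eq: "f = sc (f (pt True)) (fx True) + sc (f (pt False)) (fx False)" .
  have "act pi k y = y" if k: "k \<in> I1" for k
  proof -
    have "tr k (sc (f (pt True)) (fx True) + sc (f (pt False)) (fx False)) = sc (f (pt True)) (fx True) + sc (f (pt False)) (fx False)"
      using k by (simp only: tr_add tr_sc fx_I1)
    then have "tr k f = f" using f_eq by metis
    then show ?thesis using Phi_tr[of k f] f k I1_props by simp
  qed
  then show "y \<in> invariants pi I1" using y J_pi by (auto simp: invariants_def)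
next
  fix y assume "y \<in> invariants pi I1"
  then obtain f where f: "f \<in> V" "f \<in> Q True" "f \<in> Q False" "y = Phi f" by (rule invariants_lift)
  have "sc (f (pt True)) (fx True) + sc (f (pt False)) (fx False) \<in> Wl s" for s
    by (intro SC.subspace_add[OF Wl_subspace] SC.subspace_scale[OF Wl_subspace] fx_Wl)
  then have "f \<in> Wl s" for s using Q_both[OF f(2,3)] by metis
  then show "y \<in> J S True \<inter> J S False" using f(4) by (auto simp: Wl_def)
qed

end

end

section \<open>Compact induction\<close>

context unramified_vertex
begin

lemma maxcpt_K: "maxcpt D i = K"
  by (rule maxcpt_eq)

lemma continuous_right_mult: "continuous_map X X (\<lambda>h. h ** a)"
  using continuous_map_mult[of "mat 1" a] by simp

section \<open>Locally constant functions on G\<close>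

definition locconst :: "('e^3^3 \<Rightarrow> 'b) \<Rightarrow> bool"
  where "locconst f \<longleftrightarrow> (\<forall>g\<in>carrier G. \<exists>N. \<forall>h\<in>carrier G. h - g \<in> box N \<longrightarrow> f h = f g)"

lemma locconst_iff:
  "locconst f \<longleftrightarrow> (\<forall>g\<in>carrier G. \<exists>S. openin (subtopology X (carrier G)) S \<and> g \<in> S \<and> (\<forall>h\<in>S. f h = f g))"
proof
  assume l: "locconst f"
  show "\<forall>g\<in>carrier G. \<exists>S. openin (subtopology X (carrier G)) S \<and> g \<in> S \<and> (\<forall>h\<in>S. f h = f g)"
  proof
    fix g assume g: "g \<in> carrier G"
    then obtain N where N: "\<forall>h\<in>carrier G. h - g \<in> box N \<longrightarrow> f h = f g" using l unfolding locconst_def by blast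
    let ?S = "{h. h - g \<in> box N} \<inter> carrier G"
    have "openin (subtopology X (carrier G)) ?S"
      unfolding openin_subtopology using open_ball_X[of g N] by (intro exI[of _ "{h. h - g \<in> box N}"] conjI refl)
    moreover have "g \<in> ?S" using g by simp
    moreover have "\<forall>h\<in>?S. f h = f g" using N by blast
    ultimately show "\<exists>S. openin (subtopology X (carrier G)) S \<and> g \<in> S \<and> (\<forall>h\<in>S. f h = f g)" by blast
  qed
next
  assume r: "\<forall>g\<in>carrier G. \<exists>S. openin (subtopology X (carrier G)) S \<and> g \<in> S \<and> (\<forall>h\<in>S. f h = f g)"
  show "locconst f" unfolding locconst_def
  proof
    fix g assume "g \<in> carrier G"
    then obtain S where S: "openin (subtopology X (carrier G)) S" "g \<in> S" "\<forall>h\<in>S. f h = f g" using r by blast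
    then obtain T where T: "openin X T" "S = T \<inter> carrier G" by (auto simp: openin_subtopology)
    then obtain N where "\<forall>h. h - g \<in> box N \<longrightarrow> h \<in> T" using S(2) by (auto simp: openin_X)
    then show "\<exists>N. \<forall>h\<in>carrier G. h - g \<in> box N \<longrightarrow> f h = f g" using S(3) T(2) by blast
  qed
qed

lemma closedin_support:
  assumes "locconst f"
  shows "closedin X {g \<in> carrier G. f g \<noteq> 0}"
  unfolding closedin_def openin_X
proof (intro conjI ballI)
  fix g assume g: "g \<in> topspace X - {g \<in> carrier G. f g \<noteq> 0}"
  show "\<exists>n. \<forall>h. h - g \<in> box n \<longrightarrow> h \<in> topspace X - {g \<in> carrier G. f g \<noteq> 0}"
  proof (cases "g \<in> carrier G")
    case True
    then obtain N where N: "\<forall>h\<in>carrier G. h - g \<in> box N \<longrightarrow> f h = f g" using assms unfolding locconst_def by blast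
    have "f g = 0" using g True by simp
    then have "\<forall>h. h - g \<in> box N \<longrightarrow> h \<in> topspace X - {g \<in> carrier G. f g \<noteq> 0}" using N by auto
    then show ?thesis by blast
  next
    case False
    then have "g \<in> topspace X - carrier G" by simp
    then obtain n where "\<forall>h. h - g \<in> box n \<longrightarrow> h \<in> topspace X - carrier G"
      using closedin_U21 unfolding closedin_def openin_X by blast
    then show ?thesis by blast
  qed
qed simp

lemma locconst_add: "locconst f \<Longrightarrow> locconst f' \<Longrightarrow> locconst (\<lambda>g. F (f g) (f' g))"
  unfolding locconst_def
proof
  fix g assume l: "\<forall>g\<in>carrier G. \<exists>N. \<forall>h\<in>carrier G. h - g \<in> box N \<longrightarrow> f h = f g"
    "\<forall>g\<in>carrier G. \<exists>N. \<forall>h\<in>carrier G. h - g \<in> box N \<longrightarrow> f' h = f' g" and g: "g \<in> carrier G"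
  obtain N where N: "\<forall>h\<in>carrier G. h - g \<in> box N \<longrightarrow> f h = f g" using l(1) g by blast
  obtain N' where N': "\<forall>h\<in>carrier G. h - g \<in> box N' \<longrightarrow> f' h = f' g" using l(2) g by blast
  have "\<forall>h\<in>carrier G. h - g \<in> box (max N N') \<longrightarrow> F (f h) (f' h) = F (f g) (f' g)"
    using N N' box_mono[of _ "max N N'" N] box_mono[of _ "max N N'" N'] by simp
  then show "\<exists>N. \<forall>h\<in>carrier G. h - g \<in> box N \<longrightarrow> F (f h) (f' h) = F (f g) (f' g)" by blast
qed

lemma locconst_translate:
  assumes "locconst f" "a \<in> carrier G"
  shows "locconst (\<lambda>g. f (g ** a))"
  unfolding locconst_def
proof
  fix g assume g: "g \<in> carrier G"
  then obtain N where N: "\<forall>h\<in>carrier G. h - g ** a \<in> box N \<longrightarrow> f h = f (g ** a)"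
    using assms by (fastforce simp: locconst_def)
  obtain M where M: "\<forall>Z\<in>box M. mat 1 ** Z ** a \<in> box N" using mult_small by blast
  have "f (h ** a) = f (g ** a)" if "h \<in> carrier G" "h - g \<in> box M" for h
  proof -
    have "mat 1 ** (h - g) ** a = h ** a - g ** a" by (simp add: matrix_diff_rdistrib)
    then have "h ** a - g ** a \<in> box N" using M that(2) by metis
    then show ?thesis using N that(1) assms(2) by simp
  qed
  then show "\<exists>N. \<forall>h\<in>carrier G. h - g \<in> box N \<longrightarrow> f (h ** a) = f (g ** a)" by blast
qed

end

locale weight_embedded = unramified_vertex D i
  for D :: "'e::field quad_ext" and i :: vertex +
  fixes \<sigma> :: "('e^3^3, 'c::field, 'w::ab_group_add) repr" and \<pi> :: "('e^3^3, 'c, 'v::ab_group_add) repr"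
    and j :: "'w \<Rightarrow> 'v" and \<iota> :: "('e^3^3 \<Rightarrow> 'w) \<Rightarrow> 'v"
  assumes char_c: "CHAR('c) = rchar D"
    and smooth_pi: "smooth_rep (matrix_topology D) (U21 D) \<pi>"
    and weight: "weight D i \<sigma>"
    and embedding: "weight_embedding D i \<sigma> \<pi> j"
    and frobenius: "frobenius_map D i \<sigma> \<pi> j \<iota>"
begin

abbreviation C where "C \<equiv> vspace (cind D i \<sigma>)"

lemma smooth_\<sigma>: "smooth_rep X (subgrp D K) \<sigma>"
  using weight by (simp add: weight_def maxcpt_K)

sublocale SI: vector_space "scal \<sigma>" using smooth_\<sigma> by (simp add: smooth_rep_def)
sublocale PI: vector_space "scal \<pi>" using smooth_pi by (simp add: smooth_rep_def)

lemma \<sigma>_subspace: "SI.subspace (vspace \<sigma>)" using smooth_\<sigma> by (simp add: smooth_rep_def)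
lemma \<pi>_subspace: "PI.subspace (vspace \<pi>)" using smooth_pi by (simp add: smooth_rep_def)

lemma \<sigma>_act: "k \<in> K \<Longrightarrow> x \<in> vspace \<sigma> \<Longrightarrow> act \<sigma> k x \<in> vspace \<sigma>"
  "k \<in> K \<Longrightarrow> x \<in> vspace \<sigma> \<Longrightarrow> y \<in> vspace \<sigma> \<Longrightarrow> act \<sigma> k (x + y) = act \<sigma> k x + act \<sigma> k y"
  "k \<in> K \<Longrightarrow> x \<in> vspace \<sigma> \<Longrightarrow> act \<sigma> k (scal \<sigma> a x) = scal \<sigma> a (act \<sigma> k x)"
  "x \<in> vspace \<sigma> \<Longrightarrow> act \<sigma> (mat 1) x = x"
  "k \<in> K \<Longrightarrow> l \<in> K \<Longrightarrow> x \<in> vspace \<sigma> \<Longrightarrow> act \<sigma> (k ** l) x = act \<sigma> k (act \<sigma> l x)"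
  using smooth_\<sigma> by (auto simp: smooth_rep_def linear_on_def)

lemma \<sigma>_0: "k \<in> K \<Longrightarrow> act \<sigma> k 0 = 0"
  using \<sigma>_act(3)[of k 0 0] SI.subspace_0[OF \<sigma>_subspace] by simp

lemma \<sigma>_stab: "x \<in> vspace \<sigma> \<Longrightarrow> nhd1 (carrier G) {k \<in> K. act \<sigma> k x = x}"
proof -
  assume x: "x \<in> vspace \<sigma>"
  then have "openin (subtopology X K) {k \<in> K. act \<sigma> k x = x}"
    using smooth_\<sigma> by (simp add: smooth_rep_def)
  then have "nhd1 K {k \<in> K. act \<sigma> k x = x}"
    using K_props(1) \<sigma>_act(4) x by (intro openin_nhd1) auto
  moreover have "nhd1 (carrier G) K" by (rule nhd1_Kf) simp
  ultimately show ?thesis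
  proof -
    obtain n where n: "\<forall>g\<in>K. g - mat 1 \<in> box n \<longrightarrow> g \<in> {k \<in> K. act \<sigma> k x = x}"
      using \<open>nhd1 K _\<close> unfolding nhd1_def by blast
    then have "nhd1 (carrier G) {g. g \<in> K \<and> g - mat 1 \<in> box n}"
      using nhd1_Int[OF \<open>nhd1 (carrier G) K\<close>, of "{g. g - mat 1 \<in> box n}"] by (force simp: nhd1_def)
    then show ?thesis using n by (auto elim!: nhd1_subset)
  qed
qed

lemma \<pi>_act: "g \<in> carrier G \<Longrightarrow> y \<in> vspace \<pi> \<Longrightarrow> act \<pi> g y \<in> vspace \<pi>"
  "g \<in> carrier G \<Longrightarrow> h \<in> carrier G \<Longrightarrow> y \<in> vspace \<pi> \<Longrightarrow> act \<pi> (g ** h) y = act \<pi> g (act \<pi> h y)"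
  "y \<in> vspace \<pi> \<Longrightarrow> act \<pi> (mat 1) y = y"
  using smooth_pi by (auto simp: smooth_rep_def linear_on_def)

lemma j_in: "x \<in> vspace \<sigma> \<Longrightarrow> j x \<in> vspace \<pi>"
  and j_act: "k \<in> K \<Longrightarrow> x \<in> vspace \<sigma> \<Longrightarrow> j (act \<sigma> k x) = act \<pi> k (j x)"
  and j_inj: "inj_on j (vspace \<sigma>)"
  and j_scal: "x \<in> vspace \<sigma> \<Longrightarrow> j (scal \<sigma> a x) = scal \<pi> a (j x)"
  using embedding by (auto simp: weight_embedding_def intertwiner_def linear_on_def maxcpt_K)

lemma j_0: "j 0 = 0"
  using j_scal[OF SI.subspace_0[OF \<sigma>_subspace], of 0] by simp

section \<open>The weight as a subspace of \<pi>\<close>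

definition S where "S = j ` vspace \<sigma>"

lemma S_\<pi>: "S \<subseteq> vspace \<pi>"
  using j_in by (auto simp: S_def)

lemma S_K: "k \<in> K \<Longrightarrow> y \<in> S \<Longrightarrow> act \<pi> k y \<in> S"
  using \<sigma>_act(1) by (auto simp: S_def j_act[symmetric])

lemma \<sigma>_nz: "\<exists>x\<in>vspace \<sigma>. x \<noteq> 0"
  using weight SI.subspace_0[OF \<sigma>_subspace] by (auto simp: weight_def irreducible_rep_def)

lemma S_nz: "\<exists>y\<in>S. y \<noteq> 0"
proof -
  obtain x where x: "x \<in> vspace \<sigma>" "x \<noteq> 0" using \<sigma>_nz by blast
  then have "j x \<noteq> j 0" using j_inj SI.subspace_0[OF \<sigma>_subspace] by (auto dest: inj_onD)
  then show ?thesis using x j_0 by (auto simp: S_def)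
qed

text \<open>The radical is pro-p, so it fixes a nonzero vector. It is normal in K, so its fixed
  vectors form a subrepresentation, which is everything by irreducibility.\<close>

lemma \<sigma>_R: "k \<in> R \<Longrightarrow> x \<in> vspace \<sigma> \<Longrightarrow> act \<sigma> k x = x"
proof -
  let ?W = "{x \<in> vspace \<sigma>. \<forall>k\<in>R. act \<sigma> k x = x}"
  have RK: "R \<subseteq> K" by (rule Hf_subset_Kf) auto
  obtain w where w: "w \<in> vspace \<sigma>" "w \<noteq> 0" using \<sigma>_nz by blast
  have ex: "\<exists>x\<in>vspace \<sigma>. x \<noteq> 0 \<and> (\<forall>k\<in>R. act \<sigma> k x = x)"
  proof (rule pro_p_fixed_vector[OF pro_p_Hf char_c SI.vector_space_axioms \<sigma>_subspace _ _ _ _ _ _ w])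
    show "nhd1 R {g. act \<sigma> g x = x}" if "x \<in> vspace \<sigma>" for x
      by (rule nhd1_subset[OF \<sigma>_stab[OF that]]) (use R_props in auto)
  qed (use subsetD[OF RK] \<sigma>_act in auto)
  have sub: "SI.subspace ?W"
    by (rule SI.subspaceI)
      (use RK \<sigma>_0 \<sigma>_act SI.subspace_0[OF \<sigma>_subspace] SI.subspace_add[OF \<sigma>_subspace] SI.subspace_scale[OF \<sigma>_subspace] in auto)
  have "act \<sigma> k x \<in> ?W" if k: "k \<in> K" and x: "x \<in> ?W" for k x
  proof -
    have "act \<sigma> h (act \<sigma> k x) = act \<sigma> k x" if h: "h \<in> R" for h
    proof -
      have kG: "k \<in> carrier G" using k K_props by blast
      have c: "adj k ** h ** adj (adj k) \<in> R" using K_conj_R[of "adj k" h] k h K_props by blast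
      have "act \<sigma> h (act \<sigma> k x) = act \<sigma> (h ** k) x" using \<sigma>_act(5)[of h k x] h k x RK by auto
      also have "h ** k = k ** (adj k ** h ** adj (adj k))" using kG by (simp add: matrix_mul_assoc mult_adj)
      also have "act \<sigma> \<dots> x = act \<sigma> k (act \<sigma> (adj k ** h ** adj (adj k)) x)" using \<sigma>_act(5) k x c RK by blast
      also have "\<dots> = act \<sigma> k x" using x c by auto
      finally show ?thesis .
    qed
    then show ?thesis using \<sigma>_act(1) k x by auto
  qed
  then have "?W = {0} \<or> ?W = vspace \<sigma>"
    using weight sub unfolding weight_def irreducible_rep_def maxcpt_K by auto
  then have "?W = vspace \<sigma>" using ex by blast
  then show "k \<in> R \<Longrightarrow> x \<in> vspace \<sigma> \<Longrightarrow> act \<sigma> k x = x" by blast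
qed

lemma S_R: "k \<in> R \<Longrightarrow> y \<in> S \<Longrightarrow> act \<pi> k y = y"
proof -
  assume k: "k \<in> R" and y: "y \<in> S"
  then obtain x where x: "x \<in> vspace \<sigma>" "y = j x" by (auto simp: S_def)
  have "k \<in> K" using k Hf_subset_Kf[of 2 1 "vx i"] by auto
  then show ?thesis using j_act[of k x] \<sigma>_R[OF k x(1)] x by simp
qed

section \<open>The space of the compact induction\<close>

lemma C_iff:
  "f \<in> C \<longleftrightarrow> (\<forall>g. g \<notin> carrier G \<longrightarrow> f g = 0) \<and> (\<forall>g\<in>carrier G. f g \<in> vspace \<sigma>) \<and>
    (\<forall>k\<in>K. \<forall>g\<in>carrier G. f (k ** g) = act \<sigma> k (f g)) \<and> locconst f \<and>
    compactin X {g \<in> carrier G. f g \<noteq> 0}"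
  by (simp add: cind_def locconst_iff maxcpt_K)

lemma cind_simps: "scal (cind D i \<sigma>) = (\<lambda>a f g. scal \<sigma> a (f g))" "act (cind D i \<sigma>) = (\<lambda>h f g. f (g ** h))"
  by (simp_all add: cind_def)

sublocale CI: vector_space "scal (cind D i \<sigma>)"
  unfolding cind_simps
  by unfold_locales (auto simp: SI.scale_right_distrib SI.scale_left_distrib)

lemma C_subspace: "CI.subspace C"
proof (rule CI.subspaceI)
  have "locconst (\<lambda>g. 0 :: 'w)" by (simp add: locconst_def)
  then show "0 \<in> C" using \<sigma>_0 SI.subspace_0[OF \<sigma>_subspace] by (simp add: C_iff zero_fun_def)
  show "f + f' \<in> C" if f: "f \<in> C" "f' \<in> C" for f f'
  proof -
    have l: "locconst (f + f')" using locconst_add[of f f' "(+)"] f by (simp add: C_iff plus_fun_def)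
    have "compactin X ({g \<in> carrier G. f g \<noteq> 0} \<union> {g \<in> carrier G. f' g \<noteq> 0})"
      using f by (intro compactin_Un) (auto simp: C_iff)
    then have "compactin X {g \<in> carrier G. (f + f') g \<noteq> 0}"
      by (rule closed_compactin[OF _ _ closedin_support[OF l]]) auto
    then show ?thesis using f l \<sigma>_act(2) SI.subspace_add[OF \<sigma>_subspace] by (simp add: C_iff)
  qed
  show "scal (cind D i \<sigma>) a f \<in> C" if f: "f \<in> C" for a f
  proof -
    have l: "locconst (scal (cind D i \<sigma>) a f)" using locconst_add[of f f "\<lambda>x y. scal \<sigma> a x"] f
      by (simp add: C_iff cind_simps)
    have "compactin X {g \<in> carrier G. f g \<noteq> 0}" using f by (simp add: C_iff)
    then have "compactin X {g \<in> carrier G. scal (cind D i \<sigma>) a f g \<noteq> 0}"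
      by (rule closed_compactin[OF _ _ closedin_support[OF l]]) (auto simp: cind_simps)
    then show ?thesis using f l \<sigma>_act(3) SI.subspace_scale[OF \<sigma>_subspace] by (simp add: C_iff cind_simps)
  qed
qed

lemma C_translate:
  assumes "f \<in> C" "a \<in> carrier G"
  shows "(\<lambda>g. f (g ** a)) \<in> C"
proof -
  have out: "g ** a \<in> carrier G \<longleftrightarrow> g \<in> carrier G" for g
    using assms(2) mult_in[of "g ** a" "adj a"] by auto
  have "compactin X ((\<lambda>h. h ** adj a) ` {g \<in> carrier G. f g \<noteq> 0})"
    using assms(1) by (intro image_compactin[OF _ continuous_right_mult]) (simp add: C_iff)
  moreover have "(\<lambda>h. h ** adj a) ` {g \<in> carrier G. f g \<noteq> 0} = {g \<in> carrier G. f (g ** a) \<noteq> 0}"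
  proof (rule subset_antisym; rule subsetI)
    fix h assume "h \<in> {g \<in> carrier G. f (g ** a) \<noteq> 0}"
    then show "h \<in> (\<lambda>h. h ** adj a) ` {g \<in> carrier G. f g \<noteq> 0}"
      using assms(2) by (intro image_eqI[of _ _ "h ** a"]) auto
  qed (use assms(2) in auto)
  ultimately have "compactin X {g \<in> carrier G. f (g ** a) \<noteq> 0}" by simp
  moreover have "f (k ** g ** a) = act \<sigma> k (f (g ** a))" if "k \<in> K" "g \<in> carrier G" for k g
    using assms that by (simp add: C_iff matrix_mul_assoc[symmetric])
  ultimately show ?thesis using assms locconst_translate[of f a] by (simp add: C_iff out)
qed

lemma frob_unit_C:
  assumes x: "x \<in> vspace \<sigma>"
  shows "frob_unit D i \<sigma> x \<in> C"
proof -
  let ?f = "frob_unit D i \<sigma> x"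
  have f: "?f g = (if g \<in> K then act \<sigma> g x else 0)" for g by (simp add: frob_unit_def maxcpt_K)
  have l: "locconst ?f" unfolding locconst_def
  proof
    fix g assume g: "g \<in> carrier G"
    obtain N where N: "\<And>h. h \<in> carrier G \<Longrightarrow> h - g \<in> box N \<Longrightarrow> adj g ** h \<in> {k \<in> K. act \<sigma> k x = x}"
      by (rule nhd1_left[OF \<sigma>_stab[OF x] UG.subgroup_self g]) blast
    have "?f h = ?f g" if h: "h \<in> carrier G" "h - g \<in> box N" for h
    proof -
      have u: "adj g ** h \<in> K" "act \<sigma> (adj g ** h) x = x" using N[OF h] by auto
      have hg: "h = g ** (adj g ** h)" "g = h ** adj (adj g ** h)" using g h(1) by (simp_all add: adj_mult)
      have "h \<in> K \<longleftrightarrow> g \<in> K" using hg u(1) K_props(3,4) by metis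
      moreover have "act \<sigma> h x = act \<sigma> g x" if "g \<in> K"
        using \<sigma>_act(5)[OF that u(1) x] u(2) g by simp
      ultimately show ?thesis by (simp add: f)
    qed
    then show "\<exists>N. \<forall>h\<in>carrier G. h - g \<in> box N \<longrightarrow> ?f h = ?f g" by blast
  qed
  have "compactin X K" by (rule compact_Kf) simp
  then have "compactin X {g \<in> carrier G. ?f g \<noteq> 0}"
    by (rule closed_compactin[OF _ _ closedin_support[OF l]]) (auto simp: f)
  moreover have "?f (k ** g) = act \<sigma> k (?f g)" if "k \<in> K" "g \<in> carrier G" for k g
  proof -
    have "k ** g \<in> K \<longleftrightarrow> g \<in> K"
      using that K_props(2,3,4)[of k] K_props(3)[of "adj k" "k ** g"] by auto
    then show ?thesis using \<sigma>_act(5) \<sigma>_0 that x by (simp add: f)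
  qed
  ultimately show ?thesis using l x \<sigma>_act(1) SI.subspace_0[OF \<sigma>_subspace] K_props(2) by (auto simp: C_iff f)
qed

text \<open>The function supported on the coset K g with value x at g. Such functions span the
  compact induction.\<close>

definition ta :: "'w \<Rightarrow> 'e^3^3 \<Rightarrow> 'e^3^3 \<Rightarrow> 'w"
  where "ta x g = (\<lambda>h. frob_unit D i \<sigma> x (h ** adj g))"

lemma ta_C: "x \<in> vspace \<sigma> \<Longrightarrow> g \<in> carrier G \<Longrightarrow> ta x g \<in> C"
  unfolding ta_def by (intro C_translate frob_unit_C) auto

lemma \<iota>_lin: "f \<in> C \<Longrightarrow> \<iota> f \<in> vspace \<pi>" "f \<in> C \<Longrightarrow> f' \<in> C \<Longrightarrow> \<iota> (f + f') = \<iota> f + \<iota> f'"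
  "f \<in> C \<Longrightarrow> \<iota> (scal (cind D i \<sigma>) a f) = scal \<pi> a (\<iota> f)"
  using frobenius by (auto simp: frobenius_map_def intertwiner_def linear_on_def)

lemma \<iota>_0: "\<iota> 0 = 0"
  using \<iota>_lin(3)[OF CI.subspace_0[OF C_subspace], of 0] by simp

lemma \<iota>_ta: "x \<in> vspace \<sigma> \<Longrightarrow> g \<in> carrier G \<Longrightarrow> \<iota> (ta x g) = act \<pi> (adj g) (j x)"
proof -
  assume x: "x \<in> vspace \<sigma>" and g: "g \<in> carrier G"
  have "\<iota> (act (cind D i \<sigma>) (adj g) (frob_unit D i \<sigma> x)) = act \<pi> (adj g) (\<iota> (frob_unit D i \<sigma> x))"
    using frobenius frob_unit_C[OF x] adj_in[OF g] unfolding frobenius_map_def intertwiner_def by blast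
  then show ?thesis using frobenius x by (simp add: frobenius_map_def ta_def cind_simps)
qed

section \<open>Images of the subspaces supported on double cosets\<close>

definition dc :: "int \<Rightarrow> ('e^3^3) set"
  where "dc m = {k ** al m ** h | k h. k \<in> K \<and> h \<in> Iw}"

lemma double_coset_dc: "double_coset D i m = dc m"
  unfolding double_coset_def alpha_pow iwahori_Iw maxcpt_K dc_def set_mult_def by auto

lemma dc_K: "k \<in> K \<Longrightarrow> g \<in> dc m \<Longrightarrow> k ** g \<in> dc m"
proof -
  assume k: "k \<in> K" and "g \<in> dc m"
  then obtain l h where "l \<in> K" "h \<in> Iw" "g = l ** al m ** h" by (auto simp: dc_def)
  then have "k ** g = (k ** l) ** al m ** h" "k ** l \<in> K" "h \<in> Iw" using k K_props by (auto simp: matrix_mul_assoc)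
  then show ?thesis unfolding dc_def by blast
qed

lemma dc_in: "g \<in> dc m \<Longrightarrow> g \<in> carrier G"
  using K_props(2) Iw_props(2) by (auto simp: dc_def)

definition Rm :: "int \<Rightarrow> ('e^3^3 \<Rightarrow> 'w) set"
  where "Rm m = {f \<in> C. {g. f g \<noteq> 0} \<subseteq> dc m}"

text \<open>Translates of the weight by the inverses of the elements of \<open>dc m\<close>; the
  factor from K is absorbed by S.\<close>

definition GG :: "int \<Rightarrow> 'v set"
  where "GG m = {act \<pi> (h ** al (- m)) y | h y. h \<in> Iw \<and> y \<in> S}"

lemma act_adj_GG: "g \<in> dc m \<Longrightarrow> x \<in> vspace \<sigma> \<Longrightarrow> act \<pi> (adj g) (j x) \<in> GG m"
proof -
  assume g: "g \<in> dc m" and x: "x \<in> vspace \<sigma>"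
  then obtain k h where kh: "k \<in> K" "h \<in> Iw" "g = k ** al m ** h" by (auto simp: dc_def)
  have G: "k \<in> carrier G" "h \<in> carrier G" using kh K_props(2) Iw_props(2) by auto
  have "adj g = (adj h ** al (- m)) ** adj k" by (simp add: kh(3) adj_mult matrix_mul_assoc)
  then have "act \<pi> (adj g) (j x) = act \<pi> (adj h ** al (- m)) (act \<pi> (adj k) (j x))"
    using \<pi>_act(2)[of "adj h ** al (- m)" "adj k" "j x"] G j_in[OF x] by simp
  moreover have "act \<pi> (adj k) (j x) \<in> S" using S_K kh(1) K_props(4) x by (auto simp: S_def)
  ultimately show ?thesis using kh(2) Iw_props(4) unfolding GG_def by blast
qed

text \<open>Compact support meets finitely many cosets K g. Induction on their number subtracts the
  part of f on one coset at a time.\<close>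

lemma Rm_image: "\<iota> ` Rm m \<subseteq> PI.span (GG m)"
proof
  fix y assume "y \<in> \<iota> ` Rm m"
  then obtain f where f: "f \<in> Rm m" "y = \<iota> f" by blast
  have claim: "\<iota> f \<in> PI.span (GG m)"
    if "finite F" "F \<subseteq> carrier G" "f \<in> Rm m" "\<And>h. f h \<noteq> 0 \<Longrightarrow> \<exists>g\<in>F. h ** adj g \<in> K" for F f
    using that
  proof (induction F arbitrary: f rule: finite_induct)
    case empty
    then have "f = 0" by (auto simp: fun_eq_iff)
    then show ?case using \<iota>_0 PI.span_zero by metis
  next
    case (insert g F)
    have fC: "f \<in> C" and fdc: "\<And>h. f h \<noteq> 0 \<Longrightarrow> h \<in> dc m" using insert.prems(2) by (auto simp: Rm_def)
    have g: "g \<in> carrier G" using insert.prems(1) by blast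
    have fg: "f g \<in> vspace \<sigma>" using fC g by (simp add: C_iff)
    have tC: "ta (f g) g \<in> C" using fg g by (rule ta_C)
    have t_on: "ta (f g) g h = f h" if "h ** adj g \<in> K" for h
    proof -
      have "f ((h ** adj g) ** g) = act \<sigma> (h ** adj g) (f g)"
        using fC that g unfolding C_iff by blast
      then show ?thesis using that g by (simp add: ta_def frob_unit_def maxcpt_K)
    qed
    have t_off: "ta (f g) g h = 0" if "h ** adj g \<notin> K" for h
      using that by (simp add: ta_def frob_unit_def maxcpt_K)
    \<comment> \<open>On the coset K g equivariance makes f agree with \<open>ta (f g) g\<close>, so
      the difference vanishes there and is unchanged elsewhere.\<close>
    let ?f = "f - ta (f g) g"
    have f'C: "?f \<in> C" using fC tC by (rule CI.subspace_diff[OF C_subspace])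
    have f'z: "h ** adj g \<notin> K \<and> f h \<noteq> 0" if "?f h \<noteq> 0" for h
    proof -
      have ne: "f h \<noteq> ta (f g) g h" using that by simp
      then have "h ** adj g \<notin> K" using t_on[of h] by metis
      then show ?thesis using ne t_off[of h] by simp
    qed
    have "?f \<in> Rm m" using f'C f'z fdc by (auto simp: Rm_def)
    moreover have "\<exists>g\<in>F. h ** adj g \<in> K" if "?f h \<noteq> 0" for h
      using f'z[OF that] insert.prems(3)[of h] by blast
    ultimately have "\<iota> ?f \<in> PI.span (GG m)" using insert.IH[of ?f] insert.prems(1) by blast
    moreover have "\<iota> (ta (f g) g) \<in> PI.span (GG m)"
    \<comment> \<open>If f vanishes at g, then g need not lie in the double coset, but the
      subtracted function is zero.\<close>
    proof (cases "f g = 0")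
      case True
      have "\<iota> (ta (f g) g) = act \<pi> (adj g) (j 0)" using \<iota>_ta[OF fg g] True by simp
      moreover have "ta 0 g = 0" using \<sigma>_0 by (auto simp: ta_def frob_unit_def maxcpt_K fun_eq_iff)
      ultimately show ?thesis using True \<iota>_0 by (simp add: PI.span_zero)
    next
      case False
      then show ?thesis using \<iota>_ta[OF fg g] act_adj_GG[OF fdc fg] by (auto intro: PI.span_base)
    qed
    ultimately have "\<iota> ?f + \<iota> (ta (f g) g) \<in> PI.span (GG m)" by (rule PI.span_add)
    moreover have "\<iota> ?f + \<iota> (ta (f g) g) = \<iota> f" using \<iota>_lin(2)[OF f'C tC] by simp
    ultimately show ?case by simp
  qed
  have fC: "f \<in> C" using f by (simp add: Rm_def)
  let ?supp = "{g \<in> carrier G. f g \<noteq> 0}"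
  have cpt: "compactin X ?supp" using fC by (simp add: C_iff)
  have nK: "nhd1 (carrier G) K" by (rule nhd1_Kf) simp
  then obtain n where n: "\<And>g. g \<in> carrier G \<Longrightarrow> g - mat 1 \<in> box n \<Longrightarrow> g \<in> K" by (auto simp: nhd1_def)
  have "\<exists>N. \<forall>h\<in>carrier G. h - g \<in> box N \<longrightarrow> h ** adj g \<in> K" if g: "g \<in> carrier G" for g
  proof -
    obtain N where "\<And>h. h - g \<in> box N \<Longrightarrow> h ** adj g - mat 1 \<in> box n" using near_identity[OF g g] by metis
    then show ?thesis using n g by (intro exI[of _ N]) simp
  qed
  then obtain N where N: "\<And>g h. g \<in> carrier G \<Longrightarrow> h \<in> carrier G \<Longrightarrow> h - g \<in> box (N g) \<Longrightarrow> h ** adj g \<in> K" by metis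
  let ?\<U> = "(\<lambda>g. {h. h - g \<in> box (N g)}) ` ?supp"
  have "?supp \<subseteq> \<Union>?\<U>" by auto
  moreover have "\<forall>U\<in>?\<U>. openin X U" by (auto intro: open_ball_X)
  ultimately obtain \<F> where \<F>: "finite \<F>" "\<F> \<subseteq> ?\<U>" "?supp \<subseteq> \<Union>\<F>"
    using cpt unfolding compactin_def by meson
  obtain F where F: "F \<subseteq> ?supp" "finite F" "\<F> = (\<lambda>g. {h. h - g \<in> box (N g)}) ` F"
    using finite_subset_image[OF \<F>(1,2)] by blast
  have cover: "\<exists>g\<in>F. h ** adj g \<in> K" if "f h \<noteq> 0" for h
  proof -
    have h: "h \<in> carrier G" using fC that by (auto simp: C_iff)
    then have "h \<in> \<Union>\<F>" using \<F>(3) that by blast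
    then obtain g where "g \<in> F" "h - g \<in> box (N g)" using F(3) by blast
    then show ?thesis using N h F(1) by blast
  qed
  show "y \<in> PI.span (GG m)" unfolding f(2) using F(1) by (intro claim[OF F(2) _ f(1) cover]) auto
qed

text \<open>Each generator is the image of a function supported on one coset K g, and left stability
  of the double coset under K keeps that support inside it.\<close>

lemma GG_image: "GG m \<subseteq> \<iota> ` Rm m"
proof
  fix z assume "z \<in> GG m"
  then obtain h y where hy: "h \<in> Iw" "y \<in> S" "z = act \<pi> (h ** al (- m)) y" by (auto simp: GG_def)
  then obtain x where x: "x \<in> vspace \<sigma>" "y = j x" by (auto simp: S_def)
  let ?g = "al m ** adj h"
  have hG: "h \<in> carrier G" "adj h \<in> Iw" using hy(1) Iw_props(2,4) by auto
  have "mat 1 ** al m ** adj h \<in> dc m" unfolding dc_def using hG K_props(1) by blast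
  then have g: "?g \<in> dc m" by simp
  have "k \<in> dc m" if "ta x ?g k \<noteq> 0" for k
  proof -
    have "k ** adj ?g \<in> K" using that by (auto simp: ta_def frob_unit_def maxcpt_K split: if_splits)
    then have "(k ** adj ?g) ** ?g \<in> dc m" using g by (rule dc_K)
    then show ?thesis using dc_in[OF g] by simp
  qed
  then have "ta x ?g \<in> Rm m" using ta_C[OF x(1) dc_in[OF g]] by (auto simp: Rm_def)
  moreover have "\<iota> (ta x ?g) = z"
    using \<iota>_ta[OF x(1) dc_in[OF g]] by (simp add: hy(3) x(2) adj_mult)
  ultimately show "z \<in> \<iota> ` Rm m" by blast
qed

lemma span_image:
  assumes A: "A \<subseteq> C" and le: "\<iota> ` A \<subseteq> PI.span Z" and ge: "Z \<subseteq> \<iota> ` A"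
  shows "\<iota> ` CI.span A = PI.span Z"
proof
  have AC: "CI.span A \<subseteq> C" using A C_subspace by (rule CI.span_minimal)
  show "\<iota> ` CI.span A \<subseteq> PI.span Z"
  proof
    fix y assume "y \<in> \<iota> ` CI.span A"
    then obtain f where f: "f \<in> CI.span A" "y = \<iota> f" by blast
    from f(1) have "f \<in> C \<and> \<iota> f \<in> PI.span Z"
    proof (induction rule: CI.span_induct_alt)
      case base
      show ?case by (intro conjI CI.subspace_0[OF C_subspace]) (subst \<iota>_0, rule PI.span_zero)
    next
      case (step a f g)
      then have f: "f \<in> C" "\<iota> f \<in> PI.span Z" and g: "g \<in> C" "\<iota> g \<in> PI.span Z" using A le by auto
      have af: "scal (cind D i \<sigma>) a f \<in> C" using f(1) by (rule CI.subspace_scale[OF C_subspace])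
      have "\<iota> (scal (cind D i \<sigma>) a f + g) \<in> PI.span Z"
        unfolding \<iota>_lin(2)[OF af g(1)] \<iota>_lin(3)[OF f(1)] using f(2) g(2) by (intro PI.span_add PI.span_scale)
      then show ?case using CI.subspace_add[OF C_subspace af g(1)] by (rule conjI[rotated])
    qed
    then show "y \<in> PI.span Z" using f(2) by simp
  qed
  have "PI.subspace (\<iota> ` CI.span A)"
  proof (rule PI.subspaceI)
    show "0 \<in> \<iota> ` CI.span A" using \<iota>_0 CI.span_zero by force
    show "y + z \<in> \<iota> ` CI.span A" if yz: "y \<in> \<iota> ` CI.span A" "z \<in> \<iota> ` CI.span A" for y z
    proof -
      obtain f g where fg: "f \<in> CI.span A" "g \<in> CI.span A" "y = \<iota> f" "z = \<iota> g" using yz by blast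
      have "\<iota> (f + g) = \<iota> f + \<iota> g" using fg(1,2) AC by (intro \<iota>_lin(2)) blast+
      then have "y + z = \<iota> (f + g)" using fg(3,4) by (simp only:)
      then show ?thesis using CI.span_add fg by blast
    qed
    show "scal \<pi> a y \<in> \<iota> ` CI.span A" if y: "y \<in> \<iota> ` CI.span A" for a y
    proof -
      obtain f where f: "f \<in> CI.span A" "y = \<iota> f" using y by blast
      have "\<iota> (scal (cind D i \<sigma>) a f) = scal \<pi> a (\<iota> f)" using f(1) AC by (intro \<iota>_lin(3)) blast
      then have "scal \<pi> a y = \<iota> (scal (cind D i \<sigma>) a f)" using f(2) by (simp only:)
      then show ?thesis using CI.span_scale f by blast
    qed
  qed
  moreover have "Z \<subseteq> \<iota> ` CI.span A" using ge CI.span_superset[of A] by blast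
  ultimately show "PI.span Z \<subseteq> \<iota> ` CI.span A" by (intro PI.span_minimal)
qed

definition GS :: "bool \<Rightarrow> 'v set"
  where "GS s = {act \<pi> (k ** dl s m) y | k m y. k \<in> Iw \<and> y \<in> S \<and> (\<not> s \<longrightarrow> m \<ge> 1)}"

lemma image_I_plus: "\<iota> ` I_plus D i \<sigma> = PI.span (GS True)"
proof -
  have "R_plus D i \<sigma> n = Rm (int n)" for n by (simp add: R_plus_def Rm_def double_coset_dc)
  moreover have "\<iota> ` CI.span (\<Union>n. Rm (int n)) = PI.span (GS True)"
  proof (rule span_image)
    show "(\<Union>n. Rm (int n)) \<subseteq> C" by (auto simp: Rm_def)
    have GS: "GS True = (\<Union>n. GG (int n))" by (auto simp: GS_def GG_def dl_def)
    then have "PI.span (GG (int n)) \<subseteq> PI.span (GS True)" for n by (intro PI.span_mono) auto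
    then show "\<iota> ` (\<Union>n. Rm (int n)) \<subseteq> PI.span (GS True)" using Rm_image by blast
    show "GS True \<subseteq> \<iota> ` (\<Union>n. Rm (int n))" unfolding GS using GG_image by blast
  qed
  ultimately show ?thesis by (simp add: I_plus_def)
qed

lemma image_I_minus: "\<iota> ` I_minus D i \<sigma> = PI.span (GS False)"
proof -
  have "R_minus D i \<sigma> n = Rm (- (int n + 1))" for n by (simp add: R_minus_def Rm_def double_coset_dc)
  moreover have "\<iota> ` CI.span (\<Union>n. Rm (- (int n + 1))) = PI.span (GS False)"
  proof (rule span_image)
    show "(\<Union>n. Rm (- (int n + 1))) \<subseteq> C" by (auto simp: Rm_def)
    have GS: "GS False = (\<Union>n. GG (- (int n + 1)))"
    proof (rule subset_antisym; rule subsetI)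
      fix z assume "z \<in> GS False"
      then obtain k m y where z: "k \<in> Iw" "y \<in> S" "m \<ge> 1" "z = act \<pi> (k ** dl False m) y" by (auto simp: GS_def)
      then obtain n where "m = Suc n" by (cases m) auto
      then have "z = act \<pi> (k ** al (- (- (int n + 1)))) y" using z(4) by (simp add: dl_def add.commute)
      then show "z \<in> (\<Union>n. GG (- (int n + 1)))" using z(1,2) unfolding GG_def by blast
    next
      fix z assume "z \<in> (\<Union>n. GG (- (int n + 1)))"
      then obtain n k y where z: "k \<in> Iw" "y \<in> S" "z = act \<pi> (k ** al (- (- (int n + 1)))) y" by (auto simp: GG_def)
      then have "z = act \<pi> (k ** dl False (Suc n)) y" by (simp add: dl_def add.commute)
      then show "z \<in> GS False" using z(1,2) unfolding GS_def by force
    qed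
    then have "PI.span (GG (- (int n + 1))) \<subseteq> PI.span (GS False)" for n by (intro PI.span_mono) auto
    then show "\<iota> ` (\<Union>n. Rm (- (int n + 1))) \<subseteq> PI.span (GS False)" using Rm_image by blast
    show "GS False \<subseteq> \<iota> ` (\<Union>n. Rm (- (int n + 1)))" unfolding GS using GG_image by blast
  qed
  ultimately show ?thesis by (simp add: I_minus_def)
qed

lemma conclusion_of_quotient:
  assumes "principal_series_quotient D i eps \<pi> Phi"
  shows "\<iota> ` I_plus D i \<sigma> \<inter> \<iota> ` I_minus D i \<sigma> = invariants \<pi> (pro_p_iwahori D i)"
proof -
  interpret PS: principal_series_quotient D i eps \<pi> Phi by fact
  have "PS.J S True \<inter> PS.J S False = invariants \<pi> I1"
    by (rule PS.J_Int) (use S_\<pi> S_K S_R S_nz in auto)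
  moreover have "PS.J S s = PI.span (GS s)" for s
    unfolding PS.J_def PS.Gen_def GS_def ..
  ultimately show ?thesis by (simp add: image_I_plus image_I_minus pro_p_iwahori_eq)
qed

end

section \<open>The three kinds of principal series\<close>

context unramified_vertex
begin

text \<open>Some p^n-th power of g lies in the open set where the character is 1, and in
  characteristic p the equation x^(p^n) = 1 forces x = 1.\<close>

lemma char_trivial:
  fixes \<xi> :: "'e^3^3 \<Rightarrow> 'c::field"
  assumes p: "CHAR('c) = rchar D" and H: "subgroup H G"
    and mult: "\<And>g h. g \<in> H \<Longrightarrow> h \<in> H \<Longrightarrow> \<xi> (g ** h) = \<xi> g * \<xi> h" and nz: "\<And>g. g \<in> H \<Longrightarrow> \<xi> g \<noteq> 0"
    and sm: "nhd1 H {g. \<xi> g = 1}" and g: "g \<in> H" "g \<in> I1"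
  shows "\<xi> g = 1"
proof -
  have one: "\<xi> (mat 1) = 1" using mult[of "mat 1" "mat 1"] nz subgroup_props(1)[OF H] by simp
  have pow: "g [^]\<^bsub>G\<^esub> n \<in> H \<and> \<xi> (g [^]\<^bsub>G\<^esub> n) = \<xi> g ^ n" for n :: nat
    by (induction n) (use one mult g(1) subgroup_props[OF H] in \<open>auto simp: mult.commute\<close>)
  obtain n where "g [^]\<^bsub>G\<^esub> (rchar D ^ n) \<in> {g. \<xi> g = 1}"
    using pow_power_nhd1[OF _ g(2) sm H g(1)] by auto
  then have "\<xi> g ^ (rchar D ^ n) = 1" using pow by simp
  moreover have "(\<xi> g - 1 + 1) ^ (rchar D ^ n) = (\<xi> g - 1) ^ (rchar D ^ n) + 1 ^ (rchar D ^ n)"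
    by (rule freshmans_dream'[of _ n]) (simp_all add: p prime_rchar)
  ultimately have "(\<xi> g - 1) ^ (rchar D ^ n) = 0" by simp
  then show ?thesis by simp
qed

lemma subgroup_B: "subgroup B G"
proof (rule UG.subgroupI)
  show "inv\<^bsub>G\<^esub> b \<in> B" if "b \<in> B" for b using that B_props by (simp add: inv_U21)
qed (use B_props in auto)

lemma det_adj: "det (adj g) = cj (det g)"
  by (simp add: det_3 adj_entries algebra_simps)

lemma det_norm: "g \<in> carrier G \<Longrightarrow> det g \<in> carrier (norm_one_group D)"
proof -
  assume "g \<in> carrier G"
  then have "det (g ** adj g) = 1" by (simp add: mult_adj)
  then show ?thesis by (simp add: det_mul det_adj norm_one_group_def)
qed

text \<open>Every term in the expansion of det(1 + Z) - 1 contains an entry of Z, and the remaining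
  factors are integral because n \<ge> 0.\<close>

lemma det_near_one:
  assumes g: "g - mat 1 \<in> box n" and n: "n \<ge> 0"
  shows "det g - 1 \<in> P n"
proof -
  define Z where "Z = g - mat 1"
  have Z: "Z $ k $ l \<in> P n" for k l using g by (simp add: Z_def box_def)
  have Z0: "Z $ k $ l \<in> P 0" for k l using Z n frakp_le by blast
  have g_eq: "g = mat 1 + Z" by (simp add: Z_def)
  have Z2: "x * y \<in> P n" if "x \<in> P n" "y \<in> P 0" for x y using frakp_mult[OF that] by simp
  have "det g - 1 = (Z$1$1 + Z$2$2 + Z$3$3) + (Z$1$1 * Z$2$2 + Z$1$1 * Z$3$3 + Z$2$2 * Z$3$3)
      - (Z$1$2 * Z$2$1 + Z$1$3 * Z$3$1 + Z$2$3 * Z$3$2)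
      + (Z$1$1 * Z$2$2 * Z$3$3 + Z$1$2 * Z$2$3 * Z$3$1 + Z$1$3 * Z$2$1 * Z$3$2)
      - (Z$1$2 * Z$2$1 * Z$3$3 + Z$1$1 * Z$2$3 * Z$3$2 + Z$1$3 * Z$2$2 * Z$3$1)"
    unfolding g_eq by (simp add: det_3 mat_1_3 algebra_simps)
  also have "\<dots> \<in> P n" by (intro frakp_add frakp_diff Z2 Z Z0)
  finally show ?thesis .
qed

lemma det_char:
  assumes \<eta>: "smooth_character (field_topology D) (norm_one_group D) \<eta>"
  shows "g \<in> carrier G \<Longrightarrow> \<eta> (det g) \<noteq> 0"
    "g \<in> carrier G \<Longrightarrow> h \<in> carrier G \<Longrightarrow> \<eta> (det (g ** h)) = \<eta> (det g) * \<eta> (det h)"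
    "nhd1 (carrier G) {g. \<eta> (det g) = 1}"
proof -
  have nz: "\<And>x. x \<in> carrier (norm_one_group D) \<Longrightarrow> \<eta> x \<noteq> 0"
    and mult: "\<And>x y. x \<in> carrier (norm_one_group D) \<Longrightarrow> y \<in> carrier (norm_one_group D) \<Longrightarrow> \<eta> (x * y) = \<eta> x * \<eta> y"
    and opn: "openin (subtopology (field_topology D) (carrier (norm_one_group D))) {g \<in> carrier (norm_one_group D). \<eta> g = 1}"
    using \<eta> by (auto simp: smooth_character_def norm_one_group_def)
  show "g \<in> carrier G \<Longrightarrow> \<eta> (det g) \<noteq> 0"
    "g \<in> carrier G \<Longrightarrow> h \<in> carrier G \<Longrightarrow> \<eta> (det (g ** h)) = \<eta> (det g) * \<eta> (det h)"
    using nz mult det_norm by (simp_all add: det_mul)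
  have one: "1 \<in> carrier (norm_one_group D)" by (simp add: norm_one_group_def)
  then have "\<eta> 1 = 1" using mult[OF one one] nz[OF one] by simp
  obtain T where T: "openin (field_topology D) T" "{g \<in> carrier (norm_one_group D). \<eta> g = 1} = T \<inter> carrier (norm_one_group D)"
    using opn by (auto simp: openin_subtopology)
  have "1 \<in> {g \<in> carrier (norm_one_group D). \<eta> g = 1}" using one \<open>\<eta> 1 = 1\<close> by simp
  then have "1 \<in> T" unfolding T(2) by blast
  then obtain n where n: "\<And>y. y - 1 \<in> P n \<Longrightarrow> y \<in> T" using T(1) unfolding openin_field_topology by blast
  have "\<eta> (det g) = 1" if g: "g \<in> carrier G" "g - mat 1 \<in> box (max n 0)" for g
  proof -
    have "det g - 1 \<in> P (max n 0)" using g(2) by (rule det_near_one) simp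
    then have "det g \<in> T" by (intro n) (rule frakp_le, auto)
    then have "det g \<in> {g \<in> carrier (norm_one_group D). \<eta> g = 1}" unfolding T(2) using det_norm[OF g(1)] by blast
    then show ?thesis by simp
  qed
  then show "nhd1 (carrier G) {g. \<eta> (det g) = 1}" by (auto simp: nhd1_def)
qed

lemma carrier_open: "openin (subtopology X (carrier G)) (carrier G)"
  by (rule nhd1_openin[OF _ UG.subgroup_self UG.subgroup_self]) (auto simp: nhd1_def)

lemma ind_borel_twist:
  fixes \<xi> :: "'e^3^3 \<Rightarrow> 'c::field"
  assumes f: "f \<in> vspace (ind_borel D \<epsilon>1)"
    and mult: "\<And>g h. g \<in> carrier G \<Longrightarrow> h \<in> carrier G \<Longrightarrow> \<xi> (g ** h) = \<xi> g * \<xi> h"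
    and nz: "\<And>g. g \<in> carrier G \<Longrightarrow> \<xi> g \<noteq> 0" and sm: "nhd1 (carrier G) {g. \<xi> g = 1}"
    and \<epsilon>: "\<And>b. b \<in> B \<Longrightarrow> \<epsilon>2 b = \<xi> b * \<epsilon>1 b"
  shows "(\<lambda>g. \<xi> g * f g) \<in> vspace (ind_borel D \<epsilon>2)"
proof -
  have f0: "\<And>g. g \<notin> carrier G \<Longrightarrow> f g = 0" and fB: "\<And>b g. b \<in> B \<Longrightarrow> g \<in> carrier G \<Longrightarrow> f (b ** g) = \<epsilon>1 b * f g"
    using f by (auto simp: ind_borel_def)
  obtain U where U: "subgroup U G" "openin (subtopology X (carrier G)) U" "\<And>g u. g \<in> carrier G \<Longrightarrow> u \<in> U \<Longrightarrow> f (g ** u) = f g"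
    using f by (auto simp: ind_borel_def)
  have one: "\<xi> (mat 1) = 1" using mult[of "mat 1" "mat 1"] nz[of "mat 1"] by simp
  let ?U = "{g \<in> carrier G. \<xi> g = 1}"
  have subU: "subgroup ?U G"
  proof (rule UG.subgroupI)
    show "inv\<^bsub>G\<^esub> a \<in> ?U" if "a \<in> ?U" for a
      using that mult[of a "adj a"] one by (simp add: inv_U21 mult_adj)
    show "?U \<noteq> {}" using one one_in_U21 by blast
  qed (use mult in auto)
  have "nhd1 (carrier G) ?U" using sm by (auto simp: nhd1_def)
  then have "openin (subtopology X (carrier G)) ?U" by (rule nhd1_openin[OF _ UG.subgroup_self subU]) auto
  then have "openin (subtopology X (carrier G)) (U \<inter> ?U)" using U(2) by (intro openin_Int)
  moreover have "subgroup (U \<inter> ?U) G" using U(1) subU by (rule UG.subgroups_Inter_pair)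
  moreover have "\<forall>g\<in>carrier G. \<forall>u\<in>U \<inter> ?U. \<xi> (g ** u) * f (g ** u) = \<xi> g * f g"
    using mult U(3) by simp
  ultimately have "\<exists>U. subgroup U G \<and> openin (subtopology X (carrier G)) U \<and>
      (\<forall>g\<in>carrier G. \<forall>u\<in>U. \<xi> (g ** u) * f (g ** u) = \<xi> g * f g)" by blast
  then show ?thesis using f0 fB \<epsilon> mult B_props(1) by (auto simp: ind_borel_def)
qed

text \<open>The analogue of \<open>V_tr\<close> outside the quotient setting; it serves for the
  trivial character while that setting is still being established for a Steinberg twist.\<close>

lemma ind_borel_translate:
  assumes f: "f \<in> vspace (ind_borel D \<epsilon>)" and h: "h \<in> carrier G"
  shows "(\<lambda>g. f (g ** h)) \<in> vspace (ind_borel D \<epsilon>)"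
proof -
  have f0: "\<And>g. g \<notin> carrier G \<Longrightarrow> f g = 0" and fB: "\<And>b g. b \<in> B \<Longrightarrow> g \<in> carrier G \<Longrightarrow> f (b ** g) = \<epsilon> b * f g"
    using f by (auto simp: ind_borel_def)
  obtain U where U: "subgroup U G" "openin (subtopology X (carrier G)) U" "\<And>g u. g \<in> carrier G \<Longrightarrow> u \<in> U \<Longrightarrow> f (g ** u) = f g"
    using f by (auto simp: ind_borel_def)
  obtain n where n: "\<And>g. g \<in> carrier G \<Longrightarrow> g - mat 1 \<in> box n \<Longrightarrow> g \<in> U"
    using openin_nhd1[OF U(2)] subgroup_props(1)[OF U(1)] by (auto simp: nhd1_def)
  obtain N where N: "\<forall>Z\<in>box N. adj h ** Z ** h \<in> box n" using mult_small by blast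
  obtain r where r: "r \<ge> 0" "\<forall>g\<in>Hf 1 0 r. g - mat 1 \<in> box N" using nhd_Hf[of 1 0 N] by auto
  have sub: "subgroup (Hf 1 0 r) G" using r(1) by (intro subgroup_Hf) auto
  have "openin (subtopology X (carrier G)) (Hf 1 0 r)"
    using sub by (intro nhd1_openin nhd1_Hf UG.subgroup_self) (auto simp: Hf_def)
  moreover have "f (g ** u ** h) = f (g ** h)" if "g \<in> carrier G" "u \<in> Hf 1 0 r" for g u
  proof -
    have u: "u \<in> carrier G" using that(2) by (simp add: Hf_def)
    have "adj h ** (u - mat 1) ** h = adj h ** u ** h - mat 1"
      using h by (simp add: matrix_diff_ldistrib matrix_diff_rdistrib adj_mult_self)
    then have "adj h ** u ** h \<in> U" using N r(2) that(2) h u by (intro n) (simp, metis)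
    then have "f ((g ** h) ** (adj h ** u ** h)) = f (g ** h)" using U(3) that h by simp
    moreover have "(g ** h) ** (adj h ** u ** h) = g ** u ** h" using h by (simp add: matrix_mul_assoc)
    ultimately show ?thesis by simp
  qed
  moreover have "f (g ** h) = 0" if "g \<notin> carrier G" for g
  proof (rule f0, rule notI)
    assume "g ** h \<in> carrier G"
    then have "g ** h ** adj h \<in> carrier G" by (rule mult_in[OF _ adj_in[OF h]])
    then show False using that h by simp
  qed
  moreover have "f (b ** g ** h) = \<epsilon> b * f (g ** h)" if "b \<in> B" "g \<in> carrier G" for b g
    using fB[of b "g ** h"] that h by (simp add: matrix_mul_assoc)
  ultimately show ?thesis using sub by (auto simp: ind_borel_def)
qed

end

context weight_embedded
begin

abbreviation conclusion where
  "conclusion \<equiv> \<iota> ` I_plus D i \<sigma> \<inter> \<iota> ` I_minus D i \<sigma> = invariants \<pi> (pro_p_iwahori D i)"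

text \<open>I1 acts trivially, so all of \<pi> is invariant. Both spans contain a nonzero vector of
  a one-dimensional space and hence are everything.\<close>

lemma conclusion_character:
  assumes \<eta>: "smooth_character (field_topology D) (norm_one_group D) \<eta>"
    and iso: "isomorphic_rep G (char_rep (\<eta> \<circ> det)) \<pi>"
  shows conclusion
proof -
  obtain T where T: "intertwiner G (char_rep (\<eta> \<circ> det)) \<pi> T" "bij_betw T UNIV (vspace \<pi>)"
    using iso by (auto simp: isomorphic_rep_def char_rep_def)
  have T_scal: "T (a * x) = scal \<pi> a (T x)" for a x
    using T(1) by (auto simp: intertwiner_def linear_on_def char_rep_def)
  have T_act: "g \<in> carrier G \<Longrightarrow> act \<pi> g (T x) = T (\<eta> (det g) * x)" for g x
    using T(1) by (auto simp: intertwiner_def char_rep_def)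
  have T_sur: "y \<in> vspace \<pi> \<Longrightarrow> \<exists>x. y = T x" for y using T(2) by (auto simp: bij_betw_def)
  have T_0: "T 0 = 0" using T_scal[of 0 0] by simp
  have det1: "\<eta> (det g) = 1" if "g \<in> I1" for g
    by (rule char_trivial[OF char_c UG.subgroup_self]) (use det_char[OF \<eta>] that I1_props in auto)
  have "act \<pi> g y = y" if g: "g \<in> I1" and y: "y \<in> vspace \<pi>" for g y
  proof -
    obtain x where "y = T x" using T_sur[OF y] by blast
    then show ?thesis using T_act[OF I1_props(2)[OF g], of x] det1[OF g] by simp
  qed
  then have inv: "invariants \<pi> I1 = vspace \<pi>" by (auto simp: invariants_def)
  have "PI.span (GS s) = vspace \<pi>" for s
  proof
    have "GS s \<subseteq> vspace \<pi>" using S_\<pi> Iw_props(2) by (auto simp: GS_def intro!: \<pi>_act)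
    then show "PI.span (GS s) \<subseteq> vspace \<pi>" using \<pi>_subspace by (rule PI.span_minimal)
    obtain y where y: "y \<in> S" "y \<noteq> 0" using S_nz by blast
    obtain x where x: "y = T x" using T_sur y(1) S_\<pi> by blast
    have x0: "x \<noteq> 0" using x y T_0 by auto
    have G1: "mat 1 ** dl s 1 \<in> carrier G" by simp
    have "act \<pi> (mat 1 ** dl s 1) y \<in> GS s" unfolding GS_def using y(1) Iw_props(1) by blast
    then have z: "T (\<eta> (det (mat 1 ** dl s 1)) * x) \<in> GS s" using T_act[OF G1] x by simp
    show "vspace \<pi> \<subseteq> PI.span (GS s)"
    proof
      fix u assume "u \<in> vspace \<pi>"
      then obtain v where v: "u = T v" using T_sur by blast
      let ?t = "\<eta> (det (mat 1 ** dl s 1)) * x"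
      have "?t \<noteq> 0" using x0 det_char(1)[OF \<eta> G1] by simp
      then have "u = scal \<pi> (v / ?t) (T ?t)" using v T_scal[of "v / ?t" ?t] by simp
      then show "u \<in> PI.span (GS s)" using z by (metis PI.span_base PI.span_scale)
    qed
  qed
  then show ?thesis by (simp add: image_I_plus image_I_minus pro_p_iwahori_eq inv)
qed

text \<open>The isomorphism itself serves as the quotient map; its kernel is zero, so the condition
  on \<open>\<epsilon>\<close> is available unconditionally.\<close>

lemma conclusion_induced:
  assumes \<epsilon>: "smooth_character X (subgrp D B) \<epsilon>"
    and nd: "\<not> (\<exists>\<eta>. \<forall>b\<in>B. \<epsilon> b = \<eta> (det b))"
    and iso: "isomorphic_rep G (ind_borel D \<epsilon>) \<pi>"
  shows conclusion
proof -
  obtain T where T: "intertwiner G (ind_borel D \<epsilon>) \<pi> T" "bij_betw T (vspace (ind_borel D \<epsilon>)) (vspace \<pi>)"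
    using iso by (auto simp: isomorphic_rep_def)
  have nz: "\<And>b. b \<in> B \<Longrightarrow> \<epsilon> b \<noteq> 0" and mult: "\<And>b b'. b \<in> B \<Longrightarrow> b' \<in> B \<Longrightarrow> \<epsilon> (b ** b') = \<epsilon> b * \<epsilon> b'"
    and opn: "openin (subtopology X B) {b \<in> B. \<epsilon> b = 1}"
    using \<epsilon> by (auto simp: smooth_character_def)
  have "\<epsilon> (mat 1) = 1" using mult[of "mat 1" "mat 1"] nz[of "mat 1"] B_props(2) by simp
  then have "nhd1 B {b \<in> B. \<epsilon> b = 1}" using opn B_props(2) by (intro openin_nhd1) auto
  then have sm: "nhd1 B {b. \<epsilon> b = 1}" by (rule nhd1_subset) auto
  have zero: "(\<lambda>_. 0) \<in> vspace (ind_borel D \<epsilon>)"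
    using UG.subgroup_self carrier_open by (auto simp: ind_borel_def intro!: exI[of _ "carrier G"])
  have T0: "T (\<lambda>_. 0) = 0"
  proof -
    have "T (scal (ind_borel D \<epsilon>) 0 (\<lambda>_. 0)) = scal \<pi> 0 (T (\<lambda>_. 0))"
      using T(1) zero unfolding intertwiner_def linear_on_def by blast
    then show ?thesis by (simp add: ind_borel_def)
  qed
  have ker: "f = 0" if "f \<in> vspace (ind_borel D \<epsilon>)" "T f = 0" for f
  proof -
    have "f = (\<lambda>_. 0)" using T(2) zero T0 that by (metis bij_betw_imp_inj_on inj_onD)
    then show ?thesis by (simp add: fun_eq_iff)
  qed
  have "principal_series_quotient D i \<epsilon> \<pi> T"
  proof unfold_locales
    show "\<epsilon> b = 1" if "b \<in> B" "b \<in> I1" for b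
      using char_trivial[OF char_c subgroup_B mult nz sm that] .
    show "T ` vspace (ind_borel D \<epsilon>) = vspace \<pi>" using T(2) by (simp add: bij_betw_def)
  qed (use char_c nz mult smooth_pi T(1) ker nd in blast)+
  then show ?thesis by (rule conclusion_of_quotient)
qed

text \<open>A twist of the Steinberg representation is a quotient of the induction of a character that
  factors through the determinant; the kernel is spanned by that character.\<close>

lemma conclusion_steinberg:
  fixes \<rho> :: "('e^3^3, 'c, 'u::ab_group_add) repr"
  assumes \<eta>: "smooth_character (field_topology D) (norm_one_group D) \<eta>"
    and st: "is_steinberg D \<rho>" and iso: "isomorphic_rep G (twist (\<eta> \<circ> det) \<rho>) \<pi>"
  shows conclusion
proof -
  let ?\<epsilon> = "\<lambda>g. \<eta> (det g)" and ?V1 = "vspace (ind_borel D (\<lambda>_. 1 :: 'c))"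
  let ?V = "vspace (ind_borel D ?\<epsilon>)" and ?W = "constant_functions D :: ('e^3^3 \<Rightarrow> 'c) set"
  note d = det_char[OF \<eta>]
  obtain T where T: "intertwiner G (twist (\<eta> \<circ> det) \<rho>) \<pi> T" "bij_betw T (vspace \<rho>) (vspace \<pi>)"
    using iso by (auto simp: isomorphic_rep_def twist_def)
  have T_in: "\<And>x. x \<in> vspace \<rho> \<Longrightarrow> T x \<in> vspace \<pi>"
    and T_add: "\<And>x y. x \<in> vspace \<rho> \<Longrightarrow> y \<in> vspace \<rho> \<Longrightarrow> T (x + y) = T x + T y"
    and T_scal: "\<And>a x. x \<in> vspace \<rho> \<Longrightarrow> T (scal \<rho> a x) = scal \<pi> a (T x)"
    and T_act: "\<And>g x. g \<in> carrier G \<Longrightarrow> x \<in> vspace \<rho> \<Longrightarrow> T (scal \<rho> (\<eta> (det g)) (act \<rho> g x)) = act \<pi> g (T x)"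
    using T(1) by (auto simp: intertwiner_def linear_on_def twist_def)
  obtain \<phi> where \<phi>: "bij_betw \<phi> ((\<lambda>x. (+) x ` ?W) ` ?V1) (vspace \<rho>)"
    "intertwiner G (ind_borel D (\<lambda>_. 1)) \<rho> (\<lambda>x. \<phi> ((+) x ` ?W))"
    using st by (auto simp: is_steinberg_def isomorphic_quotient_def)
  have smooth_\<rho>: "smooth_rep X G \<rho>" using st by (simp add: is_steinberg_def)
  interpret RH: vector_space "scal \<rho>" using smooth_\<rho> by (simp add: smooth_rep_def)
  have \<rho>_sub: "RH.subspace (vspace \<rho>)" and \<rho>_act: "\<And>g x. g \<in> carrier G \<Longrightarrow> x \<in> vspace \<rho> \<Longrightarrow> act \<rho> g x \<in> vspace \<rho>"
    using smooth_\<rho> by (auto simp: smooth_rep_def linear_on_def)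
  define \<psi> where "\<psi> x = \<phi> ((+) x ` ?W)" for x
  have \<psi>_in: "\<And>x. x \<in> ?V1 \<Longrightarrow> \<psi> x \<in> vspace \<rho>"
    and \<psi>_add: "\<And>x y. x \<in> ?V1 \<Longrightarrow> y \<in> ?V1 \<Longrightarrow> \<psi> (x + y) = \<psi> x + \<psi> y"
    and \<psi>_scal: "\<And>a x. x \<in> ?V1 \<Longrightarrow> \<psi> (\<lambda>g. a * x g) = scal \<rho> a (\<psi> x)"
    and \<psi>_act: "\<And>h x. h \<in> carrier G \<Longrightarrow> x \<in> ?V1 \<Longrightarrow> \<psi> (\<lambda>g. x (g ** h)) = act \<rho> h (\<psi> x)"
    using \<phi>(2) unfolding intertwiner_def linear_on_def \<psi>_def by (auto simp: ind_borel_def)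
  \<comment> \<open>Division by the character identifies the induction of that character with the
    twist of the induction of the trivial one, of which Steinberg is a quotient.\<close>
  define dn where "dn f = (\<lambda>g. inverse (\<eta> (det g)) * f g)" for f :: "'e^3^3 \<Rightarrow> 'c"
  have dn_V: "dn f \<in> ?V1" if "f \<in> ?V" for f
    unfolding dn_def
  proof (rule ind_borel_twist[OF that])
    show "nhd1 (carrier G) {g. inverse (\<eta> (det g)) = 1}" using d(3) by (rule nhd1_subset) auto
  qed (use d B_props(1) in auto)
  have up_V: "(\<lambda>g. \<eta> (det g) * f g) \<in> ?V" if "f \<in> ?V1" for f
    by (rule ind_borel_twist[OF that]) (use d in auto)
  have V_out: "f g = 0" if "f \<in> ?V" "g \<notin> carrier G" for f g using that by (simp add: ind_borel_def)
  have V1_out: "f g = 0" if "f \<in> ?V1" "g \<notin> carrier G" for f g using that by (simp add: ind_borel_def)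
  define \<Phi> where "\<Phi> f = T (\<psi> (dn f))" for f
  have zero1: "(\<lambda>_. 0) \<in> ?V1"
    using UG.subgroup_self carrier_open by (auto simp: ind_borel_def intro!: exI[of _ "carrier G"])
  have const1: "(\<lambda>g. if g \<in> carrier G then a else 0) \<in> ?V1" for a
    using UG.subgroup_self carrier_open B_props(1)
    by (auto simp: ind_borel_def intro!: exI[of _ "carrier G"])
  have \<psi>0: "\<psi> (\<lambda>_. 0) = 0" using \<psi>_scal[OF zero1, of 0] by simp
  have T0: "T 0 = 0" using T_scal[of 0 0] RH.subspace_0[OF \<rho>_sub] by simp
  have W0: "0 \<in> ?W" by (auto simp: constant_functions_def fun_eq_iff intro!: image_eqI[of _ _ 0])
  have W_add: "x + y \<in> ?W" if xy: "x \<in> ?W" "y \<in> ?W" for x y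
  proof -
    obtain a b where "x = (\<lambda>g. if g \<in> carrier G then a else 0)" "y = (\<lambda>g. if g \<in> carrier G then b else 0)"
      using xy by (auto simp: constant_functions_def)
    then have "x + y = (\<lambda>g. if g \<in> carrier G then a + b else 0)" by (auto simp: fun_eq_iff)
    then show ?thesis by (auto simp: constant_functions_def)
  qed
  have W_coset: "(+) x ` ?W = (+) 0 ` ?W" if x: "x \<in> ?W" for x
  proof (rule subset_antisym; rule subsetI)
    obtain a where a: "x = (\<lambda>g. if g \<in> carrier G then a else 0)" using x by (auto simp: constant_functions_def)
    have "(\<lambda>g. if g \<in> carrier G then - a else 0) \<in> ?W" by (auto simp: constant_functions_def)
    moreover have "- x = (\<lambda>g. if g \<in> carrier G then - a else 0)" by (auto simp: a fun_eq_iff)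
    ultimately have mx: "- x \<in> ?W" by simp
    fix z
    show "z \<in> (+) 0 ` ?W" if "z \<in> (+) x ` ?W" using that W_add x by auto
    show "z \<in> (+) x ` ?W" if "z \<in> (+) 0 ` ?W"
      using that W_add[OF mx] by (intro image_eqI[of _ _ "- x + z"]) auto
  qed
  have \<psi>_ker: "\<psi> f = 0 \<longleftrightarrow> f \<in> ?W" if f: "f \<in> ?V1" for f
  proof
    assume "\<psi> f = 0"
    then have "\<phi> ((+) f ` ?W) = \<phi> ((+) (\<lambda>_. 0) ` ?W)" using \<psi>0 by (simp add: \<psi>_def)
    then have "(+) f ` ?W = (+) (\<lambda>_. 0) ` ?W" using \<phi>(1) f zero1 by (auto simp: bij_betw_def dest: inj_onD)
    moreover have "f + 0 \<in> (+) f ` ?W" using W0 by (rule imageI)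
    ultimately have "f \<in> (+) (\<lambda>_. 0) ` ?W" by simp
    then show "f \<in> ?W" by (auto simp: plus_fun_def)
  next
    assume "f \<in> ?W"
    then have "(+) f ` ?W = (+) (\<lambda>_. 0) ` ?W" using W_coset by (simp add: zero_fun_def)
    then show "\<psi> f = 0" using \<psi>0 by (simp add: \<psi>_def)
  qed
  have T_ker: "T x = 0 \<longleftrightarrow> x = 0" if "x \<in> vspace \<rho>" for x
    using T(2) T0 RH.subspace_0[OF \<rho>_sub] that by (metis bij_betw_imp_inj_on inj_onD)
  have \<Phi>_ker: "\<Phi> f = 0 \<longleftrightarrow> dn f \<in> ?W" if "f \<in> ?V" for f
    using T_ker[OF \<psi>_in[OF dn_V[OF that]]] \<psi>_ker[OF dn_V[OF that]] by (simp add: \<Phi>_def)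
  have "principal_series_quotient D i ?\<epsilon> \<pi> \<Phi>"
  proof unfold_locales
    show "?\<epsilon> b = 1" if "b \<in> B" "b \<in> I1" for b
      by (rule char_trivial[OF char_c UG.subgroup_self]) (use d that I1_props in auto)
    show "intertwiner G (ind_borel D ?\<epsilon>) \<pi> \<Phi>"
      unfolding intertwiner_def linear_on_def
    proof (intro conjI ballI allI)
      fix f assume f: "f \<in> ?V"
      show "\<Phi> f \<in> vspace \<pi>" using f by (simp add: \<Phi>_def T_in \<psi>_in dn_V)
      show "\<Phi> (scal (ind_borel D ?\<epsilon>) a f) = scal \<pi> a (\<Phi> f)" for a
      proof -
        have "dn (scal (ind_borel D ?\<epsilon>) a f) = (\<lambda>g. a * dn f g)" by (simp add: dn_def ind_borel_def fun_eq_iff)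
        then show ?thesis using \<psi>_scal[OF dn_V[OF f]] T_scal[OF \<psi>_in[OF dn_V[OF f]]] by (simp add: \<Phi>_def)
      qed
      show "\<Phi> (f + f') = \<Phi> f + \<Phi> f'" if f': "f' \<in> ?V" for f'
      proof -
        have "dn (f + f') = dn f + dn f'" by (simp add: dn_def fun_eq_iff distrib_left)
        then show ?thesis using \<psi>_add[OF dn_V[OF f] dn_V[OF f']] T_add[OF \<psi>_in[OF dn_V[OF f]] \<psi>_in[OF dn_V[OF f']]]
          by (simp add: \<Phi>_def)
      qed
      show "\<Phi> (act (ind_borel D ?\<epsilon>) h f) = act \<pi> h (\<Phi> f)" if h: "h \<in> carrier G" for h
      proof -
        have "dn (\<lambda>g. f (g ** h)) = (\<lambda>g. \<eta> (det h) * dn f (g ** h))"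
        proof
          fix g
          show "dn (\<lambda>g. f (g ** h)) g = \<eta> (det h) * dn f (g ** h)"
          proof (cases "g \<in> carrier G")
            case True
            then show ?thesis using d(1)[OF h] d(2)[OF True h] by (simp add: dn_def)
          next
            case False
            have "g ** h \<notin> carrier G"
            proof
              assume "g ** h \<in> carrier G"
              then have "g ** h ** adj h \<in> carrier G" by (rule mult_in[OF _ adj_in[OF h]])
              then show False using False h by simp
            qed
            then show ?thesis using V_out[OF f] by (simp add: dn_def)
          qed
        qed
        moreover have dh: "(\<lambda>g. dn f (g ** h)) \<in> ?V1"
          by (rule ind_borel_translate[OF dn_V[OF f] h])
        ultimately have "\<psi> (dn (\<lambda>g. f (g ** h))) = scal \<rho> (\<eta> (det h)) (act \<rho> h (\<psi> (dn f)))"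
          using \<psi>_scal[OF dh] \<psi>_act[OF h dn_V[OF f]] by simp
        then show ?thesis using T_act[OF h \<psi>_in[OF dn_V[OF f]]] by (simp add: \<Phi>_def ind_borel_def)
      qed
    qed
    show "\<Phi> ` ?V = vspace \<pi>"
    proof (rule subset_antisym; rule subsetI)
      fix y assume "y \<in> vspace \<pi>"
      then obtain x where x: "x \<in> vspace \<rho>" "y = T x" using T(2) by (auto simp: bij_betw_def)
      then obtain f where f: "f \<in> ?V1" "x = \<psi> f" using \<phi>(1) by (auto simp: bij_betw_def \<psi>_def)
      have "dn (\<lambda>g. \<eta> (det g) * f g) = f"
      proof
        fix g
        show "dn (\<lambda>g. \<eta> (det g) * f g) g = f g"
          using d(1)[of g] V1_out[OF f(1), of g] by (cases "g \<in> carrier G") (simp_all add: dn_def)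
      qed
      then have "y = \<Phi> (\<lambda>g. \<eta> (det g) * f g)" using x f by (simp add: \<Phi>_def)
      then show "y \<in> \<Phi> ` ?V" using up_V[OF f(1)] by blast
    qed (auto simp: \<Phi>_def T_in \<psi>_in dn_V)
    show "f = 0" if f: "f \<in> ?V" "\<Phi> f = 0" and g: "g \<in> carrier G" "f g = 0" for f g
    proof -
      obtain a where a: "dn f = (\<lambda>g. if g \<in> carrier G then a else 0)"
        using \<Phi>_ker[OF f(1)] f(2) by (auto simp: constant_functions_def)
      have "dn f g = 0" using g by (simp add: dn_def)
      then have "a = 0" using a g(1) by simp
      then have z: "dn f h = 0" for h using a by simp
      have "f h = 0" for h
        using z[of h] d(1)[of h] V_out[OF f(1), of h] by (cases "h \<in> carrier G") (auto simp: dn_def)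
      then show ?thesis by (simp add: fun_eq_iff)
    qed
    show "\<not> (\<exists>\<eta>'. \<forall>b\<in>B. ?\<epsilon> b = \<eta>' (det b))" if ker: "\<And>f. f \<in> ?V \<Longrightarrow> \<Phi> f = 0 \<Longrightarrow> f = 0"
    proof -
      \<comment> \<open>The character, extended by zero, is a nonzero element of the kernel, so the
        assumption of a trivial kernel is contradictory here.\<close>
      let ?z = "\<lambda>g. \<eta> (det g) * (if g \<in> carrier G then 1 else 0)"
      have z: "?z \<in> ?V" by (rule up_V[OF const1])
      have "dn ?z = (\<lambda>g. if g \<in> carrier G then 1 else 0)" using d(1) by (auto simp: dn_def fun_eq_iff)
      then have "dn ?z \<in> ?W" by (auto simp: constant_functions_def)
      then have "?z = 0" using ker[OF z] \<Phi>_ker[OF z] by simp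
      from fun_cong[OF this, of "mat 1"] have "?z (mat 1) = 0" by simp
      then show ?thesis using d(1)[of "mat 1"] by simp
    qed
  qed (use char_c d B_props(1) smooth_pi in auto)
  then show ?thesis by (rule conclusion_of_quotient)
qed

end

theorem theorem1p2:
  fixes D :: "'e::field quad_ext"
    and i :: vertex
    and \<sigma> :: "('e^3^3, 'c::alg_closed_field, 'w::ab_group_add) repr"
    and \<pi> :: "('e^3^3, 'c, 'v::ab_group_add) repr"
    and j :: "'w \<Rightarrow> 'v"
    and \<iota> :: "('e^3^3 \<Rightarrow> 'w) \<Rightarrow> 'v"
  assumes "unramified_quadratic D"
    and "is_Fp_bar TYPE('c) (rchar D)"
    and "irreducible_principal_series D \<pi>"
    and "weight D i \<sigma>"
    and "weight_embedding D i \<sigma> \<pi> j"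
    and "frobenius_map D i \<sigma> \<pi> j \<iota>"
  shows "\<iota> ` I_plus D i \<sigma> \<inter> \<iota> ` I_minus D i \<sigma> = invariants \<pi> (pro_p_iwahori D i)"
proof -
  interpret unramified_quadratic D by fact
  interpret weight_embedded D i \<sigma> \<pi> j \<iota>
    by unfold_locales (use assms in \<open>auto simp: is_Fp_bar_def irreducible_principal_series_def\<close>)
  show ?thesis
    using assms(3) conclusion_character conclusion_steinberg conclusion_induced
    unfolding irreducible_principal_series_def by blast
qed

end
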